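(* Let $a_1,a_2:\mathbf{R}^d\to\mathbf{R}^d$ be differentiable and suppose there are constants $c_1,c_2,c_3>0$ such that for $i=1,2$ and all $x,y\in\mathbf{R}^d$: (i) $(a_i(x)-a_i(y))\cdot(x-y)\ge c_1|x-y|^2$; (ii) $|a_i(x)-a_i(y)|\le c_2|x-y|$; (iii) $|\partial a_i(x)-\partial a_i(y)|\le c_3|x-y|$. Let $\Omega\subset\mathsf{D}$ be open, let $u_0\in H^1_0(\mathsf{D})$ be the solution of the state equation for $\Omega$ and $p_0\in H^1_0(\mathsf{D})$ the solution of the adjoint equation for $\Omega$ (both given in the context). Let $z\in\mathsf{D}\setminus\overline{\Omega}$ and assume $u_0\in C^{1,\alpha}(\overline{B_\delta(z)})$ and $p_0\in C^1(\overline{B_\delta(z)})$ for some $\delta>0$ and $0<\alpha<1$. Assume further that $\nabla p_0\in L_\infty(\mathsf{D})^d$. Set $U_0:=\nabla u_0(z)$, $P_0:=\nabla p_0(z)$, and let $G$, $\ell$, $R_1^\varepsilon$, $R_2^\varepsilon$ be as in the context. (a) $G$ is an $\ell$-differentiable parametrised Lagrangian satisfying Hypothesis (H0), the limits $R_1(u_0,p_0):=\lim_{\varepsilon\searrow0}R_1^\varepsilon(u_0,p_0)$ and $R_2(u_0,p_0):=\lim_{\varepsilon\searrow0}R_2^\varepsilon(u_0,p_0)$ exist, and the topological derivative at $z$ is given by $$dJ(\Omega)(z)=\partial_\ell G(0,u_0,p_0)+R_1(u_0,p_0)+R_2(u_0,p_0).$$ (b) One has $$\partial_\ell G(0,u_0,p_0)=(a_1(U_0)-a_2(U_0))\cdot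 P_0,$$ $$R_1(u_0,p_0)=\frac1{|\omega|}\left(\int_{\mathbf{R}^d}\big[\mathcal{A}_\omega(x,\nabla K+U_0)-\mathcal{A}_\omega(x,U_0)-\partial_u\mathcal{A}_\omega(x,U_0)(\nabla K)\big]\cdot P_0\,dx+\int_{\mathbf{R}^d}|\nabla K|^2\,dx\right),$$ $$R_2(u_0,p_0)=\frac1{|\omega|}\int_\omega\big[\partial_u a_1(U_0)-\partial_u a_2(U_0)\big](\nabla K)\cdot P_0\,dx,$$ where $\mathcal{A}_\omega(x,y):=a_1(y)\chi_\omega(x)+a_2(y)\chi_{\mathbf{R}^d\setminus\omega}(x)$ and $K\in\dot{BL}(\mathbf{R}^d)$ is the unique solution of $$\int_{\mathbf{R}^d}\big(\mathcal{A}_\omega(x,\nabla K+U_0)-\mathcal{A}_\omega(x,U_0)\big)\cdot\nabla\varphi\,dx=-\int_\omega(a_1(U_0)-a_2(U_0))\cdot\nabla\varphi\,dx\quad\text{for all }\varphi\in BL(\mathbf{R}^d).$$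
   Context: Let $\mathsf{D}\subset\mathbf{R}^d$ be a fixed open bounded set, $f\in L_2(\mathsf{D})$, $u_d\in H^1_0(\mathsf{D})$. For measurable $\Omega\subset\mathsf{D}$ put $\mathcal{A}_\Omega(x,y):=a_1(y)$ if $x\in\Omega$ and $\mathcal{A}_\Omega(x,y):=a_2(y)$ if $x\in\mathsf{D}\setminus\Omega$. Here $\partial a_i(y)=\partial_u a_i(y)$ is the derivative (Jacobian) of $a_i$ at $y$, and $\partial_u\mathcal{A}(x,y)(v)$ is the derivative of $\mathcal{A}$ with respect to its second argument at $(x,y)$ in direction $v$. State equation for $\Omega$: find $u\in H^1_0(\mathsf{D})$ with $\int_{\mathsf{D}}\mathcal{A}_\Omega(x,\nabla u)\cdot\nabla\varphi\,dx=\int_{\mathsf{D}}f\varphi\,dx$ for all $\varphi\in H^1_0(\mathsf{D})$ (uniquely solvable). Cost function: $J(\Omega):=\int_{\mathsf{D}}|\nabla(u-u_d)|^2\,dx$ with $u$ the solution of the state equation for $\Omega$. Adjoint equation for $\Omega$ (with $u=u_0$ the state): find $p\in H^1_0(\mathsf{D})$ with $\int_{\mathsf{D}}\partial_u\mathcal{A}_\Omega(x,\nabla u_0)(\nabla\varphi)\cdot\nabla p\,dx=-\int_{\mathsf{D}}2\nabla(u_0-u_d)\cdot\nabla\varphi\,dx$ for all $\varphi\in H^1_0(\mathsf{D})$ (uniquely solvable). Perturbation: $\omega\subset\mathbf{R}^d$ is open and bounded with $0\in\omega$; $\omega_\varepsilon:=\omega_\varepsilon(z):=z+\varepsilon\omega$;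 $\tau>0$ is such that $\omega_\varepsilon(z)\Subset\mathsf{D}\setminus\overline\Omega$ for all $\varepsilon\in[0,\tau]$; $\Omega_\varepsilon:=\Omega\cup\omega_\varepsilon(z)$; $\ell(\varepsilon):=|\omega_\varepsilon|$. For $z\in\mathsf{D}\setminus\overline\Omega$ the topological derivative is $dJ(\Omega)(z):=\lim_{\varepsilon\searrow0}\frac{J(\Omega\cup\omega_\varepsilon(z))-J(\Omega)}{|\omega_\varepsilon(z)|}$. For $\varepsilon\in[0,\tau]$, $u_\varepsilon\in H^1_0(\mathsf{D})$ denotes the solution of the state equation for $\Omega_\varepsilon$. Lagrangian $G:[0,\tau]\times H^1_0(\mathsf{D})\times H^1_0(\mathsf{D})\to\mathbf{R}$: $$G(\varepsilon,u,p):=\int_{\mathsf{D}}|\nabla(u-u_d)|^2\,dx+\int_{\mathsf{D}}\mathcal{A}_{\Omega_\varepsilon}(x,\nabla u)\cdot\nabla p\,dx-\int_{\mathsf{D}}fp\,dx.$$ Here $\partial_uG$, $\partial_pG$ denote derivatives with respect to the second and third argument. With $X=Y=H^1_0(\mathsf{D})$, $G$ is an $\ell$-differentiable parametrised Lagrangian if: $p\mapsto G(\varepsilon,u,p)$ is affine on $Y$; for all $\varepsilon\in[0,\tau]$, $v,w\in X$, $p\in Y$ the map $s\mapsto G(\varepsilon,v+sw,p)$ is continuously differentiable on $[0,1]$; and $\partial_\ell G(0,u_0,p_0):=\lim_{\varepsilon\searrow0}\frac{G(\varepsilon,u_0,p_0)-G(0,u_0,p_0)}{\ell(\varepsilon)}$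 exists. Hypothesis (H0): for every $\varepsilon\in[0,\tau]$ there is exactly one $u_\varepsilon\in X$ with $\partial_pG(\varepsilon,u_\varepsilon,0)(\varphi)=0$ for all $\varphi\in Y$, and there is exactly one $p_0\in Y$ with $\partial_uG(0,u_0,p_0)(\varphi)=0$ for all $\varphi\in X$. For $\varepsilon>0$, $$R_1^\varepsilon(u_0,p_0):=\frac1{\ell(\varepsilon)}\int_0^1\big(\partial_uG(\varepsilon,su_\varepsilon+(1-s)u_0,p_0)-\partial_uG(\varepsilon,u_0,p_0)\big)(u_\varepsilon-u_0)\,ds,$$ $$R_2^\varepsilon(u_0,p_0):=\frac1{\ell(\varepsilon)}\big(\partial_uG(\varepsilon,u_0,p_0)-\partial_uG(0,u_0,p_0)\big)(u_\varepsilon-u_0).$$ Beppo-Levi space: $BL(\mathbf{R}^d):=\{u\in H^1_{\mathrm{loc}}(\mathbf{R}^d):\nabla u\in L_2(\mathbf{R}^d)^d\}$ and $\dot{BL}(\mathbf{R}^d):=BL(\mathbf{R}^d)/\mathbf{R}$ (quotient by constants), with norm $\|[u]\|:=\|\nabla u\|_{L_2(\mathbf{R}^d)^d}$. $B_\delta(z)$ is the open ball of radius $\delta$ at $z$. *)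

theory Defs
  imports "HOL-Analysis.Analysis"
begin

section \<open>Function spaces\<close>

text \<open>
  Elements of Lebesgue and Sobolev spaces on \<open>D\<close> are represented by total functions, of which only
  the values on \<open>D\<close> matter; two representatives denote the same element iff they agree almost
  everywhere on \<open>D\<close>.
\<close>

definition ae_eq :: "'a::euclidean_space set \<Rightarrow> ('a \<Rightarrow> 'b) \<Rightarrow> ('a \<Rightarrow> 'b) \<Rightarrow> bool" where
  "ae_eq D u v \<longleftrightarrow> (AE x in lebesgue_on D. u x = v x)"

definition L2 :: "'a::euclidean_space set \<Rightarrow> ('a \<Rightarrow> 'b::euclidean_space) set" where
  "L2 D = {u. u \<in> borel_measurable (lebesgue_on D) \<and> integrable (lebesgue_on D) (\<lambda>x. (norm (u x))\<^sup>2)}"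

definition L2_loc :: "'a::euclidean_space set \<Rightarrow> ('a \<Rightarrow> 'b::euclidean_space) set" where
  "L2_loc D = {u. \<forall>C. compact C \<and> C \<subseteq> D \<longrightarrow> u \<in> L2 C}"

definition L1_loc :: "'a::euclidean_space set \<Rightarrow> ('a \<Rightarrow> 'b::euclidean_space) set" where
  "L1_loc D = {u. \<forall>C. compact C \<and> C \<subseteq> D \<longrightarrow> integrable (lebesgue_on C) u}"

definition L_infty :: "'a::euclidean_space set \<Rightarrow> ('a \<Rightarrow> 'b::euclidean_space) set" where
  "L_infty D = {u. u \<in> borel_measurable (lebesgue_on D) \<and>
                  (\<exists>M. AE x in lebesgue_on D. norm (u x) \<le> M)}"

definition grad :: "('a::euclidean_space \<Rightarrow> real) \<Rightarrow> 'a \<Rightarrow> 'a" where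
  "grad u x = (THE V. GDERIV u x :> V)"

fun C_k :: "nat \<Rightarrow> ('a::euclidean_space \<Rightarrow> real) \<Rightarrow> bool" where
  "C_k 0 \<phi> \<longleftrightarrow> continuous_on UNIV \<phi>"
| "C_k (Suc k) \<phi> \<longleftrightarrow>
     (\<exists>g. (\<forall>x. GDERIV \<phi> x :> g x) \<and> (\<forall>b\<in>Basis. C_k k (\<lambda>x. g x \<bullet> b)))"

definition test_functions :: "'a::euclidean_space set \<Rightarrow> ('a \<Rightarrow> real) set" where
  "test_functions D =
     {\<phi>. (\<forall>k. C_k k \<phi>) \<and> compact (closure {x. \<phi> x \<noteq> 0}) \<and> closure {x. \<phi> x \<noteq> 0} \<subseteq> D}"

definition weak_gradient ::
  "'a::euclidean_space set \<Rightarrow> ('a \<Rightarrow> real) \<Rightarrow> ('a \<Rightarrow> 'a) \<Rightarrow> bool" where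
  "weak_gradient D u g \<longleftrightarrow> u \<in> L1_loc D \<and> g \<in> L1_loc D \<and>
     (\<forall>\<phi>\<in>test_functions D.
        (LINT x|lebesgue_on D. u x *\<^sub>R grad \<phi> x) = - (LINT x|lebesgue_on D. \<phi> x *\<^sub>R g x))"

text \<open>A representative of the weak gradient, which is unique up to null sets for open \<open>D\<close>.\<close>

definition wgrad :: "'a::euclidean_space set \<Rightarrow> ('a \<Rightarrow> real) \<Rightarrow> 'a \<Rightarrow> 'a" where
  "wgrad D u = (SOME g. weak_gradient D u g)"

definition H1 :: "'a::euclidean_space set \<Rightarrow> ('a \<Rightarrow> real) set" where
  "H1 D = {u. u \<in> L2 D \<and> (\<exists>g\<in>L2 D. weak_gradient D u g)}"

definition H1_loc :: "'a::euclidean_space set \<Rightarrow> ('a \<Rightarrow> real) set" where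
  "H1_loc D = {u. u \<in> L2_loc D \<and> (\<exists>g\<in>L2_loc D. weak_gradient D u g)}"

definition H1_norm :: "'a::euclidean_space set \<Rightarrow> ('a \<Rightarrow> real) \<Rightarrow> real" where
  "H1_norm D u =
     sqrt ((LINT x|lebesgue_on D. (u x)\<^sup>2) + (LINT x|lebesgue_on D. (norm (wgrad D u x))\<^sup>2))"

definition H10 :: "'a::euclidean_space set \<Rightarrow> ('a \<Rightarrow> real) set" where
  "H10 D = {u. u \<in> H1 D \<and>
     (\<exists>\<phi>. (\<forall>n. \<phi> n \<in> test_functions D) \<and> (\<lambda>n. H1_norm D (\<lambda>x. \<phi> n x - u x)) \<longlonglongrightarrow> 0)}"

definition BL :: "('a::euclidean_space \<Rightarrow> real) set" where
  "BL = {u. u \<in> H1_loc UNIV \<and> wgrad UNIV u \<in> L2 UNIV}"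

definition BL_rel :: "(('a::euclidean_space \<Rightarrow> real) \<times> ('a \<Rightarrow> real)) set" where
  "BL_rel = {(u, v). u \<in> BL \<and> v \<in> BL \<and> (\<exists>c. AE x in lebesgue. u x - v x = c)}"

definition BL_dot :: "('a::euclidean_space \<Rightarrow> real) set set" where
  "BL_dot = BL // BL_rel"

text \<open>For open \<open>B\<close>: the classical spaces of \<open>C\<^sup>1\<close> and \<open>C\<^sup>1\<^sup>,\<^sup>\<alpha>\<close> functions up to the boundary of \<open>B\<close>.\<close>

definition C1_closure :: "'a::euclidean_space set \<Rightarrow> ('a \<Rightarrow> real) set" where
  "C1_closure B = {u. continuous_on (closure B) u \<and>
     (\<exists>g. continuous_on (closure B) g \<and> (\<forall>x\<in>B. GDERIV u x :> g x))}"

definition C1_Holder_closure ::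
  "real \<Rightarrow> 'a::euclidean_space set \<Rightarrow> ('a \<Rightarrow> real) set" where
  "C1_Holder_closure \<alpha> B = {u. continuous_on (closure B) u \<and>
     (\<exists>g. continuous_on (closure B) g \<and> (\<forall>x\<in>B. GDERIV u x :> g x) \<and>
       (\<exists>L. \<forall>x\<in>closure B. \<forall>y\<in>closure B. norm (g x - g y) \<le> L * dist x y powr \<alpha>))}"

section \<open>State equation, adjoint equation and cost\<close>

definition \<A> :: "('a \<Rightarrow> 'a) \<Rightarrow> ('a \<Rightarrow> 'a) \<Rightarrow> 'a set \<Rightarrow> 'a \<Rightarrow> 'a::euclidean_space \<Rightarrow> 'a" where
  "\<A> a\<^sub>1 a\<^sub>2 \<Omega> x y = (if x \<in> \<Omega> then a\<^sub>1 y else a\<^sub>2 y)"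

definition d\<A> :: "('a \<Rightarrow> 'a) \<Rightarrow> ('a \<Rightarrow> 'a) \<Rightarrow> 'a set \<Rightarrow> 'a \<Rightarrow> 'a::euclidean_space \<Rightarrow> 'a \<Rightarrow> 'a" where
  "d\<A> a\<^sub>1 a\<^sub>2 \<Omega> x y = frechet_derivative (\<A> a\<^sub>1 a\<^sub>2 \<Omega> x) (at y)"

definition is_state ::
  "'a::euclidean_space set \<Rightarrow> ('a \<Rightarrow> real) \<Rightarrow> ('a \<Rightarrow> 'a) \<Rightarrow> ('a \<Rightarrow> 'a) \<Rightarrow> 'a set \<Rightarrow>
     ('a \<Rightarrow> real) \<Rightarrow> bool" where
  "is_state D f a\<^sub>1 a\<^sub>2 \<Omega> u \<longleftrightarrow> u \<in> H10 D \<and>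
     (\<forall>\<phi>\<in>H10 D. (LINT x|lebesgue_on D. \<A> a\<^sub>1 a\<^sub>2 \<Omega> x (wgrad D u x) \<bullet> wgrad D \<phi> x)
               = (LINT x|lebesgue_on D. f x * \<phi> x))"

definition state ::
  "'a::euclidean_space set \<Rightarrow> ('a \<Rightarrow> real) \<Rightarrow> ('a \<Rightarrow> 'a) \<Rightarrow> ('a \<Rightarrow> 'a) \<Rightarrow> 'a set \<Rightarrow>
     ('a \<Rightarrow> real)" where
  "state D f a\<^sub>1 a\<^sub>2 \<Omega> = (SOME u. is_state D f a\<^sub>1 a\<^sub>2 \<Omega> u)"

definition cost ::
  "'a::euclidean_space set \<Rightarrow> ('a \<Rightarrow> real) \<Rightarrow> ('a \<Rightarrow> real) \<Rightarrow> ('a \<Rightarrow> 'a) \<Rightarrow> ('a \<Rightarrow> 'a) \<Rightarrow>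
     'a set \<Rightarrow> real" where
  "cost D f u\<^sub>d a\<^sub>1 a\<^sub>2 \<Omega> =
     (LINT x|lebesgue_on D. (norm (wgrad D (\<lambda>y. state D f a\<^sub>1 a\<^sub>2 \<Omega> y - u\<^sub>d y) x))\<^sup>2)"

definition is_adjoint ::
  "'a::euclidean_space set \<Rightarrow> ('a \<Rightarrow> real) \<Rightarrow> ('a \<Rightarrow> 'a) \<Rightarrow> ('a \<Rightarrow> 'a) \<Rightarrow> 'a set \<Rightarrow>
     ('a \<Rightarrow> real) \<Rightarrow> ('a \<Rightarrow> real) \<Rightarrow> bool" where
  "is_adjoint D u\<^sub>d a\<^sub>1 a\<^sub>2 \<Omega> u\<^sub>0 p \<longleftrightarrow> p \<in> H10 D \<and>
     (\<forall>\<phi>\<in>H10 D.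
        (LINT x|lebesgue_on D. d\<A> a\<^sub>1 a\<^sub>2 \<Omega> x (wgrad D u\<^sub>0 x) (wgrad D \<phi> x) \<bullet> wgrad D p x)
        = - (LINT x|lebesgue_on D. 2 * (wgrad D (\<lambda>y. u\<^sub>0 y - u\<^sub>d y) x \<bullet> wgrad D \<phi> x)))"

section \<open>Perturbation and topological derivative\<close>

definition inclusion :: "'a::euclidean_space set \<Rightarrow> 'a \<Rightarrow> real \<Rightarrow> 'a set" where
  "inclusion \<omega> z \<epsilon> = (\<lambda>x. z + \<epsilon> *\<^sub>R x) ` \<omega>"

definition has_topological_derivative ::
  "('a::euclidean_space set \<Rightarrow> real) \<Rightarrow> 'a set \<Rightarrow> 'a set \<Rightarrow> 'a \<Rightarrow> real \<Rightarrow> bool" where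
  "has_topological_derivative J \<omega> \<Omega> z T \<longleftrightarrow>
     ((\<lambda>\<epsilon>. (J (\<Omega> \<union> inclusion \<omega> z \<epsilon>) - J \<Omega>) / measure lebesgue (inclusion \<omega> z \<epsilon>))
        \<longlongrightarrow> T) (at_right 0)"

definition lagrangian ::
  "'a::euclidean_space set \<Rightarrow> ('a \<Rightarrow> real) \<Rightarrow> ('a \<Rightarrow> real) \<Rightarrow> ('a \<Rightarrow> 'a) \<Rightarrow> ('a \<Rightarrow> 'a) \<Rightarrow>
     'a set \<Rightarrow> 'a set \<Rightarrow> 'a \<Rightarrow> real \<Rightarrow> ('a \<Rightarrow> real) \<Rightarrow> ('a \<Rightarrow> real) \<Rightarrow> real" where
  "lagrangian D f u\<^sub>d a\<^sub>1 a\<^sub>2 \<Omega> \<omega> z \<epsilon> u p =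
     (LINT x|lebesgue_on D. (norm (wgrad D (\<lambda>y. u y - u\<^sub>d y) x))\<^sup>2)
     + (LINT x|lebesgue_on D. \<A> a\<^sub>1 a\<^sub>2 (\<Omega> \<union> inclusion \<omega> z \<epsilon>) x (wgrad D u x) \<bullet> wgrad D p x)
     - (LINT x|lebesgue_on D. f x * p x)"

section \<open>Parametrised Lagrangians\<close>

text \<open>
  Directional derivatives with respect to the second and third argument. For an
  \<open>ell\<close>-differentiable Lagrangian (defined below) the functions under \<open>deriv\<close> are differentiable.
\<close>

definition partial_u ::
  "(real \<Rightarrow> ('a \<Rightarrow> real) \<Rightarrow> ('a \<Rightarrow> real) \<Rightarrow> real) \<Rightarrow>
     real \<Rightarrow> ('a \<Rightarrow> real) \<Rightarrow> ('a \<Rightarrow> real) \<Rightarrow> ('a \<Rightarrow> real) \<Rightarrow> real" where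
  "partial_u G \<epsilon> u p \<phi> = deriv (\<lambda>s. G \<epsilon> (\<lambda>x. u x + s * \<phi> x) p) 0"

definition partial_p ::
  "(real \<Rightarrow> ('a \<Rightarrow> real) \<Rightarrow> ('a \<Rightarrow> real) \<Rightarrow> real) \<Rightarrow>
     real \<Rightarrow> ('a \<Rightarrow> real) \<Rightarrow> ('a \<Rightarrow> real) \<Rightarrow> ('a \<Rightarrow> real) \<Rightarrow> real" where
  "partial_p G \<epsilon> u p \<phi> = deriv (\<lambda>s. G \<epsilon> u (\<lambda>x. p x + s * \<phi> x)) 0"

definition has_partial_ell ::
  "(real \<Rightarrow> ('a \<Rightarrow> real) \<Rightarrow> ('a \<Rightarrow> real) \<Rightarrow> real) \<Rightarrow> (real \<Rightarrow> real) \<Rightarrow>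
     ('a \<Rightarrow> real) \<Rightarrow> ('a \<Rightarrow> real) \<Rightarrow> real \<Rightarrow> bool" where
  "has_partial_ell G ell u\<^sub>0 p\<^sub>0 L \<longleftrightarrow>
     ((\<lambda>\<epsilon>. (G \<epsilon> u\<^sub>0 p\<^sub>0 - G 0 u\<^sub>0 p\<^sub>0) / ell \<epsilon>) \<longlongrightarrow> L) (at_right 0)"

definition ell_differentiable_lagrangian ::
  "real \<Rightarrow> ('a \<Rightarrow> real) set \<Rightarrow> ('a \<Rightarrow> real) set \<Rightarrow>
     (real \<Rightarrow> ('a \<Rightarrow> real) \<Rightarrow> ('a \<Rightarrow> real) \<Rightarrow> real) \<Rightarrow> (real \<Rightarrow> real) \<Rightarrow>
     ('a \<Rightarrow> real) \<Rightarrow> ('a \<Rightarrow> real) \<Rightarrow> bool" where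
  "ell_differentiable_lagrangian \<tau> X Y G ell u\<^sub>0 p\<^sub>0 \<longleftrightarrow>
     (\<forall>\<epsilon>\<in>{0..\<tau>}. \<forall>u\<in>X. \<forall>p\<in>Y. \<forall>q\<in>Y. \<forall>t.
        G \<epsilon> u (\<lambda>x. (1 - t) * p x + t * q x) = (1 - t) * G \<epsilon> u p + t * G \<epsilon> u q) \<and>
     (\<forall>\<epsilon>\<in>{0..\<tau>}. \<forall>v\<in>X. \<forall>w\<in>X. \<forall>p\<in>Y.
        (\<lambda>s. G \<epsilon> (\<lambda>x. v x + s * w x) p) C1_differentiable_on {0..1}) \<and>
     (\<exists>L. has_partial_ell G ell u\<^sub>0 p\<^sub>0 L)"

text \<open>\<open>u\<close> is, up to the identification \<open>E\<close> of representatives, the only element of \<open>X\<close> with \<open>P\<close>.\<close>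

definition is_unique :: "('b \<Rightarrow> 'b \<Rightarrow> bool) \<Rightarrow> 'b set \<Rightarrow> ('b \<Rightarrow> bool) \<Rightarrow> 'b \<Rightarrow> bool" where
  "is_unique E X P u \<longleftrightarrow> u \<in> X \<and> P u \<and> (\<forall>v\<in>X. P v \<longrightarrow> E v u)"

definition hypothesis_H0 ::
  "real \<Rightarrow> (('a \<Rightarrow> real) \<Rightarrow> ('a \<Rightarrow> real) \<Rightarrow> bool) \<Rightarrow> ('a \<Rightarrow> real) set \<Rightarrow> ('a \<Rightarrow> real) set \<Rightarrow>
     (real \<Rightarrow> ('a \<Rightarrow> real) \<Rightarrow> ('a \<Rightarrow> real) \<Rightarrow> real) \<Rightarrow>
     (real \<Rightarrow> 'a \<Rightarrow> real) \<Rightarrow> ('a \<Rightarrow> real) \<Rightarrow> bool" where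
  "hypothesis_H0 \<tau> E X Y G u p\<^sub>0 \<longleftrightarrow>
     (\<forall>\<epsilon>\<in>{0..\<tau>}. is_unique E X (\<lambda>v. \<forall>\<phi>\<in>Y. partial_p G \<epsilon> v (\<lambda>x. 0) \<phi> = 0) (u \<epsilon>)) \<and>
     is_unique E Y (\<lambda>p. \<forall>\<phi>\<in>X. partial_u G 0 (u 0) p \<phi> = 0) p\<^sub>0"

definition R1_eps ::
  "(real \<Rightarrow> ('a \<Rightarrow> real) \<Rightarrow> ('a \<Rightarrow> real) \<Rightarrow> real) \<Rightarrow> (real \<Rightarrow> real) \<Rightarrow>
     (real \<Rightarrow> 'a \<Rightarrow> real) \<Rightarrow> ('a \<Rightarrow> real) \<Rightarrow> real \<Rightarrow> real" where
  "R1_eps G ell u p\<^sub>0 \<epsilon> = 1 / ell \<epsilon> *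
     (LBINT s:{0..1}. partial_u G \<epsilon> (\<lambda>x. s * u \<epsilon> x + (1 - s) * u 0 x) p\<^sub>0 (\<lambda>x. u \<epsilon> x - u 0 x)
                    - partial_u G \<epsilon> (u 0) p\<^sub>0 (\<lambda>x. u \<epsilon> x - u 0 x))"

definition R2_eps ::
  "(real \<Rightarrow> ('a \<Rightarrow> real) \<Rightarrow> ('a \<Rightarrow> real) \<Rightarrow> real) \<Rightarrow> (real \<Rightarrow> real) \<Rightarrow>
     (real \<Rightarrow> 'a \<Rightarrow> real) \<Rightarrow> ('a \<Rightarrow> real) \<Rightarrow> real \<Rightarrow> real" where
  "R2_eps G ell u p\<^sub>0 \<epsilon> = 1 / ell \<epsilon> *
     (partial_u G \<epsilon> (u 0) p\<^sub>0 (\<lambda>x. u \<epsilon> x - u 0 x) - partial_u G 0 (u 0) p\<^sub>0 (\<lambda>x. u \<epsilon> x - u 0 x))"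

section \<open>The exterior problem for the corrector\<close>

definition corrector_equation ::
  "('a::euclidean_space \<Rightarrow> 'a) \<Rightarrow> ('a \<Rightarrow> 'a) \<Rightarrow> 'a set \<Rightarrow> 'a \<Rightarrow> ('a \<Rightarrow> real) \<Rightarrow> bool" where
  "corrector_equation a\<^sub>1 a\<^sub>2 \<omega> U\<^sub>0 K \<longleftrightarrow>
     (\<forall>\<phi>\<in>BL.
        (LINT x|lebesgue. (\<A> a\<^sub>1 a\<^sub>2 \<omega> x (wgrad UNIV K x + U\<^sub>0) - \<A> a\<^sub>1 a\<^sub>2 \<omega> x U\<^sub>0) \<bullet> wgrad UNIV \<phi> x)
        = - (LINT x|lebesgue_on \<omega>. (a\<^sub>1 U\<^sub>0 - a\<^sub>2 U\<^sub>0) \<bullet> wgrad UNIV \<phi> x))"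

end

theory Submission
  imports Defs
begin

text \<open>
  Only gradients enter the state equation, the adjoint equation and the Lagrangian, so everything
  takes place in the Hilbert space of square integrable vector fields, on the closed subspace of
  limits of gradients of test functions. The superposition operators acting there are Lipschitz,
  strongly monotone and directionally differentiable, although not Frechet differentiable.
  Integrating the derivative along the segment from \<open>u\<^sub>0\<close> to \<open>u\<^sub>\<epsilon>\<close>, the state and adjoint equations give
  \<open>J(\<Omega>\<^sub>\<epsilon>) - J(\<Omega>) = G(\<epsilon>,u\<^sub>0,p\<^sub>0) - G(0,u\<^sub>0,p\<^sub>0) + ell(\<epsilon>) (R\<^sub>1\<^sup>\<epsilon> + R\<^sub>2\<^sup>\<epsilon>)\<close>.

  Blow up \<open>\<nabla>(u\<^sub>\<epsilon> - u\<^sub>0)\<close> at \<open>z\<close> by \<open>x \<mapsto> z + \<epsilon> x\<close>. The blown-up fields \<open>E\<^sub>\<epsilon>\<close> solve strongly monotone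
  equations on subspaces that exhaust the gradients of test functions on the whole space, with
  coefficients that converge almost everywhere since \<open>\<nabla>u\<^sub>0\<close> is continuous at \<open>z\<close>. Gradients of test
  functions are dense among those of Beppo-Levi functions (the orthogonal complement consists of
  square integrable gradients of harmonic functions, which vanish), so strong monotonicity yields
  \<open>E\<^sub>\<epsilon> \<rightarrow> \<nabla>K\<close> strongly in \<open>L\<^sub>2\<close>. Boundedness and continuity at \<open>z\<close> of \<open>\<nabla>p\<^sub>0\<close> then allow passing to the
  limit in the rescaled \<open>R\<^sub>1\<^sup>\<epsilon>\<close> and \<open>R\<^sub>2\<^sup>\<epsilon>\<close>.
\<close>

section \<open>Smooth functions\<close>

text \<open>The corrector problem lives on the whole space, where no Poincare inequality holds: a
  limit of gradients fixes its potential only up to a constant, and the potential need not be square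
  integrable. Potentials are therefore recovered after subtracting the mean over one fixed ball. For
  the same reason the harmonic functions behind the density statement are not treated directly: the
  Caccioppoli argument is applied to translation differences of a potential, which are square
  integrable because its gradient is. The remainder of a superposition operator is bounded pointwise
  by \<open>c\<^sub>3\<close> times the squared increment. That is integrable but in general not
  square integrable, so it can be paired only with a bounded field; this is where the bound on the
  gradient of \<open>p\<^sub>0\<close> enters. Derivatives of the operators along lines, paired with
  a field that is merely in L2, rest instead on dominated convergence with the Lipschitz constant
  \<open>c\<^sub>2\<close>. Both \<open>ell\<close> and the Jacobian of the blow-up are proportional
  to \<epsilon>^d, so plain strong convergence of the blown-up fields suffices for the
  limits.\<close>

lemma C_k_SucI:
  "(\<And>x. GDERIV \<phi> x :> g x) \<Longrightarrow> (\<And>b. b \<in> Basis \<Longrightarrow> C_k k (\<lambda>x. g x \<bullet> b)) \<Longrightarrow> C_k (Suc k) \<phi>"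
  by auto

lemma GDERIV_imp_isCont: "GDERIV \<phi> x :> g \<Longrightarrow> isCont \<phi> x"
  unfolding gderiv_def by (rule has_derivative_continuous)

lemma GDERIV_unique: "GDERIV \<phi> x :> g \<Longrightarrow> GDERIV \<phi> x :> h \<Longrightarrow> g = h"
  unfolding gderiv_def
  by (drule (1) has_derivative_unique) (metis inner_commute vector_eq_rdot)

lemma grad_eqI: "GDERIV \<phi> x :> g \<Longrightarrow> grad \<phi> x = g"
  unfolding grad_def by (blast intro: GDERIV_unique)

lemma GDERIV_affine:
  fixes z :: "'a::real_inner"
  assumes "GDERIV \<phi> (z + \<epsilon> *\<^sub>R x) :> g"
  shows "GDERIV (\<lambda>x. \<phi> (z + \<epsilon> *\<^sub>R x)) x :> \<epsilon> *\<^sub>R g"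
proof -
  have "((\<lambda>x. z + \<epsilon> *\<^sub>R x) has_derivative (\<lambda>h. \<epsilon> *\<^sub>R h)) (at x)"
    by (auto intro!: derivative_eq_intros)
  from has_derivative_compose[OF this assms[unfolded gderiv_def]] show ?thesis
    unfolding gderiv_def by simp
qed

lemma GDERIV_cmult: "GDERIV \<phi> x :> g \<Longrightarrow> GDERIV (\<lambda>x. c * \<phi> x) x :> c *\<^sub>R g"
  using GDERIV_mult[OF GDERIV_const[of c x]] by simp

lemma C_k_imp_continuous_on: "C_k k \<phi> \<Longrightarrow> continuous_on UNIV \<phi>"
  by (cases k) (auto intro!: continuous_at_imp_continuous_on dest: GDERIV_imp_isCont)

lemma C_k_SucD: "C_k (Suc k) \<phi> \<Longrightarrow> C_k k \<phi>"
proof (induction k arbitrary: \<phi>)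
  case 0
  then show ?case using C_k_imp_continuous_on[of "Suc 0"] by simp
next
  case (Suc k)
  then show ?case by (auto simp del: C_k.simps(1))
qed

lemma C_k_const: "C_k k (\<lambda>x. c)"
proof (induction k arbitrary: c)
  case (Suc k)
  then show ?case by (intro C_k_SucI[of _ "\<lambda>_. 0"] GDERIV_const) simp_all
qed simp

lemma C_k_add: "C_k k \<phi> \<Longrightarrow> C_k k \<psi> \<Longrightarrow> C_k k (\<lambda>x. \<phi> x + \<psi> x)"
proof (induction k arbitrary: \<phi> \<psi>)
  case 0
  then show ?case by (auto intro: continuous_intros)
next
  case (Suc k)
  from Suc.prems obtain g h where "\<And>x. GDERIV \<phi> x :> g x" "\<And>b. b \<in> Basis \<Longrightarrow> C_k k (\<lambda>x. g x \<bullet> b)"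
    "\<And>x. GDERIV \<psi> x :> h x" "\<And>b. b \<in> Basis \<Longrightarrow> C_k k (\<lambda>x. h x \<bullet> b)"
    by (simp only: C_k.simps) blast
  then show ?case
    by (intro C_k_SucI[of _ "\<lambda>x. g x + h x"] GDERIV_add) (auto simp: inner_add_left intro: Suc.IH)
qed

lemma C_k_mult: "C_k k \<phi> \<Longrightarrow> C_k k \<psi> \<Longrightarrow> C_k k (\<lambda>x. \<phi> x * \<psi> x)"
proof (induction k arbitrary: \<phi> \<psi>)
  case 0
  then show ?case by (auto intro: continuous_intros)
next
  case (Suc k)
  from Suc.prems obtain g h where "\<And>x. GDERIV \<phi> x :> g x" "\<And>b. b \<in> Basis \<Longrightarrow> C_k k (\<lambda>x. g x \<bullet> b)"
    "\<And>x. GDERIV \<psi> x :> h x" "\<And>b. b \<in> Basis \<Longrightarrow> C_k k (\<lambda>x. h x \<bullet> b)"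
    by (simp only: C_k.simps) blast
  then show ?case using Suc.prems[THEN C_k_SucD]
    by (intro C_k_SucI[of _ "\<lambda>x. \<phi> x *\<^sub>R h x + \<psi> x *\<^sub>R g x"] GDERIV_mult)
       (auto simp: inner_add_left intro!: C_k_add Suc.IH)
qed

lemma C_k_cmult: "C_k k \<phi> \<Longrightarrow> C_k k (\<lambda>x. c * \<phi> x)"
  by (intro C_k_mult C_k_const)

lemma C_k_prod: "finite I \<Longrightarrow> (\<And>i. i \<in> I \<Longrightarrow> C_k k (\<phi> i)) \<Longrightarrow> C_k k (\<lambda>x. \<Prod>i\<in>I. \<phi> i x)"
  by (induction I rule: finite_induct) (auto intro: C_k_const C_k_mult)

lemma C_k_affine: "C_k k \<phi> \<Longrightarrow> C_k k (\<lambda>x. \<phi> (z + \<epsilon> *\<^sub>R x))"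
proof (induction k arbitrary: \<phi>)
  case 0
  then have "continuous_on UNIV \<phi>" by simp
  then have "continuous_on UNIV (\<lambda>x. \<phi> (z + \<epsilon> *\<^sub>R x))"
    by (rule continuous_on_compose2) (auto intro!: continuous_intros)
  then show ?case by simp
next
  case (Suc k)
  from Suc.prems obtain g where g: "\<And>x. GDERIV \<phi> x :> g x" "\<And>b. b \<in> Basis \<Longrightarrow> C_k k (\<lambda>x. g x \<bullet> b)"
    by auto
  show ?case
  proof (rule C_k_SucI)
    show "GDERIV (\<lambda>x. \<phi> (z + \<epsilon> *\<^sub>R x)) x :> \<epsilon> *\<^sub>R g (z + \<epsilon> *\<^sub>R x)" for x
      by (rule GDERIV_affine) (rule g)
    show "C_k k (\<lambda>x. (\<epsilon> *\<^sub>R g (z + \<epsilon> *\<^sub>R x)) \<bullet> b)" if "b \<in> Basis" for b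
      using C_k_cmult[OF Suc.IH[OF g(2)[OF that]], of \<epsilon>] by simp
  qed
qed

text \<open>The functions \<open>t\<^sup>-\<^sup>m exp (-1/t)\<close>, extended by zero, are closed under differentiation
  (up to linear combinations), hence smooth.\<close>

definition flat :: "nat \<Rightarrow> real \<Rightarrow> real" where
  "flat m t = (if t > 0 then (1 / t) ^ m / exp (1 / t) else 0)"

text \<open>After the substitution \<open>s = 1 / t\<close> the right-hand limit is the decay of
  \<open>s ^ m / exp s\<close> at infinity.\<close>

lemma flat_tendsto_0: "(flat m \<longlongrightarrow> 0) (at 0)"
proof (rule filterlim_split_at)
  show "(flat m \<longlongrightarrow> 0) (at_left 0)"
    by (rule tendsto_eventually) (auto simp: flat_def eventually_at_left[of "-1"] intro!: exI[of _ "-1"])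
  have "((\<lambda>t::real. (1 / t) ^ m / exp (1 / t)) \<longlongrightarrow> 0) (at_right 0)"
    using filterlim_compose[OF tendsto_power_div_exp_0[of m] filterlim_inverse_at_top_right]
    by (simp add: inverse_eq_divide)
  moreover have "\<forall>\<^sub>F t in at_right 0. (1 / t) ^ m / exp (1 / t) = flat m t"
    by (auto simp: flat_def eventually_at_right[of 0 1] intro!: exI[of _ 1])
  ultimately show "(flat m \<longlongrightarrow> 0) (at_right 0)" by (rule Lim_transform_eventually)
qed

lemma DERIV_flat: "DERIV (flat m) t :> flat (m + 2) t - m * flat (Suc m) t"
proof -
  consider "t > 0" | "t < 0" | "t = 0" by linarith
  then show ?thesis
  proof cases
    case 1
    have "((\<lambda>t. (1 / t) ^ m / exp (1 / t)) has_real_derivative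
       flat (m + 2) t - m * flat (Suc m) t) (at t)"
      using 1 by (auto intro!: derivative_eq_intros simp: flat_def)
        (cases m; simp add: field_simps power2_eq_square)
    then show ?thesis
      by (rule has_field_derivative_transform_within_open[of _ _ _ "{0<..}"])
         (use 1 in \<open>auto simp: flat_def\<close>)
  next
    case 2
    have "((\<lambda>t. 0) has_real_derivative 0) (at t)" by simp
    then have "(flat m has_real_derivative 0) (at t)"
      by (rule has_field_derivative_transform_within_open[of _ _ _ "{..<0}"])
         (use 2 in \<open>auto simp: flat_def\<close>)
    with 2 show ?thesis by (simp add: flat_def)
  next
    case 3
    \<comment> \<open>At the origin the difference quotient of \<open>flat m\<close> is literally
      \<open>flat (Suc m)\<close>, also for \<open>h = 0\<close>, where both sides are 0. The
      derivative there is therefore the limit 0.\<close>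
    have "flat (Suc m) = (\<lambda>h. (flat m (0 + h) - flat m 0) / h)"
      by (auto simp: flat_def)
    then have "(flat m has_real_derivative 0) (at 0)"
      unfolding DERIV_def using flat_tendsto_0[of "Suc m"] by argo
    with 3 show ?thesis by (simp add: flat_def)
  qed
qed

text \<open>The order \<open>m\<close> is generalised in the induction because the gradient of
  \<open>flat m\<close> along an affine function is a combination of the orders \<open>m + 2\<close>
  and \<open>Suc m\<close>, in the fixed direction \<open>v\<close>.\<close>

lemma C_k_flat: "C_k k (\<lambda>x. flat m (x \<bullet> v + e))"
proof (induction k arbitrary: m)
  have *: "GDERIV (\<lambda>x. flat m (x \<bullet> v + e)) x :>
      (flat (m + 2) (x \<bullet> v + e) - m * flat (Suc m) (x \<bullet> v + e)) *\<^sub>R v" for x m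
  proof (rule GDERIV_DERIV_compose[OF _ DERIV_flat])
    show "GDERIV (\<lambda>x. x \<bullet> v + e) x :> v"
      unfolding gderiv_def by (auto intro!: derivative_eq_intros)
  qed
  {
    case 0
    show ?case using GDERIV_imp_isCont[OF *[of m]]
      by (simp add: continuous_at_imp_continuous_on)
  next
    case (Suc k)
    show ?case
    proof (rule C_k_SucI[OF *])
      fix b :: 'a
      have "C_k k (\<lambda>x. (v \<bullet> b) * flat (m + 2) (x \<bullet> v + e) + (- (v \<bullet> b) * m) * flat (Suc m) (x \<bullet> v + e))"
        by (intro C_k_add C_k_cmult Suc.IH)
      then show "C_k k (\<lambda>x. ((flat (m + 2) (x \<bullet> v + e) - m * flat (Suc m) (x \<bullet> v + e)) *\<^sub>R v) \<bullet> b)"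
        by (simp add: algebra_simps)
    qed
  }
qed

lemma flat_0_bounds: "0 \<le> flat 0 t" "flat 0 t \<le> 1"
  by (auto simp: flat_def)

lemma flat_0_pos_iff: "flat 0 t \<noteq> 0 \<longleftrightarrow> t > 0"
  by (auto simp: flat_def)

text \<open>For \<open>c > 0\<close> this is smooth and positive exactly on the open box. The
  parameter \<open>c\<close> steepens the flanks: \<open>flat 0 (c * t)\<close> tends to 1 for every
  \<open>t > 0\<close> as \<open>c\<close> grows, so these are smooth approximations of the box
  indicator from below.\<close>

definition bump :: "'a::euclidean_space \<Rightarrow> 'a \<Rightarrow> real \<Rightarrow> 'a \<Rightarrow> real" where
  "bump l u c x = (\<Prod>b\<in>Basis. flat 0 (c * (x \<bullet> b - l \<bullet> b)) * flat 0 (c * (u \<bullet> b - x \<bullet> b)))"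

lemma C_k_bump: "C_k k (bump l u c)"
proof -
  have "C_k k (\<lambda>x. \<Prod>b\<in>Basis. flat 0 (x \<bullet> (c *\<^sub>R b) + - c * (l \<bullet> b)) * flat 0 (x \<bullet> (- c *\<^sub>R b) + c * (u \<bullet> b)))"
    by (intro C_k_prod C_k_mult C_k_flat) simp
  also have "(\<lambda>x. \<Prod>b\<in>Basis. flat 0 (x \<bullet> (c *\<^sub>R b) + - c * (l \<bullet> b)) * flat 0 (x \<bullet> (- c *\<^sub>R b) + c * (u \<bullet> b))) = bump l u c"
    by (auto simp: bump_def fun_eq_iff algebra_simps intro!: prod.cong arg_cong2[of _ _ _ _ "(*)"] arg_cong[of _ _ "flat 0"])
  finally show ?thesis .
qed

lemma bump_bounds: "0 \<le> bump l u c x" "bump l u c x \<le> 1"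
  by (auto simp: bump_def intro!: prod_nonneg prod_le_1 mult_le_one flat_0_bounds mult_nonneg_nonneg)

lemma bump_nonzero_iff: "c > 0 \<Longrightarrow> bump l u c x \<noteq> 0 \<longleftrightarrow> x \<in> box l u"
  by (auto simp: bump_def flat_0_pos_iff mem_box zero_less_mult_iff)

lemma bump_tendsto_indicator: "(\<lambda>n. bump l u (real (Suc n)) x) \<longlonglongrightarrow> indicator (box l u) x"
proof (cases "x \<in> box l u")
  case True
  have *: "(\<lambda>n. flat 0 (real (Suc n) * t)) \<longlonglongrightarrow> 1" if "t > 0" for t :: real
  proof -
    have "(\<lambda>n. exp (- ((1 / t) * (1 / real (Suc n))))) \<longlonglongrightarrow> exp (- ((1 / t) * 0))"
      by (intro tendsto_intros LIMSEQ_Suc[OF lim_1_over_n])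
    moreover have "exp (- ((1 / t) * (1 / real (Suc n)))) = flat 0 (real (Suc n) * t)" for n
      using that by (simp add: flat_def exp_minus inverse_eq_divide mult.commute)
    ultimately show ?thesis by simp
  qed
  have "(\<lambda>n. bump l u (real (Suc n)) x) \<longlonglongrightarrow> (\<Prod>b\<in>(Basis::'a set). 1 * 1)"
    unfolding bump_def using True by (intro tendsto_prod tendsto_mult *) (auto simp: mem_box)
  with True show ?thesis by simp
next
  case False
  then have "bump l u (real (Suc n)) x = 0" for n
    using bump_nonzero_iff[of "real (Suc n)" l u x] by auto
  then show ?thesis using False by simp
qed

section \<open>Test functions\<close>

lemma test_functionsD:
  assumes "\<phi> \<in> test_functions D"
  shows "C_k k \<phi>" "continuous_on UNIV \<phi>" "GDERIV \<phi> x :> grad \<phi> x" "continuous_on UNIV (grad \<phi>)"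
    "C_k k (\<lambda>x. grad \<phi> x \<bullet> b)"
proof -
  have C: "C_k k \<phi>" for k using assms by (auto simp: test_functions_def)
  then show "C_k k \<phi>" .
  show "continuous_on UNIV \<phi>" by (rule C_k_imp_continuous_on[OF C[of 0]])
  have G: "\<exists>g. (\<forall>x. GDERIV \<phi> x :> g x) \<and> (\<forall>b\<in>Basis. C_k k (\<lambda>x. g x \<bullet> b))" for k
    using C[of "Suc k"] by simp
  then show *: "GDERIV \<phi> x :> grad \<phi> x" for x
    using G[of 0] grad_eqI[of \<phi> x] by fastforce
  \<comment> \<open>\<open>C_k (Suc k)\<close> supplies its own gradient witness for each
    \<open>k\<close>. Uniqueness of gradients identifies all of them with
    \<open>grad \<phi>\<close>, so one function has every order of smoothness.\<close>
  have C1: "C_k k (\<lambda>x. grad \<phi> x \<bullet> b)" if "b \<in> Basis" for b k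
  proof -
    obtain g where g: "\<forall>x. GDERIV \<phi> x :> g x" "\<forall>b\<in>Basis. C_k k (\<lambda>x. g x \<bullet> b)" using G by blast
    then have "grad \<phi> = g" using grad_eqI by blast
    with g that show ?thesis by simp
  qed
  show "continuous_on UNIV (grad \<phi>)"
    using C1[of _ 0] by (subst continuous_on_componentwise) auto
  have fin: "C_k k (\<lambda>x. \<Sum>i\<in>I. (grad \<phi> x \<bullet> i) * (b \<bullet> i))" if "finite I" "I \<subseteq> Basis" for I
    using that by (induction I rule: finite_induct) (auto intro!: C_k_const C_k_add C_k_mult C1)
  show "C_k k (\<lambda>x. grad \<phi> x \<bullet> b)"
    using fin[of Basis] by (simp add: euclidean_inner[of _ b])
qed

lemma test_functions_support:
  assumes "\<phi> \<in> test_functions D"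
  obtains S where "compact S" "S \<subseteq> D" "\<And>x. x \<notin> S \<Longrightarrow> \<phi> x = 0" "\<And>x. x \<notin> S \<Longrightarrow> grad \<phi> x = 0"
proof
  let ?S = "closure {x. \<phi> x \<noteq> 0}"
  show "compact ?S" "?S \<subseteq> D" using assms by (auto simp: test_functions_def)
  show z: "\<phi> x = 0" if "x \<notin> ?S" for x using that closure_subset[of "{x. \<phi> x \<noteq> 0}"] by auto
  show "grad \<phi> x = 0" if "x \<notin> ?S" for x
  proof (rule grad_eqI)
    have "((\<lambda>x. 0) has_derivative (\<lambda>h. h \<bullet> 0)) (at x)" by simp
    then show "GDERIV \<phi> x :> 0" unfolding gderiv_def
    proof (rule has_derivative_transform_within_open[of _ _ _ _ "- ?S"])
      show "open (- ?S)" by (rule open_Compl) simp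
      show "x \<in> - ?S" using that by simp
      show "0 = \<phi> y" if "y \<in> - ?S" for y using z[of y] that by simp
    qed
  qed
qed

lemma test_functionsI:
  assumes "\<And>k. C_k k \<phi>" "compact S" "S \<subseteq> D" "\<And>x. x \<notin> S \<Longrightarrow> \<phi> x = 0"
  shows "\<phi> \<in> test_functions D"
proof -
  have "closure {x. \<phi> x \<noteq> 0} \<subseteq> S"
    using assms by (intro closure_minimal) (auto intro: compact_imp_closed)
  then show ?thesis using assms
    using compact_Int_closed[of S "closure {x. \<phi> x \<noteq> 0}"]
    by (auto simp: test_functions_def Int_absorb1)
qed

lemma test_functions_mono: "D \<subseteq> E \<Longrightarrow> test_functions D \<subseteq> test_functions E"
  by (auto simp: test_functions_def)

lemma test_functions_mult_smooth:
  assumes "\<phi> \<in> test_functions D" "\<And>k. C_k k \<psi>"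
  shows "(\<lambda>x. \<phi> x * \<psi> x) \<in> test_functions D"
proof -
  obtain S where "compact S" "S \<subseteq> D" "\<And>x. x \<notin> S \<Longrightarrow> \<phi> x = 0" using test_functions_support[OF assms(1)] by metis
  then show ?thesis using assms(2) test_functionsD(1)[OF assms(1)]
    by (intro test_functionsI[of _ S] C_k_mult) auto
qed

lemma test_functions_cmult: "\<phi> \<in> test_functions D \<Longrightarrow> (\<lambda>x. c * \<phi> x) \<in> test_functions D"
  using test_functions_mult_smooth[OF _ C_k_const, of \<phi> D c] by (simp add: mult.commute)

lemma test_functions_add:
  assumes "\<phi> \<in> test_functions D" "\<psi> \<in> test_functions D"
  shows "(\<lambda>x. \<phi> x + \<psi> x) \<in> test_functions D"
proof -
  obtain S where "compact S" "S \<subseteq> D" "\<And>x. x \<notin> S \<Longrightarrow> \<phi> x = 0" using test_functions_support[OF assms(1)] by metis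
  moreover obtain T where "compact T" "T \<subseteq> D" "\<And>x. x \<notin> T \<Longrightarrow> \<psi> x = 0" using test_functions_support[OF assms(2)] by metis
  ultimately show ?thesis using test_functionsD(1)[OF assms(1)] test_functionsD(1)[OF assms(2)]
    by (intro test_functionsI[of _ "S \<union> T"] C_k_add) auto
qed

lemma test_functions_zero: "(\<lambda>x. 0) \<in> test_functions D"
  by (intro test_functionsI[of _ "{}"] C_k_const) auto

lemma test_functions_affine:
  assumes "\<phi> \<in> test_functions D" "\<epsilon> \<noteq> 0" "\<And>x. z + \<epsilon> *\<^sub>R x \<in> D \<Longrightarrow> x \<in> E"
  shows "(\<lambda>x. \<phi> (z + \<epsilon> *\<^sub>R x)) \<in> test_functions E"
proof -
  obtain S where S: "compact S" "S \<subseteq> D" "\<And>x. x \<notin> S \<Longrightarrow> \<phi> x = 0" using test_functions_support[OF assms(1)] by metis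
  let ?T = "(\<lambda>y. (1 / \<epsilon>) *\<^sub>R (y - z)) ` S"
  have mem: "x \<in> ?T" if "z + \<epsilon> *\<^sub>R x \<in> S" for x
    using that assms(2) by (intro image_eqI[of _ _ "z + \<epsilon> *\<^sub>R x"]) auto
  show ?thesis
  proof (rule test_functionsI[of _ ?T])
    show "compact ?T" by (intro compact_continuous_image S continuous_intros)
    show "?T \<subseteq> E" using S(2) assms(2,3) by auto
    show "\<phi> (z + \<epsilon> *\<^sub>R x) = 0" if "x \<notin> ?T" for x using mem that S(3) by blast
  qed (rule C_k_affine[OF test_functionsD(1)[OF assms(1)]])
qed

lemma bump_test_function: "c > 0 \<Longrightarrow> cbox l u \<subseteq> D \<Longrightarrow> bump l u c \<in> test_functions D"
  using bump_nonzero_iff[of c l u] box_subset_cbox[of l u]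
  by (intro test_functionsI[of _ "cbox l u"] C_k_bump) auto

lemma grad_affine:
  assumes "\<phi> \<in> test_functions D"
  shows "grad (\<lambda>x. \<phi> (z + \<epsilon> *\<^sub>R x)) x = \<epsilon> *\<^sub>R grad \<phi> (z + \<epsilon> *\<^sub>R x)"
  by (rule grad_eqI) (intro GDERIV_affine test_functionsD(3)[OF assms])

lemma grad_add:
  assumes "\<phi> \<in> test_functions D" "\<psi> \<in> test_functions E"
  shows "grad (\<lambda>x. \<phi> x + \<psi> x) x = grad \<phi> x + grad \<psi> x"
  by (rule grad_eqI) (intro GDERIV_add test_functionsD(3)[OF assms(1)] test_functionsD(3)[OF assms(2)])

lemma grad_cmult:
  assumes "\<phi> \<in> test_functions D"
  shows "grad (\<lambda>x. c * \<phi> x) x = c *\<^sub>R grad \<phi> x"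
  by (rule grad_eqI) (intro GDERIV_cmult test_functionsD(3)[OF assms(1)])

lemma compact_support_bounded:
  fixes f :: "'a::euclidean_space \<Rightarrow> 'b::real_normed_vector"
  assumes "continuous_on UNIV f" "compact S" "\<And>x. x \<notin> S \<Longrightarrow> f x = 0"
  obtains M where "M > 0" "\<And>x. norm (f x) \<le> M"
proof -
  have "bounded (f ` S)"
    using assms by (intro compact_imp_bounded compact_continuous_image) (auto intro: continuous_on_subset)
  then obtain M where "M > 0" "\<And>x. x \<in> S \<Longrightarrow> norm (f x) \<le> M"
    unfolding bounded_pos by auto
  then show ?thesis using that[of M] assms(3) by (metis norm_zero less_imp_le)
qed

lemma continuous_on_imp_lebesgue_measurable:
  fixes f :: "'a::euclidean_space \<Rightarrow> 'b::real_normed_vector"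
  shows "continuous_on UNIV f \<Longrightarrow> f \<in> borel_measurable lebesgue"
  by (intro measurable_completion) (auto intro: borel_measurable_continuous_onI)

lemma test_functions_measurable:
  assumes "\<phi> \<in> test_functions D"
  shows "\<phi> \<in> borel_measurable borel" "grad \<phi> \<in> borel_measurable borel"
    "\<phi> \<in> borel_measurable lebesgue" "grad \<phi> \<in> borel_measurable lebesgue"
  using test_functionsD(2,4)[OF assms]
  by (auto intro: borel_measurable_continuous_onI continuous_on_imp_lebesgue_measurable)

lemma compact_support_integrable:
  fixes f :: "'a::euclidean_space \<Rightarrow> 'b::euclidean_space"
  assumes "continuous_on UNIV f" "compact S" "\<And>x. x \<notin> S \<Longrightarrow> f x = 0"
  shows "integrable lborel f" "integrable lebesgue f"
proof -
  have "integrable lborel (\<lambda>x. indicator S x *\<^sub>R f x)"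
    using borel_integrable_compact[of S f] assms by (auto intro: continuous_on_subset)
  also have "(\<lambda>x. indicator S x *\<^sub>R f x) = f" using assms(3) by (auto simp: indicator_def)
  finally show "integrable lborel f" .
  then show "integrable lebesgue f"
    using assms(1) by (subst integrable_completion) (auto intro: borel_measurable_continuous_onI)
qed

lemma test_functions_bounds:
  assumes "\<phi> \<in> test_functions D"
  obtains M where "M > 0" "\<And>x. norm (\<phi> x) \<le> M" "\<And>x. norm (grad \<phi> x) \<le> M"
proof -
  obtain S where S: "compact S" "\<And>x. x \<notin> S \<Longrightarrow> \<phi> x = 0" "\<And>x. x \<notin> S \<Longrightarrow> grad \<phi> x = 0"
    using test_functions_support[OF assms] by metis
  obtain M where "M > 0" "\<And>x. norm (\<phi> x) \<le> M"
    using compact_support_bounded[OF test_functionsD(2)[OF assms] S(1,2)] by blast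
  moreover obtain N where "N > 0" "\<And>x. norm (grad \<phi> x) \<le> N"
    using compact_support_bounded[OF test_functionsD(4)[OF assms] S(1,3)] by blast
  ultimately show ?thesis using that[of "max M N"] by (metis less_max_iff_disj max.coboundedI1 max.coboundedI2)
qed

section \<open>Lebesgue integration on subsets and under affine maps\<close>

lemma
  fixes f :: "'a::euclidean_space \<Rightarrow> 'b::euclidean_space"
  assumes "S \<in> sets lebesgue"
  shows integral_lebesgue_on:
      "(LINT x|lebesgue_on S. f x) = (LINT x|lebesgue. indicator S x *\<^sub>R f x)"
    and integrable_lebesgue_on:
      "integrable (lebesgue_on S) f \<longleftrightarrow> integrable lebesgue (\<lambda>x. indicator S x *\<^sub>R f x)"
    and measurable_lebesgue_on:
      "f \<in> borel_measurable (lebesgue_on S) \<longleftrightarrow> (\<lambda>x. indicator S x *\<^sub>R f x) \<in> borel_measurable lebesgue"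
  using assms
  by (simp_all add: integral_restrict_space integrable_restrict_space borel_measurable_restrict_space_iff)

lemma AE_lebesgue_on:
  "S \<in> sets lebesgue \<Longrightarrow> (AE x in lebesgue_on S. P x) \<longleftrightarrow> (AE x in lebesgue. x \<in> S \<longrightarrow> P x)"
  by (simp add: AE_restrict_space_iff)

lemma integral_lebesgue_on_eq:
  fixes f :: "'a::euclidean_space \<Rightarrow> 'b::euclidean_space"
  assumes "S \<in> sets lebesgue" "\<And>x. x \<notin> S \<Longrightarrow> f x = 0"
  shows "(LINT x|lebesgue_on S. f x) = (LINT x|lebesgue. f x)"
  unfolding integral_lebesgue_on[OF assms(1)]
  by (rule Bochner_Integration.integral_cong) (use assms(2) in \<open>auto simp: indicator_def\<close>)

lemma integrable_lebesgue_on_eq: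
  fixes f :: "'a::euclidean_space \<Rightarrow> 'b::euclidean_space"
  assumes "S \<in> sets lebesgue" "\<And>x. x \<notin> S \<Longrightarrow> f x = 0"
  shows "integrable (lebesgue_on S) f \<longleftrightarrow> integrable lebesgue f"
  unfolding integrable_lebesgue_on[OF assms(1)]
  by (rule Bochner_Integration.integrable_cong) (use assms(2) in \<open>auto simp: indicator_def\<close>)

text \<open>Fubini is used on products of \<open>lborel\<close>, where a Lebesgue measurable
  function composed with a sum or difference of the variables need not be measurable. A Borel
  representative is taken instead, coordinate by coordinate.\<close>

lemma borel_version:
  fixes f :: "'a::euclidean_space \<Rightarrow> 'b::euclidean_space"
  assumes "f \<in> borel_measurable lebesgue"
  obtains g where "g \<in> borel_measurable borel" "AE x in lebesgue. f x = g x"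
proof -
  have "\<forall>b\<in>Basis. \<exists>g\<in>borel_measurable lborel. AE x in lborel. f x \<bullet> b = g x"
    using assms by (intro ballI completion_ex_borel_measurable_real borel_measurable_inner) auto
  then obtain g where g: "\<And>b. b \<in> Basis \<Longrightarrow> g b \<in> borel_measurable lborel"
    "\<And>b. b \<in> Basis \<Longrightarrow> AE x in lborel. f x \<bullet> b = g b x" by metis
  have "AE x in lborel. \<forall>b\<in>Basis. f x \<bullet> b = g b x"
    by (intro AE_finite_allI g) simp
  then have "AE x in lebesgue. f x = (\<Sum>b\<in>Basis. g b x *\<^sub>R b)"
  proof (intro AE_completion, eventually_elim)
    case (elim x)
    then have "(\<Sum>b\<in>Basis. g b x *\<^sub>R b) = (\<Sum>b\<in>Basis. (f x \<bullet> b) *\<^sub>R b)" by (intro sum.cong) simp_all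
    then show ?case by (simp add: euclidean_representation)
  qed
  moreover have "(\<lambda>x. \<Sum>b\<in>Basis. g b x *\<^sub>R b) \<in> borel_measurable borel"
    using g(1) by (intro borel_measurable_sum borel_measurable_scaleR) auto
  ultimately show ?thesis by (rule that[rotated])
qed

context
  fixes z :: "'a::euclidean_space" and \<epsilon> :: real
  assumes \<epsilon>: "\<epsilon> \<noteq> 0"
begin

lemma lebesgue_affine:
  "lebesgue = density (distr lebesgue lebesgue (\<lambda>x. z + \<epsilon> *\<^sub>R x)) (\<lambda>_. ennreal (\<bar>\<epsilon>\<bar> ^ DIM('a)))"
  and affine_measurable: "(\<lambda>x. z + \<epsilon> *\<^sub>R x) \<in> lebesgue \<rightarrow>\<^sub>M lebesgue"
proof -
  \<comment> \<open>The facts on affine images allow a separate factor for each coordinate; with all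
    factors equal to \<open>\<epsilon>\<close> the sum is scalar multiplication.\<close>
  have *: "(\<lambda>x. z + (\<Sum>j\<in>Basis. (\<epsilon> * (x \<bullet> j)) *\<^sub>R j)) = (\<lambda>x. z + \<epsilon> *\<^sub>R x)"
    unfolding scaleR_scaleR[symmetric] scaleR_sum_right[symmetric]
    by (simp add: euclidean_representation)
  show "lebesgue = density (distr lebesgue lebesgue (\<lambda>x. z + \<epsilon> *\<^sub>R x)) (\<lambda>_. ennreal (\<bar>\<epsilon>\<bar> ^ DIM('a)))"
    using lebesgue_affine_euclidean[of "\<lambda>_. \<epsilon>" z] \<epsilon> unfolding * by simp
  show "(\<lambda>x. z + \<epsilon> *\<^sub>R x) \<in> lebesgue \<rightarrow>\<^sub>M lebesgue"
    using lebesgue_affine_measurable[of "\<lambda>_. \<epsilon>" z] \<epsilon> unfolding * by simp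
qed

lemma nn_integral_affine:
  assumes f: "f \<in> borel_measurable lebesgue"
  shows "(\<integral>\<^sup>+x. f x \<partial>lebesgue) = ennreal (\<bar>\<epsilon>\<bar> ^ DIM('a)) * (\<integral>\<^sup>+x. f (z + \<epsilon> *\<^sub>R x) \<partial>lebesgue)"
proof -
  have "(\<integral>\<^sup>+x. f x \<partial>lebesgue) =
      (\<integral>\<^sup>+x. f x \<partial>density (distr lebesgue lebesgue (\<lambda>x. z + \<epsilon> *\<^sub>R x)) (\<lambda>_. ennreal (\<bar>\<epsilon>\<bar> ^ DIM('a))))"
    using lebesgue_affine by simp
  also have "\<dots> = ennreal (\<bar>\<epsilon>\<bar> ^ DIM('a)) * (\<integral>\<^sup>+x. f x \<partial>distr lebesgue lebesgue (\<lambda>x. z + \<epsilon> *\<^sub>R x))"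
    using f by (simp add: nn_integral_density nn_integral_cmult)
  also have "\<dots> = ennreal (\<bar>\<epsilon>\<bar> ^ DIM('a)) * (\<integral>\<^sup>+x. f (z + \<epsilon> *\<^sub>R x) \<partial>lebesgue)"
    using f affine_measurable by (simp add: nn_integral_distr)
  finally show ?thesis .
qed

lemma measurable_affine:
  "f \<in> borel_measurable lebesgue \<Longrightarrow> (\<lambda>x. f (z + \<epsilon> *\<^sub>R x)) \<in> borel_measurable lebesgue"
  using measurable_compose[OF affine_measurable] by blast

lemma AE_affine:
  assumes "AE x in lebesgue. P x"
  shows "AE x in lebesgue. P (z + \<epsilon> *\<^sub>R x)"
proof -
  have "AE x in density (distr lebesgue lebesgue (\<lambda>x. z + \<epsilon> *\<^sub>R x)) (\<lambda>_. ennreal (\<bar>\<epsilon>\<bar> ^ DIM('a))). P x"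
    using assms by (subst lebesgue_affine[symmetric])
  then have "AE x in distr lebesgue lebesgue (\<lambda>x. z + \<epsilon> *\<^sub>R x). P x"
    using \<epsilon> by (simp add: AE_density)
  then show ?thesis
    by (rule AE_distrD[OF affine_measurable])
qed

lemma
  fixes f :: "'a \<Rightarrow> 'b::euclidean_space"
  assumes f: "f \<in> borel_measurable lebesgue"
  shows integral_affine: "(LINT x|lebesgue. f x) = \<bar>\<epsilon>\<bar> ^ DIM('a) *\<^sub>R (LINT x|lebesgue. f (z + \<epsilon> *\<^sub>R x))"
    and integrable_affine_iff: "integrable lebesgue (\<lambda>x. f (z + \<epsilon> *\<^sub>R x)) \<longleftrightarrow> integrable lebesgue f"
proof -
  let ?D = "density (distr lebesgue lebesgue (\<lambda>x. z + \<epsilon> *\<^sub>R x)) (\<lambda>_. ennreal (\<bar>\<epsilon>\<bar> ^ DIM('a)))"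
  have "(LINT x|lebesgue. f x) = (LINT x|?D. f x)"
    using lebesgue_affine by simp
  also have "\<dots> = \<bar>\<epsilon>\<bar> ^ DIM('a) *\<^sub>R (LINT x|lebesgue. f (z + \<epsilon> *\<^sub>R x))"
    using f affine_measurable by (subst integral_density) (auto simp: integral_distr)
  finally show "(LINT x|lebesgue. f x) = \<bar>\<epsilon>\<bar> ^ DIM('a) *\<^sub>R (LINT x|lebesgue. f (z + \<epsilon> *\<^sub>R x))" .
  have "integrable lebesgue f \<longleftrightarrow> integrable ?D f"
    using lebesgue_affine by simp
  also have "\<dots> \<longleftrightarrow> integrable lebesgue (\<lambda>x. f (z + \<epsilon> *\<^sub>R x))"
  proof (subst integrable_density)
    have "integrable (distr lebesgue lebesgue (\<lambda>x. z + \<epsilon> *\<^sub>R x)) (\<lambda>x. \<bar>\<epsilon>\<bar> ^ DIM('a) *\<^sub>R f x)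
        \<longleftrightarrow> integrable lebesgue (\<lambda>x. \<bar>\<epsilon>\<bar> ^ DIM('a) *\<^sub>R f (z + \<epsilon> *\<^sub>R x))"
      using f affine_measurable by (intro integrable_distr_eq) auto
    then show "integrable (distr lebesgue lebesgue (\<lambda>x. z + \<epsilon> *\<^sub>R x)) (\<lambda>x. \<bar>\<epsilon>\<bar> ^ DIM('a) *\<^sub>R f x)
        \<longleftrightarrow> integrable lebesgue (\<lambda>x. f (z + \<epsilon> *\<^sub>R x))"
      using \<epsilon> integrable_scaleR_right[of "inverse (\<bar>\<epsilon>\<bar> ^ DIM('a))" lebesgue "\<lambda>x. \<bar>\<epsilon>\<bar> ^ DIM('a) *\<^sub>R f (z + \<epsilon> *\<^sub>R x)"]
      by auto
  qed (use f in auto)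
  finally show "integrable lebesgue (\<lambda>x. f (z + \<epsilon> *\<^sub>R x)) \<longleftrightarrow> integrable lebesgue f" by simp
qed

end

section \<open>The fundamental lemma of the calculus of variations\<close>

text \<open>Dynkin argument: boxes are stable under intersection and generate the Borel sets.
  Closure under complements requires that the total integral vanishes, which is why an exhaustion by
  boxes is treated first.\<close>

lemma AE_zero_if_box_integrals_zero:
  fixes f :: "'a::euclidean_space \<Rightarrow> 'b::euclidean_space"
  assumes f: "integrable lborel f"
    and box: "\<And>l u. (LINT x:box l u|lborel. f x) = 0"
  shows "AE x in lborel. f x = 0"
proof (rule sigma_finite_measure.density_zero[OF lborel.sigma_finite_measure_axioms f])
  let ?G = "range (\<lambda>(l, u). box l u :: 'a set)"
  have "(\<lambda>n. LINT x:box (- real n *\<^sub>R One) (real n *\<^sub>R One)|lborel. f x) \<longlonglongrightarrow> (LINT x|lborel. f x)"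
    unfolding set_lebesgue_integral_def
  proof (rule integral_dominated_convergence[where w="\<lambda>x. norm (f x)"])
    show "AE x in lborel. (\<lambda>n. indicat_real (box (- real n *\<^sub>R One) (real n *\<^sub>R One)) x *\<^sub>R f x) \<longlonglongrightarrow> f x"
    proof (rule AE_I2)
      fix x :: 'a
      obtain N where N: "norm x < real N" using reals_Archimedean2 by blast
      have "x \<in> box (- real n *\<^sub>R One) (real n *\<^sub>R One)" if "n \<ge> N" for n
        using Basis_le_norm[of _ x] N that by (fastforce simp: mem_box abs_le_iff)
      then have "\<forall>\<^sub>F n in sequentially. f x = indicat_real (box (- real n *\<^sub>R One) (real n *\<^sub>R One)) x *\<^sub>R f x"
        by (intro eventually_sequentiallyI[of N]) simp
      then show "(\<lambda>n. indicat_real (box (- real n *\<^sub>R One) (real n *\<^sub>R One)) x *\<^sub>R f x) \<longlonglongrightarrow> f x"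
        by (rule Lim_transform_eventually[OF tendsto_const])
    qed
  qed (use f in \<open>auto simp: indicator_def\<close>)
  then have total: "(LINT x|lborel. f x) = 0"
    using box by (simp add: LIMSEQ_const_iff)
  fix A :: "'a set" assume "A \<in> sets lborel"
  then have A: "A \<in> sigma_sets UNIV ?G"
    by (simp add: borel_eq_box)
  have "Int_stable ?G"
    by (auto simp: Int_stable_def box_Int_box)
  moreover have "?G \<subseteq> Pow UNIV" by simp
  ultimately show "(LINT x:A|lborel. f x) = 0"
    using A
  proof (induction A rule: sigma_sets_induct_disjoint[consumes 3, case_names basic empty compl union])
    case (basic A)
    then show ?case using box by auto
  next
    case empty
    then show ?case by (simp add: set_lebesgue_integral_def)
  next
    case (compl A)
    have "A \<in> sets lborel" using compl(1) by (simp add: borel_eq_box)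
    then have "(LINT x:UNIV - A|lborel. f x) = (LINT x|lborel. f x - indicator A x *\<^sub>R f x)"
      unfolding set_lebesgue_integral_def
      by (intro Bochner_Integration.integral_cong) (auto simp: indicator_def)
    also have "\<dots> = (LINT x|lborel. f x) - (LINT x:A|lborel. f x)"
      unfolding set_lebesgue_integral_def using f \<open>A \<in> sets lborel\<close>
      by (intro Bochner_Integration.integral_diff integrable_mult_indicator) auto
    finally show ?case using compl total by simp
  next
    case (union A)
    have A: "A i \<in> sets lborel" for i using union(2) by (auto simp: borel_eq_box)
    then have "(LINT x:(\<Union>i. A i)|lborel. f x) = (\<Sum>i. LINT x:A i|lborel. f x)"
      using union(1) f
      by (intro lebesgue_integral_countable_add)
         (auto simp: disjoint_family_on_def set_integrable_def intro!: integrable_mult_indicator)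
    then show ?case using union by simp
  qed
qed

text \<open>Common source of integrability for products with a test function or its gradient: such a
  product lives on a compact \<open>S\<close> and is dominated there by a multiple of
  \<open>w\<close>. The whole-space version is included because the later computations take place
  over \<open>lebesgue\<close>.\<close>

lemma L1_loc_dominated:
  fixes w :: "'a::euclidean_space \<Rightarrow> 'b::euclidean_space" and p :: "'a \<Rightarrow> 'c::euclidean_space"
  assumes D: "D \<in> sets lebesgue" and w: "w \<in> L1_loc D" and S: "compact S" "S \<subseteq> D"
    and p: "p \<in> borel_measurable (lebesgue_on S)" "\<And>x. x \<notin> S \<Longrightarrow> p x = 0"
      "\<And>x. x \<in> S \<Longrightarrow> norm (p x) \<le> M * norm (w x)"
  shows "integrable (lebesgue_on D) p" "integrable lebesgue p"
proof -
  have S': "S \<in> sets lebesgue" using S by (simp add: compact_imp_closed)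
  have "integrable (lebesgue_on S) w" using w S by (auto simp: L1_loc_def)
  then have "integrable (lebesgue_on S) (\<lambda>x. M * norm (w x))" by simp
  then have "integrable (lebesgue_on S) p"
    by (rule Bochner_Integration.integrable_bound[OF _ p(1)])
       (use p(3) in \<open>auto simp: intro!: AE_I2 order_trans[OF p(3) abs_ge_self]\<close>)
  then show "integrable lebesgue p"
    using p(2) integrable_lebesgue_on_eq[OF S', of p] by simp
  then show "integrable (lebesgue_on D) p"
    using p(2) S(2) by (subst integrable_lebesgue_on_eq[OF D]) auto
qed

lemma L1_loc_measurable:
  "w \<in> L1_loc D \<Longrightarrow> compact S \<Longrightarrow> S \<subseteq> D \<Longrightarrow> w \<in> borel_measurable (lebesgue_on S)"
  by (auto simp: L1_loc_def)

lemma
  fixes w :: "'a::euclidean_space \<Rightarrow> 'b::euclidean_space"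
  assumes D: "D \<in> sets lebesgue" and w: "w \<in> L1_loc D" and \<phi>: "\<phi> \<in> test_functions D"
  shows integrable_test_scaleR:
      "integrable (lebesgue_on D) (\<lambda>x. \<phi> x *\<^sub>R w x)" "integrable lebesgue (\<lambda>x. \<phi> x *\<^sub>R w x)"
proof -
  obtain S where S: "compact S" "S \<subseteq> D" "\<And>x. x \<notin> S \<Longrightarrow> \<phi> x = 0" "\<And>x. x \<notin> S \<Longrightarrow> grad \<phi> x = 0"
    using test_functions_support[OF \<phi>] by metis
  obtain M where M: "\<And>x. norm (\<phi> x) \<le> M" using test_functions_bounds[OF \<phi>] by metis
  have "(\<lambda>x. \<phi> x *\<^sub>R w x) \<in> borel_measurable (lebesgue_on S)"
    by (intro borel_measurable_scaleR L1_loc_measurable[OF w S(1,2)]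
        measurable_restrict_space1 test_functions_measurable[OF \<phi>])
  moreover have "norm (\<phi> x *\<^sub>R w x) \<le> M * norm (w x)" for x
    using M[of x] by (simp add: mult_right_mono)
  ultimately show "integrable (lebesgue_on D) (\<lambda>x. \<phi> x *\<^sub>R w x)" "integrable lebesgue (\<lambda>x. \<phi> x *\<^sub>R w x)"
    using S(3) by (blast intro: L1_loc_dominated[OF D w S(1,2), of "\<lambda>x. \<phi> x *\<^sub>R w x" M] scaleR_eq_0_iff[THEN iffD2])+
qed

lemma
  fixes u :: "'a::euclidean_space \<Rightarrow> real"
  assumes D: "D \<in> sets lebesgue" and u: "u \<in> L1_loc D" and \<phi>: "\<phi> \<in> test_functions D"
  shows integrable_scaleR_grad_test:
      "integrable (lebesgue_on D) (\<lambda>x. u x *\<^sub>R grad \<phi> x)" "integrable lebesgue (\<lambda>x. u x *\<^sub>R grad \<phi> x)"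
proof -
  obtain S where S: "compact S" "S \<subseteq> D" "\<And>x. x \<notin> S \<Longrightarrow> \<phi> x = 0" "\<And>x. x \<notin> S \<Longrightarrow> grad \<phi> x = 0"
    using test_functions_support[OF \<phi>] by metis
  obtain M where M: "\<And>x. norm (grad \<phi> x) \<le> M" using test_functions_bounds[OF \<phi>] by metis
  have "(\<lambda>x. u x *\<^sub>R grad \<phi> x) \<in> borel_measurable (lebesgue_on S)"
    by (intro borel_measurable_scaleR L1_loc_measurable[OF u S(1,2)]
        measurable_restrict_space1 test_functions_measurable[OF \<phi>])
  moreover have "norm (u x *\<^sub>R grad \<phi> x) \<le> M * norm (u x)" for x
    using mult_left_mono[OF M[of x], of "\<bar>u x\<bar>"] by (simp add: mult.commute)
  ultimately show "integrable (lebesgue_on D) (\<lambda>x. u x *\<^sub>R grad \<phi> x)" "integrable lebesgue (\<lambda>x. u x *\<^sub>R grad \<phi> x)"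
    using S(4) by (blast intro: L1_loc_dominated[OF D u S(1,2), of "\<lambda>x. u x *\<^sub>R grad \<phi> x" M] scaleR_eq_0_iff[THEN iffD2])+
qed

text \<open>Bumps of increasing steepness turn the hypothesis into vanishing integrals over all
  boxes whose closed box lies in \<open>D\<close>, with \<open>w\<close> itself on the closed box as
  dominating function. Each closed box in \<open>D\<close> then falls under the box criterion, and
  \<open>D\<close> is a countable union of such boxes.\<close>

theorem fundamental_lemma:
  fixes w :: "'a::euclidean_space \<Rightarrow> 'b::euclidean_space"
  assumes D: "open D" and w: "w \<in> L1_loc D"
    and test: "\<And>\<phi>. \<phi> \<in> test_functions D \<Longrightarrow> (LINT x|lebesgue_on D. \<phi> x *\<^sub>R w x) = 0"
  shows "AE x in lebesgue_on D. w x = 0"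
proof -
  have D': "D \<in> sets lebesgue" using D by simp
  have box: "(LINT x|lebesgue. indicator (box l u) x *\<^sub>R w x) = 0" if lu: "cbox l u \<subseteq> D" for l u
  proof -
    have w': "integrable lebesgue (\<lambda>x. indicator (cbox l u) x *\<^sub>R w x)"
      using w lu by (simp add: L1_loc_def integrable_lebesgue_on[symmetric])
    have "(\<lambda>n. LINT x|lebesgue. bump l u (real (Suc n)) x *\<^sub>R w x)
        \<longlonglongrightarrow> (LINT x|lebesgue. indicator (box l u) x *\<^sub>R w x)"
    proof (rule integral_dominated_convergence[where w="\<lambda>x. norm (indicator (cbox l u) x *\<^sub>R w x)"])
      have bw: "bump l u (real (Suc n)) \<in> test_functions D" for n using lu by (intro bump_test_function) auto
      show "(\<lambda>x. bump l u (real (Suc n)) x *\<^sub>R w x) \<in> borel_measurable lebesgue" for n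
        using integrable_test_scaleR(2)[OF D' w bw] by (rule borel_measurable_integrable)
      have "(\<lambda>x. indicat_real (box l u) x *\<^sub>R indicat_real (cbox l u) x *\<^sub>R w x) \<in> borel_measurable lebesgue"
        by (intro borel_measurable_scaleR borel_measurable_integrable[OF w'] borel_measurable_indicator) simp
      also have "(\<lambda>x. indicat_real (box l u) x *\<^sub>R indicat_real (cbox l u) x *\<^sub>R w x) =
          (\<lambda>x. indicator (box l u) x *\<^sub>R w x)"
        using box_subset_cbox by (fastforce simp: indicator_def)
      finally show "(\<lambda>x. indicator (box l u) x *\<^sub>R w x) \<in> borel_measurable lebesgue" .
      show "integrable lebesgue (\<lambda>x. norm (indicator (cbox l u) x *\<^sub>R w x))"
        using w' by (rule integrable_norm)
      show "AE x in lebesgue. (\<lambda>n. bump l u (real (Suc n)) x *\<^sub>R w x) \<longlonglongrightarrow> indicator (box l u) x *\<^sub>R w x"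
        by (intro AE_I2 tendsto_scaleR bump_tendsto_indicator tendsto_const)
      show "AE x in lebesgue. norm (bump l u (real (Suc n)) x *\<^sub>R w x) \<le> norm (indicator (cbox l u) x *\<^sub>R w x)" for n
      proof (rule AE_I2)
        fix x
        have "\<bar>bump l u (real (Suc n)) x\<bar> \<le> indicat_real (cbox l u) x"
          using bump_bounds[of l u "real (Suc n)" x] bump_nonzero_iff[of "real (Suc n)" l u x]
            box_subset_cbox[of l u] by (auto simp: indicator_def)
        then show "norm (bump l u (real (Suc n)) x *\<^sub>R w x) \<le> norm (indicator (cbox l u) x *\<^sub>R w x)"
          by (simp add: mult_right_mono)
      qed
    qed
    moreover have "(LINT x|lebesgue. bump l u (real (Suc n)) x *\<^sub>R w x) = 0" for n
    proof -
      have bt: "bump l u (real (Suc n)) \<in> test_functions D" using lu by (intro bump_test_function) auto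
      have "bump l u (real (Suc n)) x = 0" if "x \<notin> D" for x
        using that lu box_subset_cbox[of l u] bump_nonzero_iff[of "real (Suc n)" l u x] by auto
      then show ?thesis
        using test[OF bt] by (subst (asm) integral_lebesgue_on_eq[OF D']) auto
    qed
    ultimately show ?thesis by (simp add: LIMSEQ_const_iff)
  qed
  have cbox: "AE x in lebesgue. x \<in> cbox a b \<longrightarrow> w x = 0" if ab: "cbox a b \<subseteq> D" for a b
  proof -
    define W where "W x = indicator (cbox a b) x *\<^sub>R w x" for x
    have W: "integrable lebesgue W"
      using w ab by (simp add: W_def[abs_def] L1_loc_def integrable_lebesgue_on[symmetric])
    obtain W' where W': "W' \<in> borel_measurable borel" "AE x in lebesgue. W x = W' x"
      using borel_version borel_measurable_integrable[OF W] by blast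
    have "AE x in lborel. W' x = 0"
    proof (rule AE_zero_if_box_integrals_zero)
      have "integrable lebesgue W'"
        using W W' by (subst integrable_cong_AE[of _ _ W]) (auto intro: measurable_completion)
      then show "integrable lborel W'" using W' by (simp add: integrable_completion)
      fix l u :: 'a
      \<comment> \<open>Every box meets \<open>box a b\<close> in a box again and the boundary of
        \<open>cbox a b\<close> is a null set, so the restricted function has vanishing integrals
        over all boxes of the space.\<close>
      obtain c d where cd: "box l u \<inter> box a b = box c d" by (simp add: box_Int_box)
      have "(LINT x:box l u|lborel. W' x) = (LINT x|lebesgue. indicator (box l u) x *\<^sub>R W' x)"
        unfolding set_lebesgue_integral_def using W'(1) by (subst integral_completion) auto
      also have "\<dots> = (LINT x|lebesgue. indicator (box l u) x *\<^sub>R W x)"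
        using W' W by (intro integral_cong_AE borel_measurable_scaleR) (auto intro: measurable_completion)
      also have "\<dots> = (LINT x|lebesgue. indicator (box c d) x *\<^sub>R W x)"
      proof (intro integral_cong_AE borel_measurable_scaleR)
        have "AE x in lebesgue. x \<notin> cbox a b - box a b"
          by (intro AE_not_in) (simp add: negligible_iff_null_sets[symmetric] negligible_frontier_interval)
        then show "AE x in lebesgue. indicat_real (box l u) x *\<^sub>R W x = indicat_real (box c d) x *\<^sub>R W x"
          by eventually_elim (auto simp: W_def indicator_def cd[symmetric])
      qed (use W in \<open>auto intro!: borel_measurable_indicator\<close>)
      also have "\<dots> = (LINT x|lebesgue. indicator (box c d) x *\<^sub>R w x)"
        using cd box_subset_cbox[of a b]
        by (intro Bochner_Integration.integral_cong) (auto simp: W_def indicator_def)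
      also have "\<dots> = 0"
      proof (cases "box c d = {}")
        case False
        have "cbox c d = closure (box c d)" using False by (simp add: closure_box)
        also have "\<dots> \<subseteq> closure (box a b)" using cd by (intro closure_mono) auto
        also have "\<dots> \<subseteq> cbox a b" by (rule closure_minimal) (auto simp: box_subset_cbox)
        finally show ?thesis using ab by (intro box) auto
      qed simp
      finally show "(LINT x:box l u|lborel. W' x) = 0" .
    qed
    then have "AE x in lebesgue. W' x = 0" by (rule AE_completion)
    with W'(2) show ?thesis by eventually_elim (auto simp: W_def)
  qed
  obtain \<D> where \<D>: "countable \<D>" "\<D> \<subseteq> Pow D" "\<And>X. X \<in> \<D> \<Longrightarrow> \<exists>a b. X = cbox a b" "\<Union>\<D> = D"
    using open_countable_Union_open_cbox[OF D] by metis
  have "AE x in lebesgue. \<forall>X\<in>\<D>. x \<in> X \<longrightarrow> w x = 0"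
  proof (subst AE_ball_countable[OF \<D>(1)], rule ballI)
    fix X assume X: "X \<in> \<D>"
    then obtain a b where "X = cbox a b" "cbox a b \<subseteq> D" using \<D>(2,3) by (metis PowD subsetD)
    then show "AE x in lebesgue. x \<in> X \<longrightarrow> w x = 0" using cbox by simp
  qed
  then show ?thesis
    unfolding AE_lebesgue_on[OF D'] by eventually_elim (use \<D>(4) in blast)
qed

section \<open>Weak gradients\<close>

lemma GDERIV_bounded_imp_lipschitz:
  fixes F :: "'a::euclidean_space \<Rightarrow> real"
  assumes "convex S" "\<And>x. x \<in> S \<Longrightarrow> GDERIV F x :> G x" "\<And>x. x \<in> S \<Longrightarrow> norm (G x) \<le> M" "x \<in> S" "y \<in> S"
  shows "\<bar>F y - F x\<bar> \<le> M * norm (y - x)"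
proof -
  have "onorm (\<lambda>h. h \<bullet> G w) \<le> M" if "w \<in> S" for w
  proof (rule onorm_le)
    fix h
    have "norm (h \<bullet> G w) \<le> norm h * norm (G w)" using Cauchy_Schwarz_ineq2 by simp
    also have "\<dots> \<le> norm h * M" using assms(3)[OF that] by (intro mult_left_mono) auto
    finally show "norm (h \<bullet> G w) \<le> M * norm h" by (simp add: mult.commute)
  qed
  then show ?thesis
    using differentiable_bound[of S F "\<lambda>x h. h \<bullet> G x" M y x] assms
    by (auto simp: gderiv_def intro: has_derivative_at_withinI)
qed

text \<open>A translation difference of \<open>F\<close> has integral zero. Its quotients in
  direction \<open>b\<close> are dominated by the Lipschitz constant on a ball and converge to the
  component of \<open>G\<close> along \<open>b\<close>.\<close>

lemma integral_gradient_compact_support: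
  fixes F :: "'a::euclidean_space \<Rightarrow> real"
  assumes F: "\<And>x. GDERIV F x :> G x" and G: "continuous_on UNIV G"
    and S: "compact S" "\<And>x. x \<notin> S \<Longrightarrow> F x = 0" "\<And>x. x \<notin> S \<Longrightarrow> G x = 0"
  shows "(LINT x|lebesgue. G x) = 0"
proof (rule euclidean_eqI)
  fix b :: 'a assume b: "b \<in> Basis"
  have contF: "continuous_on UNIV F"
    using GDERIV_imp_isCont[OF F] by (auto intro: continuous_at_imp_continuous_on)
  obtain M where M: "M > 0" "\<And>x. norm (G x) \<le> M" using compact_support_bounded[OF G S(1,3)] by metis
  have lip: "\<bar>F y - F x\<bar> \<le> M * norm (y - x)" for x y
    by (rule GDERIV_bounded_imp_lipschitz[OF convex_UNIV F M(2)]) auto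
  obtain R where R: "R > 0" "S \<subseteq> ball 0 R" using compact_imp_bounded[OF S(1)] bounded_subset_ballD by blast
  \<comment> \<open>The factor \<open>1\<close> in front of \<open>x\<close> matches the affine
    change of variables at scale 1. The shift has length at most 1, whence the ball of radius
    \<open>R + 1\<close> in the domination.\<close>
  define q where "q n x = real (Suc n) * (F (b /\<^sub>R real (Suc n) + 1 *\<^sub>R x) - F x)" for n x
  have "(\<lambda>n. LINT x|lebesgue. q n x) \<longlonglongrightarrow> (LINT x|lebesgue. G x \<bullet> b)"
  proof (rule integral_dominated_convergence[where w="\<lambda>x. M * indicator (cball 0 (R + 1)) x"])
    show "(\<lambda>x. G x \<bullet> b) \<in> borel_measurable lebesgue"
      using continuous_on_imp_lebesgue_measurable[OF G] by measurable
    show "q n \<in> borel_measurable lebesgue" for n unfolding q_def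
      by (intro continuous_on_imp_lebesgue_measurable continuous_intros continuous_on_compose2[OF contF]) auto
    show "integrable lebesgue (\<lambda>x::'a. M * indicator (cball 0 (R + 1)) x)"
      by (intro integrable_mult_right integrable_real_indicator) (auto simp: emeasure_lborel_cball_finite[simplified infinity_ennreal_def])
    show "AE x in lebesgue. norm (q n x) \<le> M * indicator (cball 0 (R + 1)) x" for n
    proof (rule AE_I2)
      fix x
      have "norm (q n x) \<le> real (Suc n) * (M * norm (b /\<^sub>R real (Suc n)))"
        unfolding q_def norm_mult using lip[of "b /\<^sub>R real (Suc n) + 1 *\<^sub>R x" x]
        by (intro mult_mono) auto
      also have "\<dots> = M" using b by simp
      finally have 1: "norm (q n x) \<le> M" .
      have 2: "q n x = 0" if "x \<notin> cball 0 (R + 1)"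
      proof -
        have "norm x \<le> norm (b /\<^sub>R real (Suc n) + x) + norm (b /\<^sub>R real (Suc n))"
          using norm_triangle_ineq4[of "b /\<^sub>R real (Suc n) + x" "b /\<^sub>R real (Suc n)"] by simp
        also have "norm (b /\<^sub>R real (Suc n)) \<le> 1" using b by (simp add: field_simps)
        finally have "b /\<^sub>R real (Suc n) + x \<notin> S" "x \<notin> S" using that R by force+
        then show ?thesis using S(2) by (simp add: q_def)
      qed
      show "norm (q n x) \<le> M * indicator (cball 0 (R + 1)) x"
        using 1 2 by (cases "x \<in> cball 0 (R + 1)") auto
    qed
    show "AE x in lebesgue. (\<lambda>n. q n x) \<longlonglongrightarrow> G x \<bullet> b"
    proof (rule AE_I2)
      fix x
      have "((\<lambda>t. x + t *\<^sub>R b) has_derivative (\<lambda>t. t *\<^sub>R b)) (at 0)"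
        by (auto intro!: derivative_eq_intros)
      moreover have "(F has_derivative (\<lambda>h. h \<bullet> G x)) (at (x + 0 *\<^sub>R b))" using F[of x] by (simp add: gderiv_def)
      ultimately have "((\<lambda>t. F (x + t *\<^sub>R b)) has_derivative (\<lambda>t. (t *\<^sub>R b) \<bullet> G x)) (at 0)"
        by (rule has_derivative_compose)
      then have "((\<lambda>t. F (x + t *\<^sub>R b)) has_real_derivative (G x \<bullet> b)) (at 0)"
        unfolding has_field_derivative_def
        by (rule has_derivative_eq_rhs) (auto simp: inner_commute mult.commute)
      then have "((\<lambda>t. (F (x + t *\<^sub>R b) - F x) / t) \<longlongrightarrow> G x \<bullet> b) (at 0)"
        unfolding DERIV_def by simp
      moreover have "filterlim (\<lambda>n. 1 / real (Suc n)) (at 0) sequentially"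
        using LIMSEQ_Suc[OF lim_1_over_n[where ?'a=real]] by (auto simp: filterlim_at)
      ultimately have "(\<lambda>n. (F (x + (1 / real (Suc n)) *\<^sub>R b) - F x) / (1 / real (Suc n))) \<longlonglongrightarrow> G x \<bullet> b"
        by (rule filterlim_compose)
      then show "(\<lambda>n. q n x) \<longlonglongrightarrow> G x \<bullet> b"
        by (simp add: q_def field_simps add.commute inverse_eq_divide)
    qed
  qed
  moreover have "(LINT x|lebesgue. q n x) = 0" for n
  proof -
    note int = compact_support_integrable(2)[OF contF S(1,2)]
    have m: "F \<in> borel_measurable lebesgue" by (rule continuous_on_imp_lebesgue_measurable[OF contF])
    have "integrable lebesgue (\<lambda>x. F (b /\<^sub>R real (Suc n) + 1 *\<^sub>R x))"
      using int m by (subst integrable_affine_iff) auto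
    moreover have "(LINT x|lebesgue. F (b /\<^sub>R real (Suc n) + 1 *\<^sub>R x)) = (LINT x|lebesgue. F x)"
      using integral_affine[of 1 F "b /\<^sub>R real (Suc n)"] m by simp
    ultimately show ?thesis using int
      unfolding q_def by (subst integral_mult_right_zero, subst Bochner_Integration.integral_diff) auto
  qed
  ultimately have "(LINT x|lebesgue. G x \<bullet> b) = 0" by (simp add: LIMSEQ_const_iff)
  then show "(LINT x|lebesgue. G x) \<bullet> b = 0 \<bullet> b"
    using compact_support_integrable(2)[OF G S(1,3)] by simp
qed

lemma continuous_on_imp_L1_loc:
  fixes f :: "'a::euclidean_space \<Rightarrow> 'b::euclidean_space"
  assumes "continuous_on B f"
  shows "f \<in> L1_loc B"
  unfolding L1_loc_def
proof safe
  fix C assume C: "compact C" "C \<subseteq> B"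
  then have C': "C \<in> sets lebesgue" "C \<in> sets borel" by (auto simp: compact_imp_closed)
  have "integrable lborel (\<lambda>x. indicator C x *\<^sub>R f x)"
    using C assms by (intro borel_integrable_compact) (auto intro: continuous_on_subset)
  then have "integrable lebesgue (\<lambda>x. indicator C x *\<^sub>R f x)"
    using integrable_completion[OF borel_measurable_integrable] by blast
  then show "integrable (lebesgue_on C) f" by (simp add: integrable_lebesgue_on C')
qed

text \<open>The product \<open>u * \<phi>\<close> vanishes outside a compact subset of
  \<open>B\<close>, so it is continuously differentiable on the whole space whatever
  \<open>u\<close> does outside \<open>B\<close>. That its gradient integrates to zero is
  integration by parts.\<close>

lemma weak_gradient_C1:
  fixes u :: "'a::euclidean_space \<Rightarrow> real"
  assumes B: "open B" and u: "\<And>x. x \<in> B \<Longrightarrow> GDERIV u x :> g x" and g: "continuous_on B g"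
  shows "weak_gradient B u g"
proof -
  have B': "B \<in> sets lebesgue" using B by simp
  have cu: "continuous_on B u"
    using GDERIV_imp_isCont[OF u] by (auto intro: continuous_at_imp_continuous_on)
  note loc = continuous_on_imp_L1_loc[OF cu] continuous_on_imp_L1_loc[OF g]
  have "(LINT x|lebesgue_on B. u x *\<^sub>R grad \<phi> x) = - (LINT x|lebesgue_on B. \<phi> x *\<^sub>R g x)"
    if \<phi>: "\<phi> \<in> test_functions B" for \<phi>
  proof -
    obtain S where S: "compact S" "S \<subseteq> B" "\<And>x. x \<notin> S \<Longrightarrow> \<phi> x = 0" "\<And>x. x \<notin> S \<Longrightarrow> grad \<phi> x = 0"
      using test_functions_support[OF \<phi>] by metis
    have opS: "open (- S)" using S(1) by (simp add: compact_imp_closed open_Compl)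
    define G where "G x = u x *\<^sub>R grad \<phi> x + \<phi> x *\<^sub>R g x" for x
    have "(LINT x|lebesgue. G x) = 0"
    proof (rule integral_gradient_compact_support[where F="\<lambda>x. u x * \<phi> x", OF _ _ S(1)])
      show "GDERIV (\<lambda>x. u x * \<phi> x) x :> G x" for x
      proof (cases "x \<in> B")
        case True
        then show ?thesis unfolding G_def by (intro GDERIV_mult u test_functionsD(3)[OF \<phi>])
      next
        case False
        then have x: "x \<in> - S" using S(2) by auto
        have "((\<lambda>x. 0) has_derivative (\<lambda>h. h \<bullet> 0)) (at x)" by simp
        then have "((\<lambda>x. u x * \<phi> x) has_derivative (\<lambda>h. h \<bullet> 0)) (at x)"
          by (rule has_derivative_transform_within_open[OF _ opS x]) (simp add: S(3))
        then show ?thesis using x S by (simp add: G_def gderiv_def)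
      qed
      have "continuous_on (B \<union> - S) G"
      proof (rule continuous_on_open_Un[OF B opS])
        show "continuous_on B G" unfolding G_def
          by (intro continuous_intros cu g continuous_on_subset[OF test_functionsD(2)[OF \<phi>]]
              continuous_on_subset[OF test_functionsD(4)[OF \<phi>]]) auto
        show "continuous_on (- S) G"
          by (rule continuous_on_eq[of _ "\<lambda>_. 0"]) (auto simp: G_def S)
      qed
      also have "B \<union> - S = UNIV" using S(2) by auto
      finally show "continuous_on UNIV G" .
    qed (auto simp: G_def S)
    then have "(LINT x|lebesgue. u x *\<^sub>R grad \<phi> x) + (LINT x|lebesgue. \<phi> x *\<^sub>R g x) = 0"
      unfolding G_def
      using integrable_scaleR_grad_test(2)[OF B' loc(1) \<phi>] integrable_test_scaleR(2)[OF B' loc(2) \<phi>] by simp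
    moreover have "(LINT x|lebesgue_on B. u x *\<^sub>R grad \<phi> x) = (LINT x|lebesgue. u x *\<^sub>R grad \<phi> x)"
      "(LINT x|lebesgue_on B. \<phi> x *\<^sub>R g x) = (LINT x|lebesgue. \<phi> x *\<^sub>R g x)"
      using S by (intro integral_lebesgue_on_eq[OF B']; metis scaleR_zero_left scaleR_zero_right subsetD)+
    ultimately show ?thesis by (simp add: eq_neg_iff_add_eq_0)
  qed
  then show ?thesis using loc by (auto simp: weak_gradient_def)
qed

lemma weak_gradient_test_function: "\<phi> \<in> test_functions E \<Longrightarrow> open D \<Longrightarrow> weak_gradient D \<phi> (grad \<phi>)"
  by (intro weak_gradient_C1) (auto intro: test_functionsD continuous_on_subset)

lemma L1_loc_lincomb:
  assumes "w \<in> L1_loc D" "v \<in> L1_loc D"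
  shows "(\<lambda>x. a *\<^sub>R w x + b *\<^sub>R v x) \<in> L1_loc D"
  using assms by (auto simp: L1_loc_def)

lemma weak_gradient_lincomb:
  assumes D: "open D" and u: "weak_gradient D u g" and v: "weak_gradient D v h"
  shows "weak_gradient D (\<lambda>x. a * u x + b * v x) (\<lambda>x. a *\<^sub>R g x + b *\<^sub>R h x)"
proof -
  have D': "D \<in> sets lebesgue" using D by simp
  have loc: "u \<in> L1_loc D" "g \<in> L1_loc D" "v \<in> L1_loc D" "h \<in> L1_loc D"
    using u v by (auto simp: weak_gradient_def)
  have "(LINT x|lebesgue_on D. (a * u x + b * v x) *\<^sub>R grad \<phi> x) =
      - (LINT x|lebesgue_on D. \<phi> x *\<^sub>R (a *\<^sub>R g x + b *\<^sub>R h x))" if \<phi>: "\<phi> \<in> test_functions D" for \<phi>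
  proof -
    note I = integrable_scaleR_grad_test(1)[OF D' _ \<phi>] integrable_test_scaleR(1)[OF D' _ \<phi>]
    have "(LINT x|lebesgue_on D. (a * u x + b * v x) *\<^sub>R grad \<phi> x) =
        (LINT x|lebesgue_on D. a *\<^sub>R (u x *\<^sub>R grad \<phi> x) + b *\<^sub>R (v x *\<^sub>R grad \<phi> x))"
      by (simp add: algebra_simps)
    also have "\<dots> = a *\<^sub>R (LINT x|lebesgue_on D. u x *\<^sub>R grad \<phi> x) + b *\<^sub>R (LINT x|lebesgue_on D. v x *\<^sub>R grad \<phi> x)"
      using I(1)[OF loc(1)] I(1)[OF loc(3)]
      by (subst Bochner_Integration.integral_add) (auto simp del: scaleR_scaleR)
    also have "\<dots> = - (a *\<^sub>R (LINT x|lebesgue_on D. \<phi> x *\<^sub>R g x) + b *\<^sub>R (LINT x|lebesgue_on D. \<phi> x *\<^sub>R h x))"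
      using u v \<phi> by (simp add: weak_gradient_def)
    also have "a *\<^sub>R (LINT x|lebesgue_on D. \<phi> x *\<^sub>R g x) + b *\<^sub>R (LINT x|lebesgue_on D. \<phi> x *\<^sub>R h x) =
        (LINT x|lebesgue_on D. a *\<^sub>R (\<phi> x *\<^sub>R g x) + b *\<^sub>R (\<phi> x *\<^sub>R h x))"
      using I(2)[OF loc(2)] I(2)[OF loc(4)]
      by (subst Bochner_Integration.integral_add) (auto simp del: scaleR_scaleR)
    also have "\<dots> = (LINT x|lebesgue_on D. \<phi> x *\<^sub>R (a *\<^sub>R g x + b *\<^sub>R h x))"
      by (simp add: algebra_simps)
    finally show ?thesis .
  qed
  then show ?thesis using L1_loc_lincomb[OF loc(1,3), of a b] L1_loc_lincomb[OF loc(2,4), of a b]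
    by (auto simp: weak_gradient_def)
qed

lemma weak_gradient_unique:
  assumes D: "open D" and "weak_gradient D u g" "weak_gradient D u h"
  shows "AE x in lebesgue_on D. g x = h x"
proof -
  have D': "D \<in> sets lebesgue" using D by simp
  have *: "weak_gradient D (\<lambda>x. 1 * u x + - 1 * u x) (\<lambda>x. 1 *\<^sub>R g x + - 1 *\<^sub>R h x)"
    by (intro weak_gradient_lincomb assms)
  have "AE x in lebesgue_on D. 1 *\<^sub>R g x + - 1 *\<^sub>R h x = 0"
    by (rule fundamental_lemma[OF D]) (use * in \<open>auto simp: weak_gradient_def\<close>)
  then show ?thesis by simp
qed

lemma weak_gradient_wgrad: "weak_gradient D u g \<Longrightarrow> weak_gradient D u (wgrad D u)"
  unfolding wgrad_def by (rule someI[where P="weak_gradient D u"])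

lemma wgrad_AE:
  "open D \<Longrightarrow> weak_gradient D u g \<Longrightarrow> AE x in lebesgue_on D. wgrad D u x = g x"
  by (rule weak_gradient_unique) (auto intro: weak_gradient_wgrad)

lemma weak_gradient_subset:
  assumes "open D" "open B" "B \<subseteq> D" "weak_gradient D u g"
  shows "weak_gradient B u g"
proof -
  have sets: "D \<in> sets lebesgue" "B \<in> sets lebesgue" using assms by auto
  have "(LINT x|lebesgue_on B. u x *\<^sub>R grad \<phi> x) = - (LINT x|lebesgue_on B. \<phi> x *\<^sub>R g x)"
    if \<phi>: "\<phi> \<in> test_functions B" for \<phi>
  proof -
    obtain S where S: "compact S" "S \<subseteq> B" "\<And>x. x \<notin> S \<Longrightarrow> \<phi> x = 0" "\<And>x. x \<notin> S \<Longrightarrow> grad \<phi> x = 0"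
      using test_functions_support[OF \<phi>] by metis
    have z: "\<phi> x = 0" "grad \<phi> x = 0" if "x \<notin> B" for x using that S by auto
    have z': "\<phi> x = 0" "grad \<phi> x = 0" if "x \<notin> D" for x using that z assms(3) by auto
    have "\<phi> \<in> test_functions D" using \<phi> test_functions_mono[OF assms(3)] by auto
    then have "(LINT x|lebesgue_on D. u x *\<^sub>R grad \<phi> x) = - (LINT x|lebesgue_on D. \<phi> x *\<^sub>R g x)"
      using assms(4) by (simp add: weak_gradient_def)
    then show ?thesis using z z' by (simp add: integral_lebesgue_on_eq[OF sets(1)] integral_lebesgue_on_eq[OF sets(2)])
  qed
  then show ?thesis using assms(3,4) by (auto simp: weak_gradient_def L1_loc_def)
qed

section \<open>The Hilbert space of square integrable fields\<close>

text \<open>Riesz-Fischer for sequences with a geometric rate. The limit is the pointwise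
  \<open>lim\<close>, which does not depend on \<open>M\<close>: one limit function therefore serves
  for all balls at once when Beppo-Levi potentials are built.\<close>

lemma L2_Cauchy_limit:
  fixes f :: "nat \<Rightarrow> 'a \<Rightarrow> 'b::euclidean_space"
  assumes meas[measurable]: "\<And>n. f n \<in> borel_measurable M" and C: "C \<ge> 0"
    and Cauchy: "\<And>n m. n \<le> m \<Longrightarrow> (\<integral>\<^sup>+x. ennreal ((norm (f m x - f n x))\<^sup>2) \<partial>M) \<le> ennreal (C / 4 ^ n)"
  shows "(\<lambda>x. lim (\<lambda>n. f n x)) \<in> borel_measurable M"
    and "AE x in M. (\<lambda>n. f n x) \<longlonglongrightarrow> lim (\<lambda>n. f n x)"
    and "(\<integral>\<^sup>+x. ennreal ((norm (lim (\<lambda>k. f k x) - f n x))\<^sup>2) \<partial>M) \<le> ennreal (C / 4 ^ n)"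
proof -
  show meas_lim[measurable]: "(\<lambda>x. lim (\<lambda>n. f n x)) \<in> borel_measurable M" by measurable
  define d where "d n x = f (Suc n) x - f n x" for n x
  have [measurable]: "d n \<in> borel_measurable M" for n unfolding d_def by measurable
  \<comment> \<open>The weights \<open>2\<^sup>n\<close> still leave a convergent sum, and make the increments geometrically small a.e.\<close>
  have "(\<integral>\<^sup>+x. (\<Sum>n. ennreal (2 ^ n * (norm (d n x))\<^sup>2)) \<partial>M) = (\<Sum>n. \<integral>\<^sup>+x. ennreal (2 ^ n * (norm (d n x))\<^sup>2) \<partial>M)"
    by (rule nn_integral_suminf) measurable
  also have "\<dots> \<le> (\<Sum>n. ennreal (C * (1 / 2) ^ n))"
  proof (intro suminf_le summableI)
    fix n
    have "(\<integral>\<^sup>+x. ennreal (2 ^ n * (norm (d n x))\<^sup>2) \<partial>M) = ennreal (2 ^ n) * (\<integral>\<^sup>+x. ennreal ((norm (d n x))\<^sup>2) \<partial>M)"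
      by (subst nn_integral_cmult[symmetric]) (auto simp: ennreal_mult)
    also have "\<dots> \<le> ennreal (2 ^ n) * ennreal (C / 4 ^ n)"
      using Cauchy[of n "Suc n"] by (intro mult_left_mono) (auto simp: d_def)
    also have "\<dots> = ennreal (C * (1 / 2) ^ n)"
    proof -
      have "(4::real) ^ n = 2 ^ n * 2 ^ n" by (simp flip: power_mult_distrib)
      then show ?thesis using C by (simp add: ennreal_mult[symmetric] power_one_over)
    qed
    finally show "(\<integral>\<^sup>+x. ennreal (2 ^ n * (norm (d n x))\<^sup>2) \<partial>M) \<le> ennreal (C * (1 / 2) ^ n)" .
  qed
  also have "\<dots> = ennreal (\<Sum>n. C * (1 / 2) ^ n)"
    using C by (intro suminf_ennreal2) (auto intro!: summable_mult summable_geometric)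
  finally have "(\<integral>\<^sup>+x. (\<Sum>n. ennreal (2 ^ n * (norm (d n x))\<^sup>2)) \<partial>M) \<noteq> \<infinity>"
    by (auto simp: top_unique)
  then have "AE x in M. (\<Sum>n. ennreal (2 ^ n * (norm (d n x))\<^sup>2)) \<noteq> \<infinity>"
    by (intro nn_integral_PInf_AE) measurable
  then show lim: "AE x in M. (\<lambda>n. f n x) \<longlonglongrightarrow> lim (\<lambda>n. f n x)"
  proof eventually_elim
    case (elim x)
    define s where "s = (\<Sum>n. ennreal (2 ^ n * (norm (d n x))\<^sup>2))"
    define S where "S = enn2real s"
    have "s < top" using elim unfolding s_def[symmetric] infinity_ennreal_def top.not_eq_extremum .
    then have "s = ennreal S" unfolding S_def by (rule ennreal_enn2real[symmetric])
    then have S: "(\<Sum>n. ennreal (2 ^ n * (norm (d n x))\<^sup>2)) = ennreal S" "S \<ge> 0"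
      by (simp_all only: s_def S_def enn2real_nonneg)
    have "norm (d n x) \<le> sqrt S * (1 / sqrt 2) ^ n" for n
    proof -
      have "ennreal (2 ^ n * (norm (d n x))\<^sup>2) \<le> ennreal S"
        using sum_le_suminf[OF summableI, of "{n}" "\<lambda>n. ennreal (2 ^ n * (norm (d n x))\<^sup>2)"]
        unfolding S(1) by simp
      then have "2 ^ n * (norm (d n x))\<^sup>2 \<le> S" using S(2) by (simp only: ennreal_le_iff)
      then have "(norm (d n x))\<^sup>2 * 2 ^ n \<le> S" by (simp only: mult.commute)
      then have "(norm (d n x))\<^sup>2 \<le> S / 2 ^ n" by (simp only: pos_le_divide_eq zero_less_power zero_less_numeral)
      also have "S / 2 ^ n = (sqrt S)\<^sup>2 * ((1 / sqrt 2)\<^sup>2) ^ n"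
        using S(2) by (simp add: power_divide)
      also have "\<dots> = (sqrt S * (1 / sqrt 2) ^ n)\<^sup>2"
        by (simp only: power_mult_distrib power_mult[symmetric] mult.commute[of n])
      finally have "(norm (d n x))\<^sup>2 \<le> (sqrt S * (1 / sqrt 2) ^ n)\<^sup>2" .
      then show ?thesis by (rule power2_le_imp_le) (use S in auto)
    qed
    moreover have "summable (\<lambda>n. sqrt S * (1 / sqrt 2) ^ n)"
      by (intro summable_mult summable_geometric) auto
    ultimately have "summable (\<lambda>n. d n x)"
      by (intro summable_comparison_test[of "\<lambda>n. d n x" "\<lambda>n. sqrt S * (1 / sqrt 2) ^ n"]) auto
    then have "convergent (\<lambda>n. \<Sum>i<n. d i x)" by (simp add: summable_iff_convergent)
    then have "convergent (\<lambda>n. f 0 x + (\<Sum>i<n. d i x))" by (intro convergent_add convergent_const)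
    moreover have "f 0 x + (\<Sum>i<n. d i x) = f n x" for n
      unfolding d_def by (subst sum_lessThan_telescope) simp
    ultimately show ?case by (simp add: convergent_LIMSEQ_iff)
  qed
  \<comment> \<open>Fatou: the squared distance of the limit from \<open>f n\<close> is at most the
    lower limit of the squared distances of \<open>f m\<close> from \<open>f n\<close>.\<close>
  have "(\<integral>\<^sup>+x. ennreal ((norm (lim (\<lambda>k. f k x) - f n x))\<^sup>2) \<partial>M)
      = (\<integral>\<^sup>+x. liminf (\<lambda>m. ennreal ((norm (f m x - f n x))\<^sup>2)) \<partial>M)"
  proof (rule nn_integral_cong_AE, use lim in eventually_elim)
    case (elim x)
    have "(\<lambda>m. ennreal ((norm (f m x - f n x))\<^sup>2)) \<longlonglongrightarrow> ennreal ((norm (lim (\<lambda>k. f k x) - f n x))\<^sup>2)"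
      using elim by (intro tendsto_intros)
    then show ?case by (intro lim_imp_Liminf[symmetric]) auto
  qed
  also have "\<dots> \<le> liminf (\<lambda>m. \<integral>\<^sup>+x. ennreal ((norm (f m x - f n x))\<^sup>2) \<partial>M)"
    by (rule nn_integral_liminf) measurable
  also have "\<dots> \<le> ennreal (C / 4 ^ n)"
    using Cauchy by (intro Liminf_le) (auto simp: eventually_sequentially)
  finally show "(\<integral>\<^sup>+x. ennreal ((norm (lim (\<lambda>k. f k x) - f n x))\<^sup>2) \<partial>M) \<le> ennreal (C / 4 ^ n)" .
qed

lemma L2_UNIV_iff:
  "f \<in> L2 UNIV \<longleftrightarrow> f \<in> borel_measurable lebesgue \<and> integrable lebesgue (\<lambda>x. (norm (f x))\<^sup>2)"
  by (simp add: L2_def lebesgue_on_UNIV_eq)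

lemma L2_UNIV_nn_integral_iff:
  "f \<in> L2 UNIV \<longleftrightarrow> f \<in> borel_measurable lebesgue \<and> (\<integral>\<^sup>+x. ennreal ((norm (f x))\<^sup>2) \<partial>lebesgue) < \<infinity>"
  by (auto simp: L2_UNIV_iff integrable_iff_bounded)

lemma L2_iff_UNIV:
  fixes f :: "'a::euclidean_space \<Rightarrow> 'b::euclidean_space"
  assumes "D \<in> sets lebesgue"
  shows "f \<in> L2 D \<longleftrightarrow> (\<lambda>x. indicator D x *\<^sub>R f x) \<in> L2 UNIV"
proof -
  have "(\<lambda>x. indicat_real D x *\<^sub>R (norm (f x))\<^sup>2) = (\<lambda>x. (norm (indicat_real D x *\<^sub>R f x))\<^sup>2)"
    by (auto simp: indicator_def)
  then show ?thesis
    by (simp add: L2_def lebesgue_on_UNIV_eq measurable_lebesgue_on[OF assms] integrable_lebesgue_on[OF assms])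
qed

lemma L2_bound:
  fixes f :: "'a::euclidean_space \<Rightarrow> 'b::euclidean_space" and g :: "'a \<Rightarrow> 'c::euclidean_space"
  assumes "f \<in> L2 UNIV" "g \<in> borel_measurable lebesgue" "\<And>x. norm (g x) \<le> M * norm (f x)"
  shows "g \<in> L2 UNIV"
proof -
  have "integrable lebesgue (\<lambda>x. M\<^sup>2 * (norm (f x))\<^sup>2)" using assms(1) by (simp add: L2_UNIV_iff)
  then have "integrable lebesgue (\<lambda>x. (norm (g x))\<^sup>2)"
  proof (rule Bochner_Integration.integrable_bound)
    show "AE x in lebesgue. norm ((norm (g x))\<^sup>2) \<le> norm (M\<^sup>2 * (norm (f x))\<^sup>2)"
      using power_mono[OF assms(3) norm_ge_zero, of _ 2] by (auto simp: power_mult_distrib)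
  qed (use assms(2) in measurable)
  with assms(2) show ?thesis by (simp add: L2_UNIV_iff)
qed

lemma integrable_inner_L2:
  fixes f g :: "'a::euclidean_space \<Rightarrow> 'b::euclidean_space"
  assumes "f \<in> L2 UNIV" "g \<in> L2 UNIV"
  shows "integrable lebesgue (\<lambda>x. f x \<bullet> g x)"
proof -
  have "integrable lebesgue (\<lambda>x. (norm (f x))\<^sup>2 + (norm (g x))\<^sup>2)"
    using assms by (simp add: L2_UNIV_iff)
  then show ?thesis
  proof (rule Bochner_Integration.integrable_bound)
    have "\<bar>a \<bullet> b\<bar> \<le> (norm a)\<^sup>2 + (norm b)\<^sup>2" for a b :: 'b
      using Cauchy_Schwarz_ineq2[of a b] sum_squares_bound[of "norm a" "norm b"]
        zero_le_mult_iff[of "norm a" "norm b"] by simp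
    then show "AE x in lebesgue. norm (f x \<bullet> g x) \<le> norm ((norm (f x))\<^sup>2 + (norm (g x))\<^sup>2)"
      by auto
  qed (use assms in \<open>auto simp: L2_UNIV_iff\<close>)
qed

lemma L2_add:
  fixes f g :: "'a::euclidean_space \<Rightarrow> 'b::euclidean_space"
  assumes "f \<in> L2 UNIV" "g \<in> L2 UNIV"
  shows "(\<lambda>x. f x + g x) \<in> L2 UNIV"
proof -
  have "integrable lebesgue (\<lambda>x. (norm (f x))\<^sup>2 + 2 * (f x \<bullet> g x) + (norm (g x))\<^sup>2)"
    using assms integrable_inner_L2[OF assms] by (simp add: L2_UNIV_iff)
  moreover have "(\<lambda>x. (norm (f x + g x))\<^sup>2) = (\<lambda>x. (norm (f x))\<^sup>2 + 2 * (f x \<bullet> g x) + (norm (g x))\<^sup>2)"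
    by (simp add: power2_norm_eq_inner inner_simps inner_commute fun_eq_iff)
  ultimately show ?thesis using assms by (auto simp: L2_UNIV_iff)
qed

lemma L2_scaleR:
  fixes f :: "'a::euclidean_space \<Rightarrow> 'b::euclidean_space"
  shows "f \<in> L2 UNIV \<Longrightarrow> (\<lambda>x. c *\<^sub>R f x) \<in> L2 UNIV"
  by (rule L2_bound[of f _ "\<bar>c\<bar>"]) (auto simp: L2_UNIV_iff)

lemma L2_zero: "(\<lambda>x. 0) \<in> L2 UNIV"
  by (simp add: L2_UNIV_iff)

lemma L2_uminus:
  fixes f :: "'a::euclidean_space \<Rightarrow> 'b::euclidean_space"
  shows "f \<in> L2 UNIV \<Longrightarrow> (\<lambda>x. - f x) \<in> L2 UNIV"
  using L2_scaleR[of f "-1"] by simp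

lemma L2_diff:
  fixes f g :: "'a::euclidean_space \<Rightarrow> 'b::euclidean_space"
  shows "f \<in> L2 UNIV \<Longrightarrow> g \<in> L2 UNIV \<Longrightarrow> (\<lambda>x. f x - g x) \<in> L2 UNIV"
  using L2_add[OF _ L2_uminus, of f g] by simp

\<comment> \<open>The relation is partial: functions that are not square integrable are related to
  nothing, so \<open>cl f\<close> is meaningful only for \<open>f \<in> L2 UNIV\<close>. All domains
  share this one space of classes over the whole space; a field on \<open>D\<close> enters
  multiplied by the indicator of \<open>D\<close>.\<close>
quotient_type (overloaded) ('a, 'b) ell2 = "'a::euclidean_space \<Rightarrow> 'b::euclidean_space" /
  partial: "\<lambda>f g. f \<in> L2 UNIV \<and> g \<in> L2 UNIV \<and> (AE x in lebesgue. f x = g x)"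
proof (rule part_equivpI)
  show "\<exists>f::'a \<Rightarrow> 'b. f \<in> L2 UNIV \<and> f \<in> L2 UNIV \<and> (AE x in lebesgue. f x = f x)"
    using L2_zero by auto
qed (auto intro!: sympI transpI)

instantiation ell2 :: (euclidean_space, euclidean_space) real_inner
begin

lift_definition zero_ell2 :: "('a, 'b) ell2" is "\<lambda>_. 0" by (simp add: L2_zero)

lift_definition plus_ell2 :: "('a, 'b) ell2 \<Rightarrow> ('a, 'b) ell2 \<Rightarrow> ('a, 'b) ell2" is "\<lambda>f g x. f x + g x"
  by (auto simp: L2_add)

lift_definition minus_ell2 :: "('a, 'b) ell2 \<Rightarrow> ('a, 'b) ell2 \<Rightarrow> ('a, 'b) ell2" is "\<lambda>f g x. f x - g x"
  by (auto simp: L2_diff)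

lift_definition uminus_ell2 :: "('a, 'b) ell2 \<Rightarrow> ('a, 'b) ell2" is "\<lambda>f x. - f x"
  by (auto simp: L2_uminus)

lift_definition scaleR_ell2 :: "real \<Rightarrow> ('a, 'b) ell2 \<Rightarrow> ('a, 'b) ell2" is "\<lambda>c f x. c *\<^sub>R f x"
  by (auto simp: L2_scaleR)

lift_definition inner_ell2 :: "('a, 'b) ell2 \<Rightarrow> ('a, 'b) ell2 \<Rightarrow> real" is "\<lambda>f g. LINT x|lebesgue. f x \<bullet> g x"
  by (intro integral_cong_AE) (auto simp: L2_UNIV_iff)

definition norm_ell2 :: "('a, 'b) ell2 \<Rightarrow> real" where "norm_ell2 F = sqrt (F \<bullet> F)"
definition dist_ell2 :: "('a, 'b) ell2 \<Rightarrow> ('a, 'b) ell2 \<Rightarrow> real" where "dist_ell2 F G = norm (F - G)"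
definition sgn_ell2 :: "('a, 'b) ell2 \<Rightarrow> ('a, 'b) ell2" where "sgn_ell2 F = scaleR (inverse (norm F)) F"
definition uniformity_ell2 :: "(('a, 'b) ell2 \<times> ('a, 'b) ell2) filter" where
  "uniformity_ell2 = (INF e\<in>{0<..}. principal {(F, G). dist F G < e})"
definition open_ell2 :: "('a, 'b) ell2 set \<Rightarrow> bool" where
  "open_ell2 U \<longleftrightarrow> (\<forall>F\<in>U. \<forall>\<^sub>F (F', G) in uniformity. F' = F \<longrightarrow> G \<in> U)"

instance
proof
  fix F G H :: "('a, 'b) ell2" and a b :: real
  show "F + G + H = F + (G + H)" by transfer (auto simp: L2_add add.assoc)
  show "F + G = G + F" by transfer (auto simp: L2_add add.commute)
  show "0 + F = F" by transfer auto
  show "- F + F = 0" by transfer (auto simp: L2_zero)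
  show "F - G = F + - G" by transfer (auto simp: L2_diff)
  show "a *\<^sub>R (F + G) = a *\<^sub>R F + a *\<^sub>R G"
    by transfer (auto simp: L2_add L2_scaleR scaleR_add_right intro!: L2_add[OF L2_scaleR L2_scaleR])
  show "(a + b) *\<^sub>R F = a *\<^sub>R F + b *\<^sub>R F"
    by transfer (auto simp: scaleR_add_left intro!: L2_add L2_scaleR)
  show "a *\<^sub>R b *\<^sub>R F = (a * b) *\<^sub>R F" by transfer (auto intro!: L2_scaleR)
  show "1 *\<^sub>R F = F" by transfer auto
  show "F \<bullet> G = G \<bullet> F" by transfer (simp add: inner_commute)
  show "(F + G) \<bullet> H = F \<bullet> H + G \<bullet> H"
    by transfer (simp add: inner_add_left integrable_inner_L2)
  show "(a *\<^sub>R F) \<bullet> G = a * (F \<bullet> G)" by transfer simp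
  show "0 \<le> F \<bullet> F" by transfer (simp add: integral_nonneg_AE)
  show "F \<bullet> F = 0 \<longleftrightarrow> F = 0"
  proof transfer
    fix f :: "'a \<Rightarrow> 'b" assume "f \<in> L2 UNIV \<and> f \<in> L2 UNIV \<and> (AE x in lebesgue. f x = f x)"
    then have "f \<in> L2 UNIV" "integrable lebesgue (\<lambda>x. f x \<bullet> f x)" by (auto intro: integrable_inner_L2)
    then show "(LINT x|lebesgue. f x \<bullet> f x) = 0 \<longleftrightarrow> f \<in> L2 UNIV \<and> (\<lambda>_. 0) \<in> L2 UNIV \<and> (AE x in lebesgue. f x = 0)"
      using integral_nonneg_eq_0_iff_AE[of lebesgue "\<lambda>x. f x \<bullet> f x"] L2_zero by auto
  qed
qed (simp_all only: norm_ell2_def dist_ell2_def sgn_ell2_def uniformity_ell2_def open_ell2_def)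

end

abbreviation cl :: "('a::euclidean_space \<Rightarrow> 'b::euclidean_space) \<Rightarrow> ('a, 'b) ell2" where
  "cl \<equiv> abs_ell2"

abbreviation rep :: "('a::euclidean_space, 'b::euclidean_space) ell2 \<Rightarrow> 'a \<Rightarrow> 'b" where
  "rep \<equiv> rep_ell2"

lemma rep_L2: "rep F \<in> L2 UNIV" and cl_rep: "cl (rep F) = F"
  using Quotient3_rep_reflp[OF Quotient3_ell2, of F] Quotient3_abs_rep[OF Quotient3_ell2, of F] by auto

lemma rep_measurable: "rep F \<in> borel_measurable lebesgue"
  using rep_L2[of F] by (simp add: L2_UNIV_iff)

lemma cl_eq_iff: "f \<in> L2 UNIV \<Longrightarrow> g \<in> L2 UNIV \<Longrightarrow> cl f = cl g \<longleftrightarrow> (AE x in lebesgue. f x = g x)"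
  using Quotient3_rel[OF Quotient3_ell2, of f g] by auto

lemma rep_cl: "f \<in> L2 UNIV \<Longrightarrow> AE x in lebesgue. rep (cl f) x = f x"
  using cl_eq_iff[of "rep (cl f)" f] rep_L2 cl_rep by auto

lemma
  assumes "f \<in> L2 UNIV" "g \<in> L2 UNIV"
  shows cl_add: "cl f + cl g = cl (\<lambda>x. f x + g x)"
    and cl_diff: "cl f - cl g = cl (\<lambda>x. f x - g x)"
    and inner_cl: "cl f \<bullet> cl g = (LINT x|lebesgue. f x \<bullet> g x)"
  using assms by (auto simp: plus_ell2.abs_eq minus_ell2.abs_eq inner_ell2.abs_eq eq_onp_def)

lemma cl_scaleR: "f \<in> L2 UNIV \<Longrightarrow> c *\<^sub>R cl f = cl (\<lambda>x. c *\<^sub>R f x)"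
  by (auto simp: scaleR_ell2.abs_eq eq_onp_def)

lemma norm_cl_power2: "f \<in> L2 UNIV \<Longrightarrow> (norm (cl f))\<^sup>2 = (LINT x|lebesgue. (norm (f x))\<^sup>2)"
  by (simp add: power2_norm_eq_inner inner_cl)

lemma nn_integral_norm_cl:
  "f \<in> L2 UNIV \<Longrightarrow> (\<integral>\<^sup>+x. ennreal ((norm (f x))\<^sup>2) \<partial>lebesgue) = ennreal ((norm (cl f))\<^sup>2)"
  by (subst norm_cl_power2) (auto simp: L2_UNIV_iff nn_integral_eq_integral)

lemma inner_rep: "F \<bullet> G = (LINT x|lebesgue. rep F x \<bullet> rep G x)"
  using inner_cl[OF rep_L2 rep_L2, of F G] by (simp add: cl_rep)

lemma Cauchy_fast_subsequence:
  fixes X :: "nat \<Rightarrow> 'b::metric_space"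
  assumes "Cauchy X"
  obtains r where "strict_mono r" "\<And>n m. n \<le> m \<Longrightarrow> dist (X (r m)) (X (r n)) \<le> 1 / 2 ^ n"
proof -
  have "\<forall>n. \<exists>N. \<forall>m\<ge>N. \<forall>k\<ge>N. dist (X m) (X k) < 1 / 2 ^ n"
    using assms unfolding Cauchy_def by simp
  then obtain N where N: "\<And>n m k. m \<ge> N n \<Longrightarrow> k \<ge> N n \<Longrightarrow> dist (X m) (X k) < 1 / 2 ^ n" by metis
  \<comment> \<open>Partial sums of \<open>Suc (N i)\<close> increase strictly and satisfy
    \<open>N n \<le> r n\<close>.\<close>
  define r where "r n = (\<Sum>i\<le>n. Suc (N i))" for n
  have "strict_mono r" by (auto simp: strict_mono_Suc_iff r_def)
  moreover have "N n \<le> r n" for n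
    unfolding r_def using member_le_sum[of n "{..n}" "\<lambda>i. Suc (N i)"] by simp
  ultimately show ?thesis
    using that[of r] N by (meson less_imp_le order_trans strict_mono_less_eq)
qed

text \<open>A Cauchy sequence has a subsequence with steps \<open>1 / 2 ^ n\<close>, whose squares
  are the rate \<open>1 / 4 ^ n\<close> asked for by \<open>L2_Cauchy_limit\<close>; convergence of
  the subsequence carries over to the sequence.\<close>

instance ell2 :: (euclidean_space, euclidean_space) complete_space
proof
  fix X :: "nat \<Rightarrow> ('a, 'b) ell2" assume X: "Cauchy X"
  obtain r where r: "strict_mono r" "\<And>n m. n \<le> m \<Longrightarrow> dist (X (r m)) (X (r n)) \<le> 1 / 2 ^ n"
    using Cauchy_fast_subsequence[OF X] by metis
  define f where "f n = rep (X (r n))" for n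
  have fL2: "f n \<in> L2 UNIV" and cl_f: "cl (f n) = X (r n)" for n
    by (auto simp: f_def rep_L2 cl_rep)
  have fm: "f n \<in> borel_measurable lebesgue" for n using fL2 by (auto simp: L2_UNIV_iff)
  have "(\<integral>\<^sup>+x. ennreal ((norm (f m x - f n x))\<^sup>2) \<partial>lebesgue) \<le> ennreal (1 / 4 ^ n)" if "n \<le> m" for n m
  proof -
    have "(\<integral>\<^sup>+x. ennreal ((norm (f m x - f n x))\<^sup>2) \<partial>lebesgue) = ennreal ((norm (X (r m) - X (r n)))\<^sup>2)"
      using nn_integral_norm_cl[OF L2_diff[OF fL2[of m] fL2[of n]]]
      by (simp add: cl_diff[OF fL2 fL2, symmetric] cl_f)
    also have "(norm (X (r m) - X (r n)))\<^sup>2 \<le> (1 / 2 ^ n)\<^sup>2"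
      using r(2)[OF that] by (intro power_mono) (auto simp: dist_norm)
    also have "((1::real) / 2 ^ n)\<^sup>2 = 1 / 4 ^ n"
      by (simp add: power_divide power2_eq_square flip: power_mult_distrib)
    finally show ?thesis by (simp add: ennreal_leI)
  qed
  note lim = L2_Cauchy_limit[OF fm zero_le_one this]
  define F where "F x = lim (\<lambda>n. f n x)" for x
  have F_diff: "(\<lambda>x. F x - f n x) \<in> L2 UNIV" for n
    using lim(1) lim(3)[of n] fm[of n] unfolding L2_UNIV_nn_integral_iff F_def
    by (auto simp: le_less_trans[OF _ ennreal_less_top])
  have FL2: "F \<in> L2 UNIV"
    using L2_add[OF F_diff[of 0] fL2[of 0]] by simp
  have dist: "(dist (X (r n)) (cl F))\<^sup>2 \<le> (1 / 4) ^ n" for n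
  proof -
    have "ennreal ((norm (cl F - cl (f n)))\<^sup>2) \<le> ennreal ((1 / 4) ^ n)"
      using lim(3)[of n] nn_integral_norm_cl[OF F_diff[of n]]
      by (simp add: cl_diff[OF FL2 fL2] F_def power_one_over)
    then show ?thesis by (simp add: cl_f dist_norm norm_minus_commute)
  qed
  have "(\<lambda>n. (dist (X (r n)) (cl F))\<^sup>2) \<longlonglongrightarrow> 0"
  proof (rule tendsto_sandwich[OF _ _ tendsto_const])
    show "(\<lambda>n. (1 / 4 :: real) ^ n) \<longlonglongrightarrow> 0" by (rule LIMSEQ_realpow_zero) auto
  qed (use dist in auto)
  then have "(\<lambda>n. sqrt ((dist (X (r n)) (cl F))\<^sup>2)) \<longlonglongrightarrow> sqrt 0" by (rule tendsto_real_sqrt)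
  then have "(X \<circ> r) \<longlonglongrightarrow> cl F" by (subst tendsto_dist_iff) (simp add: o_def)
  then show "convergent X"
    using X r(1) Cauchy_converges_subseq[OF X] unfolding convergent_def by blast
qed

section \<open>Strongly monotone equations on closed subspaces\<close>

text \<open>A minimising sequence for the distance is Cauchy by the parallelogram identity, and
  minimality along each line through the limit gives orthogonality.\<close>

lemma closed_subspace_projection:
  fixes W :: "'h::{real_inner, complete_space} set"
  assumes W: "subspace W" "closed W"
  shows "\<exists>p\<in>W. \<forall>w\<in>W. (x - p) \<bullet> w = 0"
proof -
  define d where "d = (INF w\<in>W. norm (x - w))"
  have ne: "W \<noteq> {}" using subspace_0[OF W(1)] by auto
  have bdd: "bdd_below ((\<lambda>w. norm (x - w)) ` W)" by (rule bdd_belowI2[of _ 0]) auto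
  have d_le: "d \<le> norm (x - w)" if "w \<in> W" for w
    unfolding d_def using that by (intro cINF_lower bdd)
  have d0: "d \<ge> 0" unfolding d_def by (rule cINF_greatest) (use ne in auto)
  have "\<exists>w\<in>W. norm (x - w) < d + 1 / real (Suc n)" for n
    using cINF_less_iff[OF ne bdd, of "d + 1 / real (Suc n)"] by (simp add: d_def)
  then obtain X where X: "\<And>n. X n \<in> W" "\<And>n. norm (x - X n) < d + 1 / real (Suc n)" by metis
  \<comment> \<open>Parallelogram identity: the midpoint of \<open>X m\<close> and
    \<open>X n\<close> lies in \<open>W\<close>, hence at distance at least \<open>d\<close> from
    \<open>x\<close>.\<close>
  have par: "(norm (X m - X n))\<^sup>2 \<le> 2 * (norm (x - X n))\<^sup>2 + 2 * (norm (x - X m))\<^sup>2 - 4 * d\<^sup>2" for m n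
  proof -
    have "(1 / 2) *\<^sub>R (X m + X n) \<in> W" using X W by (intro subspace_scale subspace_add) auto
    then have "d\<^sup>2 \<le> (norm (x - (1 / 2) *\<^sub>R (X m + X n)))\<^sup>2" using d_le d0 by (intro power_mono) auto
    then show ?thesis
      by (simp add: power2_norm_eq_inner inner_simps inner_commute field_simps)
  qed
  have "Cauchy X"
  proof (rule metric_CauchyI)
    fix e :: real assume e: "e > 0"
    define h where "h n = 4 * ((d + 1 / real (Suc n))\<^sup>2 - d\<^sup>2)" for n
    have "h \<longlonglongrightarrow> 4 * ((d + 0)\<^sup>2 - d\<^sup>2)" unfolding h_def
      by (intro tendsto_intros LIMSEQ_Suc[OF lim_1_over_n])
    then have "\<forall>\<^sub>F n in sequentially. h n < e\<^sup>2" using e by (intro order_tendstoD) auto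
    then obtain N where N: "\<And>n. n \<ge> N \<Longrightarrow> h n < e\<^sup>2" by (auto simp: eventually_sequentially)
    have "dist (X m) (X n) < e" if "m \<ge> N" "n \<ge> N" for m n
    proof -
      have "(norm (x - X k))\<^sup>2 \<le> (d + 1 / real (Suc k))\<^sup>2" for k
        using X(2)[of k] by (intro power_mono) auto
      then have "(norm (X m - X n))\<^sup>2 \<le> h m / 2 + h n / 2"
        using par[of m n] by (smt (verit) h_def field_sum_of_halves)
      also have "\<dots> < e\<^sup>2" using N[OF that(1)] N[OF that(2)] by linarith
      finally show ?thesis using e by (simp add: dist_norm power_less_imp_less_base)
    qed
    then show "\<exists>N. \<forall>m\<ge>N. \<forall>n\<ge>N. dist (X m) (X n) < e" by blast
  qed
  then obtain p where p: "X \<longlonglongrightarrow> p" using Cauchy_convergent convergentD by blast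
  have pW: "p \<in> W" using W(2) X(1) p closed_sequentially by blast
  have "norm (x - p) \<le> d + 0"
  proof (rule LIMSEQ_le)
    show "(\<lambda>n. norm (x - X n)) \<longlonglongrightarrow> norm (x - p)" by (intro tendsto_intros p)
    show "(\<lambda>n. d + 1 / real (Suc n)) \<longlonglongrightarrow> d + 0" by (intro tendsto_intros LIMSEQ_Suc[OF lim_1_over_n])
  qed (use X(2) less_imp_le in blast)
  then have np: "norm (x - p) = d" using d_le[OF pW] by simp
  have "(x - p) \<bullet> w = 0" if w: "w \<in> W" for w
  proof (cases "w = 0")
    case False
    \<comment> \<open>The step length that minimises the distance from \<open>x\<close> along the
      line through \<open>p\<close> in direction \<open>w\<close>.\<close>
    define t where "t = ((x - p) \<bullet> w) / (w \<bullet> w)"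
    have "p + t *\<^sub>R w \<in> W" using pW w W(1) by (intro subspace_add subspace_scale)
    then have "(norm (x - p))\<^sup>2 \<le> (norm (x - (p + t *\<^sub>R w)))\<^sup>2"
      using d_le np d0 by (intro power_mono) auto
    also have "x - (p + t *\<^sub>R w) = (x - p) - t *\<^sub>R w" by simp
    also have "(norm ((x - p) - t *\<^sub>R w))\<^sup>2 = (norm (x - p))\<^sup>2 - 2 * t * ((x - p) \<bullet> w) + t * t * (w \<bullet> w)"
      by (simp add: power2_norm_eq_inner inner_diff_left inner_diff_right inner_commute algebra_simps)
    also have "t * t * (w \<bullet> w) = t * ((x - p) \<bullet> w)" using False by (simp add: t_def)
    finally have "t * ((x - p) \<bullet> w) \<le> 0" by simp
    then have "((x - p) \<bullet> w)\<^sup>2 / (w \<bullet> w) \<le> 0" by (simp add: t_def power2_eq_square)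
    moreover have "w \<bullet> w > 0" using False by simp
    ultimately show ?thesis by (simp add: divide_le_0_iff not_less)
  qed simp
  with pW show ?thesis by blast
qed

text \<open>Zarantonello's argument: with \<open>P\<close> the projection onto \<open>W\<close>, the
  map \<open>S\<close> is a contraction of \<open>W\<close> for the chosen \<open>t\<close>, and its
  fixed point satisfies \<open>P (T x - b) = 0\<close>, which is the equation tested with
  \<open>W\<close>.\<close>

theorem strongly_monotone_solution:
  fixes W :: "'h::{real_inner, complete_space} set" and T :: "'h \<Rightarrow> 'h"
  assumes W: "subspace W" "closed W" and c: "c > 0"
    and mono: "\<And>x y. x \<in> W \<Longrightarrow> y \<in> W \<Longrightarrow> (T x - T y) \<bullet> (x - y) \<ge> c * (norm (x - y))\<^sup>2"
    and lip: "\<And>x y. x \<in> W \<Longrightarrow> y \<in> W \<Longrightarrow> norm (T x - T y) \<le> L * norm (x - y)"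
  shows "\<exists>x\<in>W. \<forall>w\<in>W. T x \<bullet> w = b \<bullet> w"
proof -
  obtain P where P: "\<And>x. P x \<in> W" "\<And>x w. w \<in> W \<Longrightarrow> (x - P x) \<bullet> w = 0"
    using closed_subspace_projection[OF W] by metis
  \<comment> \<open>Enlarging the Lipschitz constant makes it positive and at least
    \<open>c\<close>. Then \<open>t * c = c\<^sup>2 / M\<^sup>2 \<le> 1\<close>, so the contraction
    factor \<open>k\<close> is a genuine square root.\<close>
  define M where "M = max 1 (max L c)"
  have M: "M > 0" "M \<ge> L" "M \<ge> c" by (auto simp: M_def)
  define t where "t = c / M\<^sup>2"
  have t: "t > 0" using c M by (simp add: t_def)
  define S where "S x = x - t *\<^sub>R P (T x - b)" for x
  define k where "k = sqrt (1 - t * c)"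
  have tc: "t * c \<le> 1"
  proof -
    have "t * c = c\<^sup>2 / M\<^sup>2" by (simp add: t_def power2_eq_square)
    also have "\<dots> \<le> 1" using c M by simp
    finally show ?thesis .
  qed
  have k: "0 \<le> k" "k < 1" using tc t c by (auto simp: k_def)
  have P_diff: "norm (P x - P y) \<le> norm (x - y)" and P_inner: "w \<in> W \<Longrightarrow> (P x - P y) \<bullet> w = (x - y) \<bullet> w" for x y w
  proof -
    show inn: "w \<in> W \<Longrightarrow> (P x - P y) \<bullet> w = (x - y) \<bullet> w" for w
      using P(2)[of w x] P(2)[of w y] by (simp add: inner_diff_left)
    have "(norm (P x - P y))\<^sup>2 = (x - y) \<bullet> (P x - P y)"
      using inn[of "P x - P y"] P(1) subspace_diff[OF W(1)] by (simp add: power2_norm_eq_inner)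
    also have "\<dots> \<le> norm (x - y) * norm (P x - P y)" by (rule norm_cauchy_schwarz)
    finally show "norm (P x - P y) \<le> norm (x - y)"
      by (cases "norm (P x - P y) = 0") (auto simp: power2_eq_square)
  qed
  have "\<exists>!x\<in>W. S x = x"
  proof (rule Banach_fix[OF _ _ k])
    show "complete W" using W(2) by (simp add: complete_eq_closed)
    show "W \<noteq> {}" using subspace_0[OF W(1)] by auto
    show "S ` W \<subseteq> W" using W(1) P(1) by (auto simp: S_def intro!: subspace_diff subspace_scale)
    show "dist (S x) (S y) \<le> k * dist x y" if xy: "x \<in> W" "y \<in> W" for x y
    proof -
      define v where "v = x - y"
      define q where "q = P (T x - b) - P (T y - b)"
      have vW: "v \<in> W" using xy W(1) by (auto simp: v_def intro: subspace_diff)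
      have q1: "norm q \<le> M * norm v"
      proof -
        have "norm q \<le> norm (T x - T y)" using P_diff[of "T x - b" "T y - b"] by (simp add: q_def)
        also have "\<dots> \<le> L * norm v" using lip[OF xy] by (simp add: v_def)
        also have "\<dots> \<le> M * norm v" using M by (intro mult_right_mono) auto
        finally show ?thesis .
      qed
      have q2: "q \<bullet> v \<ge> c * (norm v)\<^sup>2"
        using mono[OF xy] P_inner[OF vW, of "T x - b" "T y - b"] by (simp add: q_def v_def)
      have "(norm (S x - S y))\<^sup>2 = (norm (v - t *\<^sub>R q))\<^sup>2"
        by (simp add: S_def v_def q_def algebra_simps)
      also have "\<dots> = (norm v)\<^sup>2 - 2 * t * (q \<bullet> v) + t\<^sup>2 * (norm q)\<^sup>2"
        by (simp add: power2_norm_eq_inner inner_diff_left inner_diff_right inner_commute algebra_simps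
            power2_eq_square[of t])
      also have "\<dots> \<le> (norm v)\<^sup>2 - 2 * t * (c * (norm v)\<^sup>2) + t\<^sup>2 * (M * norm v)\<^sup>2"
        using q1 q2 t by (intro add_mono diff_mono mult_left_mono power_mono) auto
      \<comment> \<open>The choice \<open>t = c / M\<^sup>2\<close> makes the quadratic term equal
        to half of the gain \<open>2 * t * c\<close>, which leaves the factor
        \<open>1 - t * c = k\<^sup>2\<close>.\<close>
      also have "t\<^sup>2 * (M * norm v)\<^sup>2 = t * c * (norm v)\<^sup>2"
        using M by (simp add: t_def power_mult_distrib power2_eq_square)
      also have "(norm v)\<^sup>2 - 2 * t * (c * (norm v)\<^sup>2) + t * c * (norm v)\<^sup>2 = (k * norm v)\<^sup>2"
        using tc by (simp add: k_def power_mult_distrib algebra_simps)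
      finally have "(norm (S x - S y))\<^sup>2 \<le> (k * norm v)\<^sup>2" .
      then have "norm (S x - S y) \<le> k * norm v"
        by (rule power2_le_imp_le) (simp add: k)
      then show "dist (S x) (S y) \<le> k * dist x y" by (simp add: dist_norm v_def)
    qed
  qed
  then obtain x where x: "x \<in> W" "S x = x" by blast
  then have "P (T x - b) = 0" using t by (simp add: S_def)
  then have "T x \<bullet> w = b \<bullet> w" if "w \<in> W" for w
    using P(2)[OF that, of "T x - b"] by (simp add: inner_diff_left)
  with x(1) show ?thesis by blast
qed

section \<open>Translation and Poincare estimates\<close>

lemma nn_integral_isometry:
  fixes f :: "'a::euclidean_space \<Rightarrow> ennreal"
  assumes f: "f \<in> borel_measurable borel" and c: "\<bar>c\<bar> = 1"
  shows "(\<integral>\<^sup>+x. f (y + c *\<^sub>R x) \<partial>lborel) = (\<integral>\<^sup>+x. f x \<partial>lborel)"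
proof -
  have "c \<noteq> 0" using c by auto
  then show ?thesis
    using nn_integral_affine[of c f y] f c by (simp add: nn_integral_completion measurable_completion)
qed

text \<open>The difference \<open>U (x + y) - U x\<close> is the integral of
  \<open>H (x + t *\<^sub>R y) \<bullet> y\<close> over the unit interval; Cauchy-Schwarz in
  \<open>t\<close>, Fubini and translation invariance give the bound. It is phrased with nonnegative
  integrals because potentials will be used that are not square integrable.\<close>

lemma nn_integral_translation_estimate:
  fixes U :: "'a::euclidean_space \<Rightarrow> real"
  assumes U: "\<And>x. GDERIV U x :> H x" and H: "continuous_on UNIV H"
  shows "(\<integral>\<^sup>+x. ennreal ((U (x + y) - U x)\<^sup>2) \<partial>lborel)
      \<le> ennreal ((norm y)\<^sup>2) * (\<integral>\<^sup>+x. ennreal ((norm (H x))\<^sup>2) \<partial>lborel)"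
proof -
  have [measurable]: "H \<in> borel_measurable borel" using H by (rule borel_measurable_continuous_onI)
  define N where "N = (\<integral>\<^sup>+x. ennreal ((norm (H x))\<^sup>2) \<partial>lborel)"
  have pointwise: "ennreal ((U (x + y) - U x)\<^sup>2)
      \<le> ennreal ((norm y)\<^sup>2) * (\<integral>\<^sup>+t. ennreal ((norm (H (x + t *\<^sub>R y)))\<^sup>2) * indicator {0..1} t \<partial>lborel)" for x
  proof -
    have der: "((\<lambda>t. U (x + t *\<^sub>R y)) has_vector_derivative (H (x + t *\<^sub>R y) \<bullet> y)) (at t within {0..1})" for t
    proof -
      have "((\<lambda>t. x + t *\<^sub>R y) has_derivative (\<lambda>s. s *\<^sub>R y)) (at t)"
        by (auto intro!: derivative_eq_intros)
      from has_derivative_compose[OF this U[of "x + t *\<^sub>R y", unfolded gderiv_def]]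
      show ?thesis unfolding has_vector_derivative_def
        by (rule has_derivative_at_withinI[OF has_derivative_eq_rhs]) (simp add: inner_commute fun_eq_iff)
    qed
    have cont: "continuous_on {0..1} (\<lambda>t. H (x + t *\<^sub>R y) \<bullet> y)"
      by (intro continuous_intros continuous_on_compose2[OF H]) auto
    have bi: "has_bochner_integral lborel (\<lambda>t. indicator {0..1} t *\<^sub>R (H (x + t *\<^sub>R y) \<bullet> y)) (U (x + y) - U x)"
      using has_bochner_integral_FTC_Icc[OF zero_le_one der cont] by simp
    have "ennreal \<bar>U (x + y) - U x\<bar> \<le> (\<integral>\<^sup>+t. ennreal (norm (indicator {0..1} t *\<^sub>R (H (x + t *\<^sub>R y) \<bullet> y))) \<partial>lborel)"
      using integral_norm_bound_ennreal[of lborel "\<lambda>t. indicator {0..1} t *\<^sub>R (H (x + t *\<^sub>R y) \<bullet> y)"] bi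
      by (simp add: has_bochner_integral_iff)
    \<comment> \<open>The indicator is written twice so that Cauchy-Schwarz applies with the
      indicator, of mass 1, as second factor.\<close>
    also have "\<dots> \<le> (\<integral>\<^sup>+t. (ennreal (norm y * norm (H (x + t *\<^sub>R y))) * indicator {0..1} t) * indicator {0..1} t \<partial>lborel)"
    proof (intro nn_integral_mono)
      fix t :: real
      have "\<bar>H (x + t *\<^sub>R y) \<bullet> y\<bar> \<le> norm y * norm (H (x + t *\<^sub>R y))"
        using Cauchy_Schwarz_ineq2[of "H (x + t *\<^sub>R y)" y] by (simp add: mult.commute)
      then show "ennreal (norm (indicator {0..1} t *\<^sub>R (H (x + t *\<^sub>R y) \<bullet> y)))
          \<le> (ennreal (norm y * norm (H (x + t *\<^sub>R y))) * indicator {0..1} t) * indicator {0..1} t"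
        by (auto simp: indicator_def intro: ennreal_leI)
    qed
    finally have "(ennreal \<bar>U (x + y) - U x\<bar>)\<^sup>2 \<le>
        (\<integral>\<^sup>+t. (ennreal (norm y * norm (H (x + t *\<^sub>R y))) * indicator {0..1} t) * indicator {0..1} t \<partial>lborel)\<^sup>2"
      by (intro power_mono) auto
    also have "\<dots> \<le> (\<integral>\<^sup>+t. (ennreal (norm y * norm (H (x + t *\<^sub>R y))) * indicator {0..1} t)\<^sup>2 \<partial>lborel) *
        (\<integral>\<^sup>+t. (indicator {0..1::real} t)\<^sup>2 \<partial>lborel)"
      by (rule Cauchy_Schwarz_nn_integral) measurable
    also have "(\<integral>\<^sup>+t. (indicator {0..1::real} t)\<^sup>2 \<partial>lborel) = (1::ennreal)"
    proof -
      have "(\<lambda>t. (indicator {0..1::real} t)\<^sup>2) = (indicator {0..1} :: real \<Rightarrow> ennreal)"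
        by (auto simp: indicator_def)
      then show ?thesis by simp
    qed
    also have "(\<integral>\<^sup>+t. (ennreal (norm y * norm (H (x + t *\<^sub>R y))) * indicator {0..1} t)\<^sup>2 \<partial>lborel) =
        (\<integral>\<^sup>+t. ennreal ((norm y)\<^sup>2) * (ennreal ((norm (H (x + t *\<^sub>R y)))\<^sup>2) * indicator {0..1} t) \<partial>lborel)"
      by (intro nn_integral_cong)
         (auto simp: indicator_def ennreal_power power_mult_distrib ennreal_mult[symmetric])
    also have "\<dots> = ennreal ((norm y)\<^sup>2) * (\<integral>\<^sup>+t. ennreal ((norm (H (x + t *\<^sub>R y)))\<^sup>2) * indicator {0..1} t \<partial>lborel)"
      by (rule nn_integral_cmult) measurable
    finally show ?thesis by (simp add: ennreal_power)
  qed
  have "(\<integral>\<^sup>+x. ennreal ((U (x + y) - U x)\<^sup>2) \<partial>lborel)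
      \<le> (\<integral>\<^sup>+x. ennreal ((norm y)\<^sup>2) * (\<integral>\<^sup>+t. ennreal ((norm (H (x + t *\<^sub>R y)))\<^sup>2) * indicator {0..1} t \<partial>lborel) \<partial>lborel)"
    by (intro nn_integral_mono pointwise)
  also have "\<dots> = ennreal ((norm y)\<^sup>2) * (\<integral>\<^sup>+x. (\<integral>\<^sup>+t. ennreal ((norm (H (x + t *\<^sub>R y)))\<^sup>2) * indicator {0..1} t \<partial>lborel) \<partial>lborel)"
    by (rule nn_integral_cmult) measurable
  also have "(\<integral>\<^sup>+x. (\<integral>\<^sup>+t. ennreal ((norm (H (x + t *\<^sub>R y)))\<^sup>2) * indicator {0..1} t \<partial>lborel) \<partial>lborel)
      = (\<integral>\<^sup>+t. (\<integral>\<^sup>+x. ennreal ((norm (H (x + t *\<^sub>R y)))\<^sup>2) * indicator {0..1} t \<partial>lborel) \<partial>lborel)"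
    by (rule lborel_pair.Fubini'[symmetric]) measurable
  also have "\<dots> = (\<integral>\<^sup>+t. N * indicator {0..1} t \<partial>(lborel::real measure))"
  proof (intro nn_integral_cong)
    fix t :: real
    have "(\<integral>\<^sup>+x. ennreal ((norm (H (x + t *\<^sub>R y)))\<^sup>2) \<partial>lborel) = N"
      using nn_integral_isometry[of "\<lambda>x. ennreal ((norm (H x))\<^sup>2)" 1 "t *\<^sub>R y"]
      by (simp add: N_def add.commute)
    then show "(\<integral>\<^sup>+x. ennreal ((norm (H (x + t *\<^sub>R y)))\<^sup>2) * indicator {0..1} t \<partial>lborel) = N * indicator {0..1} t"
      by (subst nn_integral_multc) auto
  qed
  also have "\<dots> = N" by (simp add: nn_integral_cmult)
  finally show ?thesis by (simp add: N_def)
qed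

text \<open>A shift by \<open>2 * r\<close> along a coordinate moves the ball, and with it
  \<open>D\<close>, off itself, so on \<open>D\<close> the value of \<open>\<phi>\<close> is a
  translation difference up to sign. The constant is the square of the shift length.\<close>

lemma Poincare_test_function:
  fixes \<phi> :: "'a::euclidean_space \<Rightarrow> real"
  assumes \<phi>: "\<phi> \<in> test_functions D" and D: "D \<subseteq> ball 0 r" and r: "r > 0"
  shows "(\<integral>\<^sup>+x. ennreal ((\<phi> x)\<^sup>2) \<partial>lborel) \<le> ennreal (4 * r\<^sup>2) * (\<integral>\<^sup>+x. ennreal ((norm (grad \<phi> x))\<^sup>2) \<partial>lborel)"
proof -
  obtain b :: 'a where b: "b \<in> Basis" by (meson ex_in_conv nonempty_Basis)
  define y where "y = (2 * r) *\<^sub>R b"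
  have y: "norm y = 2 * r" using b r by (simp add: y_def)
  have z: "\<phi> x = 0" if "x \<notin> D" for x using \<phi> that by (metis test_functions_support subsetD)
  have "(\<phi> x)\<^sup>2 \<le> (\<phi> (x + y) - \<phi> x)\<^sup>2" for x
  proof (cases "x \<in> D")
    case True
    then have "norm x < r" using D by auto
    then have "norm (x + y) > r" using norm_diff_ineq[of y x] y by (simp add: add.commute)
    then have "x + y \<notin> D" using D by auto
    then show ?thesis using z by simp
  qed (simp add: z)
  then have "(\<integral>\<^sup>+x. ennreal ((\<phi> x)\<^sup>2) \<partial>lborel) \<le> (\<integral>\<^sup>+x. ennreal ((\<phi> (x + y) - \<phi> x)\<^sup>2) \<partial>lborel)"
    by (intro nn_integral_mono ennreal_leI)
  also have "\<dots> \<le> ennreal ((norm y)\<^sup>2) * (\<integral>\<^sup>+x. ennreal ((norm (grad \<phi> x))\<^sup>2) \<partial>lborel)"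
    by (intro nn_integral_translation_estimate test_functionsD[OF \<phi>])
  finally show ?thesis by (simp add: y power_mult_distrib)
qed

text \<open>Substituting \<open>y = x + w\<close> turns the integral over pairs of points in two
  balls into one over shifts \<open>w\<close> of length at most \<open>r + 1\<close>, each
  controlled by the translation estimate.\<close>

lemma nn_integral_indicator_translate_le:
  fixes \<psi> :: "'a::euclidean_space \<Rightarrow> real"
  assumes U: "\<And>x. GDERIV \<psi> x :> H x" and H: "continuous_on UNIV H"
  shows "(\<integral>\<^sup>+y. (\<integral>\<^sup>+x. ennreal ((\<psi> y - \<psi> x)\<^sup>2) * indicator (ball 0 1) x \<partial>lborel) * indicator (cball 0 r) y \<partial>lborel)
      \<le> ennreal ((r + 1)\<^sup>2) * emeasure lborel (cball (0::'a) (r + 1)) * (\<integral>\<^sup>+x. ennreal ((norm (H x))\<^sup>2) \<partial>lborel)"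
proof -
  have "continuous_on UNIV \<psi>" using GDERIV_imp_isCont[OF U] by (auto intro: continuous_at_imp_continuous_on)
  then have [measurable]: "\<psi> \<in> borel_measurable borel" by (rule borel_measurable_continuous_onI)
  have [measurable]: "ball (0::'a) s \<in> sets borel" "cball (0::'a) s \<in> sets borel" for s by simp_all
  define N where "N = (\<integral>\<^sup>+x. ennreal ((norm (H x))\<^sup>2) \<partial>lborel)"
  have [measurable]: "Measurable.pred (borel \<Otimes>\<^sub>M borel) (\<lambda>(x::'a, w). x + w \<in> cball 0 r)" for r
    unfolding case_prod_beta by (rule pred_sets2[of "cball 0 r" borel]) (simp, measurable)
  have "(\<integral>\<^sup>+y. (\<integral>\<^sup>+x. ennreal ((\<psi> y - \<psi> x)\<^sup>2) * indicator (ball 0 1) x \<partial>lborel) * indicator (cball 0 r) y \<partial>lborel)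
      = (\<integral>\<^sup>+y. (\<integral>\<^sup>+x. ennreal ((\<psi> y - \<psi> x)\<^sup>2) * indicator (ball 0 1) x * indicator (cball 0 r) y \<partial>lborel) \<partial>lborel)"
    by (intro nn_integral_cong nn_integral_multc[symmetric]) measurable
  also have "\<dots> = (\<integral>\<^sup>+x. (\<integral>\<^sup>+y. ennreal ((\<psi> y - \<psi> x)\<^sup>2) * indicator (ball 0 1) x * indicator (cball 0 r) y \<partial>lborel) \<partial>lborel)"
    by (rule lborel_pair.Fubini') measurable
  also have "\<dots> = (\<integral>\<^sup>+x. (\<integral>\<^sup>+w. ennreal ((\<psi> (x + w) - \<psi> x)\<^sup>2) * indicator (ball 0 1) x * indicator (cball 0 r) (x + w) \<partial>lborel) \<partial>lborel)"
  proof (rule nn_integral_cong)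
    fix x :: 'a
    show "(\<integral>\<^sup>+y. ennreal ((\<psi> y - \<psi> x)\<^sup>2) * indicator (ball 0 1) x * indicator (cball 0 r) y \<partial>lborel)
        = (\<integral>\<^sup>+w. ennreal ((\<psi> (x + w) - \<psi> x)\<^sup>2) * indicator (ball 0 1) x * indicator (cball 0 r) (x + w) \<partial>lborel)"
      using nn_integral_isometry[of "\<lambda>y. ennreal ((\<psi> y - \<psi> x)\<^sup>2) * indicator (ball 0 1) x * indicator (cball 0 r) y" 1 x]
      by simp
  qed
  also have "\<dots> \<le> (\<integral>\<^sup>+x. (\<integral>\<^sup>+w. ennreal ((\<psi> (x + w) - \<psi> x)\<^sup>2) * indicator (cball 0 (r + 1)) w \<partial>lborel) \<partial>lborel)"
  proof (intro nn_integral_mono)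
    fix x w :: 'a
    have "norm w \<le> r + 1" if "norm x < 1" "norm (x + w) \<le> r"
      using that norm_triangle_ineq4[of "x + w" x] by simp
    then show "ennreal ((\<psi> (x + w) - \<psi> x)\<^sup>2) * indicator (ball 0 1) x * indicator (cball 0 r) (x + w)
        \<le> ennreal ((\<psi> (x + w) - \<psi> x)\<^sup>2) * indicator (cball 0 (r + 1)) w"
      by (auto simp: indicator_def)
  qed
  also have "\<dots> = (\<integral>\<^sup>+w. (\<integral>\<^sup>+x. ennreal ((\<psi> (x + w) - \<psi> x)\<^sup>2) * indicator (cball 0 (r + 1)) w \<partial>lborel) \<partial>lborel)"
    by (rule lborel_pair.Fubini'[symmetric]) measurable
  also have "\<dots> \<le> (\<integral>\<^sup>+w. ennreal ((r + 1)\<^sup>2) * N * indicator (cball (0::'a) (r + 1)) w \<partial>lborel)"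
  proof (intro nn_integral_mono)
    fix w :: 'a
    have "(\<integral>\<^sup>+x. ennreal ((\<psi> (x + w) - \<psi> x)\<^sup>2) * indicator (cball 0 (r + 1)) w \<partial>lborel)
        = (\<integral>\<^sup>+x. ennreal ((\<psi> (x + w) - \<psi> x)\<^sup>2) \<partial>lborel) * indicator (cball 0 (r + 1)) w"
      by (rule nn_integral_multc) measurable
    also have "\<dots> \<le> ennreal ((norm w)\<^sup>2) * N * indicator (cball 0 (r + 1)) w"
      unfolding N_def by (intro mult_right_mono nn_integral_translation_estimate U H) auto
    also have "\<dots> \<le> ennreal ((r + 1)\<^sup>2) * N * indicator (cball 0 (r + 1)) w"
      by (auto simp: indicator_def intro!: mult_right_mono ennreal_leI power_mono)
    finally show "(\<integral>\<^sup>+x. ennreal ((\<psi> (x + w) - \<psi> x)\<^sup>2) * indicator (cball 0 (r + 1)) w \<partial>lborel)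
        \<le> ennreal ((r + 1)\<^sup>2) * N * indicator (cball 0 (r + 1)) w" .
  qed
  also have "\<dots> = ennreal ((r + 1)\<^sup>2) * N * emeasure lborel (cball (0::'a) (r + 1))"
    by (rule nn_integral_cmult_indicator) simp
  finally show ?thesis unfolding N_def by (simp add: ac_simps)
qed

lemma continuous_imp_set_integrable_ball:
  fixes \<theta> :: "'a::euclidean_space \<Rightarrow> real"
  assumes "continuous_on UNIV \<theta>"
  shows "set_integrable lborel (ball 0 1) \<theta>"
proof (rule set_integrable_subset)
  show "set_integrable lborel (cball 0 1) \<theta>" unfolding set_integrable_def
    by (rule borel_integrable_compact) (use assms in \<open>auto intro: continuous_on_subset\<close>)
qed auto

text \<open>Normalising constant for potentials on the whole space. The same unit ball is used for
  every radius, so that a single normalised sequence converges on all balls.\<close>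

definition ball_mean :: "('a::euclidean_space \<Rightarrow> real) \<Rightarrow> real" where
  "ball_mean \<psi> = (LINT x:ball 0 1|lborel. \<psi> x) / measure lborel (ball (0::'a) 1)"

lemma ball_mean_diff:
  fixes \<phi> \<psi> :: "'a::euclidean_space \<Rightarrow> real"
  assumes "continuous_on UNIV \<phi>" "continuous_on UNIV \<psi>"
  shows "ball_mean (\<lambda>x. \<phi> x - \<psi> x) = ball_mean \<phi> - ball_mean \<psi>"
proof -
  show ?thesis using assms[THEN continuous_imp_set_integrable_ball]
    by (simp add: ball_mean_def diff_divide_distrib)
qed

text \<open>By Cauchy-Schwarz the squared deviation from the mean is at most the mean of the squared
  differences, and the double integral of these has just been estimated. \<open>C\<close> is fixed
  before \<open>\<psi>\<close> since it has to serve all differences of an approximating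
  sequence.\<close>

lemma Poincare_ball_mean:
  fixes \<psi> :: "'a::euclidean_space \<Rightarrow> real"
  assumes r: "r \<ge> 0"
  shows "\<exists>C\<ge>0. \<forall>\<psi> H. (\<forall>x. GDERIV \<psi> x :> H x) \<longrightarrow> continuous_on UNIV H \<longrightarrow>
     (\<integral>\<^sup>+y. ennreal ((\<psi> y - ball_mean \<psi>)\<^sup>2) * indicator (cball (0::'a) r) y \<partial>lborel)
      \<le> ennreal C * (\<integral>\<^sup>+x. ennreal ((norm (H x))\<^sup>2) \<partial>lborel)"
proof -
  define m where "m = measure lborel (ball (0::'a) 1)"
  define \<mu> where "\<mu> = measure lborel (cball (0::'a) (r + 1))"
  have m0: "m > 0" unfolding m_def by (rule content_ball_pos) simp
  have em: "emeasure lborel (ball (0::'a) 1) = ennreal m" "emeasure lborel (cball (0::'a) (r + 1)) = ennreal \<mu>"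
    unfolding m_def \<mu>_def
    by (intro emeasure_eq_ennreal_measure; use emeasure_lborel_ball_finite[of "0::'a" 1]
        emeasure_lborel_cball_finite[of "0::'a" "r + 1"] in auto)+
  have "(\<integral>\<^sup>+y. ennreal ((\<psi> y - ball_mean \<psi>)\<^sup>2) * indicator (cball (0::'a) r) y \<partial>lborel)
      \<le> ennreal ((1 / m) * ((r + 1)\<^sup>2 * \<mu>)) * (\<integral>\<^sup>+x. ennreal ((norm (H x))\<^sup>2) \<partial>lborel)"
    if \<psi>': "\<forall>x. GDERIV \<psi> x :> H x" and H: "continuous_on UNIV H" for \<psi> H
  proof -
    have \<psi>: "GDERIV \<psi> x :> H x" for x using \<psi>' by blast
    have [measurable]: "ball (0::'a) 1 \<in> sets borel" "cball (0::'a) r \<in> sets borel" by simp_all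
    have cont: "continuous_on UNIV \<psi>" using GDERIV_imp_isCont[OF \<psi>] by (auto intro: continuous_at_imp_continuous_on)
    then have [measurable]: "\<psi> \<in> borel_measurable borel" by (rule borel_measurable_continuous_onI)
    note int = continuous_imp_set_integrable_ball[OF cont]
    have const: "set_integrable lborel (ball (0::'a) 1) (\<lambda>_. c)" "(LINT x:ball (0::'a) 1|lborel. c) = m * c" for c :: real
      using em(1) by (auto simp: set_integrable_def set_lebesgue_integral_def m_def)
    have point: "ennreal ((\<psi> y - ball_mean \<psi>)\<^sup>2)
        \<le> ennreal (1 / m) * (\<integral>\<^sup>+x. ennreal ((\<psi> y - \<psi> x)\<^sup>2) * indicator (ball 0 1) x \<partial>lborel)" for y
    proof -
      have eq: "m * (\<psi> y - ball_mean \<psi>) = (LINT x:ball 0 1|lborel. \<psi> y - \<psi> x)"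
        using m0 const int by (simp add: set_integral_diff ball_mean_def m_def[symmetric] algebra_simps)
      have "set_integrable lborel (ball 0 1) (\<lambda>x. \<psi> y - \<psi> x)" using const int by simp
      then have "ennreal \<bar>m * (\<psi> y - ball_mean \<psi>)\<bar> \<le> (\<integral>\<^sup>+x. ennreal (norm (indicator (ball 0 1) x *\<^sub>R (\<psi> y - \<psi> x))) \<partial>lborel)"
        unfolding eq set_lebesgue_integral_def set_integrable_def
        by (subst real_norm_def[symmetric]) (rule integral_norm_bound_ennreal)
      also have "\<dots> = (\<integral>\<^sup>+x. (ennreal \<bar>\<psi> y - \<psi> x\<bar> * indicator (ball 0 1) x) * indicator (ball 0 1) x \<partial>lborel)"
        by (intro nn_integral_cong) (auto simp: indicator_def)
      finally have "(ennreal \<bar>m * (\<psi> y - ball_mean \<psi>)\<bar>)\<^sup>2 \<le>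
          (\<integral>\<^sup>+x. (ennreal \<bar>\<psi> y - \<psi> x\<bar> * indicator (ball 0 1) x) * indicator (ball 0 1) x \<partial>lborel)\<^sup>2"
        by (intro power_mono) auto
      also have "\<dots> \<le> (\<integral>\<^sup>+x. (ennreal \<bar>\<psi> y - \<psi> x\<bar> * indicator (ball 0 1) x)\<^sup>2 \<partial>lborel) *
          (\<integral>\<^sup>+x. (indicator (ball (0::'a) 1) x)\<^sup>2 \<partial>lborel)"
        by (rule Cauchy_Schwarz_nn_integral) measurable
      also have "(\<lambda>x. (indicator (ball (0::'a) 1) x)\<^sup>2) = (indicator (ball (0::'a) 1) :: _ \<Rightarrow> ennreal)"
        by (auto simp: indicator_def)
      also have "(\<integral>\<^sup>+x. (ennreal \<bar>\<psi> y - \<psi> x\<bar> * indicator (ball 0 1) x)\<^sup>2 \<partial>lborel)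
          = (\<integral>\<^sup>+x. ennreal ((\<psi> y - \<psi> x)\<^sup>2) * indicator (ball 0 1) x \<partial>lborel)"
        by (intro nn_integral_cong) (auto simp: indicator_def ennreal_power)
      \<comment> \<open>Both sides are multiplied by \<open>1 / m\<^sup>2\<close>. The factor
        \<open>m\<close> on the right is the mass of the unit ball from Cauchy-Schwarz, so
        \<open>1 / m\<close> remains.\<close>
      finally have "ennreal (1 / m\<^sup>2) * ennreal (m\<^sup>2 * (\<psi> y - ball_mean \<psi>)\<^sup>2)
          \<le> ennreal (1 / m\<^sup>2) * ((\<integral>\<^sup>+x. ennreal ((\<psi> y - \<psi> x)\<^sup>2) * indicator (ball 0 1) x \<partial>lborel) * ennreal m)"
        by (intro mult_left_mono) (auto simp: ennreal_power power_mult_distrib em(1))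
      also have "ennreal (1 / m\<^sup>2) * ennreal (m\<^sup>2 * (\<psi> y - ball_mean \<psi>)\<^sup>2) = ennreal ((\<psi> y - ball_mean \<psi>)\<^sup>2)"
        using m0 by (subst ennreal_mult[symmetric]) auto
      also have "ennreal (1 / m\<^sup>2) * ((\<integral>\<^sup>+x. ennreal ((\<psi> y - \<psi> x)\<^sup>2) * indicator (ball 0 1) x \<partial>lborel) * ennreal m)
          = (ennreal (1 / m\<^sup>2) * ennreal m) * (\<integral>\<^sup>+x. ennreal ((\<psi> y - \<psi> x)\<^sup>2) * indicator (ball 0 1) x \<partial>lborel)"
        by (simp add: ac_simps)
      also have "ennreal (1 / m\<^sup>2) * ennreal m = ennreal (1 / m)"
        using m0 by (subst ennreal_mult[symmetric]) (auto simp: power2_eq_square)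
      finally show ?thesis .
    qed
    have "(\<integral>\<^sup>+y. ennreal ((\<psi> y - ball_mean \<psi>)\<^sup>2) * indicator (cball (0::'a) r) y \<partial>lborel)
        \<le> (\<integral>\<^sup>+y. ennreal (1 / m) * ((\<integral>\<^sup>+x. ennreal ((\<psi> y - \<psi> x)\<^sup>2) * indicator (ball 0 1) x \<partial>lborel) * indicator (cball 0 r) y) \<partial>lborel)"
    proof (rule nn_integral_mono)
      fix y :: 'a
      show "ennreal ((\<psi> y - ball_mean \<psi>)\<^sup>2) * indicator (cball 0 r) y
          \<le> ennreal (1 / m) * ((\<integral>\<^sup>+x. ennreal ((\<psi> y - \<psi> x)\<^sup>2) * indicator (ball 0 1) x \<partial>lborel) * indicator (cball 0 r) y)"
        using point[of y] by (cases "y \<in> cball 0 r") (simp_all del: mem_cball mem_ball)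
    qed
    also have "\<dots> = ennreal (1 / m) * (\<integral>\<^sup>+y. (\<integral>\<^sup>+x. ennreal ((\<psi> y - \<psi> x)\<^sup>2) * indicator (ball 0 1) x \<partial>lborel) * indicator (cball 0 r) y \<partial>lborel)"
      by (rule nn_integral_cmult) measurable
    also have "\<dots> \<le> ennreal (1 / m) * (ennreal ((r + 1)\<^sup>2) * emeasure lborel (cball (0::'a) (r + 1)) * (\<integral>\<^sup>+x. ennreal ((norm (H x))\<^sup>2) \<partial>lborel))"
      by (intro mult_left_mono nn_integral_indicator_translate_le \<psi> H) auto
    also have "\<dots> = ennreal ((1 / m) * ((r + 1)\<^sup>2 * \<mu>)) * (\<integral>\<^sup>+x. ennreal ((norm (H x))\<^sup>2) \<partial>lborel)"
    proof -
      have "ennreal ((1 / m) * ((r + 1)\<^sup>2 * \<mu>)) = ennreal (1 / m) * (ennreal ((r + 1)\<^sup>2) * ennreal \<mu>)"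
        using m0 by (simp add: ennreal_mult[symmetric] \<mu>_def)
      then show ?thesis by (simp only: em(2) mult.assoc)
    qed
    finally show ?thesis .
  qed
  moreover have "(1 / m) * ((r + 1)\<^sup>2 * \<mu>) \<ge> 0" using m0 by (simp add: \<mu>_def)
  ultimately show ?thesis by blast
qed

section \<open>Convolution with test functions\<close>

lemma L2_loc_imp_L1_loc:
  fixes f :: "'a::euclidean_space \<Rightarrow> 'b::euclidean_space"
  assumes "f \<in> L2_loc D"
  shows "f \<in> L1_loc D"
  unfolding L1_loc_def
proof safe
  fix C assume C: "compact C" "C \<subseteq> D"
  then have f: "f \<in> L2 C" using assms by (auto simp: L2_loc_def)
  have C': "C \<in> lmeasurable" using C by (intro lmeasurable_compact)
  then have "integrable (lebesgue_on C) (\<lambda>x. 1 + (norm (f x))\<^sup>2)"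
    using f lmeasurable_iff_integrable[THEN iffD1, OF C']
    by (intro Bochner_Integration.integrable_add) (auto simp: L2_def integrable_restrict_space)
  then show "integrable (lebesgue_on C) f"
  proof (rule Bochner_Integration.integrable_bound)
    have "norm w \<le> 1 + (norm w)\<^sup>2" for w :: 'b
    proof -
      have "2 * norm w \<le> 1 + (norm w)\<^sup>2" using sum_squares_bound[of 1 "norm w"] by simp
      then show ?thesis using norm_ge_zero[of w] by linarith
    qed
    then show "AE x in lebesgue_on C. norm (f x) \<le> norm (1 + (norm (f x))\<^sup>2)" by simp
  qed (use f in \<open>simp add: L2_def\<close>)
qed

lemma L2_imp_L2_loc:
  fixes f :: "'a::euclidean_space \<Rightarrow> 'b::euclidean_space"
  assumes D: "D \<in> sets lebesgue" and f: "f \<in> L2 D"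
  shows "f \<in> L2_loc D"
  unfolding L2_loc_def
proof safe
  fix C assume C: "compact C" "C \<subseteq> D"
  then have C': "C \<in> sets lebesgue" by (simp add: compact_imp_closed)
  have f': "(\<lambda>x. indicator D x *\<^sub>R f x) \<in> L2 UNIV" using f L2_iff_UNIV[OF D] by blast
  have "(\<lambda>x. indicator C x *\<^sub>R indicator D x *\<^sub>R f x) \<in> L2 UNIV"
  proof (rule L2_bound[OF f', of _ 1])
    show "(\<lambda>x. indicator C x *\<^sub>R indicator D x *\<^sub>R f x) \<in> borel_measurable lebesgue"
      by (rule borel_measurable_scaleR[OF borel_measurable_indicator[OF C']])
         (use f' in \<open>simp only: L2_UNIV_iff\<close>)
    show "norm (indicat_real C x *\<^sub>R indicat_real D x *\<^sub>R f x) \<le> 1 * norm (indicat_real D x *\<^sub>R f x)" for x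
      by (simp add: indicator_def)
  qed
  also have "(\<lambda>x. indicator C x *\<^sub>R indicator D x *\<^sub>R f x) = (\<lambda>x. indicator C x *\<^sub>R f x)"
    using C(2) by (fastforce simp: indicator_def)
  finally show "f \<in> L2 C" by (simp only: L2_iff_UNIV[OF C'])
qed

lemma L2_imp_L1_loc:
  fixes f :: "'a::euclidean_space \<Rightarrow> 'b::euclidean_space"
  shows "D \<in> sets lebesgue \<Longrightarrow> f \<in> L2 D \<Longrightarrow> f \<in> L1_loc D"
  by (intro L2_loc_imp_L1_loc L2_imp_L2_loc)

lemma L1_loc_inner:
  fixes f :: "'a::euclidean_space \<Rightarrow> 'b::euclidean_space"
  shows "f \<in> L1_loc D \<Longrightarrow> (\<lambda>x. f x \<bullet> b) \<in> L1_loc D"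
  by (auto simp: L1_loc_def)

lemma test_functions_partial: "\<phi> \<in> test_functions D \<Longrightarrow> (\<lambda>x. grad \<phi> x \<bullet> b) \<in> test_functions D"
  by (rule test_functions_support[of \<phi> D], assumption)
     (rule test_functionsI, auto intro: test_functionsD)

lemma test_functions_reflect:
  assumes "\<phi> \<in> test_functions UNIV"
  shows "(\<lambda>y. \<phi> (x - y)) \<in> test_functions UNIV" "grad (\<lambda>y. \<phi> (x - y)) y = - grad \<phi> (x - y)"
  using test_functions_affine[OF assms, of "-1" x UNIV] grad_affine[OF assms, of x "-1" y] by simp_all

text \<open>Each component of the gradient is again a test function, so its own gradient is bounded;
  the constants are summed over the basis.\<close>

lemma grad_test_lipschitz:
  assumes \<phi>: "\<phi> \<in> test_functions D"
  obtains L where "L \<ge> 0" "\<And>x y. norm (grad \<phi> y - grad \<phi> x) \<le> L * norm (y - x)"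
proof -
  have "\<exists>M. M > 0 \<and> (\<forall>x y. \<bar>grad \<phi> y \<bullet> b - grad \<phi> x \<bullet> b\<bar> \<le> M * norm (y - x))" for b
  proof -
    note t = test_functions_partial[OF \<phi>, of b]
    obtain M where M: "M > 0" "\<And>x. norm (grad (\<lambda>x. grad \<phi> x \<bullet> b) x) \<le> M"
      using test_functions_bounds[OF t] by metis
    then show ?thesis
      using GDERIV_bounded_imp_lipschitz[of UNIV "\<lambda>x. grad \<phi> x \<bullet> b", OF _ test_functionsD(3)[OF t]]
      by (intro exI[of _ M]) auto
  qed
  then obtain M where M: "\<And>b. M b > 0" "\<And>b x y. \<bar>grad \<phi> y \<bullet> b - grad \<phi> x \<bullet> b\<bar> \<le> M b * norm (y - x)" by metis
  show ?thesis
  proof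
    show "(\<Sum>b\<in>Basis. M b) \<ge> 0" using M(1) by (intro sum_nonneg) (simp add: less_imp_le)
    fix x y
    have "norm (grad \<phi> y - grad \<phi> x) \<le> (\<Sum>b\<in>Basis. \<bar>(grad \<phi> y - grad \<phi> x) \<bullet> b\<bar>)" by (rule norm_le_l1)
    also have "\<dots> \<le> (\<Sum>b\<in>Basis. M b * norm (y - x))"
      using M(2) by (intro sum_mono) (simp add: inner_diff_left)
    finally show "norm (grad \<phi> y - grad \<phi> x) \<le> (\<Sum>b\<in>Basis. M b) * norm (y - x)" by (simp add: sum_distrib_right)
  qed
qed

text \<open>The kernels are neither normalised nor shrunk to a point. Information on
  \<open>u\<close> is regained from its convolutions with all kernels by the fundamental lemma,
  since the value at a point is the pairing of \<open>u\<close> with a reflected and translated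
  kernel.\<close>

definition conv :: "('a::euclidean_space \<Rightarrow> 'b::euclidean_space) \<Rightarrow> ('a \<Rightarrow> real) \<Rightarrow> 'a \<Rightarrow> 'b" where
  "conv u \<rho> x = (LINT y|lebesgue. \<rho> (x - y) *\<^sub>R u y)"

lemma conv_integrable:
  fixes u :: "'a::euclidean_space \<Rightarrow> 'b::euclidean_space"
  shows "u \<in> L1_loc UNIV \<Longrightarrow> \<rho> \<in> test_functions UNIV \<Longrightarrow> integrable lebesgue (\<lambda>y. \<rho> (x - y) *\<^sub>R u y)"
  by (rule integrable_test_scaleR(2)[of UNIV]) (auto intro: test_functions_reflect)

lemma conv_integrable_grad:
  fixes u :: "'a::euclidean_space \<Rightarrow> real"
  assumes "u \<in> L1_loc UNIV" "\<rho> \<in> test_functions UNIV"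
  shows "integrable lebesgue (\<lambda>y. u y *\<^sub>R grad \<rho> (x - y))"
proof -
  have "integrable lebesgue (\<lambda>y. u y *\<^sub>R grad (\<lambda>y. \<rho> (x - y)) y)"
    by (rule integrable_scaleR_grad_test(2)[of UNIV]) (use assms in \<open>auto intro: test_functions_reflect\<close>)
  then show ?thesis unfolding test_functions_reflect(2)[OF assms(2)]
    using Bochner_Integration.integrable_minus[of lebesgue "\<lambda>y. u y *\<^sub>R - grad \<rho> (x - y)"] by simp
qed

text \<open>The second-order Taylor bound of the kernel is uniform, and for increments shorter than
  1 all kernels involved live on one ball on which \<open>u\<close> is integrable. The remainder is
  thus quadratic in the increment, with the mass \<open>A\<close> of \<open>u\<close> on that ball
  in the constant.\<close>

lemma conv_GDERIV_kernel:
  fixes u :: "'a::euclidean_space \<Rightarrow> real"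
  assumes u: "u \<in> L1_loc UNIV" and \<rho>: "\<rho> \<in> test_functions UNIV"
  shows "GDERIV (conv u \<rho>) x :> (LINT y|lebesgue. u y *\<^sub>R grad \<rho> (x - y))"
proof -
  let ?G = "LINT y|lebesgue. u y *\<^sub>R grad \<rho> (x - y)"
  obtain S where S: "compact S" "\<And>x. x \<notin> S \<Longrightarrow> \<rho> x = 0" "\<And>x. x \<notin> S \<Longrightarrow> grad \<rho> x = 0"
    using test_functions_support[OF \<rho>] by metis
  obtain R where R: "R > 0" "S \<subseteq> ball 0 R" using compact_imp_bounded[OF S(1)] bounded_subset_ballD by blast
  obtain L where L: "L \<ge> 0" "\<And>x y. norm (grad \<rho> y - grad \<rho> x) \<le> L * norm (y - x)"
    using grad_test_lipschitz[OF \<rho>] by metis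
  define A where "A = (LINT y|lebesgue. indicator (cball x (R + 1)) y * \<bar>u y\<bar>)"
  have A: "integrable lebesgue (\<lambda>y. indicator (cball x (R + 1)) y * \<bar>u y\<bar>)"
  proof -
    have "integrable (lebesgue_on (cball x (R + 1))) u" using u by (auto simp: L1_loc_def)
    then have "integrable lebesgue (\<lambda>y. norm (indicator (cball x (R + 1)) y *\<^sub>R u y))"
      by (intro integrable_norm) (simp add: integrable_lebesgue_on)
    then show ?thesis by (simp add: abs_mult)
  qed
  have taylor: "\<bar>\<rho> b - \<rho> a - (b - a) \<bullet> grad \<rho> a\<bar> \<le> L * (norm (b - a))\<^sup>2" for a b
  proof -
    \<comment> \<open>Mean value inequality for \<open>\<rho>\<close> minus its linear part at
      \<open>a\<close>, on the ball whose radius is the increment; there the gradient is at most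
      \<open>L\<close> times that radius.\<close>
    have "\<bar>(\<rho> b - b \<bullet> grad \<rho> a) - (\<rho> a - a \<bullet> grad \<rho> a)\<bar> \<le> (L * norm (b - a)) * norm (b - a)"
    proof (rule GDERIV_bounded_imp_lipschitz)
      show "GDERIV (\<lambda>x. \<rho> x - x \<bullet> grad \<rho> a) w :> grad \<rho> w - grad \<rho> a" for w
      proof (rule GDERIV_diff[OF test_functionsD(3)[OF \<rho>]])
        show "GDERIV (\<lambda>x. x \<bullet> grad \<rho> a) w :> grad \<rho> a"
          unfolding gderiv_def by (auto intro!: derivative_eq_intros)
      qed
      show "norm (grad \<rho> w - grad \<rho> a) \<le> L * norm (b - a)" if "w \<in> cball a (norm (b - a))" for w
        using that L(1) by (intro order_trans[OF L(2)] mult_left_mono) (auto simp: dist_norm norm_minus_commute)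
      show "convex (cball a (norm (b - a)))" by simp
      show "b \<in> cball a (norm (b - a))" by (simp add: dist_norm norm_minus_commute)
      show "a \<in> cball a (norm (b - a))" by simp
    qed
    then show ?thesis by (simp add: inner_diff_left power2_eq_square algebra_simps)
  qed
  have "(conv u \<rho> has_derivative (\<lambda>h. h \<bullet> ?G)) (at x)"
  proof (rule has_derivativeI_sandwich[of 1])
    show "bounded_linear (\<lambda>h. h \<bullet> ?G)" by (rule bounded_linear_inner_left)
    show "((\<lambda>y. L * A * norm (y - x)) \<longlongrightarrow> 0) (at x)"
      by (rule tendsto_eq_intros refl | simp)+
    fix w assume w: "w \<noteq> x" "dist w x < 1"
    define q where "q y = \<rho> (w - y) - \<rho> (x - y) - (w - x) \<bullet> grad \<rho> (x - y)" for y
    note I = conv_integrable[OF u \<rho>, of w] conv_integrable[OF u \<rho>, of x]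
    have Ig: "integrable lebesgue (\<lambda>y. (w - x) \<bullet> (u y *\<^sub>R grad \<rho> (x - y)))"
      by (rule integrable_inner_right) (rule conv_integrable_grad[OF u \<rho>])
    have q_int: "integrable lebesgue (\<lambda>y. u y * q y)"
      using Bochner_Integration.integrable_diff[OF Bochner_Integration.integrable_diff[OF I] Ig]
      by (simp add: q_def algebra_simps)
    have "conv u \<rho> w - conv u \<rho> x - (w - x) \<bullet> ?G = (LINT y|lebesgue. u y * q y)"
    proof -
      have "(w - x) \<bullet> ?G = (LINT y|lebesgue. (w - x) \<bullet> (u y *\<^sub>R grad \<rho> (x - y)))"
        by (rule integral_inner_right[symmetric]) (rule conv_integrable_grad[OF u \<rho>])
      then show ?thesis
        unfolding conv_def using I Ig
        by (simp flip: Bochner_Integration.integral_diff add: q_def algebra_simps)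
    qed
    also have "norm \<dots> \<le> (LINT y|lebesgue. norm (u y * q y))" by (rule integral_norm_bound)
    also have "\<dots> \<le> (LINT y|lebesgue. L * (norm (w - x))\<^sup>2 * (indicator (cball x (R + 1)) y * \<bar>u y\<bar>))"
    proof (rule integral_mono)
      fix y
      have "q y = 0" if "y \<notin> cball x (R + 1)"
      proof -
        have "norm (x - y) > R + 1" using that by (simp add: dist_norm)
        moreover have "norm (x - y) \<le> norm (w - y) + norm (w - x)"
          using norm_triangle_ineq4[of "w - y" "w - x"] by simp
        ultimately have "norm (w - y) > R" "norm (x - y) > R" using w(2) by (auto simp: dist_norm)
        then have "w - y \<notin> S" "x - y \<notin> S" using R(2) by force+
        then show ?thesis by (simp add: q_def S)
      qed
      moreover have "\<bar>q y\<bar> \<le> L * (norm (w - x))\<^sup>2" using taylor[of "w - y" "x - y"] by (simp add: q_def)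
      ultimately show "norm (u y * q y) \<le> L * (norm (w - x))\<^sup>2 * (indicator (cball x (R + 1)) y * \<bar>u y\<bar>)"
        by (cases "y \<in> cball x (R + 1)") (auto simp: abs_mult mult.commute[of "\<bar>u y\<bar>"] intro!: mult_right_mono)
    qed (use q_int A in auto)
    also have "\<dots> = L * A * norm (w - x) * norm (w - x)" by (simp add: A_def power2_eq_square)
    finally show "norm ((conv u \<rho> w - conv u \<rho> x) - (w - x) \<bullet> ?G) / norm (w - x) \<le> L * A * norm (w - x)"
      using w(1) by (subst pos_divide_le_eq) auto
  qed simp
  then show ?thesis by (simp add: gderiv_def)
qed

text \<open>The components of the gradient are convolutions with partial derivatives of the kernel,
  which are again test functions; hence the kernel is generalised in the induction.\<close>

lemma C_k_conv:
  fixes u :: "'a::euclidean_space \<Rightarrow> real"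
  assumes u: "u \<in> L1_loc UNIV" and \<rho>: "\<rho> \<in> test_functions UNIV"
  shows "C_k k (conv u \<rho>)"
  using \<rho>
proof (induction k arbitrary: \<rho>)
  case 0
  then show ?case using GDERIV_imp_isCont[OF conv_GDERIV_kernel[OF u]]
    by (auto intro: continuous_at_imp_continuous_on)
next
  case (Suc k)
  show ?case
  proof (rule C_k_SucI[OF conv_GDERIV_kernel[OF u Suc.prems]])
    fix b :: 'a
    have "conv u (\<lambda>x. grad \<rho> x \<bullet> b) x = (LINT y|lebesgue. u y *\<^sub>R grad \<rho> (x - y)) \<bullet> b" for x
      using integral_inner_left[OF conv_integrable_grad[OF u Suc.prems, of x], of b]
      by (simp add: conv_def mult.commute)
    with Suc.IH[OF test_functions_partial[OF Suc.prems, of b]]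
    show "C_k k (\<lambda>x. (LINT y|lebesgue. u y *\<^sub>R grad \<rho> (x - y)) \<bullet> b)" by simp
  qed
qed

text \<open>The function \<open>\<lambda>y. \<rho> (x - y)\<close> is itself a test function for the
  weak gradient, and the sign from reflecting it cancels the sign of integration by parts.\<close>

lemma conv_GDERIV:
  fixes u :: "'a::euclidean_space \<Rightarrow> real"
  assumes u: "weak_gradient UNIV u h" and \<rho>: "\<rho> \<in> test_functions UNIV"
  shows "GDERIV (conv u \<rho>) x :> conv h \<rho> x"
proof -
  have u': "u \<in> L1_loc UNIV" using u by (simp add: weak_gradient_def)
  have "(LINT y|lebesgue. u y *\<^sub>R grad (\<lambda>y. \<rho> (x - y)) y) = - (LINT y|lebesgue. \<rho> (x - y) *\<^sub>R h y)"
    using u test_functions_reflect(1)[OF \<rho>, of x] by (simp add: weak_gradient_def lebesgue_on_UNIV_eq)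
  then have "(LINT y|lebesgue. u y *\<^sub>R grad \<rho> (x - y)) = conv h \<rho> x"
    unfolding test_functions_reflect(2)[OF \<rho>] conv_def by simp
  then show ?thesis using conv_GDERIV_kernel[OF u' \<rho>, of x] by simp
qed

lemma continuous_on_conv:
  fixes h :: "'a::euclidean_space \<Rightarrow> 'b::euclidean_space"
  assumes h: "h \<in> L1_loc UNIV" and \<rho>: "\<rho> \<in> test_functions UNIV"
  shows "continuous_on UNIV (conv h \<rho>)"
proof (subst continuous_on_componentwise, rule ballI)
  fix b :: 'b
  have "conv h \<rho> x \<bullet> b = conv (\<lambda>y. h y \<bullet> b) \<rho> x" for x
    using integral_inner_left[OF conv_integrable[OF h \<rho>, of x], of b] by (simp add: conv_def)
  then show "continuous_on UNIV (\<lambda>x. conv h \<rho> x \<bullet> b)"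
    using C_k_conv[OF L1_loc_inner[OF h, of b] \<rho>, of 0] by simp
qed

text \<open>Young's inequality: split \<open>\<bar>\<rho>\<bar>\<close> into two square roots, apply
  Cauchy-Schwarz in \<open>y\<close> and exchange the integrals. The mass \<open>N\<close> of the
  kernel enters once from each of the last two steps.\<close>

lemma conv_L2:
  fixes h :: "'a::euclidean_space \<Rightarrow> 'b::euclidean_space"
  assumes h: "h \<in> L2 UNIV" and \<rho>: "\<rho> \<in> test_functions UNIV"
  shows "conv h \<rho> \<in> L2 UNIV"
proof -
  have h': "h \<in> L1_loc UNIV" by (rule L2_imp_L1_loc) (use h in auto)
  note [measurable] = test_functions_measurable(1)[OF \<rho>]
  obtain g where [measurable]: "g \<in> borel_measurable borel" and g: "AE x in lebesgue. h x = g x"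
    using borel_version h by (auto simp: L2_UNIV_iff)
  define N where "N = (\<integral>\<^sup>+x. ennreal \<bar>\<rho> x\<bar> \<partial>lborel)"
  have N: "N < \<infinity>"
  proof -
    obtain S where S: "compact S" "\<And>x. x \<notin> S \<Longrightarrow> \<rho> x = 0"
      using test_functions_support[OF \<rho>] by metis
    have "integrable lborel \<rho>" by (rule compact_support_integrable(1)[OF test_functionsD(2)[OF \<rho>] S])
    then show ?thesis by (simp add: integrable_iff_bounded N_def)
  qed
  have N1: "(\<integral>\<^sup>+y. ennreal \<bar>\<rho> (x - y)\<bar> \<partial>lborel) = N" for x
    using nn_integral_isometry[of "\<lambda>y. ennreal \<bar>\<rho> y\<bar>" "-1" x] by (simp add: N_def)
  have N2: "(\<integral>\<^sup>+x. ennreal \<bar>\<rho> (x - y)\<bar> \<partial>lborel) = N" for y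
    using nn_integral_isometry[of "\<lambda>y. ennreal \<bar>\<rho> y\<bar>" "1" "-y"] by (simp add: N_def)
  have point: "ennreal ((norm (conv h \<rho> x))\<^sup>2) \<le> (\<integral>\<^sup>+y. ennreal (\<bar>\<rho> (x - y)\<bar> * (norm (g y))\<^sup>2) \<partial>lborel) * N" for x
  proof -
    have "ennreal (norm (conv h \<rho> x)) \<le> (\<integral>\<^sup>+y. ennreal (norm (\<rho> (x - y) *\<^sub>R h y)) \<partial>lebesgue)"
      unfolding conv_def by (rule integral_norm_bound_ennreal[OF conv_integrable[OF h' \<rho>]])
    also have "\<dots> = (\<integral>\<^sup>+y. ennreal (norm (\<rho> (x - y) *\<^sub>R g y)) \<partial>lebesgue)"
      by (rule nn_integral_cong_AE) (use g in eventually_elim, simp)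
    also have "\<dots> = (\<integral>\<^sup>+y. ennreal (sqrt \<bar>\<rho> (x - y)\<bar> * norm (g y)) * ennreal (sqrt \<bar>\<rho> (x - y)\<bar>) \<partial>lborel)"
      unfolding nn_integral_completion
      by (intro nn_integral_cong) (simp add: ennreal_mult[symmetric] mult.commute mult.left_commute)
    finally have "(ennreal (norm (conv h \<rho> x)))\<^sup>2 \<le>
        (\<integral>\<^sup>+y. ennreal (sqrt \<bar>\<rho> (x - y)\<bar> * norm (g y)) * ennreal (sqrt \<bar>\<rho> (x - y)\<bar>) \<partial>lborel)\<^sup>2"
      by (intro power_mono) auto
    also have "\<dots> \<le> (\<integral>\<^sup>+y. (ennreal (sqrt \<bar>\<rho> (x - y)\<bar> * norm (g y)))\<^sup>2 \<partial>lborel) *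
        (\<integral>\<^sup>+y. (ennreal (sqrt \<bar>\<rho> (x - y)\<bar>))\<^sup>2 \<partial>lborel)"
      by (rule Cauchy_Schwarz_nn_integral) measurable
    finally show ?thesis by (simp add: ennreal_power power_mult_distrib N1)
  qed
  have "(\<integral>\<^sup>+x. ennreal ((norm (conv h \<rho> x))\<^sup>2) \<partial>lebesgue) = (\<integral>\<^sup>+x. ennreal ((norm (conv h \<rho> x))\<^sup>2) \<partial>lborel)"
    by (rule nn_integral_completion)
  also have "\<dots> \<le> (\<integral>\<^sup>+x. (\<integral>\<^sup>+y. ennreal (\<bar>\<rho> (x - y)\<bar> * (norm (g y))\<^sup>2) \<partial>lborel) * N \<partial>lborel)"
    by (intro nn_integral_mono point)
  also have "\<dots> = (\<integral>\<^sup>+x. (\<integral>\<^sup>+y. ennreal (\<bar>\<rho> (x - y)\<bar> * (norm (g y))\<^sup>2) \<partial>lborel) \<partial>lborel) * N"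
    by (rule nn_integral_multc) measurable
  also have "(\<integral>\<^sup>+x. (\<integral>\<^sup>+y. ennreal (\<bar>\<rho> (x - y)\<bar> * (norm (g y))\<^sup>2) \<partial>lborel) \<partial>lborel)
      = (\<integral>\<^sup>+y. (\<integral>\<^sup>+x. ennreal (\<bar>\<rho> (x - y)\<bar> * (norm (g y))\<^sup>2) \<partial>lborel) \<partial>lborel)"
    by (rule lborel_pair.Fubini'[symmetric]) measurable
  also have "\<dots> = (\<integral>\<^sup>+y. N * ennreal ((norm (g y))\<^sup>2) \<partial>lborel)"
    by (intro nn_integral_cong) (simp add: ennreal_mult nn_integral_multc N2)
  also have "\<dots> = N * (\<integral>\<^sup>+y. ennreal ((norm (g y))\<^sup>2) \<partial>lborel)"
    by (rule nn_integral_cmult) measurable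
  also have "(\<integral>\<^sup>+y. ennreal ((norm (g y))\<^sup>2) \<partial>lborel) = (\<integral>\<^sup>+y. ennreal ((norm (h y))\<^sup>2) \<partial>lebesgue)"
  proof -
    have "(\<integral>\<^sup>+y. ennreal ((norm (g y))\<^sup>2) \<partial>lebesgue) = (\<integral>\<^sup>+y. ennreal ((norm (h y))\<^sup>2) \<partial>lebesgue)"
      by (rule nn_integral_cong_AE) (use g in eventually_elim, simp)
    then show ?thesis by (simp only: nn_integral_completion)
  qed
  also have "N * \<dots> * N < \<infinity>"
    using N h by (simp add: L2_UNIV_nn_integral_iff ennreal_mult_less_top)
  finally show ?thesis
    unfolding L2_UNIV_nn_integral_iff
    by (simp add: continuous_on_imp_lebesgue_measurable continuous_on_conv h' \<rho>)
qed

section \<open>Gradient fields as a closed subspace\<close>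

lemma L2_AE_cong:
  fixes f g :: "'a::euclidean_space \<Rightarrow> 'b::euclidean_space"
  assumes "f \<in> L2 UNIV" "AE x in lebesgue. f x = g x"
  shows "g \<in> L2 UNIV"
proof -
  have m: "f \<in> borel_measurable lebesgue" "integrable lebesgue (\<lambda>x. (norm (f x))\<^sup>2)"
    using assms(1) by (auto simp: L2_UNIV_iff)
  then have m': "g \<in> borel_measurable lebesgue" using borel_measurable_AE assms(2) by blast
  have "integrable lebesgue (\<lambda>x. (norm (g x))\<^sup>2)"
    by (rule integrable_cong_AE_imp[OF m(2)]) (use m' assms(2) in auto)
  with m' show ?thesis by (simp add: L2_UNIV_iff)
qed

lemma cl_cong: "f \<in> L2 UNIV \<Longrightarrow> AE x in lebesgue. f x = g x \<Longrightarrow> cl f = cl g"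
  using L2_AE_cong cl_eq_iff by blast

lemma L2_indicator:
  fixes f :: "'a::euclidean_space \<Rightarrow> 'b::euclidean_space"
  assumes "f \<in> L2 UNIV" "S \<in> sets lebesgue"
  shows "(\<lambda>x. indicator S x *\<^sub>R f x) \<in> L2 UNIV"
proof (rule L2_bound[OF assms(1), of _ 1])
  show "(\<lambda>x. indicator S x *\<^sub>R f x) \<in> borel_measurable lebesgue"
    using assms by (intro borel_measurable_scaleR borel_measurable_indicator) (auto simp: L2_UNIV_iff)
qed (simp add: indicator_def)

lemma compact_support_L2:
  fixes f :: "'a::euclidean_space \<Rightarrow> 'b::euclidean_space"
  assumes "continuous_on UNIV f" "compact S" "\<And>x. x \<notin> S \<Longrightarrow> f x = 0"
  shows "f \<in> L2 UNIV"
proof -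
  have "integrable lebesgue (\<lambda>x. (norm (f x))\<^sup>2)"
    by (rule compact_support_integrable(2)[OF _ assms(2)])
       (use assms(1,3) in \<open>auto intro!: continuous_intros\<close>)
  then show ?thesis
    using continuous_on_imp_lebesgue_measurable[OF assms(1)] by (simp add: L2_UNIV_iff)
qed

lemma test_functions_L2:
  assumes "\<phi> \<in> test_functions D"
  shows "\<phi> \<in> L2 UNIV" "grad \<phi> \<in> L2 UNIV"
proof -
  obtain S where "compact S" "\<And>x. x \<notin> S \<Longrightarrow> \<phi> x = 0" "\<And>x. x \<notin> S \<Longrightarrow> grad \<phi> x = 0"
    using test_functions_support[OF assms] by metis
  then show "\<phi> \<in> L2 UNIV" "grad \<phi> \<in> L2 UNIV"
    using compact_support_L2 test_functionsD(2,4)[OF assms] by blast+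
qed

text \<open>For bounded \<open>D\<close> these are the gradients of \<open>H10 D\<close>. For
  \<open>UNIV\<close> potentials need not be square integrable, and the space turns out to consist
  of exactly the gradients of \<open>BL\<close>.\<close>

definition gradspace :: "'a::euclidean_space set \<Rightarrow> ('a, 'a) ell2 set" where
  "gradspace D = closure ((\<lambda>\<phi>. cl (grad \<phi>)) ` test_functions D)"

lemma cl_grad_lincomb:
  assumes "\<phi> \<in> test_functions D" "\<psi> \<in> test_functions D"
  shows "(\<lambda>x. a * \<phi> x + b * \<psi> x) \<in> test_functions D"
    "cl (grad (\<lambda>x. a * \<phi> x + b * \<psi> x)) = a *\<^sub>R cl (grad \<phi>) + b *\<^sub>R cl (grad \<psi>)"
proof -
  note c = test_functions_cmult[OF assms(1), of a] test_functions_cmult[OF assms(2), of b]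
  show "(\<lambda>x. a * \<phi> x + b * \<psi> x) \<in> test_functions D" by (intro test_functions_add c)
  have "grad (\<lambda>x. a * \<phi> x + b * \<psi> x) = (\<lambda>x. a *\<^sub>R grad \<phi> x + b *\<^sub>R grad \<psi> x)"
    using grad_add[OF c] grad_cmult[OF assms(1)] grad_cmult[OF assms(2)] by auto
  then show "cl (grad (\<lambda>x. a * \<phi> x + b * \<psi> x)) = a *\<^sub>R cl (grad \<phi>) + b *\<^sub>R cl (grad \<psi>)"
    using test_functions_L2[OF assms(1)] test_functions_L2[OF assms(2)]
    by (simp add: cl_scaleR cl_add L2_scaleR)
qed

lemma subspace_closure_normed:
  fixes S :: "'h::real_normed_vector set"
  assumes "subspace S"
  shows "subspace (closure S)"
proof (rule subspaceI)
  show "0 \<in> closure S" using subspace_0[OF assms] closure_subset by auto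
  show "x + y \<in> closure S" if "x \<in> closure S" "y \<in> closure S" for x y
  proof -
    from that obtain X Y where "\<And>n. X n \<in> S" "X \<longlonglongrightarrow> x" "\<And>n. Y n \<in> S" "Y \<longlonglongrightarrow> y"
      unfolding closure_sequential by blast
    then show ?thesis unfolding closure_sequential
      by (intro exI[of _ "\<lambda>n. X n + Y n"]) (auto intro: tendsto_add subspace_add[OF assms])
  qed
  show "c *\<^sub>R x \<in> closure S" if "x \<in> closure S" for c x
  proof -
    from that obtain X where "\<And>n. X n \<in> S" "X \<longlonglongrightarrow> x"
      unfolding closure_sequential by blast
    then show ?thesis unfolding closure_sequential
      by (intro exI[of _ "\<lambda>n. c *\<^sub>R X n"]) (auto intro!: tendsto_intros subspace_scale[OF assms])
  qed
qed

lemma subspace_gradspace: "subspace (gradspace D)"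
  unfolding gradspace_def
proof (intro subspace_closure_normed subspaceI)
  let ?S = "(\<lambda>\<phi>. cl (grad \<phi>)) ` test_functions D"
  have lin: "a *\<^sub>R x + b *\<^sub>R y \<in> ?S" if "x \<in> ?S" "y \<in> ?S" for a b x y
  proof -
    obtain \<phi> \<psi> where "\<phi> \<in> test_functions D" "x = cl (grad \<phi>)" "\<psi> \<in> test_functions D" "y = cl (grad \<psi>)"
      using \<open>x \<in> ?S\<close> \<open>y \<in> ?S\<close> by auto
    then show ?thesis
      using cl_grad_lincomb[of \<phi> D \<psi> a b] by (intro image_eqI[of _ _ "\<lambda>x. a * \<phi> x + b * \<psi> x"]) auto
  qed
  obtain x where "x \<in> ?S" using test_functions_zero by blast
  then show "0 \<in> ?S" using lin[of x x 0 0] by simp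
  show "x + y \<in> ?S" if "x \<in> ?S" "y \<in> ?S" for x y using lin[OF that, of 1 1] by simp
  show "c *\<^sub>R x \<in> ?S" if "x \<in> ?S" for c x using lin[OF that that, of c 0] by simp
qed

lemma closed_gradspace: "closed (gradspace D)"
  by (simp add: gradspace_def)

lemma cl_grad_in_gradspace: "\<phi> \<in> test_functions D \<Longrightarrow> cl (grad \<phi>) \<in> gradspace D"
  unfolding gradspace_def by (rule subsetD[OF closure_subset]) (rule imageI)

text \<open>The rate is the one that \<open>L2_Cauchy_limit\<close> consumes. Increments are
  measured with \<open>lborel\<close>, as in the Poincare estimates, and the distance to
  \<open>F\<close> with \<open>lebesgue\<close>, with respect to which \<open>rep F\<close> is
  measurable.\<close>

lemma gradspace_fast_sequence:
  assumes "F \<in> gradspace D"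
  obtains \<phi> where "\<And>n::nat. \<phi> n \<in> test_functions D"
    "\<And>n m. n \<le> m \<Longrightarrow> (\<integral>\<^sup>+x. ennreal ((norm (grad (\<lambda>x. \<phi> m x - \<phi> n x) x))\<^sup>2) \<partial>lborel) \<le> ennreal (1 / 4 ^ n)"
    "\<And>n. (\<integral>\<^sup>+x. ennreal ((norm (grad (\<phi> n) x - rep F x))\<^sup>2) \<partial>lebesgue) \<le> ennreal (1 / 4 ^ n)"
proof -
  obtain X where X: "\<And>n. X n \<in> (\<lambda>\<phi>. cl (grad \<phi>)) ` test_functions D" "X \<longlonglongrightarrow> F"
    using assms unfolding gradspace_def closure_sequential by blast
  obtain r where r: "strict_mono r" "\<And>n m. n \<le> m \<Longrightarrow> dist (X (r m)) (X (r n)) \<le> 1 / 2 ^ n"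
    using Cauchy_fast_subsequence[OF LIMSEQ_imp_Cauchy[OF X(2)]] by metis
  have "\<exists>\<psi>. \<psi> \<in> test_functions D \<and> X (r n) = cl (grad \<psi>)" for n
    using X(1)[of "r n"] by (simp only: image_iff Bex_def)
  then obtain \<phi> where \<phi>: "\<And>n. \<phi> n \<in> test_functions D" "\<And>n. X (r n) = cl (grad (\<phi> n))"
    using choice[of "\<lambda>n \<psi>. \<psi> \<in> test_functions D \<and> X (r n) = cl (grad \<psi>)"] by blast
  have four: "a\<^sup>2 \<le> 1 / 4 ^ n" if "0 \<le> a" "a \<le> 1 / 2 ^ n" for a :: real and n
  proof -
    have "a\<^sup>2 \<le> (1 / 2 ^ n)\<^sup>2" using that by (intro power_mono)
    also have "((1::real) / 2 ^ n)\<^sup>2 = 1 / 4 ^ n"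
      by (simp add: power_divide power2_eq_square flip: power_mult_distrib)
    finally show ?thesis .
  qed
  have 1: "(\<integral>\<^sup>+x. ennreal ((norm (grad (\<lambda>x. \<phi> m x - \<phi> n x) x))\<^sup>2) \<partial>lborel) \<le> ennreal (1 / 4 ^ n)"
    if nm: "n \<le> m" for n m
  proof -
    have t: "(\<lambda>x. \<phi> m x - \<phi> n x) \<in> test_functions D"
      "cl (grad (\<lambda>x. \<phi> m x - \<phi> n x)) = X (r m) - X (r n)"
      using cl_grad_lincomb[OF \<phi>(1)[of m] \<phi>(1)[of n], of 1 "-1"] \<phi>(2) by simp_all
    have "(\<integral>\<^sup>+x. ennreal ((norm (grad (\<lambda>x. \<phi> m x - \<phi> n x) x))\<^sup>2) \<partial>lebesgue) = ennreal ((norm (X (r m) - X (r n)))\<^sup>2)"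
      using nn_integral_norm_cl[OF test_functions_L2(2)[OF t(1)]] t(2) by simp
    also have "\<dots> \<le> ennreal (1 / 4 ^ n)"
      using r(2)[OF nm] by (intro ennreal_leI four) (auto simp: dist_norm)
    finally show ?thesis by (simp only: nn_integral_completion)
  qed
  have 2: "(\<integral>\<^sup>+x. ennreal ((norm (grad (\<phi> n) x - rep F x))\<^sup>2) \<partial>lebesgue) \<le> ennreal (1 / 4 ^ n)" for n
  proof -
    have "(\<lambda>m. dist (X (r m)) (X (r n))) \<longlonglongrightarrow> dist F (X (r n))"
      using LIMSEQ_subseq_LIMSEQ[OF X(2) r(1)] by (intro tendsto_intros) (simp add: o_def)
    then have "dist F (X (r n)) \<le> 1 / 2 ^ n"
      by (rule Lim_bounded[of _ _ n]) (use r(2) in auto)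
    then have "(norm (cl (grad (\<phi> n)) - cl (rep F)))\<^sup>2 \<le> 1 / 4 ^ n"
      using \<phi>(2)[of n] by (intro four) (auto simp: dist_norm norm_minus_commute cl_rep)
    then show ?thesis
      using nn_integral_norm_cl[OF L2_diff[OF test_functions_L2(2)[OF \<phi>(1)[of n]] rep_L2[of F]]]
      by (simp add: cl_diff[OF test_functions_L2(2)[OF \<phi>(1)[of n]] rep_L2[of F]] ennreal_leI)
  qed
  show ?thesis by (rule that[OF \<phi>(1) 1 2])
qed

text \<open>Cauchy-Schwarz on a compact set, in the form that pairs a local L2 error
  \<open>w\<close> with a bounded function supported in \<open>S\<close>.\<close>

lemma integral_product_bound:
  fixes w :: "'a::euclidean_space \<Rightarrow> 'b::euclidean_space" and p :: "'a \<Rightarrow> 'c::euclidean_space"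
  assumes S: "compact S" and w: "w \<in> borel_measurable lebesgue" and p: "integrable lebesgue p"
    and pw: "\<And>x. norm (p x) \<le> M * (indicator S x * norm (w x))" and M: "M \<ge> 0"
    and A: "(\<integral>\<^sup>+x. ennreal ((norm (w x))\<^sup>2) * indicator S x \<partial>lebesgue) \<le> ennreal A" "A \<ge> 0"
  shows "norm (LINT x|lebesgue. p x) \<le> M * sqrt (A * measure lebesgue S)"
proof -
  have S': "S \<in> lmeasurable" using S by (rule lmeasurable_compact)
  then have S'': "S \<in> sets lebesgue" by blast
  have "ennreal (norm (LINT x|lebesgue. p x)) \<le> (\<integral>\<^sup>+x. ennreal (norm (p x)) \<partial>lebesgue)"
    by (rule integral_norm_bound_ennreal[OF p])
  also have "\<dots> \<le> (\<integral>\<^sup>+x. ennreal M * ((ennreal (norm (w x)) * indicator S x) * indicator S x) \<partial>lebesgue)"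
  proof (rule nn_integral_mono)
    fix x
    show "ennreal (norm (p x)) \<le> ennreal M * ((ennreal (norm (w x)) * indicator S x) * indicator S x)"
      using pw[of x] M by (cases "x \<in> S") (auto simp: ennreal_mult[symmetric] intro: ennreal_leI)
  qed
  also have "\<dots> = ennreal M * (\<integral>\<^sup>+x. (ennreal (norm (w x)) * indicator S x) * indicator S x \<partial>lebesgue)"
    using w S'' by (intro nn_integral_cmult borel_measurable_times_ennreal borel_measurable_indicator) auto
  finally have "(ennreal (norm (LINT x|lebesgue. p x)))\<^sup>2
      \<le> (ennreal M * (\<integral>\<^sup>+x. (ennreal (norm (w x)) * indicator S x) * indicator S x \<partial>lebesgue))\<^sup>2"
    by (intro power_mono) auto
  also have "\<dots> = (ennreal M)\<^sup>2 * (\<integral>\<^sup>+x. (ennreal (norm (w x)) * indicator S x) * indicator S x \<partial>lebesgue)\<^sup>2"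
    by (rule power_mult_distrib)
  also have "\<dots> \<le> (ennreal M)\<^sup>2 * ((\<integral>\<^sup>+x. (ennreal (norm (w x)) * indicator S x)\<^sup>2 \<partial>lebesgue) * (\<integral>\<^sup>+x. (indicator S x)\<^sup>2 \<partial>lebesgue))"
    using w S'' by (intro mult_left_mono Cauchy_Schwarz_nn_integral borel_measurable_times_ennreal borel_measurable_indicator) auto
  also have "(\<integral>\<^sup>+x. (ennreal (norm (w x)) * indicator S x)\<^sup>2 \<partial>lebesgue) = (\<integral>\<^sup>+x. ennreal ((norm (w x))\<^sup>2) * indicator S x \<partial>lebesgue)"
    by (intro nn_integral_cong) (auto simp: indicator_def ennreal_power)
  also have "(\<lambda>x. (indicator S x)\<^sup>2) = (indicator S :: 'a \<Rightarrow> ennreal)" by (auto simp: indicator_def)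
  also have "(\<integral>\<^sup>+x. indicator S x \<partial>lebesgue) = ennreal (measure lebesgue S)"
    using S' by (simp add: emeasure_eq_measure2 fmeasurableD)
  also have "(ennreal M)\<^sup>2 * ((\<integral>\<^sup>+x. ennreal ((norm (w x))\<^sup>2) * indicator S x \<partial>lebesgue) * ennreal (measure lebesgue S))
      \<le> (ennreal M)\<^sup>2 * (ennreal A * ennreal (measure lebesgue S))"
    by (intro mult_left_mono mult_right_mono A) auto
  also have "\<dots> = ennreal (M\<^sup>2 * (A * measure lebesgue S))"
    using M A(2) by (simp add: ennreal_power ennreal_mult)
  finally have "(norm (LINT x|lebesgue. p x))\<^sup>2 \<le> M\<^sup>2 * (A * measure lebesgue S)"
    using A(2) by (simp add: ennreal_power)
  also have "\<dots> = (M * sqrt (A * measure lebesgue S))\<^sup>2"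
    using A(2) by (simp add: power_mult_distrib)
  finally show ?thesis by (rule power2_le_imp_le) (use M A(2) in auto)
qed

lemma geometric_tendsto:
  fixes v :: "nat \<Rightarrow> 'b::real_normed_vector"
  assumes "\<And>n. norm (v n - l) \<le> M * sqrt (A / 4 ^ n * B)"
  shows "v \<longlonglongrightarrow> l"
proof -
  have "(\<lambda>n. M * sqrt (A * (1 / 4) ^ n * B)) \<longlonglongrightarrow> M * sqrt (A * 0 * B)"
    by (intro tendsto_intros LIMSEQ_realpow_zero) auto
  then have "(\<lambda>n. M * sqrt (A / 4 ^ n * B)) \<longlonglongrightarrow> 0" by (simp add: power_one_over)
  then have "(\<lambda>n. v n - l) \<longlonglongrightarrow> 0" by (rule Lim_null_comparison[OF always_eventually, rotated]) (use assms in simp)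
  then show ?thesis by (rule LIM_zero_cancel)
qed

text \<open>Both sides of the defining identity see only the compact support of the test function,
  so local L2 convergence of functions and gradients is enough to pass to the limit.\<close>

lemma weak_gradient_limit:
  fixes u :: "nat \<Rightarrow> 'a::euclidean_space \<Rightarrow> real"
  assumes wg: "\<And>n. weak_gradient UNIV (u n) (g n)"
    and meas: "\<And>n. u n \<in> borel_measurable lebesgue" "\<And>n. g n \<in> borel_measurable lebesgue"
      "v \<in> borel_measurable lebesgue" "h \<in> borel_measurable lebesgue"
    and loc: "v \<in> L1_loc UNIV" "h \<in> L1_loc UNIV"
    and conv: "\<And>C. compact C \<Longrightarrow> \<exists>A\<ge>0. \<forall>n. (\<integral>\<^sup>+x. ennreal ((u n x - v x)\<^sup>2) * indicator C x \<partial>lebesgue) \<le> ennreal (A / 4 ^ n)"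
      "\<And>C. compact C \<Longrightarrow> \<exists>A\<ge>0. \<forall>n. (\<integral>\<^sup>+x. ennreal ((norm (g n x - h x))\<^sup>2) * indicator C x \<partial>lebesgue) \<le> ennreal (A / 4 ^ n)"
  shows "weak_gradient UNIV v h"
proof -
  have "(LINT x|lebesgue. v x *\<^sub>R grad \<phi> x) = - (LINT x|lebesgue. \<phi> x *\<^sub>R h x)"
    if \<phi>: "\<phi> \<in> test_functions UNIV" for \<phi>
  proof -
    obtain S where S: "compact S" "\<And>x. x \<notin> S \<Longrightarrow> \<phi> x = 0" "\<And>x. x \<notin> S \<Longrightarrow> grad \<phi> x = 0"
      using test_functions_support[OF \<phi>] by metis
    obtain M where M: "M > 0" "\<And>x. norm (\<phi> x) \<le> M" "\<And>x. norm (grad \<phi> x) \<le> M"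
      using test_functions_bounds[OF \<phi>] by metis
    have loc': "u n \<in> L1_loc UNIV" "g n \<in> L1_loc UNIV" for n using wg by (auto simp: weak_gradient_def)
    have sU: "(UNIV :: 'a set) \<in> sets lebesgue" by simp
    note I = integrable_scaleR_grad_test(2)[OF sU _ \<phi>] integrable_test_scaleR(2)[OF sU _ \<phi>]
    have 1: "(\<lambda>n. LINT x|lebesgue. u n x *\<^sub>R grad \<phi> x) \<longlonglongrightarrow> (LINT x|lebesgue. v x *\<^sub>R grad \<phi> x)"
    proof -
      obtain A where A: "A \<ge> 0" "\<And>n. (\<integral>\<^sup>+x. ennreal ((u n x - v x)\<^sup>2) * indicator S x \<partial>lebesgue) \<le> ennreal (A / 4 ^ n)"
        using conv(1)[OF S(1)] by metis
      show ?thesis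
      proof (rule geometric_tendsto)
        fix n
        have "norm (LINT x|lebesgue. u n x *\<^sub>R grad \<phi> x - v x *\<^sub>R grad \<phi> x)
            \<le> M * sqrt (A / 4 ^ n * measure lebesgue S)"
        proof (rule integral_product_bound[where w="\<lambda>x. u n x - v x", OF S(1)])
          show "integrable lebesgue (\<lambda>x. u n x *\<^sub>R grad \<phi> x - v x *\<^sub>R grad \<phi> x)"
            by (intro Bochner_Integration.integrable_diff I loc loc')
          show "norm (u n x *\<^sub>R grad \<phi> x - v x *\<^sub>R grad \<phi> x) \<le> M * (indicator S x * norm (u n x - v x))" for x
            using M(3)[of x] S(3)[of x]
            by (cases "x \<in> S") (auto simp: mult_left_mono mult.commute[of M] simp flip: scaleR_diff_left)
          show "(\<integral>\<^sup>+x. ennreal ((norm (u n x - v x))\<^sup>2) * indicator S x \<partial>lebesgue) \<le> ennreal (A / 4 ^ n)"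
            using A(2) by simp
        qed (use meas M A in auto)
        then show "norm ((LINT x|lebesgue. u n x *\<^sub>R grad \<phi> x) - (LINT x|lebesgue. v x *\<^sub>R grad \<phi> x))
            \<le> M * sqrt (A / 4 ^ n * measure lebesgue S)"
          by (simp add: Bochner_Integration.integral_diff[OF I(1)[OF loc'(1)] I(1)[OF loc(1)]])
      qed
    qed
    have 2: "(\<lambda>n. LINT x|lebesgue. \<phi> x *\<^sub>R g n x) \<longlonglongrightarrow> (LINT x|lebesgue. \<phi> x *\<^sub>R h x)"
    proof -
      obtain A where A: "A \<ge> 0" "\<And>n. (\<integral>\<^sup>+x. ennreal ((norm (g n x - h x))\<^sup>2) * indicator S x \<partial>lebesgue) \<le> ennreal (A / 4 ^ n)"
        using conv(2)[OF S(1)] by metis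
      show ?thesis
      proof (rule geometric_tendsto)
        fix n
        have "norm (LINT x|lebesgue. \<phi> x *\<^sub>R g n x - \<phi> x *\<^sub>R h x)
            \<le> M * sqrt (A / 4 ^ n * measure lebesgue S)"
        proof (rule integral_product_bound[where w="\<lambda>x. g n x - h x", OF S(1)])
          show "integrable lebesgue (\<lambda>x. \<phi> x *\<^sub>R g n x - \<phi> x *\<^sub>R h x)"
            by (intro Bochner_Integration.integrable_diff I loc loc')
          show "norm (\<phi> x *\<^sub>R g n x - \<phi> x *\<^sub>R h x) \<le> M * (indicator S x * norm (g n x - h x))" for x
            using M(2)[of x] S(2)[of x]
            by (cases "x \<in> S") (auto simp: mult_right_mono simp flip: scaleR_diff_right)
          show "(\<integral>\<^sup>+x. ennreal ((norm (g n x - h x))\<^sup>2) * indicator S x \<partial>lebesgue) \<le> ennreal (A / 4 ^ n)"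
            using A(2) by simp
        qed (use meas M A in auto)
        then show "norm ((LINT x|lebesgue. \<phi> x *\<^sub>R g n x) - (LINT x|lebesgue. \<phi> x *\<^sub>R h x))
            \<le> M * sqrt (A / 4 ^ n * measure lebesgue S)"
          by (simp add: Bochner_Integration.integral_diff[OF I(2)[OF loc'(2)] I(2)[OF loc(2)]])
      qed
    qed
    have "(\<lambda>n. - (LINT x|lebesgue. \<phi> x *\<^sub>R g n x)) \<longlonglongrightarrow> - (LINT x|lebesgue. \<phi> x *\<^sub>R h x)"
      by (intro tendsto_minus 2)
    moreover have "- (LINT x|lebesgue. \<phi> x *\<^sub>R g n x) = (LINT x|lebesgue. u n x *\<^sub>R grad \<phi> x)" for n
      using wg[of n] \<phi> by (simp add: weak_gradient_def lebesgue_on_UNIV_eq)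
    ultimately show ?thesis using 1 LIMSEQ_unique by simp
  qed
  then show ?thesis using loc by (auto simp: weak_gradient_def lebesgue_on_UNIV_eq)
qed

lemma gradspace_fast_sequence_conv:
  assumes "\<And>n. (\<integral>\<^sup>+x. ennreal ((norm (grad (\<phi> n) x - rep F x))\<^sup>2) \<partial>lebesgue) \<le> ennreal (1 / 4 ^ n)"
  shows "\<exists>A\<ge>0. \<forall>n. (\<integral>\<^sup>+x. ennreal ((norm (grad (\<phi> n) x - rep F x))\<^sup>2) * indicator C x \<partial>lebesgue) \<le> ennreal (A / 4 ^ n)"
proof (intro exI[of _ 1] conjI allI)
  fix n
  have "(\<integral>\<^sup>+x. ennreal ((norm (grad (\<phi> n) x - rep F x))\<^sup>2) * indicator C x \<partial>lebesgue)
      \<le> (\<integral>\<^sup>+x. ennreal ((norm (grad (\<phi> n) x - rep F x))\<^sup>2) \<partial>lebesgue)"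
    by (intro nn_integral_mono) (auto simp: indicator_def)
  then show "(\<integral>\<^sup>+x. ennreal ((norm (grad (\<phi> n) x - rep F x))\<^sup>2) * indicator C x \<partial>lebesgue) \<le> ennreal (1 / 4 ^ n)"
    using assms[of n] by (rule order_trans)
qed simp

text \<open>On the whole space convergence of the gradients does not make the approximating test
  functions converge. After subtracting their means over the unit ball they are Cauchy in L2 of
  every ball, with a constant that depends on the ball but with one pointwise limit.\<close>

theorem gradspace_imp_weak_gradient:
  fixes F :: "('a::euclidean_space, 'a) ell2"
  assumes F: "F \<in> gradspace UNIV"
  obtains u where "u \<in> L2_loc UNIV" "weak_gradient UNIV u (rep F)"
proof -
  obtain \<phi> where \<phi>: "\<And>n::nat. \<phi> n \<in> test_functions UNIV"
    "\<And>n m. n \<le> m \<Longrightarrow> (\<integral>\<^sup>+x. ennreal ((norm (grad (\<lambda>x. \<phi> m x - \<phi> n x) x))\<^sup>2) \<partial>lborel) \<le> ennreal (1 / 4 ^ n)"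
    "\<And>n. (\<integral>\<^sup>+x. ennreal ((norm (grad (\<phi> n) x - rep F x))\<^sup>2) \<partial>lebesgue) \<le> ennreal (1 / 4 ^ n)"
    by (rule gradspace_fast_sequence[OF F]) (rule that, blast+)
  define \<psi> where "\<psi> n x = \<phi> n x - ball_mean (\<phi> n)" for n x
  define u where "u x = lim (\<lambda>n. \<psi> n x)" for x
  have \<psi>c: "continuous_on UNIV (\<psi> n)" for n
    unfolding \<psi>_def by (intro continuous_intros test_functionsD(2)[OF \<phi>(1)])
  have \<psi>g: "GDERIV (\<psi> n) x :> grad (\<phi> n) x" for n x
    unfolding \<psi>_def using GDERIV_diff[OF test_functionsD(3)[OF \<phi>(1)] GDERIV_const] by simp
  have \<psi>m[measurable]: "\<psi> n \<in> borel_measurable lebesgue" for n by (rule continuous_on_imp_lebesgue_measurable[OF \<psi>c])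
  have um[measurable]: "u \<in> borel_measurable lebesgue" unfolding u_def by measurable
  have ball: "\<exists>A\<ge>0. \<forall>n. (\<integral>\<^sup>+x. ennreal ((u x - \<psi> n x)\<^sup>2) * indicator (cball 0 (real N)) x \<partial>lebesgue) \<le> ennreal (A / 4 ^ n)" for N
  proof -
    obtain C where C: "C \<ge> 0" "\<And>\<psi> H. \<forall>x. GDERIV \<psi> x :> H x \<Longrightarrow> continuous_on UNIV H \<Longrightarrow>
       (\<integral>\<^sup>+y. ennreal ((\<psi> y - ball_mean \<psi>)\<^sup>2) * indicator (cball (0::'a) (real N)) y \<partial>lborel)
        \<le> ennreal C * (\<integral>\<^sup>+x. ennreal ((norm (H x))\<^sup>2) \<partial>lborel)"
      using Poincare_ball_mean[OF of_nat_0_le_iff[of N]] by blast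
    have bs: "cball (0::'a) (real N) \<in> sets lebesgue" by simp
    let ?M = "lebesgue_on (cball (0::'a) (real N))"
    have "(\<integral>\<^sup>+x. ennreal ((norm (\<psi> m x - \<psi> n x))\<^sup>2) \<partial>?M) \<le> ennreal (C / 4 ^ n)" if nm: "n \<le> m" for n m
    proof -
      have t: "(\<lambda>x. \<phi> m x - \<phi> n x) \<in> test_functions UNIV"
        using cl_grad_lincomb(1)[OF \<phi>(1)[of m] \<phi>(1)[of n], of 1 "-1"] by simp
      have eq: "(\<phi> m x - \<phi> n x) - ball_mean (\<lambda>x. \<phi> m x - \<phi> n x) = \<psi> m x - \<psi> n x" for x
        unfolding \<psi>_def by (subst ball_mean_diff) (auto intro: test_functionsD(2)[OF \<phi>(1)])
      have "(\<integral>\<^sup>+x. ennreal ((norm (\<psi> m x - \<psi> n x))\<^sup>2) \<partial>?M)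
          = (\<integral>\<^sup>+x. ennreal ((\<psi> m x - \<psi> n x)\<^sup>2) * indicator (cball 0 (real N)) x \<partial>lebesgue)"
        using bs by (subst nn_integral_restrict_space) auto
      also have "\<dots> = (\<integral>\<^sup>+x. ennreal ((\<psi> m x - \<psi> n x)\<^sup>2) * indicator (cball 0 (real N)) x \<partial>lborel)"
        by (rule nn_integral_completion)
      also have "\<dots> \<le> ennreal C * (\<integral>\<^sup>+x. ennreal ((norm (grad (\<lambda>x. \<phi> m x - \<phi> n x) x))\<^sup>2) \<partial>lborel)"
        using C(2)[OF allI[OF test_functionsD(3)[OF t]] test_functionsD(4)[OF t]] by (simp only: eq)
      also have "\<dots> \<le> ennreal C * ennreal (1 / 4 ^ n)" by (intro mult_left_mono \<phi>(2)[OF nm]) auto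
      also have "\<dots> = ennreal (C / 4 ^ n)" using C(1) by (simp add: ennreal_mult[symmetric])
      finally show ?thesis .
    qed
    note L = L2_Cauchy_limit(3)[OF measurable_restrict_space1[OF \<psi>m] C(1) this]
    have "(\<integral>\<^sup>+x. ennreal ((u x - \<psi> n x)\<^sup>2) * indicator (cball 0 (real N)) x \<partial>lebesgue) \<le> ennreal (C / 4 ^ n)" for n
    proof -
      have "(\<integral>\<^sup>+x. ennreal ((u x - \<psi> n x)\<^sup>2) * indicator (cball 0 (real N)) x \<partial>lebesgue)
          = (\<integral>\<^sup>+x. ennreal ((norm (lim (\<lambda>k. \<psi> k x) - \<psi> n x))\<^sup>2) \<partial>?M)"
        using bs by (subst nn_integral_restrict_space) (auto simp: u_def)
      then show ?thesis using L[of n] by simp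
    qed
    with C(1) show ?thesis by blast
  qed
  have big: "\<exists>N. C \<subseteq> cball 0 (real N)" if C: "compact C" for C :: "'a set"
  proof -
    obtain r where r: "\<And>x. x \<in> C \<Longrightarrow> norm x \<le> r" using compact_imp_bounded[OF C] by (auto simp: bounded_iff)
    obtain N where "r \<le> real N" using real_arch_simple by blast
    then show ?thesis using r by (intro exI[of _ N]) force
  qed
  have conv: "\<exists>A\<ge>0. \<forall>n. (\<integral>\<^sup>+x. ennreal ((\<psi> n x - u x)\<^sup>2) * indicator C x \<partial>lebesgue) \<le> ennreal (A / 4 ^ n)" if C: "compact C" for C
  proof -
    obtain N where N: "C \<subseteq> cball 0 (real N)" using big[OF C] by blast
    obtain A where A: "A \<ge> 0" "\<And>n. (\<integral>\<^sup>+x. ennreal ((u x - \<psi> n x)\<^sup>2) * indicator (cball 0 (real N)) x \<partial>lebesgue) \<le> ennreal (A / 4 ^ n)"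
      using ball[of N] by metis
    have "(\<integral>\<^sup>+x. ennreal ((\<psi> n x - u x)\<^sup>2) * indicator C x \<partial>lebesgue) \<le> ennreal (A / 4 ^ n)" for n
    proof (rule order_trans[OF nn_integral_mono A(2)[of n]])
      fix x
      have "indicator C x \<le> (indicator (cball 0 (real N)) x :: ennreal)"
        using N by (intro indicator_leI) auto
      then show "ennreal ((\<psi> n x - u x)\<^sup>2) * indicator C x \<le> ennreal ((u x - \<psi> n x)\<^sup>2) * indicator (cball 0 (real N)) x"
        by (subst power2_commute) (rule mult_left_mono, auto)
    qed
    with A(1) show ?thesis by blast
  qed
  have u2: "u \<in> L2_loc UNIV"
    unfolding L2_loc_def
  proof safe
    fix C :: "'a set" assume C: "compact C"
    then have Cs: "C \<in> sets lebesgue" by (simp add: compact_imp_closed)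
    obtain A where A: "\<And>n. (\<integral>\<^sup>+x. ennreal ((\<psi> n x - u x)\<^sup>2) * indicator C x \<partial>lebesgue) \<le> ennreal (A / 4 ^ n)"
      using conv[OF C] by metis
    have "(\<lambda>x. indicator C x *\<^sub>R (u x - \<psi> 0 x)) \<in> L2 UNIV"
    proof -
      have "(\<integral>\<^sup>+x. ennreal ((norm (indicat_real C x *\<^sub>R (u x - \<psi> 0 x)))\<^sup>2) \<partial>lebesgue)
          = (\<integral>\<^sup>+x. ennreal ((\<psi> 0 x - u x)\<^sup>2) * indicator C x \<partial>lebesgue)"
        by (intro nn_integral_cong) (auto simp: indicator_def power2_commute)
      also have "\<dots> < \<infinity>" using A[of 0] by (rule le_less_trans) simp
      finally show ?thesis unfolding L2_UNIV_nn_integral_iff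
        using borel_measurable_scaleR[OF borel_measurable_indicator[OF Cs] borel_measurable_diff[OF um \<psi>m]] by blast
    qed
    moreover have "(\<lambda>x. indicator C x *\<^sub>R \<psi> 0 x) \<in> L2 UNIV"
    proof -
      have "integrable lborel (\<lambda>x. indicator C x *\<^sub>R (norm (\<psi> 0 x))\<^sup>2)"
        by (intro borel_integrable_compact[OF C]) (auto intro!: continuous_intros continuous_on_subset[OF \<psi>c])
      then have "integrable lebesgue (\<lambda>x. indicator C x *\<^sub>R (norm (\<psi> 0 x))\<^sup>2)"
        using integrable_completion[OF borel_measurable_integrable] by blast
      also have "(\<lambda>x. indicator C x *\<^sub>R (norm (\<psi> 0 x))\<^sup>2) = (\<lambda>x. (norm (indicat_real C x *\<^sub>R \<psi> 0 x))\<^sup>2)"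
        by (auto simp: indicator_def)
      finally show ?thesis
        using borel_measurable_scaleR[OF borel_measurable_indicator[OF Cs] \<psi>m[of 0]] by (simp only: L2_UNIV_iff)
    qed
    ultimately have "(\<lambda>x. indicator C x *\<^sub>R (u x - \<psi> 0 x) + indicator C x *\<^sub>R \<psi> 0 x) \<in> L2 UNIV" by (rule L2_add)
    then have "(\<lambda>x. indicator C x *\<^sub>R u x) \<in> L2 UNIV" by (simp add: algebra_simps)
    then show "u \<in> L2 C" by (simp only: L2_iff_UNIV[OF Cs])
  qed
  have "weak_gradient UNIV u (rep F)"
  proof (rule weak_gradient_limit[where u=\<psi> and g="\<lambda>n. grad (\<phi> n)"])
    show "weak_gradient UNIV (\<psi> n) (grad (\<phi> n))" for n
      by (intro weak_gradient_C1) (auto intro: \<psi>g test_functionsD(4)[OF \<phi>(1)])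
    show "\<exists>A\<ge>0. \<forall>n. (\<integral>\<^sup>+x. ennreal ((norm (grad (\<phi> n) x - rep F x))\<^sup>2) * indicator C x \<partial>lebesgue) \<le> ennreal (A / 4 ^ n)" for C
      by (rule gradspace_fast_sequence_conv) (rule \<phi>(3))
    show "rep F \<in> L1_loc UNIV" by (rule L2_imp_L1_loc) (auto intro: rep_L2)
    show "u \<in> L1_loc UNIV" by (rule L2_loc_imp_L1_loc[OF u2])
  qed (use conv in \<open>auto intro: rep_measurable test_functions_measurable[OF \<phi>(1)]\<close>)
  with u2 show ?thesis by (rule that)
qed

section \<open>Gradient fields of Sobolev functions\<close>

text \<open>Extension by zero puts the gradients for all domains and all scales into one Hilbert
  space.\<close>

definition gfield :: "'a::euclidean_space set \<Rightarrow> ('a \<Rightarrow> real) \<Rightarrow> ('a, 'a) ell2" where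
  "gfield D u = cl (\<lambda>x. indicator D x *\<^sub>R wgrad D u x)"

definition sfield :: "'a::euclidean_space set \<Rightarrow> ('a \<Rightarrow> real) \<Rightarrow> ('a, real) ell2" where
  "sfield D u = cl (\<lambda>x. indicator D x *\<^sub>R u x)"

lemma
  fixes D :: "'a::euclidean_space set"
  assumes D: "open D" and u: "weak_gradient D u g" and g: "g \<in> L2 D"
  shows gfield_eqI: "gfield D u = cl (\<lambda>x. indicator D x *\<^sub>R g x)"
    and L2_wgradI: "(\<lambda>x. indicator D x *\<^sub>R wgrad D u x) \<in> L2 UNIV"
proof -
  have D': "D \<in> sets lebesgue" using D by simp
  have "AE x in lebesgue. x \<in> D \<longrightarrow> wgrad D u x = g x"
    using wgrad_AE[OF D u] by (simp only: AE_lebesgue_on[OF D'])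
  then have ae: "AE x in lebesgue. indicator D x *\<^sub>R g x = indicator D x *\<^sub>R wgrad D u x"
    by eventually_elim (auto simp: indicator_def)
  have g': "(\<lambda>x. indicator D x *\<^sub>R g x) \<in> L2 UNIV" using g by (simp only: L2_iff_UNIV[OF D'])
  show "gfield D u = cl (\<lambda>x. indicator D x *\<^sub>R g x)"
    unfolding gfield_def by (rule cl_cong[OF g' ae, symmetric])
  show "(\<lambda>x. indicator D x *\<^sub>R wgrad D u x) \<in> L2 UNIV" by (rule L2_AE_cong[OF g' ae])
qed

lemma
  fixes D :: "'a::euclidean_space set"
  assumes D: "open D" and u: "u \<in> H1 D"
  shows L2_wgrad: "(\<lambda>x. indicator D x *\<^sub>R wgrad D u x) \<in> L2 UNIV"
    and L2_sobolev: "(\<lambda>x. indicator D x *\<^sub>R u x) \<in> L2 UNIV"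
proof -
  have D': "D \<in> sets lebesgue" using D by simp
  show "(\<lambda>x. indicator D x *\<^sub>R wgrad D u x) \<in> L2 UNIV"
    using u L2_wgradI[OF D] by (auto simp: H1_def)
  show "(\<lambda>x. indicator D x *\<^sub>R u x) \<in> L2 UNIV"
    using u unfolding H1_def by (simp only: L2_iff_UNIV[OF D'] mem_Collect_eq)
qed

lemma H1_weak_gradient: "u \<in> H1 D \<Longrightarrow> weak_gradient D u (wgrad D u)"
  unfolding H1_def using weak_gradient_wgrad by blast

lemma H1_lincomb:
  fixes D :: "'a::euclidean_space set"
  assumes D: "open D" and u: "u \<in> H1 D" and v: "v \<in> H1 D"
  shows "(\<lambda>x. a * u x + b * v x) \<in> H1 D"
    and "gfield D (\<lambda>x. a * u x + b * v x) = a *\<^sub>R gfield D u + b *\<^sub>R gfield D v"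
    and "sfield D (\<lambda>x. a * u x + b * v x) = a *\<^sub>R sfield D u + b *\<^sub>R sfield D v"
proof -
  have D': "D \<in> sets lebesgue" using D by simp
  have wg: "weak_gradient D (\<lambda>x. a * u x + b * v x) (\<lambda>x. a *\<^sub>R wgrad D u x + b *\<^sub>R wgrad D v x)"
    by (intro weak_gradient_lincomb D H1_weak_gradient u v)
  note L = L2_scaleR[OF L2_wgrad[OF D u], of a] L2_scaleR[OF L2_wgrad[OF D v], of b]
    L2_scaleR[OF L2_sobolev[OF D u], of a] L2_scaleR[OF L2_sobolev[OF D v], of b]
  have eq: "(\<lambda>x. a *\<^sub>R indicat_real D x *\<^sub>R wgrad D u x + b *\<^sub>R indicat_real D x *\<^sub>R wgrad D v x) =
      (\<lambda>x. indicat_real D x *\<^sub>R (a *\<^sub>R wgrad D u x + b *\<^sub>R wgrad D v x))"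
    "(\<lambda>x. a *\<^sub>R indicat_real D x *\<^sub>R u x + b *\<^sub>R indicat_real D x *\<^sub>R v x) =
      (\<lambda>x. indicat_real D x *\<^sub>R (a * u x + b * v x))"
    by (auto simp: algebra_simps)
  have g: "(\<lambda>x. a *\<^sub>R wgrad D u x + b *\<^sub>R wgrad D v x) \<in> L2 D"
    using L2_add[OF L(1,2)] unfolding L2_iff_UNIV[OF D'] eq .
  have s: "(\<lambda>x. a * u x + b * v x) \<in> L2 D"
    using L2_add[OF L(3,4)] unfolding L2_iff_UNIV[OF D'] eq .
  show "(\<lambda>x. a * u x + b * v x) \<in> H1 D" using wg g s by (auto simp: H1_def)
  have "a *\<^sub>R gfield D u + b *\<^sub>R gfield D v = cl (\<lambda>x. indicator D x *\<^sub>R (a *\<^sub>R wgrad D u x + b *\<^sub>R wgrad D v x))"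
    unfolding gfield_def cl_scaleR[OF L2_wgrad[OF D u]] cl_scaleR[OF L2_wgrad[OF D v]] cl_add[OF L(1,2)] eq ..
  then show "gfield D (\<lambda>x. a * u x + b * v x) = a *\<^sub>R gfield D u + b *\<^sub>R gfield D v"
    using gfield_eqI[OF D wg g] by simp
  show "sfield D (\<lambda>x. a * u x + b * v x) = a *\<^sub>R sfield D u + b *\<^sub>R sfield D v"
    unfolding sfield_def cl_scaleR[OF L2_sobolev[OF D u]] cl_scaleR[OF L2_sobolev[OF D v]] cl_add[OF L(3,4)] eq ..
qed

lemma H1_diff:
  fixes D :: "'a::euclidean_space set"
  assumes D: "open D" and u: "u \<in> H1 D" and v: "v \<in> H1 D"
  shows "(\<lambda>x. u x - v x) \<in> H1 D"
    and "gfield D (\<lambda>x. u x - v x) = gfield D u - gfield D v"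
    and "sfield D (\<lambda>x. u x - v x) = sfield D u - sfield D v"
  using H1_lincomb[OF assms, of 1 "-1"] by simp_all

lemma test_functions_H1:
  fixes D :: "'a::euclidean_space set"
  assumes D: "open D" and \<phi>: "\<phi> \<in> test_functions D"
  shows "\<phi> \<in> H1 D" "gfield D \<phi> = cl (grad \<phi>)" "sfield D \<phi> = cl \<phi>"
proof -
  have D': "D \<in> sets lebesgue" using D by simp
  obtain S where S: "S \<subseteq> D" "\<And>x. x \<notin> S \<Longrightarrow> \<phi> x = 0" "\<And>x. x \<notin> S \<Longrightarrow> grad \<phi> x = 0"
    using test_functions_support[OF \<phi>] by metis
  have eq: "(\<lambda>x. indicat_real D x *\<^sub>R grad \<phi> x) = grad \<phi>" "(\<lambda>x. indicat_real D x *\<^sub>R \<phi> x) = \<phi>"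
    using S by (auto simp: fun_eq_iff indicator_def)
  note wg = weak_gradient_test_function[OF \<phi> D]
  have g: "grad \<phi> \<in> L2 D" "\<phi> \<in> L2 D"
    using test_functions_L2[OF \<phi>] unfolding L2_iff_UNIV[OF D'] eq by auto
  show "\<phi> \<in> H1 D" using wg g by (auto simp: H1_def)
  show "gfield D \<phi> = cl (grad \<phi>)" unfolding gfield_eqI[OF D wg g(1)] eq ..
  show "sfield D \<phi> = cl \<phi>" unfolding sfield_def eq ..
qed

lemma H1_norm_eq:
  fixes D :: "'a::euclidean_space set"
  assumes D: "open D" and u: "u \<in> H1 D"
  shows "H1_norm D u = sqrt ((norm (sfield D u))\<^sup>2 + (norm (gfield D u))\<^sup>2)"
proof -
  have D': "D \<in> sets lebesgue" using D by simp
  have "(norm (gfield D u))\<^sup>2 = (LINT x|lebesgue_on D. (norm (wgrad D u x))\<^sup>2)"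
    unfolding gfield_def norm_cl_power2[OF L2_wgrad[OF D u]] integral_lebesgue_on[OF D']
    by (intro Bochner_Integration.integral_cong) (auto simp: indicator_def)
  moreover have "(norm (sfield D u))\<^sup>2 = (LINT x|lebesgue_on D. (u x)\<^sup>2)"
    unfolding sfield_def norm_cl_power2[OF L2_sobolev[OF D u]] integral_lebesgue_on[OF D']
    by (intro Bochner_Integration.integral_cong) (auto simp: indicator_def)
  ultimately show ?thesis by (simp add: H1_norm_def)
qed

text \<open>The H1 norm is the Euclidean combination of the two field norms, so approximation in it
  splits into convergence of the functions and convergence of the gradients.\<close>

lemma H10_iff:
  fixes D :: "'a::euclidean_space set"
  assumes D: "open D"
  shows "u \<in> H10 D \<longleftrightarrow> u \<in> H1 D \<and> (\<exists>\<phi>. (\<forall>n. \<phi> n \<in> test_functions D) \<and>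
    (\<lambda>n. cl (\<phi> n)) \<longlonglongrightarrow> sfield D u \<and> (\<lambda>n. cl (grad (\<phi> n))) \<longlonglongrightarrow> gfield D u)"
proof -
  have *: "(\<lambda>n. H1_norm D (\<lambda>x. \<phi> n x - u x)) \<longlonglongrightarrow> 0 \<longleftrightarrow>
      (\<lambda>n. cl (\<phi> n)) \<longlonglongrightarrow> sfield D u \<and> (\<lambda>n. cl (grad (\<phi> n))) \<longlonglongrightarrow> gfield D u"
    if u: "u \<in> H1 D" and \<phi>: "\<forall>n. \<phi> n \<in> test_functions D" for \<phi>
  proof -
    define s where "s n = norm (cl (\<phi> n) - sfield D u)" for n
    define g where "g n = norm (cl (grad (\<phi> n)) - gfield D u)" for n
    have t: "\<phi> n \<in> H1 D" "gfield D (\<phi> n) = cl (grad (\<phi> n))" "sfield D (\<phi> n) = cl (\<phi> n)" for n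
      using test_functions_H1[OF D] \<phi> by auto
    have eq: "H1_norm D (\<lambda>x. \<phi> n x - u x) = sqrt ((s n)\<^sup>2 + (g n)\<^sup>2)" for n
      using H1_norm_eq[OF D H1_diff(1)[OF D t(1) u]] H1_diff(2,3)[OF D t(1) u] t(2,3)
      by (simp add: s_def g_def)
    have "(\<lambda>n. sqrt ((s n)\<^sup>2 + (g n)\<^sup>2)) \<longlonglongrightarrow> 0 \<longleftrightarrow> s \<longlonglongrightarrow> 0 \<and> g \<longlonglongrightarrow> 0"
    proof
      assume l: "(\<lambda>n. sqrt ((s n)\<^sup>2 + (g n)\<^sup>2)) \<longlonglongrightarrow> 0"
      have "s \<longlonglongrightarrow> 0" "g \<longlonglongrightarrow> 0"
        by (rule Lim_null_comparison[OF always_eventually l]; simp add: s_def g_def)+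
      then show "s \<longlonglongrightarrow> 0 \<and> g \<longlonglongrightarrow> 0" by simp
    next
      assume "s \<longlonglongrightarrow> 0 \<and> g \<longlonglongrightarrow> 0"
      then have "(\<lambda>n. sqrt ((s n)\<^sup>2 + (g n)\<^sup>2)) \<longlonglongrightarrow> sqrt (0\<^sup>2 + 0\<^sup>2)" by (intro tendsto_intros) auto
      then show "(\<lambda>n. sqrt ((s n)\<^sup>2 + (g n)\<^sup>2)) \<longlonglongrightarrow> 0" by simp
    qed
    moreover have "s \<longlonglongrightarrow> 0 \<longleftrightarrow> (\<lambda>n. cl (\<phi> n)) \<longlonglongrightarrow> sfield D u"
      unfolding s_def by (subst (2) tendsto_dist_iff) (simp add: dist_norm)
    moreover have "g \<longlonglongrightarrow> 0 \<longleftrightarrow> (\<lambda>n. cl (grad (\<phi> n))) \<longlonglongrightarrow> gfield D u"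
      unfolding g_def by (subst (2) tendsto_dist_iff) (simp add: dist_norm)
    ultimately show ?thesis unfolding eq by simp
  qed
  then show ?thesis unfolding H10_def by (simp only: mem_Collect_eq) blast
qed

lemma H10_imp_H1: "u \<in> H10 D \<Longrightarrow> u \<in> H1 D"
  by (simp add: H10_def)

lemma H10_lincomb:
  fixes D :: "'a::euclidean_space set"
  assumes D: "open D" and u: "u \<in> H10 D" and v: "v \<in> H10 D"
  shows "(\<lambda>x. a * u x + b * v x) \<in> H10 D"
proof -
  obtain \<phi> where \<phi>: "\<And>n. \<phi> n \<in> test_functions D"
    "(\<lambda>n. cl (\<phi> n)) \<longlonglongrightarrow> sfield D u" "(\<lambda>n. cl (grad (\<phi> n))) \<longlonglongrightarrow> gfield D u"
    using u unfolding H10_iff[OF D] by metis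
  obtain \<psi> where \<psi>: "\<And>n. \<psi> n \<in> test_functions D"
    "(\<lambda>n. cl (\<psi> n)) \<longlonglongrightarrow> sfield D v" "(\<lambda>n. cl (grad (\<psi> n))) \<longlonglongrightarrow> gfield D v"
    using v unfolding H10_iff[OF D] by metis
  note H1 = H1_lincomb[OF D H10_imp_H1[OF u] H10_imp_H1[OF v], of a b]
  have s: "cl (\<lambda>x. a * \<phi> n x + b * \<psi> n x) = a *\<^sub>R cl (\<phi> n) + b *\<^sub>R cl (\<psi> n)" for n
    using H1_lincomb(3)[OF D test_functions_H1(1)[OF D \<phi>(1)] test_functions_H1(1)[OF D \<psi>(1)], of a n b n]
      test_functions_H1(3)[OF D \<phi>(1)] test_functions_H1(3)[OF D \<psi>(1)]
      test_functions_H1(3)[OF D cl_grad_lincomb(1)[OF \<phi>(1) \<psi>(1)]] by simp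
  have "(\<lambda>n. cl (\<lambda>x. a * \<phi> n x + b * \<psi> n x)) \<longlonglongrightarrow> sfield D (\<lambda>x. a * u x + b * v x)"
    unfolding s H1(3) by (intro tendsto_intros \<phi> \<psi>)
  moreover have "(\<lambda>n. cl (grad (\<lambda>x. a * \<phi> n x + b * \<psi> n x))) \<longlonglongrightarrow> gfield D (\<lambda>x. a * u x + b * v x)"
    unfolding cl_grad_lincomb(2)[OF \<phi>(1) \<psi>(1)] H1(2) by (intro tendsto_intros \<phi> \<psi>)
  ultimately show ?thesis
    unfolding H10_iff[OF D] using H1(1) cl_grad_lincomb(1)[OF \<phi>(1) \<psi>(1)]
    by (intro conjI exI[of _ "\<lambda>n x. a * \<phi> n x + b * \<psi> n x"]) auto
qed

lemma H10_diff: "open D \<Longrightarrow> u \<in> H10 D \<Longrightarrow> v \<in> H10 D \<Longrightarrow> (\<lambda>x. u x - v x) \<in> H10 D"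
  using H10_lincomb[of D u v 1 "-1"] by simp

lemma gfield_in_gradspace:
  fixes D :: "'a::euclidean_space set"
  assumes D: "open D" and u: "u \<in> H10 D"
  shows "gfield D u \<in> gradspace D"
proof -
  obtain \<phi> where "\<forall>n. \<phi> n \<in> test_functions D" "(\<lambda>n. cl (grad (\<phi> n))) \<longlonglongrightarrow> gfield D u"
    using u unfolding H10_iff[OF D] by metis
  then show ?thesis unfolding gradspace_def closure_sequential
    by (intro exI[of _ "\<lambda>n. cl (grad (\<phi> n))"]) auto
qed

lemma bounded_subset_ball0:
  fixes D :: "'a::euclidean_space set"
  assumes "bounded D"
  obtains r where "r > 0" "D \<subseteq> ball 0 r"
  using bounded_subset_ballD[OF assms, of 0] by blast

text \<open>The Poincare inequality passes from the approximating test functions to \<open>u\<close>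
  in the limit.\<close>

lemma gfield_zero_imp_AE_zero:
  fixes D :: "'a::euclidean_space set"
  assumes D: "open D" "bounded D" and u: "u \<in> H10 D" and g: "gfield D u = 0"
  shows "AE x in lebesgue_on D. u x = 0"
proof -
  have D': "D \<in> sets lebesgue" using D by simp
  obtain r where r: "r > 0" "D \<subseteq> ball 0 r" using bounded_subset_ball0[OF D(2)] .
  obtain \<phi> where \<phi>: "\<And>n. \<phi> n \<in> test_functions D"
    "(\<lambda>n. cl (\<phi> n)) \<longlonglongrightarrow> sfield D u" "(\<lambda>n. cl (grad (\<phi> n))) \<longlonglongrightarrow> gfield D u"
    using u unfolding H10_iff[OF D(1)] by metis
  have "(norm (cl (\<phi> n)))\<^sup>2 \<le> 4 * r\<^sup>2 * (norm (cl (grad (\<phi> n))))\<^sup>2" for n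
  proof -
    have "ennreal ((norm (cl (\<phi> n)))\<^sup>2) = (\<integral>\<^sup>+x. ennreal ((\<phi> n x)\<^sup>2) \<partial>lborel)"
      using nn_integral_norm_cl[OF test_functions_L2(1)[OF \<phi>(1)[of n]]] by (simp add: nn_integral_completion)
    also have "\<dots> \<le> ennreal (4 * r\<^sup>2) * (\<integral>\<^sup>+x. ennreal ((norm (grad (\<phi> n) x))\<^sup>2) \<partial>lborel)"
      by (rule Poincare_test_function[OF \<phi>(1) r(2,1)])
    also have "(\<integral>\<^sup>+x. ennreal ((norm (grad (\<phi> n) x))\<^sup>2) \<partial>lborel) = ennreal ((norm (cl (grad (\<phi> n))))\<^sup>2)"
      using nn_integral_norm_cl[OF test_functions_L2(2)[OF \<phi>(1)[of n]]] by (simp add: nn_integral_completion)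
    finally show ?thesis by (simp add: ennreal_mult[symmetric])
  qed
  then have "(norm (sfield D u))\<^sup>2 \<le> 4 * r\<^sup>2 * (norm (gfield D u))\<^sup>2"
    by (intro LIMSEQ_le[of "\<lambda>n. (norm (cl (\<phi> n)))\<^sup>2" _ "\<lambda>n. 4 * r\<^sup>2 * (norm (cl (grad (\<phi> n))))\<^sup>2"]
        tendsto_intros \<phi>(2,3)) auto
  then have "sfield D u = 0" by (simp add: g)
  then have "cl (\<lambda>x. indicator D x *\<^sub>R u x) = cl (\<lambda>x. 0)" by (simp add: sfield_def zero_ell2_def)
  then have "AE x in lebesgue. indicat_real D x *\<^sub>R u x = 0"
    using cl_eq_iff[OF L2_sobolev[OF D(1) H10_imp_H1[OF u]] L2_zero] by blast
  then show ?thesis unfolding AE_lebesgue_on[OF D'] by eventually_elim auto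
qed

text \<open>On a bounded domain the Poincare inequality makes the potentials of a convergent
  sequence of gradients Cauchy in L2 as well, so a limit of gradients always comes with a potential
  in \<open>H10 D\<close>.\<close>

theorem gradspace_imp_H10:
  fixes D :: "'a::euclidean_space set"
  assumes D: "open D" "bounded D" and F: "F \<in> gradspace D"
  obtains u where "u \<in> H10 D" "gfield D u = F"
proof -
  have D': "D \<in> sets lebesgue" using D by simp
  obtain r where r: "r > 0" "D \<subseteq> ball 0 r" using bounded_subset_ball0[OF D(2)] .
  obtain \<phi> where \<phi>: "\<And>n::nat. \<phi> n \<in> test_functions D"
    "\<And>n m. n \<le> m \<Longrightarrow> (\<integral>\<^sup>+x. ennreal ((norm (grad (\<lambda>x. \<phi> m x - \<phi> n x) x))\<^sup>2) \<partial>lborel) \<le> ennreal (1 / 4 ^ n)"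
    "\<And>n. (\<integral>\<^sup>+x. ennreal ((norm (grad (\<phi> n) x - rep F x))\<^sup>2) \<partial>lebesgue) \<le> ennreal (1 / 4 ^ n)"
    by (rule gradspace_fast_sequence[OF F]) (rule that, blast+)
  define u where "u x = lim (\<lambda>n. \<phi> n x)" for x
  define C where "C = 4 * r\<^sup>2"
  have C: "C \<ge> 0" by (simp add: C_def)
  have \<phi>m[measurable]: "\<phi> n \<in> borel_measurable lebesgue" for n by (rule test_functions_measurable[OF \<phi>(1)])
  have um[measurable]: "u \<in> borel_measurable lebesgue" unfolding u_def by measurable
  have "(\<integral>\<^sup>+x. ennreal ((norm (\<phi> m x - \<phi> n x))\<^sup>2) \<partial>lebesgue) \<le> ennreal (C / 4 ^ n)" if nm: "n \<le> m" for n m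
  proof -
    have t: "(\<lambda>x. \<phi> m x - \<phi> n x) \<in> test_functions D"
      using cl_grad_lincomb(1)[OF \<phi>(1)[of m] \<phi>(1)[of n], of 1 "-1"] by simp
    have "(\<integral>\<^sup>+x. ennreal ((norm (\<phi> m x - \<phi> n x))\<^sup>2) \<partial>lebesgue) = (\<integral>\<^sup>+x. ennreal ((\<phi> m x - \<phi> n x)\<^sup>2) \<partial>lborel)"
      by (simp add: nn_integral_completion)
    also have "\<dots> \<le> ennreal C * (\<integral>\<^sup>+x. ennreal ((norm (grad (\<lambda>x. \<phi> m x - \<phi> n x) x))\<^sup>2) \<partial>lborel)"
      unfolding C_def by (rule Poincare_test_function[OF t r(2,1)])
    also have "\<dots> \<le> ennreal C * ennreal (1 / 4 ^ n)" by (intro mult_left_mono \<phi>(2)[OF nm]) auto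
    also have "\<dots> = ennreal (C / 4 ^ n)" using C by (simp add: ennreal_mult[symmetric])
    finally show ?thesis .
  qed
  note L = L2_Cauchy_limit(3)[OF \<phi>m C this, folded u_def]
  have L': "(\<integral>\<^sup>+x. ennreal ((\<phi> n x - u x)\<^sup>2) \<partial>lebesgue) \<le> ennreal (C / 4 ^ n)" for n
    using L[of n] by (simp add: power2_commute)
  have udiff: "(\<lambda>x. u x - \<phi> n x) \<in> L2 UNIV" for n
    unfolding L2_UNIV_nn_integral_iff using L[of n] um \<phi>m[of n] by (auto simp: le_less_trans[OF _ ennreal_less_top])
  have u2: "u \<in> L2 UNIV" using L2_add[OF udiff[of 0] test_functions_L2(1)[OF \<phi>(1)[of 0]]] by simp
  have wg: "weak_gradient UNIV u (rep F)"
  proof (rule weak_gradient_limit[where u=\<phi> and g="\<lambda>n. grad (\<phi> n)"])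
    show "weak_gradient UNIV (\<phi> n) (grad (\<phi> n))" for n
      by (rule weak_gradient_test_function[OF \<phi>(1)]) simp
    show "\<exists>A\<ge>0. \<forall>n. (\<integral>\<^sup>+x. ennreal ((norm (grad (\<phi> n) x - rep F x))\<^sup>2) * indicator K x \<partial>lebesgue) \<le> ennreal (A / 4 ^ n)" for K
      by (rule gradspace_fast_sequence_conv) (rule \<phi>(3))
    show "\<exists>A\<ge>0. \<forall>n. (\<integral>\<^sup>+x. ennreal ((\<phi> n x - u x)\<^sup>2) * indicator K x \<partial>lebesgue) \<le> ennreal (A / 4 ^ n)" for K
    proof (intro exI[of _ C] conjI allI C)
      fix n
      show "(\<integral>\<^sup>+x. ennreal ((\<phi> n x - u x)\<^sup>2) * indicator K x \<partial>lebesgue) \<le> ennreal (C / 4 ^ n)"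
        by (rule order_trans[OF nn_integral_mono L'[of n]]) (auto simp: indicator_def)
    qed
    show "rep F \<in> L1_loc UNIV" by (rule L2_imp_L1_loc) (auto intro: rep_L2)
    show "u \<in> L1_loc UNIV" by (rule L2_imp_L1_loc) (auto intro: u2)
  qed (auto intro: rep_measurable test_functions_measurable[OF \<phi>(1)])
  then have wgD: "weak_gradient D u (rep F)" by (rule weak_gradient_subset[OF open_UNIV D(1) subset_UNIV])
  note inD = L2_indicator[OF _ D']
  have g2: "rep F \<in> L2 D" "u \<in> L2 D"
    using inD[OF rep_L2[of F]] inD[OF u2] by (simp_all only: L2_iff_UNIV[OF D'])
  then have uH1: "u \<in> H1 D" using wgD by (auto simp: H1_def)
  have zero: "\<phi> n x = 0" "grad \<phi>' x = 0" if "x \<notin> D" "\<phi>' \<in> test_functions D" for n x \<phi>'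
    using that \<phi>(1)[of n] by (metis test_functions_support subsetD)+
  have gF: "gfield D u = F" and gconv: "(\<lambda>n. cl (grad (\<phi> n))) \<longlonglongrightarrow> gfield D u"
    and sconv: "(\<lambda>n. cl (\<phi> n)) \<longlonglongrightarrow> sfield D u"
  proof -
    have half: "(\<lambda>n. sqrt (B * (1 / 4) ^ n)) \<longlonglongrightarrow> 0" for B :: real
    proof -
      have "(\<lambda>n. sqrt (B * (1 / 4) ^ n)) \<longlonglongrightarrow> sqrt (B * 0)"
        by (intro tendsto_intros LIMSEQ_realpow_zero) auto
      then show ?thesis by simp
    qed
    have conv: "X \<longlonglongrightarrow> G" if "\<And>n. (norm (X n - G))\<^sup>2 \<le> B / 4 ^ n" for X :: "nat \<Rightarrow> ('a, 'c::euclidean_space) ell2" and G B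
    proof -
      have "norm (X n - G) \<le> sqrt (B * (1 / 4) ^ n)" for n
        using real_sqrt_le_mono[OF that[of n]] by (simp add: power_one_over)
      then have "(\<lambda>n. X n - G) \<longlonglongrightarrow> 0"
        by (intro Lim_null_comparison[OF always_eventually half]) auto
      then show ?thesis by (rule LIM_zero_cancel)
    qed
    have gD: "gfield D u = cl (\<lambda>x. indicator D x *\<^sub>R rep F x)" by (rule gfield_eqI[OF D(1) wgD g2(1)])
    have "(norm (cl (grad (\<phi> n)) - F))\<^sup>2 \<le> 1 / 4 ^ n" for n
    proof -
      have "(norm (cl (grad (\<phi> n)) - cl (rep F)))\<^sup>2 \<le> 1 / 4 ^ n"
        using \<phi>(3)[of n] nn_integral_norm_cl[OF L2_diff[OF test_functions_L2(2)[OF \<phi>(1)[of n]] rep_L2[of F]]]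
        by (simp add: cl_diff[OF test_functions_L2(2)[OF \<phi>(1)[of n]] rep_L2[of F]])
      then show ?thesis by (simp only: cl_rep)
    qed
    then have c1: "(\<lambda>n. cl (grad (\<phi> n))) \<longlonglongrightarrow> F" by (rule conv)
    have "(norm (cl (grad (\<phi> n)) - gfield D u))\<^sup>2 \<le> 1 / 4 ^ n" for n
    proof -
      note di = L2_diff[OF test_functions_L2(2)[OF \<phi>(1)[of n]] inD[OF rep_L2[of F]]]
      have "ennreal ((norm (cl (grad (\<phi> n)) - gfield D u))\<^sup>2)
          = (\<integral>\<^sup>+x. ennreal ((norm (grad (\<phi> n) x - indicator D x *\<^sub>R rep F x))\<^sup>2) \<partial>lebesgue)"
        unfolding gD cl_diff[OF test_functions_L2(2)[OF \<phi>(1)[of n]] inD[OF rep_L2[of F]]]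
        by (rule nn_integral_norm_cl[OF di, symmetric])
      also have "\<dots> \<le> (\<integral>\<^sup>+x. ennreal ((norm (grad (\<phi> n) x - rep F x))\<^sup>2) \<partial>lebesgue)"
        by (intro nn_integral_mono ennreal_leI) (auto simp: indicator_def zero \<phi>(1))
      also have "\<dots> \<le> ennreal (1 / 4 ^ n)" by (rule \<phi>(3))
      finally show ?thesis by simp
    qed
    then show c2: "(\<lambda>n. cl (grad (\<phi> n))) \<longlonglongrightarrow> gfield D u" by (rule conv)
    \<comment> \<open>\<open>F\<close> is not known beforehand to vanish off \<open>D\<close>. It
      does, because the same sequence converges to \<open>F\<close> and to its restriction to
      \<open>D\<close>.\<close>
    show "gfield D u = F" by (rule LIMSEQ_unique[OF c2 c1])
    have "(norm (cl (\<phi> n) - sfield D u))\<^sup>2 \<le> C / 4 ^ n" for n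
    proof -
      note di = L2_diff[OF test_functions_L2(1)[OF \<phi>(1)[of n]] inD[OF u2]]
      have "ennreal ((norm (cl (\<phi> n) - sfield D u))\<^sup>2)
          = (\<integral>\<^sup>+x. ennreal ((norm (\<phi> n x - indicator D x *\<^sub>R u x))\<^sup>2) \<partial>lebesgue)"
        unfolding sfield_def cl_diff[OF test_functions_L2(1)[OF \<phi>(1)[of n]] inD[OF u2]]
        by (rule nn_integral_norm_cl[OF di, symmetric])
      also have "\<dots> \<le> (\<integral>\<^sup>+x. ennreal ((\<phi> n x - u x)\<^sup>2) \<partial>lebesgue)"
        by (intro nn_integral_mono ennreal_leI) (auto simp: indicator_def zero(1)[OF _ \<phi>(1)])
      also have "\<dots> \<le> ennreal (C / 4 ^ n)" by (rule L')
      finally show ?thesis using C by simp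
    qed
    then show "(\<lambda>n. cl (\<phi> n)) \<longlonglongrightarrow> sfield D u" by (rule conv)
  qed
  have "u \<in> H10 D" unfolding H10_iff[OF D(1)] using uH1 \<phi>(1) gconv sconv by blast
  then show ?thesis using gF by (rule that)
qed

section \<open>Beppo-Levi functions\<close>

text \<open>Removes the chosen representative \<open>wgrad UNIV u\<close> from membership in
  \<open>BL\<close>: any square integrable weak gradient will do.\<close>

lemma BL_iff:
  "u \<in> BL \<longleftrightarrow> u \<in> L2_loc UNIV \<and> (\<exists>g\<in>L2 UNIV. weak_gradient UNIV u g)"
proof
  assume "u \<in> BL"
  then show "u \<in> L2_loc UNIV \<and> (\<exists>g\<in>L2 UNIV. weak_gradient UNIV u g)"
    unfolding BL_def H1_loc_def using weak_gradient_wgrad by blast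
next
  assume u: "u \<in> L2_loc UNIV \<and> (\<exists>g\<in>L2 UNIV. weak_gradient UNIV u g)"
  then obtain g where g: "g \<in> L2 UNIV" "weak_gradient UNIV u g" by blast
  have "g \<in> L2_loc UNIV" using g(1) by (intro L2_imp_L2_loc) auto
  moreover have "wgrad UNIV u \<in> L2 UNIV"
    using L2_wgradI[OF open_UNIV g(2,1)] by simp
  ultimately show "u \<in> BL" using u g by (auto simp: BL_def H1_loc_def)
qed

lemma BL_D:
  assumes "u \<in> BL"
  shows "weak_gradient UNIV u (wgrad UNIV u)" "wgrad UNIV u \<in> L2 UNIV" "u \<in> L2_loc UNIV"
    "gfield UNIV u = cl (wgrad UNIV u)"
proof -
  show "weak_gradient UNIV u (wgrad UNIV u)" "u \<in> L2_loc UNIV"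
    using assms weak_gradient_wgrad unfolding BL_iff by blast+
  show "wgrad UNIV u \<in> L2 UNIV" using assms by (simp add: BL_def)
qed (simp add: gfield_def)

lemma BL_diff:
  assumes "u \<in> BL" "v \<in> BL"
  shows "(\<lambda>x. u x - v x) \<in> BL" "gfield UNIV (\<lambda>x. u x - v x) = gfield UNIV u - gfield UNIV v"
proof -
  have wg: "weak_gradient UNIV (\<lambda>x. u x - v x) (\<lambda>x. wgrad UNIV u x - wgrad UNIV v x)"
    using weak_gradient_lincomb[OF open_UNIV BL_D(1)[OF assms(1)] BL_D(1)[OF assms(2)], of 1 "-1"] by simp
  have g: "(\<lambda>x. wgrad UNIV u x - wgrad UNIV v x) \<in> L2 UNIV" by (intro L2_diff BL_D assms)
  have "(\<lambda>x. u x - v x) \<in> L2 C" if C: "compact C" for C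
  proof -
    have C': "C \<in> sets lebesgue" using C by (simp add: compact_imp_closed)
    have "u \<in> L2 C" "v \<in> L2 C" using assms C by (auto simp: BL_iff L2_loc_def)
    then have "(\<lambda>x. indicator C x *\<^sub>R u x - indicator C x *\<^sub>R v x) \<in> L2 UNIV"
      unfolding L2_iff_UNIV[OF C'] by (rule L2_diff)
    then show ?thesis unfolding L2_iff_UNIV[OF C'] by (simp add: algebra_simps)
  qed
  then show "(\<lambda>x. u x - v x) \<in> BL" using wg g by (auto simp: BL_iff L2_loc_def)
  show "gfield UNIV (\<lambda>x. u x - v x) = gfield UNIV u - gfield UNIV v"
    unfolding gfield_eqI[OF open_UNIV wg g] BL_D(4)[OF assms(1)] BL_D(4)[OF assms(2)]
      cl_diff[OF BL_D(2)[OF assms(1)] BL_D(2)[OF assms(2)]] by simp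
qed

lemma gradspace_imp_BL:
  fixes F :: "('a::euclidean_space, 'a) ell2"
  assumes F: "F \<in> gradspace UNIV"
  obtains u where "u \<in> BL" "gfield UNIV u = F"
proof -
  obtain u where u: "u \<in> L2_loc UNIV" "weak_gradient UNIV u (rep F)"
    using gradspace_imp_weak_gradient[OF F] .
  show ?thesis
  proof
    show "u \<in> BL" using u rep_L2 by (auto simp: BL_iff)
    show "gfield UNIV u = F" using gfield_eqI[OF open_UNIV u(2) rep_L2] by (simp add: cl_rep)
  qed
qed

lemma L1_loc_UNIV_measurable:
  fixes u :: "'a::euclidean_space \<Rightarrow> 'b::euclidean_space"
  assumes "u \<in> L1_loc UNIV"
  shows "u \<in> borel_measurable lebesgue"
proof (rule borel_measurable_LIMSEQ_metric)
  fix n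
  have "integrable (lebesgue_on (cball 0 (real n))) u" using assms by (auto simp: L1_loc_def)
  then show "(\<lambda>x. indicator (cball 0 (real n)) x *\<^sub>R u x) \<in> borel_measurable lebesgue"
    by (simp only: integrable_lebesgue_on[OF lmeasurable_cball[THEN fmeasurableD]] borel_measurable_integrable)
next
  fix x :: 'a
  obtain N where "norm x \<le> real N" using real_arch_simple by blast
  then have "\<forall>\<^sub>F n in sequentially. u x = indicator (cball 0 (real n)) x *\<^sub>R u x"
    by (intro eventually_sequentiallyI[of N]) (auto simp: indicator_def)
  then show "(\<lambda>n. indicator (cball 0 (real n)) x *\<^sub>R u x) \<longlonglongrightarrow> u x"
    by (rule Lim_transform_eventually[OF tendsto_const])
qed

lemma AE_lborel_imp_Ex: "AE x in lborel. P (x::'a::euclidean_space) \<Longrightarrow> \<exists>x. P x"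
proof (rule ccontr)
  assume "AE x in lborel. P x" "\<not> (\<exists>x. P x)"
  then have "AE x in (lborel :: 'a measure). \<not> (True :: bool)" by simp
  then have "emeasure lborel {x \<in> space (lborel :: 'a measure). True} = 0" by (rule emeasure_eq_0_AE)
  then show False by simp
qed

text \<open>Every convolution of \<open>u\<close> has zero gradient and is constant, so by the
  fundamental lemma \<open>u\<close> agrees almost everywhere with each of its translates. Fubini
  then yields one point whose value is taken almost everywhere.\<close>

lemma weak_gradient_zero_imp_const:
  fixes u :: "'a::euclidean_space \<Rightarrow> real"
  assumes u: "weak_gradient UNIV u g" and g: "AE x in lebesgue. g x = 0"
  shows "\<exists>c. AE x in lebesgue. u x = c"
proof -
  have uloc: "u \<in> L1_loc UNIV" using u by (simp add: weak_gradient_def)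
  have const: "conv u \<rho> x = conv u \<rho> 0" if \<rho>: "\<rho> \<in> test_functions UNIV" for \<rho> x
  proof -
    have z: "conv g \<rho> x = 0" for x unfolding conv_def
      by (rule integral_eq_zero_AE) (use g in eventually_elim, simp)
    have "\<bar>conv u \<rho> x - conv u \<rho> 0\<bar> \<le> 0 * norm (x - 0)"
      by (rule GDERIV_bounded_imp_lipschitz[where G="\<lambda>x. conv g \<rho> x", OF convex_UNIV])
         (use conv_GDERIV[OF u \<rho>] z in auto)
    then show ?thesis by simp
  qed
  have um: "u \<in> borel_measurable lebesgue" by (rule L1_loc_UNIV_measurable[OF uloc])
  have transl: "AE y in lebesgue. u (y0 + 1 *\<^sub>R y) = u y" for y0
  proof -
    have shift: "(\<lambda>y. u (y0 + 1 *\<^sub>R y)) \<in> L1_loc UNIV"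
      unfolding L1_loc_def
    proof safe
      fix C :: "'a set" assume C: "compact C"
      let ?C = "(\<lambda>y. y0 + y) ` C"
      have Cs: "C \<in> sets lebesgue" "?C \<in> sets lebesgue" "compact ?C"
        using C by (auto simp: compact_imp_closed compact_translation closed_translation)
      have "integrable (lebesgue_on ?C) u" using uloc Cs(3) by (simp add: L1_loc_def)
      then have "integrable lebesgue (\<lambda>x. indicator ?C x *\<^sub>R u x)"
        by (simp only: integrable_lebesgue_on[OF Cs(2)])
      then have "integrable lebesgue (\<lambda>x. indicator ?C (y0 + 1 *\<^sub>R x) *\<^sub>R u (y0 + 1 *\<^sub>R x))"
        using integrable_affine_iff[of 1 "\<lambda>x. indicator ?C x *\<^sub>R u x" y0] borel_measurable_integrable by auto
      also have "(\<lambda>x. indicator ?C (y0 + 1 *\<^sub>R x) *\<^sub>R u (y0 + 1 *\<^sub>R x)) = (\<lambda>x. indicator C x *\<^sub>R u (y0 + 1 *\<^sub>R x))"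
        by (auto simp: indicator_def image_iff)
      finally show "integrable (lebesgue_on C) (\<lambda>y. u (y0 + 1 *\<^sub>R y))" by (simp only: integrable_lebesgue_on[OF Cs(1)])
    qed
    have "AE y in lebesgue_on UNIV. 1 *\<^sub>R u (y0 + 1 *\<^sub>R y) + (-1) *\<^sub>R u y = 0"
    proof (rule fundamental_lemma[OF open_UNIV L1_loc_lincomb[OF shift uloc]])
      fix \<phi> :: "'a \<Rightarrow> real" assume \<phi>: "\<phi> \<in> test_functions UNIV"
      \<comment> \<open>Reflected, so that the value of \<open>conv u \<rho>\<close> at
        \<open>y0\<close> is the pairing of \<open>\<phi>\<close> with the translate of
        \<open>u\<close> by \<open>y0\<close>.\<close>
      define \<rho> where "\<rho> t = \<phi> (0 - t)" for t
      have \<rho>: "\<rho> \<in> test_functions UNIV" unfolding \<rho>_def by (rule test_functions_reflect[OF \<phi>])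
      have [simp]: "UNIV \<in> sets lebesgue" by simp
      have "(LINT y|lebesgue. \<phi> y *\<^sub>R u (y0 + 1 *\<^sub>R y)) = (LINT y|lebesgue. \<phi> (y - y0) *\<^sub>R u y)"
        using integral_affine[of 1 "\<lambda>y. \<phi> (y - y0) *\<^sub>R u y" y0]
          borel_measurable_integrable[OF conv_integrable[OF uloc \<rho>, of y0]]
        by (simp add: \<rho>_def)
      also have "\<dots> = conv u \<rho> y0" by (simp add: conv_def \<rho>_def)
      also have "\<dots> = conv u \<rho> 0" by (rule const[OF \<rho>])
      also have "\<dots> = (LINT y|lebesgue. \<phi> y *\<^sub>R u y)" by (simp add: conv_def \<rho>_def)
      finally have eq: "(LINT y|lebesgue. \<phi> y *\<^sub>R u (y0 + 1 *\<^sub>R y)) = (LINT y|lebesgue. \<phi> y *\<^sub>R u y)" .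
      have "(LINT y|lebesgue. \<phi> y *\<^sub>R (1 *\<^sub>R u (y0 + 1 *\<^sub>R y) + (-1) *\<^sub>R u y))
          = (LINT y|lebesgue. \<phi> y *\<^sub>R u (y0 + 1 *\<^sub>R y)) - (LINT y|lebesgue. \<phi> y *\<^sub>R u y)"
        using integrable_test_scaleR(2)[OF _ shift \<phi>] integrable_test_scaleR(2)[OF _ uloc \<phi>]
        by (subst Bochner_Integration.integral_diff[symmetric]) (simp_all add: algebra_simps)
      then show "(LINT y|lebesgue_on UNIV. \<phi> y *\<^sub>R (1 *\<^sub>R u (y0 + 1 *\<^sub>R y) + (-1) *\<^sub>R u y)) = 0"
        by (simp only: eq lebesgue_on_UNIV_eq diff_self)
    qed
    then show ?thesis unfolding lebesgue_on_UNIV_eq by simp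
  qed
  obtain v where [measurable]: "v \<in> borel_measurable borel" and v: "AE x in lebesgue. u x = v x"
    using borel_version[OF um] .
  have "AE y in lborel. v (y0 + y) = v y" for y0
  proof -
    have "AE y in lebesgue. v (y0 + 1 *\<^sub>R y) = v y"
      using transl[of y0] v AE_affine[of 1, OF _ v, of y0] by (auto elim: eventually_elim2)
    then show ?thesis by (simp add: AE_completion_iff)
  qed
  then have "AE y0 in lborel. AE y in lborel. v (y0 + y) = v y" by simp
  \<comment> \<open>Exchanging the two quantifiers requires joint measurability, hence the Borel
    version \<open>v\<close>.\<close>
  then have "AE y in lborel. AE y0 in lborel. v (y0 + y) = v y"
    by (subst (asm) lborel_pair.AE_commute) measurable
  then obtain y where "AE y0 in lborel. v (y0 + y) = v y" using AE_lborel_imp_Ex by blast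
  then have "AE y0 in lebesgue. v (y0 + y) = v y" by (rule AE_completion)
  from AE_affine[of 1, OF _ this, of "- y"] have "AE x in lebesgue. v x = v y" by simp
  with v have "AE x in lebesgue. u x = v y" by eventually_elim simp
  then show ?thesis by blast
qed

section \<open>Density of test functions in the Beppo-Levi space\<close>

lemma continuous_AE_zero:
  fixes f :: "'a::euclidean_space \<Rightarrow> 'b::euclidean_space"
  assumes "continuous_on UNIV f" "AE x in lebesgue. f x = 0"
  shows "f x = 0"
proof -
  let ?N = "{x. f x \<noteq> 0}"
  have op: "open ?N" by (rule open_Collect_neq[OF assms(1) continuous_on_const])
  then have "?N \<in> sets lebesgue" by simp
  then have "?N \<in> null_sets lebesgue" using assms(2) by (simp add: AE_iff_null_sets)
  then have "?N = {}" using op open_not_negligible by (auto simp: negligible_iff_null_sets)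
  then show ?thesis by auto
qed

lemma integral_L2_bound:
  fixes f g :: "'a::euclidean_space \<Rightarrow> 'b::euclidean_space"
  assumes "f \<in> L2 UNIV" "g \<in> L2 UNIV"
  shows "integrable lebesgue (\<lambda>x. norm (f x) * norm (g x))"
proof -
  have n: "(\<lambda>x. norm (h x)) \<in> L2 UNIV" if "h \<in> L2 UNIV" for h :: "'a \<Rightarrow> 'b"
    using that by (auto simp: L2_UNIV_iff)
  show ?thesis using integrable_inner_L2[OF n[OF assms(1)] n[OF assms(2)]] by simp
qed

text \<open>Caccioppoli: test the equation with \<open>V\<close> times a cut-off of scale \<open>n\<close>, whose gradient is of order \<open>1/n\<close>.\<close>

lemma harmonic_L2_zero:
  fixes V :: "'a::euclidean_space \<Rightarrow> real"
  assumes smooth: "\<And>k. C_k k V" and K: "\<And>x. GDERIV V x :> K x" "continuous_on UNIV K"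
    and V2: "V \<in> L2 UNIV" and K2: "K \<in> L2 UNIV"
    and orth: "\<And>\<phi>. \<phi> \<in> test_functions UNIV \<Longrightarrow> (LINT x|lebesgue. K x \<bullet> grad \<phi> x) = 0"
  shows "K x = 0"
proof -
  define \<eta> where "\<eta> = bump (- One) (One::'a) 1"
  have \<eta>: "\<eta> \<in> test_functions UNIV" unfolding \<eta>_def by (rule bump_test_function) auto
  have \<eta>0: "\<eta> 0 > 0"
  proof -
    have "\<eta> 0 \<noteq> 0" unfolding \<eta>_def by (subst bump_nonzero_iff) (auto simp: mem_box)
    then show ?thesis using bump_bounds(1)[of "- One" One 1 0] by (simp add: \<eta>_def less_le)
  qed
  obtain M where M: "M > 0" "\<And>x. norm (\<eta> x) \<le> M" "\<And>x. norm (grad \<eta> x) \<le> M"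
    using test_functions_bounds[OF \<eta>] by metis
  define c where "c n = 1 / real (Suc n)" for n
  define \<zeta> where "\<zeta> n x = \<eta> (0 + c n *\<^sub>R x)" for n x
  have \<zeta>: "\<zeta> n \<in> test_functions UNIV" for n
    unfolding \<zeta>_def by (rule test_functions_affine[OF \<eta>]) (auto simp: c_def)
  have g\<zeta>: "grad (\<zeta> n) x = c n *\<^sub>R grad \<eta> (0 + c n *\<^sub>R x)" for n x
    unfolding \<zeta>_def by (rule grad_affine[OF \<eta>])
  have Vm: "V \<in> borel_measurable lebesgue" and Km: "K \<in> borel_measurable lebesgue"
    using V2 K2 by (auto simp: L2_UNIV_iff)
  have K2i: "integrable lebesgue (\<lambda>x. (norm (K x))\<^sup>2)" using K2 by (simp add: L2_UNIV_iff)
  have VK: "integrable lebesgue (\<lambda>x. \<bar>V x\<bar> * norm (K x))"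
  proof (rule Bochner_Integration.integrable_bound)
    show "integrable lebesgue (\<lambda>x. (V x)\<^sup>2 + (norm (K x))\<^sup>2)" using V2 K2 by (auto simp: L2_UNIV_iff)
    have "\<bar>a\<bar> * b \<le> a\<^sup>2 + b\<^sup>2" if "b \<ge> 0" for a b :: real
    proof -
      have "2 * (\<bar>a\<bar> * b) \<le> a\<^sup>2 + b\<^sup>2" using sum_squares_bound[of "\<bar>a\<bar>" b] by (simp add: mult.assoc)
      moreover have "0 \<le> \<bar>a\<bar> * b" using that by simp
      ultimately show ?thesis by linarith
    qed
    then show "AE x in lebesgue. norm (\<bar>V x\<bar> * norm (K x)) \<le> norm ((V x)\<^sup>2 + (norm (K x))\<^sup>2)"
      by (intro AE_I2) (simp add: abs_mult)
  qed (use Vm Km in measurable)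
  have eq: "(LINT x|lebesgue. \<zeta> n x * (norm (K x))\<^sup>2) = - (LINT x|lebesgue. V x * (K x \<bullet> grad (\<zeta> n) x))"
    and bnd: "norm (LINT x|lebesgue. V x * (K x \<bullet> grad (\<zeta> n) x)) \<le> c n * (M * (LINT x|lebesgue. \<bar>V x\<bar> * norm (K x)))" for n
  proof -
    have z1: "\<bar>\<zeta> n x\<bar> \<le> M" for x using M(2) by (simp add: \<zeta>_def)
    have z2: "norm (grad (\<zeta> n) x) \<le> c n * M" for x
      using M(3) by (simp add: g\<zeta> c_def divide_right_mono)
    note zm = test_functions_measurable(3,4)[OF \<zeta>[of n]]
    have i1: "integrable lebesgue (\<lambda>x. \<zeta> n x * (norm (K x))\<^sup>2)"
    proof (rule Bochner_Integration.integrable_bound)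
      show "integrable lebesgue (\<lambda>x. M * (norm (K x))\<^sup>2)" using K2i by simp
      show "AE x in lebesgue. norm (\<zeta> n x * (norm (K x))\<^sup>2) \<le> norm (M * (norm (K x))\<^sup>2)"
        using z1 M(1) by (auto simp: abs_mult intro!: mult_right_mono)
    qed (use zm Km in measurable)
    have pt: "norm (V x * (K x \<bullet> grad (\<zeta> n) x)) \<le> c n * M * (\<bar>V x\<bar> * norm (K x))" for x
    proof -
      have "\<bar>K x \<bullet> grad (\<zeta> n) x\<bar> \<le> norm (K x) * (c n * M)"
        by (rule order_trans[OF Cauchy_Schwarz_ineq2 mult_left_mono[OF z2]]) simp
      then have "\<bar>V x\<bar> * \<bar>K x \<bullet> grad (\<zeta> n) x\<bar> \<le> \<bar>V x\<bar> * (norm (K x) * (c n * M))" by (intro mult_left_mono) auto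
      then show ?thesis by (simp add: abs_mult ac_simps)
    qed
    have i2: "integrable lebesgue (\<lambda>x. V x * (K x \<bullet> grad (\<zeta> n) x))"
    proof (rule Bochner_Integration.integrable_bound)
      show "integrable lebesgue (\<lambda>x. c n * M * (\<bar>V x\<bar> * norm (K x)))" using VK by simp
      show "AE x in lebesgue. norm (V x * (K x \<bullet> grad (\<zeta> n) x)) \<le> norm (c n * M * (\<bar>V x\<bar> * norm (K x)))"
        by (intro AE_I2) (rule order_trans[OF pt], simp)
      show "(\<lambda>x. V x * (K x \<bullet> grad (\<zeta> n) x)) \<in> borel_measurable lebesgue"
        by (intro borel_measurable_times borel_measurable_inner Vm Km zm)
    qed
    have t: "(\<lambda>x. \<zeta> n x * V x) \<in> test_functions UNIV" by (rule test_functions_mult_smooth[OF \<zeta> smooth])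
    have gt: "grad (\<lambda>x. \<zeta> n x * V x) x = \<zeta> n x *\<^sub>R K x + V x *\<^sub>R grad (\<zeta> n) x" for x
      by (rule grad_eqI[OF GDERIV_mult[OF test_functionsD(3)[OF \<zeta>] K(1)]])
    have "0 = (LINT x|lebesgue. K x \<bullet> grad (\<lambda>x. \<zeta> n x * V x) x)" using orth[OF t] by simp
    also have "\<dots> = (LINT x|lebesgue. \<zeta> n x * (norm (K x))\<^sup>2 + V x * (K x \<bullet> grad (\<zeta> n) x))"
      by (simp add: gt inner_add_right power2_norm_eq_inner)
    also have "\<dots> = (LINT x|lebesgue. \<zeta> n x * (norm (K x))\<^sup>2) + (LINT x|lebesgue. V x * (K x \<bullet> grad (\<zeta> n) x))"
      by (rule Bochner_Integration.integral_add[OF i1 i2])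
    finally show "(LINT x|lebesgue. \<zeta> n x * (norm (K x))\<^sup>2) = - (LINT x|lebesgue. V x * (K x \<bullet> grad (\<zeta> n) x))" by simp
    have "norm (LINT x|lebesgue. V x * (K x \<bullet> grad (\<zeta> n) x)) \<le> (LINT x|lebesgue. c n * M * (\<bar>V x\<bar> * norm (K x)))"
      using pt VK i2 by (intro integral_norm_bound[THEN order_trans] integral_mono) auto
    then show "norm (LINT x|lebesgue. V x * (K x \<bullet> grad (\<zeta> n) x)) \<le> c n * (M * (LINT x|lebesgue. \<bar>V x\<bar> * norm (K x)))"
      by simp
  qed
  have c0: "c \<longlonglongrightarrow> 0" unfolding c_def by (rule LIMSEQ_Suc[OF lim_1_over_n])
  \<comment> \<open>The cut-offs tend pointwise to the positive constant \<open>\<eta> 0\<close>,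
    while by \<open>eq\<close> and \<open>bnd\<close> the same integrals are of order
    \<open>c n\<close>.\<close>
  have "(\<lambda>n. LINT x|lebesgue. \<zeta> n x * (norm (K x))\<^sup>2) \<longlonglongrightarrow> (LINT x|lebesgue. \<eta> 0 * (norm (K x))\<^sup>2)"
  proof (rule integral_dominated_convergence[where w="\<lambda>x. M * (norm (K x))\<^sup>2"])
    show "AE x in lebesgue. (\<lambda>n. \<zeta> n x * (norm (K x))\<^sup>2) \<longlonglongrightarrow> \<eta> 0 * (norm (K x))\<^sup>2"
    proof (rule AE_I2)
      fix x :: 'a
      have "(\<lambda>n. 0 + c n *\<^sub>R x) \<longlonglongrightarrow> 0 + 0 *\<^sub>R x" by (intro tendsto_intros c0)
      then have "(\<lambda>n. \<eta> (0 + c n *\<^sub>R x)) \<longlonglongrightarrow> \<eta> 0"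
        using continuous_on_tendsto_compose[OF test_functionsD(2)[OF \<eta>], of "\<lambda>n. 0 + c n *\<^sub>R x" 0] by simp
      then show "(\<lambda>n. \<zeta> n x * (norm (K x))\<^sup>2) \<longlonglongrightarrow> \<eta> 0 * (norm (K x))\<^sup>2"
        unfolding \<zeta>_def by (intro tendsto_intros)
    qed
    show "(\<lambda>x. \<zeta> n x * (norm (K x))\<^sup>2) \<in> borel_measurable lebesgue" for n
      using test_functions_measurable(3)[OF \<zeta>[of n]] Km by measurable
    show "(\<lambda>x. \<eta> 0 * (norm (K x))\<^sup>2) \<in> borel_measurable lebesgue" using Km by measurable
    show "AE x in lebesgue. norm (\<zeta> n x * (norm (K x))\<^sup>2) \<le> M * (norm (K x))\<^sup>2" for n
      using M(2) by (auto simp: abs_mult \<zeta>_def intro!: mult_right_mono)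
  qed (use K2i in simp)
  moreover have "(\<lambda>n. LINT x|lebesgue. \<zeta> n x * (norm (K x))\<^sup>2) \<longlonglongrightarrow> 0"
  proof (rule Lim_null_comparison)
    show "\<forall>\<^sub>F n in sequentially. norm (LINT x|lebesgue. \<zeta> n x * (norm (K x))\<^sup>2) \<le> c n * (M * (LINT x|lebesgue. \<bar>V x\<bar> * norm (K x)))"
      using bnd by (intro always_eventually) (simp add: eq)
    show "(\<lambda>n. c n * (M * (LINT x|lebesgue. \<bar>V x\<bar> * norm (K x)))) \<longlonglongrightarrow> 0"
      by (rule tendsto_mult_left_zero[OF c0])
  qed
  ultimately have "(LINT x|lebesgue. \<eta> 0 * (norm (K x))\<^sup>2) = 0" by (rule LIMSEQ_unique)
  then have "(LINT x|lebesgue. (norm (K x))\<^sup>2) = 0" using \<eta>0 by simp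
  then have "AE x in lebesgue. (norm (K x))\<^sup>2 = 0"
    using integral_nonneg_eq_0_iff_AE[OF K2i] by simp
  then have "AE x in lebesgue. K x = 0" by simp
  then show ?thesis by (rule continuous_AE_zero[OF K(2)])
qed

text \<open>By Fubini the kernel moves, reflected, from the field \<open>h\<close> to the test
  function, whose convolution with it is again a test function.\<close>

lemma conv_orthogonal:
  fixes h :: "'a::euclidean_space \<Rightarrow> 'a"
  assumes h: "h \<in> L2 UNIV" and orth: "\<And>\<phi>. \<phi> \<in> test_functions UNIV \<Longrightarrow> (LINT x|lebesgue. h x \<bullet> grad \<phi> x) = 0"
    and \<rho>: "\<rho> \<in> test_functions UNIV" and \<phi>: "\<phi> \<in> test_functions UNIV"
  shows "(LINT x|lebesgue. conv h \<rho> x \<bullet> grad \<phi> x) = 0"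
proof -
  have hloc: "h \<in> L1_loc UNIV" by (rule L2_imp_L1_loc) (use h in auto)
  note [measurable] = test_functions_measurable(1,2)[OF \<rho>] test_functions_measurable(1,2)[OF \<phi>]
  obtain g where [measurable]: "g \<in> borel_measurable borel" and g: "AE x in lebesgue. h x = g x"
    using borel_version h by (auto simp: L2_UNIV_iff)
  obtain S where S: "compact S" "\<And>x. x \<notin> S \<Longrightarrow> \<phi> x = 0" "\<And>x. x \<notin> S \<Longrightarrow> grad \<phi> x = 0"
    using test_functions_support[OF \<phi>] by metis
  obtain T where T: "compact T" "\<And>x. x \<notin> T \<Longrightarrow> \<rho> x = 0"
    using test_functions_support[OF \<rho>] by metis
  obtain r where r: "r > 0" "S \<subseteq> ball 0 r" using bounded_subset_ball0[OF compact_imp_bounded[OF S(1)]] .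
  obtain s where s: "s > 0" "T \<subseteq> ball 0 s" using bounded_subset_ball0[OF compact_imp_bounded[OF T(1)]] .
  obtain M where M: "M > 0" "\<And>x. norm (\<rho> x) \<le> M" using test_functions_bounds[OF \<rho>] by metis
  obtain N where N: "N > 0" "\<And>x. norm (grad \<phi> x) \<le> N" using test_functions_bounds[OF \<phi>] by metis
  define B where "B = cball (0::'a) (r + s)"
  have [measurable]: "B \<in> sets borel" "cball (0::'a) r \<in> sets borel" by (simp_all add: B_def)
  have supp: "x \<in> cball 0 r \<and> y \<in> B" if "\<rho> (x - y) \<noteq> 0" "x \<in> S" for x y
  proof -
    have "norm x < r" "norm (x - y) < s" using that T(2)[of "x - y"] r(2) s(2) by (auto simp: subset_eq)
    then show ?thesis using norm_triangle_ineq4[of x "x - y"] by (simp add: B_def)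
  qed
  \<comment> \<open>the reflected kernel turns the convolution of a gradient field back into a gradient\<close>
  define \<rho>' where "\<rho>' t = \<rho> (0 - t)" for t
  have \<rho>': "\<rho>' \<in> test_functions UNIV" unfolding \<rho>'_def by (rule test_functions_reflect[OF \<rho>])
  define \<psi> where "\<psi> = conv \<phi> \<rho>'"
  have \<phi>wg: "weak_gradient UNIV \<phi> (grad \<phi>)" by (rule weak_gradient_test_function[OF \<phi>]) simp
  have \<phi>loc: "\<phi> \<in> L1_loc UNIV" "grad \<phi> \<in> L1_loc UNIV" using \<phi>wg by (auto simp: weak_gradient_def)
  have \<psi>g: "GDERIV \<psi> x :> conv (grad \<phi>) \<rho>' x" for x
    unfolding \<psi>_def by (rule conv_GDERIV[OF \<phi>wg \<rho>'])
  have \<psi>: "\<psi> \<in> test_functions UNIV"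
  proof (rule test_functionsI[of _ B])
    show "C_k k \<psi>" for k unfolding \<psi>_def by (rule C_k_conv[OF \<phi>loc(1) \<rho>'])
    show "\<psi> y = 0" if "y \<notin> B" for y
    proof -
      have "\<rho>' (y - x) *\<^sub>R \<phi> x = 0" for x
        using supp[of x y] that S(2)[of x] by (cases "x \<in> S") (auto simp: \<rho>'_def)
      then have "(\<lambda>x. \<rho>' (y - x) *\<^sub>R \<phi> x) = (\<lambda>x. 0)" by blast
      then show ?thesis unfolding \<psi>_def conv_def by simp
    qed
  qed (auto simp: B_def)
  define f where "f x y = \<rho> (x - y) * (g y \<bullet> grad \<phi> x)" for x y
  \<comment> \<open>Where \<open>f\<close> does not vanish, both variables stay in fixed balls:
    \<open>x\<close> by the support of \<open>\<phi>\<close>, then \<open>y\<close> by that of the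
    kernel. There \<open>\<rho>\<close> and \<open>grad \<phi>\<close> are bounded by
    \<open>M\<close> and \<open>N\<close>, and \<open>g\<close> is integrable.\<close>
  have fint: "integrable (lborel \<Otimes>\<^sub>M lborel) (case_prod f)"
  proof (rule integrableI_bounded)
    show "case_prod f \<in> borel_measurable (lborel \<Otimes>\<^sub>M lborel)" unfolding f_def by measurable
    have "(\<integral>\<^sup>+p. ennreal (norm (case_prod f p)) \<partial>(lborel \<Otimes>\<^sub>M lborel)) = (\<integral>\<^sup>+x. \<integral>\<^sup>+y. ennreal (norm (f x y)) \<partial>lborel \<partial>lborel)"
      unfolding f_def by (subst lborel.nn_integral_fst[symmetric]) (simp_all add: split_beta, measurable)
    also have "\<dots> \<le> (\<integral>\<^sup>+x. \<integral>\<^sup>+y. (ennreal (M * N) * indicator (cball 0 r) x) * ennreal (norm (indicator B y *\<^sub>R g y)) \<partial>lborel \<partial>(lborel :: 'a measure))"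
    proof (intro nn_integral_mono)
      fix x y :: 'a
      show "ennreal (norm (f x y)) \<le> (ennreal (M * N) * indicator (cball 0 r) x) * ennreal (norm (indicator B y *\<^sub>R g y))"
      proof (cases "f x y = 0")
        case False
        then have "x \<in> S" "\<rho> (x - y) \<noteq> 0" using S(3)[of x] by (cases "x \<in> S"; simp add: f_def)+
        then have xy: "x \<in> cball 0 r" "y \<in> B" using supp by auto
        have "norm (f x y) \<le> M * (norm (g y) * N)"
          unfolding f_def norm_mult using M(2)[of "x - y"] N M(1)
          by (intro mult_mono) (auto intro!: order_trans[OF Cauchy_Schwarz_ineq2] mult_left_mono)
        then show ?thesis using xy M(1) N(1)
          by (simp add: ennreal_mult[symmetric] ac_simps del: mem_cball)
      qed simp
    qed
    also have "\<dots> = (\<integral>\<^sup>+x. (ennreal (M * N) * indicator (cball 0 r) x) * (\<integral>\<^sup>+y. ennreal (norm (indicator B y *\<^sub>R g y)) \<partial>lborel) \<partial>(lborel :: 'a measure))"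
      by (intro nn_integral_cong nn_integral_cmult) measurable
    also have "\<dots> = (\<integral>\<^sup>+x. ennreal (M * N) * indicator (cball 0 r) x \<partial>(lborel :: 'a measure)) * (\<integral>\<^sup>+y. ennreal (norm (indicator B y *\<^sub>R g y)) \<partial>lborel)"
      by (rule nn_integral_multc) measurable
    also have "(\<integral>\<^sup>+x. ennreal (M * N) * indicator (cball 0 r) x \<partial>(lborel :: 'a measure)) = ennreal (M * N) * emeasure lborel (cball (0::'a) r)"
      by (rule nn_integral_cmult_indicator) simp
    also have "\<dots> * (\<integral>\<^sup>+y. ennreal (norm (indicator B y *\<^sub>R g y)) \<partial>lborel) < \<infinity>"
    proof -
      have "integrable (lebesgue_on B) h" using hloc by (auto simp: L1_loc_def B_def)
      then have "integrable lebesgue (\<lambda>y. indicator B y *\<^sub>R h y)"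
        by (simp add: integrable_lebesgue_on B_def)
      then have "(\<integral>\<^sup>+y. ennreal (norm (indicator B y *\<^sub>R h y)) \<partial>lebesgue) < \<infinity>" by (simp add: integrable_iff_bounded)
      also have "(\<integral>\<^sup>+y. ennreal (norm (indicator B y *\<^sub>R h y)) \<partial>lebesgue) = (\<integral>\<^sup>+y. ennreal (norm (indicator B y *\<^sub>R g y)) \<partial>lebesgue)"
        by (rule nn_integral_cong_AE) (use g in eventually_elim, simp)
      finally show ?thesis
        using emeasure_lborel_cball_finite[of "0::'a" r] by (simp add: nn_integral_completion ennreal_mult_less_top)
    qed
    finally show "(\<integral>\<^sup>+p. ennreal (norm (case_prod f p)) \<partial>(lborel \<Otimes>\<^sub>M lborel)) < \<infinity>" .
  qed
  have "(LINT x|lebesgue. conv h \<rho> x \<bullet> grad \<phi> x) = (LINT x|lebesgue. (LINT y|lborel. f x y))"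
  proof (intro Bochner_Integration.integral_cong refl)
    fix x
    have "conv h \<rho> x \<bullet> grad \<phi> x = (LINT y|lebesgue. (\<rho> (x - y) *\<^sub>R h y) \<bullet> grad \<phi> x)"
      unfolding conv_def by (rule integral_inner_left[OF conv_integrable[OF hloc \<rho>], symmetric])
    also have "\<dots> = (LINT y|lebesgue. f x y)"
    proof (rule integral_cong_AE)
      show "(\<lambda>y. (\<rho> (x - y) *\<^sub>R h y) \<bullet> grad \<phi> x) \<in> borel_measurable lebesgue"
        using conv_integrable[OF hloc \<rho>, of x] by (intro borel_measurable_inner) auto
      show "(\<lambda>y. f x y) \<in> borel_measurable lebesgue" unfolding f_def by (intro measurable_completion) measurable
      show "AE y in lebesgue. (\<rho> (x - y) *\<^sub>R h y) \<bullet> grad \<phi> x = f x y"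
        using g by eventually_elim (simp add: f_def)
    qed
    also have "\<dots> = (LINT y|lborel. f x y)" by (rule integral_completion) (simp add: f_def, measurable)
    finally show "conv h \<rho> x \<bullet> grad \<phi> x = (LINT y|lborel. f x y)" .
  qed
  also have "\<dots> = (LINT x|lborel. (LINT y|lborel. f x y))"
    by (rule integral_completion) (simp add: f_def, measurable)
  also have "\<dots> = (LINT y|lborel. (LINT x|lborel. f x y))"
    by (rule lborel_pair.Fubini_integral[OF fint, symmetric])
  also have "\<dots> = (LINT y|lborel. g y \<bullet> grad \<psi> y)"
  proof (intro Bochner_Integration.integral_cong refl)
    fix y
    have "(LINT x|lborel. f x y) = (LINT x|lebesgue. f x y)"
      by (rule integral_completion[symmetric]) (simp add: f_def, measurable)
    also have "\<dots> = (LINT x|lebesgue. g y \<bullet> (\<rho>' (y - x) *\<^sub>R grad \<phi> x))" by (simp add: f_def \<rho>'_def)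
    also have "\<dots> = g y \<bullet> conv (grad \<phi>) \<rho>' y"
      unfolding conv_def by (rule integral_inner_right[OF conv_integrable[OF \<phi>loc(2) \<rho>']])
    finally show "(LINT x|lborel. f x y) = g y \<bullet> grad \<psi> y" using grad_eqI[OF \<psi>g[of y]] by simp
  qed
  also have "\<dots> = (LINT y|lebesgue. g y \<bullet> grad \<psi> y)"
    using test_functions_measurable(2)[OF \<psi>] by (intro integral_completion[symmetric]) measurable
  also have "\<dots> = (LINT y|lebesgue. h y \<bullet> grad \<psi> y)"
  proof (rule integral_cong_AE)
    show "(\<lambda>y. g y \<bullet> grad \<psi> y) \<in> borel_measurable lebesgue"
      using test_functions_measurable(2)[OF \<psi>] by (intro measurable_completion) measurable
    show "(\<lambda>y. h y \<bullet> grad \<psi> y) \<in> borel_measurable lebesgue"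
      using test_functions_measurable(4)[OF \<psi>] h by (auto simp: L2_UNIV_iff)
    show "AE y in lebesgue. g y \<bullet> grad \<psi> y = h y \<bullet> grad \<psi> y" using g by eventually_elim simp
  qed
  also have "\<dots> = 0" by (rule orth[OF \<psi>])
  finally show ?thesis .
qed

lemma integrable_const_lebesgue_imp_zero:
  assumes "integrable (lebesgue :: 'a::euclidean_space measure) (\<lambda>x. c :: real)"
  shows "c = 0"
proof (rule ccontr)
  assume "c \<noteq> 0"
  then have "integrable (lebesgue :: 'a measure) (\<lambda>x. indicat_real UNIV x)"
    using integrable_mult_right[of "1 / c", OF assms] by simp
  then have "emeasure (lebesgue :: 'a measure) UNIV < \<infinity>" by (subst (asm) integrable_indicator_iff) auto
  then show False by simp
qed

text \<open>A mollified potential \<open>U\<close> is weakly harmonic but need not be square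
  integrable, so the Caccioppoli lemma is applied to its translation differences, which are in L2 by
  the translation estimate. Hence the mollified gradient \<open>H\<close> is translation invariant,
  thus constant, and zero because it is square integrable over a space of infinite measure.\<close>

theorem BL_orthogonal_imp_zero:
  fixes u :: "'a::euclidean_space \<Rightarrow> real"
  assumes u: "u \<in> BL" and orth: "\<And>\<phi>. \<phi> \<in> test_functions UNIV \<Longrightarrow> gfield UNIV u \<bullet> cl (grad \<phi>) = 0"
  shows "gfield UNIV u = 0"
proof -
  define h where "h = wgrad UNIV u"
  have h: "h \<in> L2 UNIV" and wg: "weak_gradient UNIV u h" and gu: "gfield UNIV u = cl h"
    using BL_D[OF u] by (auto simp: h_def)
  have uloc: "u \<in> L1_loc UNIV" and hloc: "h \<in> L1_loc UNIV" using wg by (auto simp: weak_gradient_def)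
  have orth_h: "(LINT x|lebesgue. h x \<bullet> grad \<phi> x) = 0" if "\<phi> \<in> test_functions UNIV" for \<phi>
    using orth[OF that] inner_cl[OF h test_functions_L2(2)[OF that]] gu by simp
  have conv0: "conv h \<rho> x = 0" if \<rho>: "\<rho> \<in> test_functions UNIV" for \<rho> x
  proof -
    define U where "U = conv u \<rho>"
    define H where "H = conv h \<rho>"
    have Uk: "C_k k U" for k unfolding U_def by (rule C_k_conv[OF uloc \<rho>])
    have UH: "GDERIV U x :> H x" for x unfolding U_def H_def by (rule conv_GDERIV[OF wg \<rho>])
    have Hc: "continuous_on UNIV H" unfolding H_def by (rule continuous_on_conv[OF hloc \<rho>])
    have H2: "H \<in> L2 UNIV" unfolding H_def by (rule conv_L2[OF h \<rho>])
    have Hm: "H \<in> borel_measurable lebesgue" using H2 by (simp add: L2_UNIV_iff)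
    have transl: "H (y + 1 *\<^sub>R x) - H x = 0" for x y
    proof (rule harmonic_L2_zero[where V="\<lambda>x. U (y + 1 *\<^sub>R x) - U x" and K="\<lambda>x. H (y + 1 *\<^sub>R x) - H x"])
      show "C_k k (\<lambda>x. U (y + 1 *\<^sub>R x) - U x)" for k
        using C_k_add[OF C_k_affine[OF Uk, of k y 1] C_k_cmult[OF Uk, of k "-1"]] by simp
      show g: "GDERIV (\<lambda>x. U (y + 1 *\<^sub>R x) - U x) x :> H (y + 1 *\<^sub>R x) - H x" for x
        using GDERIV_diff[OF GDERIV_affine[OF UH, of y 1 x] UH[of x]] by simp
      show cont: "continuous_on UNIV (\<lambda>x. H (y + 1 *\<^sub>R x) - H x)"
        by (intro continuous_intros continuous_on_compose2[OF Hc] Hc) auto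
      have Hy2: "(\<lambda>x. H (y + 1 *\<^sub>R x)) \<in> L2 UNIV"
        using H2 measurable_affine[of 1 H y] integrable_affine_iff[of 1 "\<lambda>x. (norm (H x))\<^sup>2" y] Hm
        by (simp add: L2_UNIV_iff)
      then show "(\<lambda>x. H (y + 1 *\<^sub>R x) - H x) \<in> L2 UNIV" by (intro L2_diff H2)
      show "(\<lambda>x. U (y + 1 *\<^sub>R x) - U x) \<in> L2 UNIV"
        unfolding L2_UNIV_nn_integral_iff
      proof
        have "continuous_on UNIV (\<lambda>x. U (y + 1 *\<^sub>R x) - U x)"
          using GDERIV_imp_isCont[OF g] by (auto intro: continuous_at_imp_continuous_on)
        then show "(\<lambda>x. U (y + 1 *\<^sub>R x) - U x) \<in> borel_measurable lebesgue"
          by (rule continuous_on_imp_lebesgue_measurable)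
        have "(\<integral>\<^sup>+x. ennreal ((norm (U (y + 1 *\<^sub>R x) - U x))\<^sup>2) \<partial>lebesgue) = (\<integral>\<^sup>+x. ennreal ((U (x + y) - U x)\<^sup>2) \<partial>lborel)"
          by (simp add: nn_integral_completion add.commute)
        also have "\<dots> \<le> ennreal ((norm y)\<^sup>2) * (\<integral>\<^sup>+x. ennreal ((norm (H x))\<^sup>2) \<partial>lborel)"
          by (rule nn_integral_translation_estimate[OF UH Hc])
        also have "\<dots> < \<infinity>"
          using H2 unfolding L2_UNIV_nn_integral_iff by (simp add: nn_integral_completion ennreal_mult_less_top)
        finally show "(\<integral>\<^sup>+x. ennreal ((norm (U (y + 1 *\<^sub>R x) - U x))\<^sup>2) \<partial>lebesgue) < \<infinity>" .
      qed
      fix \<phi> :: "'a \<Rightarrow> real" assume \<phi>: "\<phi> \<in> test_functions UNIV"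
      have \<phi>y: "(\<lambda>x. \<phi> (- y + 1 *\<^sub>R x)) \<in> test_functions UNIV" by (rule test_functions_affine[OF \<phi>]) auto
      have "(LINT x|lebesgue. H x \<bullet> grad (\<lambda>x. \<phi> (- y + 1 *\<^sub>R x)) x) = (LINT x|lebesgue. H (y + 1 *\<^sub>R x) \<bullet> grad \<phi> x)"
      proof -
        have "(\<lambda>x. H x \<bullet> grad (\<lambda>x. \<phi> (- y + 1 *\<^sub>R x)) x) \<in> borel_measurable lebesgue"
          using Hm test_functions_measurable(4)[OF \<phi>y] by (intro borel_measurable_inner)
        from integral_affine[of 1, OF _ this, of y] show ?thesis
          by (simp add: grad_affine[OF \<phi>, of "-y" 1, simplified])
      qed
      moreover have "(LINT x|lebesgue. (H (y + 1 *\<^sub>R x) - H x) \<bullet> grad \<phi> x)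
          = (LINT x|lebesgue. H (y + 1 *\<^sub>R x) \<bullet> grad \<phi> x) - (LINT x|lebesgue. H x \<bullet> grad \<phi> x)"
        unfolding inner_diff_left
        by (intro Bochner_Integration.integral_diff integrable_inner_L2 Hy2 H2 test_functions_L2[OF \<phi>])
      ultimately show "(LINT x|lebesgue. (H (y + 1 *\<^sub>R x) - H x) \<bullet> grad \<phi> x) = 0"
        using conv_orthogonal[OF h orth_h \<rho> \<phi>] conv_orthogonal[OF h orth_h \<rho> \<phi>y] by (simp add: H_def)
    qed
    have Hconst: "H x = H 0" for x using transl[of x 0] by simp
    have "(\<lambda>x. (norm (H x))\<^sup>2) = (\<lambda>x. (norm (H 0))\<^sup>2)"
    proof
      show "(norm (H x))\<^sup>2 = (norm (H 0))\<^sup>2" for x by (simp only: Hconst[of x])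
    qed
    then have "integrable lebesgue (\<lambda>x::'a. (norm (H 0))\<^sup>2)"
      using H2 unfolding L2_UNIV_iff by argo
    then have "H 0 = 0" by (drule_tac integrable_const_lebesgue_imp_zero) simp
    then show "conv h \<rho> x = 0" using Hconst[of x] by (simp add: H_def)
  qed
  have "AE x in lebesgue_on UNIV. h x = 0"
  proof (rule fundamental_lemma[OF open_UNIV hloc])
    fix \<phi> :: "'a \<Rightarrow> real" assume \<phi>: "\<phi> \<in> test_functions UNIV"
    show "(LINT x|lebesgue_on UNIV. \<phi> x *\<^sub>R h x) = 0"
      using conv0[OF test_functions_reflect(1)[OF \<phi>, of 0], of 0] by (simp add: conv_def lebesgue_on_UNIV_eq)
  qed
  then have "AE x in lebesgue. h x = (\<lambda>x. 0) x" unfolding lebesgue_on_UNIV_eq .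
  then have "cl h = cl (\<lambda>x. 0)" by (rule cl_cong[OF h])
  then show ?thesis by (simp add: gu zero_ell2_def)
qed

text \<open>The projection onto \<open>gradspace UNIV\<close> is itself the gradient of some
  \<open>v \<in> BL\<close>, so the residual is a Beppo-Levi gradient orthogonal to all gradients of
  test functions, and it vanishes.\<close>

theorem gfield_BL_in_gradspace:
  fixes u :: "'a::euclidean_space \<Rightarrow> real"
  assumes u: "u \<in> BL"
  shows "gfield UNIV u \<in> gradspace UNIV"
proof -
  obtain p where p: "p \<in> gradspace UNIV" "\<And>w. w \<in> gradspace UNIV \<Longrightarrow> (gfield UNIV u - p) \<bullet> w = 0"
    using closed_subspace_projection[OF subspace_gradspace closed_gradspace] by metis
  obtain v where v: "v \<in> BL" "gfield UNIV v = p" using gradspace_imp_BL[OF p(1)] .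
  have "gfield UNIV (\<lambda>x. u x - v x) = 0"
  proof (rule BL_orthogonal_imp_zero[OF BL_diff(1)[OF u v(1)]])
    fix \<phi> :: "'a \<Rightarrow> real" assume "\<phi> \<in> test_functions UNIV"
    from p(2)[OF cl_grad_in_gradspace[OF this]]
    show "gfield UNIV (\<lambda>x. u x - v x) \<bullet> cl (grad \<phi>) = 0"
      by (simp add: BL_diff(2)[OF u v(1)] v(2))
  qed
  then show ?thesis using p(1) by (simp add: BL_diff(2)[OF u v(1)] v(2))
qed

section \<open>Nemytskii operators\<close>

text \<open>The hypotheses are stable under shifting by a measurable field and under rescaling, with
  the same constants, so one set of estimates serves the operator on \<open>D\<close>, the blown-up
  operators and their limit. Measurability is assumed for superpositions, the form in which it
  enters the integrals.\<close>

locale monotone_field =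
  fixes A :: "'a::euclidean_space \<Rightarrow> 'a \<Rightarrow> 'a" and dA :: "'a \<Rightarrow> 'a \<Rightarrow> 'a \<Rightarrow> 'a" and c\<^sub>1 c\<^sub>2 c\<^sub>3 :: real
  assumes pos: "c\<^sub>1 > 0" "c\<^sub>2 > 0" "c\<^sub>3 > 0"
    and der: "(A x has_derivative dA x y) (at y)"
    and mono: "(A x y - A x y') \<bullet> (y - y') \<ge> c\<^sub>1 * (norm (y - y'))\<^sup>2"
    and lip: "norm (A x y - A x y') \<le> c\<^sub>2 * norm (y - y')"
    and dlip: "norm (dA x y v - dA x y' v) \<le> c\<^sub>3 * norm (y - y') * norm v"
    and meas: "f \<in> borel_measurable lebesgue \<Longrightarrow> (\<lambda>x. A x (f x)) \<in> borel_measurable lebesgue"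
    and dmeas: "f \<in> borel_measurable lebesgue \<Longrightarrow> g \<in> borel_measurable lebesgue \<Longrightarrow>
      (\<lambda>x. dA x (f x) (g x)) \<in> borel_measurable lebesgue"
begin

lemma dA_linear: "dA x y (u + v) = dA x y u + dA x y v" "dA x y (c *\<^sub>R u) = c *\<^sub>R dA x y u"
  "dA x y (u - v) = dA x y u - dA x y v" "dA x y 0 = 0"
proof -
  interpret bounded_linear "dA x y" using der by (rule has_derivative_bounded_linear)
  show "dA x y (u + v) = dA x y u + dA x y v" "dA x y (c *\<^sub>R u) = c *\<^sub>R dA x y u"
    "dA x y (u - v) = dA x y u - dA x y v" "dA x y 0 = 0"
    by (rule add scaleR diff zero)+
qed

text \<open>Mean value inequality for \<open>\<lambda>k. A x (y + k) - dA x y k\<close> on the ball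
  of radius \<open>norm k + norm k'\<close>, where its derivative is at most
  \<open>c\<^sub>3\<close> times the radius. With \<open>k' = 0\<close> this is the quadratic
  remainder bound; in general it gives stability of the remainder in \<open>k\<close>.\<close>

lemma remainder_diff:
  "norm (A x (y + k) - A x (y + k') - dA x y (k - k')) \<le> c\<^sub>3 * (norm k + norm k') * norm (k - k')"
proof -
  have "norm ((A x (y + k) - dA x y k) - (A x (y + k') - dA x y k')) \<le> (c\<^sub>3 * (norm k + norm k')) * norm (k - k')"
  proof (rule differentiable_bound[of "cball 0 (norm k + norm k')"])
    fix w :: 'a assume w: "w \<in> cball 0 (norm k + norm k')"
    have "((\<lambda>w. y + w) has_derivative (\<lambda>v. v)) (at w)" by (auto intro!: derivative_eq_intros)
    from has_derivative_compose[OF this der[of x "y + w"]]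
    have "((\<lambda>w. A x (y + w)) has_derivative dA x (y + w)) (at w)" .
    then have "((\<lambda>w. A x (y + w) - dA x y w) has_derivative (\<lambda>v. dA x (y + w) v - dA x y v)) (at w)"
      by (intro has_derivative_diff bounded_linear.has_derivative[OF has_derivative_bounded_linear[OF der]]
          has_derivative_ident)
    then show "((\<lambda>w. A x (y + w) - dA x y w) has_derivative (\<lambda>v. dA x (y + w) v - dA x y v))
        (at w within cball 0 (norm k + norm k'))" by (rule has_derivative_at_withinI)
    show "onorm (\<lambda>v. dA x (y + w) v - dA x y v) \<le> c\<^sub>3 * (norm k + norm k')"
    proof (rule onorm_le)
      fix v
      have "norm (dA x (y + w) v - dA x y v) \<le> c\<^sub>3 * norm (y + w - y) * norm v" by (rule dlip)
      also have "\<dots> \<le> c\<^sub>3 * (norm k + norm k') * norm v"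
        using w pos by (intro mult_right_mono mult_left_mono) auto
      finally show "norm (dA x (y + w) v - dA x y v) \<le> c\<^sub>3 * (norm k + norm k') * norm v" .
    qed
  qed auto
  then show ?thesis by (simp add: dA_linear algebra_simps)
qed

lemma directional_limit: "((\<lambda>h. (A x (y + h *\<^sub>R v) - A x y) /\<^sub>R h) \<longlongrightarrow> dA x y v) (at 0)"
proof -
  have bnd: "norm ((A x (y + h *\<^sub>R v) - A x y) /\<^sub>R h - dA x y v) \<le> c\<^sub>3 * (norm v)\<^sup>2 * \<bar>h\<bar>" if "h \<noteq> 0" for h
  proof -
    have "(A x (y + h *\<^sub>R v) - A x y) /\<^sub>R h - dA x y v = (A x (y + h *\<^sub>R v) - A x (y + 0) - dA x y (h *\<^sub>R v - 0)) /\<^sub>R h"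
      using that by (simp add: dA_linear scaleR_diff_right)
    also have "norm \<dots> = norm (A x (y + h *\<^sub>R v) - A x (y + 0) - dA x y (h *\<^sub>R v - 0)) / \<bar>h\<bar>"
      by (simp add: divide_inverse mult.commute)
    also have "\<dots> \<le> (c\<^sub>3 * (norm (h *\<^sub>R v) + norm (0::'a)) * norm (h *\<^sub>R v - 0)) / \<bar>h\<bar>"
      by (intro divide_right_mono remainder_diff) simp
    also have "\<dots> = c\<^sub>3 * (norm v)\<^sup>2 * \<bar>h\<bar>" using that by (simp add: power2_eq_square)
    finally show ?thesis .
  qed
  have "((\<lambda>h. (A x (y + h *\<^sub>R v) - A x y) /\<^sub>R h - dA x y v) \<longlongrightarrow> 0) (at 0)"
  proof (rule Lim_null_comparison[where g="\<lambda>h. c\<^sub>3 * (norm v)\<^sup>2 * \<bar>h\<bar>"])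
    have "((\<lambda>h. c\<^sub>3 * (norm v)\<^sup>2 * \<bar>h\<bar>) \<longlongrightarrow> c\<^sub>3 * (norm v)\<^sup>2 * \<bar>0\<bar>) (at 0)" by (intro tendsto_intros)
    then show "((\<lambda>h. c\<^sub>3 * (norm v)\<^sup>2 * \<bar>h\<bar>) \<longlongrightarrow> 0) (at 0)" by simp
  qed (use bnd in \<open>simp add: eventually_at_filter\<close>)
  then show ?thesis by (rule LIM_zero_cancel)
qed

lemma quotient_bound:
  assumes "h \<noteq> 0"
  shows "norm ((A x (y + h *\<^sub>R v) - A x y) /\<^sub>R h) \<le> c\<^sub>2 * norm v"
proof -
  have "norm ((A x (y + h *\<^sub>R v) - A x y) /\<^sub>R h) = norm (A x (y + h *\<^sub>R v) - A x y) / \<bar>h\<bar>"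
    by (simp add: divide_inverse mult.commute)
  also have "\<dots> \<le> (c\<^sub>2 * norm (h *\<^sub>R v)) / \<bar>h\<bar>"
    using lip[of x "y + h *\<^sub>R v" y] by (intro divide_right_mono) auto
  also have "\<dots> = c\<^sub>2 * norm v" using assms by simp
  finally show ?thesis .
qed

lemma dA_bound: "norm (dA x y v) \<le> c\<^sub>2 * norm v"
proof (rule tendsto_upperbound[OF tendsto_norm[OF directional_limit]])
  show "\<forall>\<^sub>F h in at 0. norm ((A x (y + h *\<^sub>R v) - A x y) /\<^sub>R h) \<le> c\<^sub>2 * norm v"
    using quotient_bound by (simp add: eventually_at_filter)
qed simp

text \<open>Strong monotonicity between \<open>y\<close> and \<open>y + h *\<^sub>R v\<close>,
  divided by \<open>h\<^sup>2\<close>, in the limit.\<close>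

lemma dA_coercive: "dA x y v \<bullet> v \<ge> c\<^sub>1 * (norm v)\<^sup>2"
proof (rule tendsto_lowerbound[OF tendsto_inner[OF directional_limit tendsto_const]])
  have "c\<^sub>1 * (norm v)\<^sup>2 \<le> ((A x (y + h *\<^sub>R v) - A x y) /\<^sub>R h) \<bullet> v" if "h \<noteq> 0" for h
  proof -
    define X where "X = A x (y + h *\<^sub>R v) - A x y"
    have "c\<^sub>1 * (norm v)\<^sup>2 * h\<^sup>2 \<le> (A x (y + h *\<^sub>R v) - A x y) \<bullet> (h *\<^sub>R v)"
      using mono[where x=x and y="y + h *\<^sub>R v" and y'=y] by (simp add: power_mult_distrib mult.commute mult.left_commute)
    then have "c\<^sub>1 * (norm v)\<^sup>2 * h\<^sup>2 / h\<^sup>2 \<le> X \<bullet> (h *\<^sub>R v) / h\<^sup>2"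
      unfolding X_def by (rule divide_right_mono) simp
    moreover have "X \<bullet> (h *\<^sub>R v) / h\<^sup>2 = (X /\<^sub>R h) \<bullet> v"
      using that by (simp add: power2_eq_square field_simps)
    moreover have "c\<^sub>1 * (norm v)\<^sup>2 * h\<^sup>2 / h\<^sup>2 = c\<^sub>1 * (norm v)\<^sup>2" using that by simp
    ultimately show ?thesis unfolding X_def by simp
  qed
  then show "\<forall>\<^sub>F h in at 0. c\<^sub>1 * (norm v)\<^sup>2 \<le> ((A x (y + h *\<^sub>R v) - A x y) /\<^sub>R h) \<bullet> v"
    by (simp add: eventually_at_filter)
qed simp

text \<open>Subtracting \<open>A x (g x)\<close> makes the shifted field vanish at 0, which lets it
  act on L2 of a set of infinite measure.\<close>

lemma shift:
  assumes "g \<in> borel_measurable lebesgue"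
  shows "monotone_field (\<lambda>x y. A x (g x + y) - A x (g x)) (\<lambda>x y. dA x (g x + y)) c\<^sub>1 c\<^sub>2 c\<^sub>3"
proof
  show "c\<^sub>1 > 0" "c\<^sub>2 > 0" "c\<^sub>3 > 0" by (rule pos)+
  fix x y y' v :: 'a and f h :: "'a \<Rightarrow> 'a"
  have "((\<lambda>w. g x + w) has_derivative (\<lambda>v. v)) (at y)" by (auto intro!: derivative_eq_intros)
  from has_derivative_compose[OF this der[of x "g x + y"]]
  show "((\<lambda>y. A x (g x + y) - A x (g x)) has_derivative dA x (g x + y)) (at y)"
    using has_derivative_diff[OF _ has_derivative_const] by fastforce
  show "c\<^sub>1 * (norm (y - y'))\<^sup>2 \<le> (A x (g x + y) - A x (g x) - (A x (g x + y') - A x (g x))) \<bullet> (y - y')"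
    using mono[where x=x and y="g x + y" and y'="g x + y'"] by simp
  show "norm (A x (g x + y) - A x (g x) - (A x (g x + y') - A x (g x))) \<le> c\<^sub>2 * norm (y - y')"
    using lip[of x "g x + y" "g x + y'"] by simp
  show "norm (dA x (g x + y) v - dA x (g x + y') v) \<le> c\<^sub>3 * norm (y - y') * norm v"
    using dlip[of x "g x + y" v "g x + y'"] by simp
  assume f: "f \<in> borel_measurable lebesgue"
  then show "(\<lambda>x. A x (g x + f x) - A x (g x)) \<in> borel_measurable lebesgue"
    using assms by (intro borel_measurable_diff meas borel_measurable_add)
  assume "h \<in> borel_measurable lebesgue"
  then show "(\<lambda>x. dA x (g x + f x) (h x)) \<in> borel_measurable lebesgue"
    using f assms by (intro dmeas borel_measurable_add)
qed

text \<open>Measurability is available only for superpositions at the original point, so the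
  arguments are first pulled back by the inverse affine map and the result is then rescaled.\<close>

lemma rescale:
  assumes "\<epsilon> \<noteq> 0"
  shows "monotone_field (\<lambda>x. A (z + \<epsilon> *\<^sub>R x)) (\<lambda>x. dA (z + \<epsilon> *\<^sub>R x)) c\<^sub>1 c\<^sub>2 c\<^sub>3"
proof
  fix f h :: "'a \<Rightarrow> 'a"
  have inv: "- ((1 / \<epsilon>) *\<^sub>R z) + (1 / \<epsilon>) *\<^sub>R (z + \<epsilon> *\<^sub>R x) = x" for x using assms by (simp add: algebra_simps)
  have e: "1 / \<epsilon> \<noteq> 0" using assms by simp
  note [simp] = inv
  assume f: "f \<in> borel_measurable lebesgue"
  from measurable_affine[OF assms meas[OF measurable_affine[OF e f, of "- ((1 / \<epsilon>) *\<^sub>R z)"]], of z]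
  show "(\<lambda>x. A (z + \<epsilon> *\<^sub>R x) (f x)) \<in> borel_measurable lebesgue" by (simp only: inv)
  assume h: "h \<in> borel_measurable lebesgue"
  from measurable_affine[OF assms dmeas[OF measurable_affine[OF e f, of "- ((1 / \<epsilon>) *\<^sub>R z)"]
      measurable_affine[OF e h, of "- ((1 / \<epsilon>) *\<^sub>R z)"]], of z]
  show "(\<lambda>x. dA (z + \<epsilon> *\<^sub>R x) (f x) (h x)) \<in> borel_measurable lebesgue" by (simp only: inv)
qed (rule pos der mono lip dlip)+

end

lemma norm_cl_le:
  fixes f g :: "'a::euclidean_space \<Rightarrow> 'b::euclidean_space"
  assumes f: "f \<in> L2 UNIV" and g: "g \<in> L2 UNIV" and M: "M \<ge> 0"
    and le: "AE x in lebesgue. norm (f x) \<le> M * norm (g x)"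
  shows "norm (cl f) \<le> M * norm (cl g)"
proof -
  have "(norm (cl f))\<^sup>2 \<le> (LINT x|lebesgue. M\<^sup>2 * (norm (g x))\<^sup>2)"
    unfolding norm_cl_power2[OF f]
  proof (rule integral_mono_AE)
    show "AE x in lebesgue. (norm (f x))\<^sup>2 \<le> M\<^sup>2 * (norm (g x))\<^sup>2"
      using le by eventually_elim (simp add: power_mono flip: power_mult_distrib)
  qed (use f g in \<open>auto simp: L2_UNIV_iff\<close>)
  also have "\<dots> = (M * norm (cl g))\<^sup>2" by (simp add: norm_cl_power2[OF g] power_mult_distrib)
  finally show ?thesis by (rule power2_le_imp_le) (use M in simp)
qed

text \<open>Together with the Lipschitz bound, \<open>A0\<close> makes the superposition operator
  map L2 into L2. It will hold on \<open>D\<close> because \<open>D\<close> has finite measure, and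
  on the whole space because the shifted fields vanish at 0.\<close>

locale nemytskii = monotone_field A dA c\<^sub>1 c\<^sub>2 c\<^sub>3
  for A :: "'a::euclidean_space \<Rightarrow> 'a \<Rightarrow> 'a" and dA c\<^sub>1 c\<^sub>2 c\<^sub>3 +
  fixes D :: "'a set"
  assumes D_sets: "D \<in> sets lebesgue"
    and A0: "(\<lambda>x. indicator D x *\<^sub>R A x 0) \<in> L2 UNIV"
begin

definition Nem :: "('a, 'a) ell2 \<Rightarrow> ('a, 'a) ell2" where
  "Nem F = cl (\<lambda>x. indicator D x *\<^sub>R A x (rep F x))"

definition DNem :: "('a, 'a) ell2 \<Rightarrow> ('a, 'a) ell2 \<Rightarrow> ('a, 'a) ell2" where
  "DNem F E = cl (\<lambda>x. indicator D x *\<^sub>R dA x (rep F x) (rep E x))"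

lemma indicator_measurable: "f \<in> borel_measurable lebesgue \<Longrightarrow> (\<lambda>x. indicator D x *\<^sub>R f x) \<in> borel_measurable lebesgue"
  for f :: "'a \<Rightarrow> 'a"
  by (intro borel_measurable_scaleR borel_measurable_indicator D_sets)

lemma Nem_L2:
  assumes f: "f \<in> L2 UNIV"
  shows "(\<lambda>x. indicator D x *\<^sub>R A x (f x)) \<in> L2 UNIV"
proof -
  have fm: "f \<in> borel_measurable lebesgue" using f by (simp add: L2_UNIV_iff)
  have "(\<lambda>x. indicator D x *\<^sub>R (A x (f x) - A x 0)) \<in> L2 UNIV"
  proof (rule L2_bound[OF f])
    show "(\<lambda>x. indicator D x *\<^sub>R (A x (f x) - A x 0)) \<in> borel_measurable lebesgue"
      by (intro indicator_measurable borel_measurable_diff meas fm) simp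
    show "norm (indicator D x *\<^sub>R (A x (f x) - A x 0)) \<le> c\<^sub>2 * norm (f x)" for x
      using lip[of x "f x" 0] pos by (auto simp: indicator_def)
  qed
  from L2_add[OF this A0] show ?thesis by (simp add: scaleR_diff_right)
qed

lemma DNem_L2:
  assumes f: "f \<in> borel_measurable lebesgue" and e: "e \<in> L2 UNIV"
  shows "(\<lambda>x. indicator D x *\<^sub>R dA x (f x) (e x)) \<in> L2 UNIV"
proof (rule L2_bound[OF e])
  show "(\<lambda>x. indicator D x *\<^sub>R dA x (f x) (e x)) \<in> borel_measurable lebesgue"
    using e by (intro indicator_measurable dmeas f) (simp add: L2_UNIV_iff)
  show "norm (indicator D x *\<^sub>R dA x (f x) (e x)) \<le> c\<^sub>2 * norm (e x)" for x
    using dA_bound[of x "f x" "e x"] pos by (auto simp: indicator_def)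
qed

lemma Nem_cl:
  assumes f: "f \<in> L2 UNIV"
  shows "Nem (cl f) = cl (\<lambda>x. indicator D x *\<^sub>R A x (f x))"
  unfolding Nem_def
  by (rule cl_cong[OF Nem_L2[OF rep_L2]]) (use rep_cl[OF f] in eventually_elim, simp)

lemma DNem_cl:
  assumes f: "f \<in> L2 UNIV" and e: "e \<in> L2 UNIV"
  shows "DNem (cl f) (cl e) = cl (\<lambda>x. indicator D x *\<^sub>R dA x (f x) (e x))"
  unfolding DNem_def
  by (rule cl_cong[OF DNem_L2[OF rep_measurable rep_L2]])
     (use rep_cl[OF f] rep_cl[OF e] in eventually_elim, simp)

lemma Nem_lip: "norm (Nem F - Nem G) \<le> c\<^sub>2 * norm (F - G)"
proof -
  note L = Nem_L2[OF rep_L2[of F]] Nem_L2[OF rep_L2[of G]]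
  have "norm (cl (\<lambda>x. indicator D x *\<^sub>R A x (rep F x) - indicator D x *\<^sub>R A x (rep G x)))
      \<le> c\<^sub>2 * norm (cl (\<lambda>x. rep F x - rep G x))"
  proof (rule norm_cl_le[OF L2_diff[OF L] L2_diff[OF rep_L2 rep_L2]])
    show "AE x in lebesgue. norm (indicat_real D x *\<^sub>R A x (rep F x) - indicat_real D x *\<^sub>R A x (rep G x))
        \<le> c\<^sub>2 * norm (rep F x - rep G x)"
      using lip pos by (auto simp: indicator_def)
  qed (use pos in simp)
  then show ?thesis
    unfolding Nem_def cl_diff[OF L] cl_diff[OF rep_L2 rep_L2, symmetric] cl_rep .
qed

text \<open>The operator sees only the values on \<open>D\<close>, so the full norm on the other
  side requires that both fields vanish outside \<open>D\<close>.\<close>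

lemma Nem_mono:
  assumes "AE x in lebesgue. x \<notin> D \<longrightarrow> rep F x = 0" "AE x in lebesgue. x \<notin> D \<longrightarrow> rep G x = 0"
  shows "(Nem F - Nem G) \<bullet> (F - G) \<ge> c\<^sub>1 * (norm (F - G))\<^sup>2"
proof -
  note L = Nem_L2[OF rep_L2[of F]] Nem_L2[OF rep_L2[of G]]
  have FG: "F - G = cl (\<lambda>x. rep F x - rep G x)" by (simp add: cl_diff[OF rep_L2 rep_L2, symmetric] cl_rep)
  have "c\<^sub>1 * (norm (F - G))\<^sup>2 = (LINT x|lebesgue. c\<^sub>1 * (norm (rep F x - rep G x))\<^sup>2)"
    unfolding FG norm_cl_power2[OF L2_diff[OF rep_L2 rep_L2]] by simp
  also have "\<dots> \<le> (LINT x|lebesgue. (indicator D x *\<^sub>R A x (rep F x) - indicator D x *\<^sub>R A x (rep G x)) \<bullet> (rep F x - rep G x))"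
  proof (rule integral_mono_AE)
    show "integrable lebesgue (\<lambda>x. c\<^sub>1 * (norm (rep F x - rep G x))\<^sup>2)"
      using L2_diff[OF rep_L2[of F] rep_L2[of G]] by (simp add: L2_UNIV_iff)
    show "AE x in lebesgue. c\<^sub>1 * (norm (rep F x - rep G x))\<^sup>2
        \<le> (indicator D x *\<^sub>R A x (rep F x) - indicator D x *\<^sub>R A x (rep G x)) \<bullet> (rep F x - rep G x)"
      using assms
    proof eventually_elim
      case (elim x)
      then show ?case using mono[where x=x and y="rep F x" and y'="rep G x"] by (cases "x \<in> D") auto
    qed
  qed (intro integrable_inner_L2 L2_diff L rep_L2)
  also have "\<dots> = (Nem F - Nem G) \<bullet> (F - G)"
    unfolding FG Nem_def cl_diff[OF L] by (rule inner_cl[symmetric]) (intro L2_diff L rep_L2)+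
  finally show ?thesis .
qed

lemma DNem_coercive:
  assumes "AE x in lebesgue. x \<notin> D \<longrightarrow> rep E x = 0"
  shows "DNem F E \<bullet> E \<ge> c\<^sub>1 * (norm E)\<^sup>2"
proof -
  note L = DNem_L2[OF rep_measurable[of F] rep_L2[of E]]
  have "c\<^sub>1 * (norm (cl (rep E)))\<^sup>2 = (LINT x|lebesgue. c\<^sub>1 * (norm (rep E x))\<^sup>2)"
    unfolding norm_cl_power2[OF rep_L2] by simp
  also have "\<dots> \<le> (LINT x|lebesgue. (indicator D x *\<^sub>R dA x (rep F x) (rep E x)) \<bullet> rep E x)"
  proof (rule integral_mono_AE)
    show "integrable lebesgue (\<lambda>x. c\<^sub>1 * (norm (rep E x))\<^sup>2)"
      using rep_L2[of E] by (simp add: L2_UNIV_iff)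
    show "AE x in lebesgue. c\<^sub>1 * (norm (rep E x))\<^sup>2 \<le> (indicator D x *\<^sub>R dA x (rep F x) (rep E x)) \<bullet> rep E x"
      using assms
    proof eventually_elim
      case (elim x)
      then show ?case using dA_coercive[of "rep E x" x "rep F x"] by (cases "x \<in> D") auto
    qed
  qed (intro integrable_inner_L2 L rep_L2)
  also have "\<dots> = DNem F E \<bullet> cl (rep E)"
    unfolding DNem_def by (rule inner_cl[OF L rep_L2, symmetric])
  finally show ?thesis by (simp add: cl_rep)
qed

theorem Nem_solution:
  assumes W: "subspace W" "closed W" and off: "\<And>F. F \<in> W \<Longrightarrow> AE x in lebesgue. x \<notin> D \<longrightarrow> rep F x = 0"
  shows "\<exists>F\<in>W. \<forall>w\<in>W. Nem F \<bullet> w = b \<bullet> w"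
  by (rule strongly_monotone_solution[OF W pos(1) Nem_mono Nem_lip]) (auto intro: off)

lemma Nem_unique:
  assumes W: "subspace W" and off: "\<And>F. F \<in> W \<Longrightarrow> AE x in lebesgue. x \<notin> D \<longrightarrow> rep F x = 0"
    and F: "F \<in> W" "G \<in> W" and eq: "\<And>w. w \<in> W \<Longrightarrow> Nem F \<bullet> w = Nem G \<bullet> w"
  shows "F = G"
proof -
  have "c\<^sub>1 * (norm (F - G))\<^sup>2 \<le> 0"
    using Nem_mono[OF off[OF F(1)] off[OF F(2)]] eq[OF subspace_diff[OF W F]] by (simp add: inner_diff_left)
  then show ?thesis using pos(1) by (simp add: mult_le_0_iff)
qed

lemma Nem_line: "Nem (F + s *\<^sub>R E) = cl (\<lambda>x. indicator D x *\<^sub>R A x (rep F x + s *\<^sub>R rep E x))"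
  and DNem_line: "DNem (F + s *\<^sub>R E) E = cl (\<lambda>x. indicator D x *\<^sub>R dA x (rep F x + s *\<^sub>R rep E x) (rep E x))"
proof -
  have eq: "F + s *\<^sub>R E = cl (\<lambda>x. rep F x + s *\<^sub>R rep E x)"
    by (simp add: cl_scaleR[OF rep_L2, symmetric] cl_add[OF rep_L2 L2_scaleR[OF rep_L2], symmetric] cl_rep)
  note L = L2_add[OF rep_L2 L2_scaleR[OF rep_L2], of F s E]
  show "Nem (F + s *\<^sub>R E) = cl (\<lambda>x. indicator D x *\<^sub>R A x (rep F x + s *\<^sub>R rep E x))"
    unfolding eq by (rule Nem_cl[OF L])
  show "DNem (F + s *\<^sub>R E) E = cl (\<lambda>x. indicator D x *\<^sub>R dA x (rep F x + s *\<^sub>R rep E x) (rep E x))"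
    using DNem_cl[OF L rep_L2[of E]] unfolding eq cl_rep .
qed

lemma integrable_norm_product:
  fixes E P :: "('a, 'a) ell2"
  shows "integrable lebesgue (\<lambda>x. c * (norm (rep E x) * norm (rep P x)))"
  by (intro integrable_mult_right integral_L2_bound rep_L2)

text \<open>A quadratic remainder could not be paired with \<open>P\<close>, which is merely in L2.
  The limit is instead taken under the integral: difference quotients converge pointwise and are
  dominated through the Lipschitz constant \<open>c\<^sub>2\<close>.\<close>

lemma Nem_has_derivative:
  "((\<lambda>s. Nem (F + s *\<^sub>R E) \<bullet> P) has_real_derivative DNem (F + s *\<^sub>R E) E \<bullet> P) (at s)"
proof -
  define j where "j h x = (indicat_real D x *\<^sub>R ((A x (rep F x + s *\<^sub>R rep E x + h *\<^sub>R rep E x) - A x (rep F x + s *\<^sub>R rep E x)) /\<^sub>R h)) \<bullet> rep P x" for h x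
  note L = L2_add[OF rep_L2 L2_scaleR[OF rep_L2], of F _ E]
  note N = Nem_L2[OF L]
  note dN = DNem_L2[OF _ rep_L2[of E], of "\<lambda>x. rep F x + s *\<^sub>R rep E x"]
  have Lm: "(\<lambda>x. rep F x + t *\<^sub>R rep E x) \<in> borel_measurable lebesgue" for t
    using L[of t] by (simp add: L2_UNIV_iff)
  have q: "(Nem (F + (s + h) *\<^sub>R E) \<bullet> P - Nem (F + s *\<^sub>R E) \<bullet> P) / h = (LINT x|lebesgue. j h x)" for h
  proof -
    have "Nem (F + (s + h) *\<^sub>R E) \<bullet> P - Nem (F + s *\<^sub>R E) \<bullet> P =
       (Nem (F + (s + h) *\<^sub>R E) - Nem (F + s *\<^sub>R E)) \<bullet> cl (rep P)" by (simp add: inner_diff_left cl_rep)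
    also have "\<dots> = (LINT x|lebesgue. (indicator D x *\<^sub>R A x (rep F x + (s + h) *\<^sub>R rep E x) -
        indicator D x *\<^sub>R A x (rep F x + s *\<^sub>R rep E x)) \<bullet> rep P x)"
      unfolding Nem_line cl_diff[OF N N] by (rule inner_cl[OF L2_diff[OF N N] rep_L2])
    finally have "(Nem (F + (s + h) *\<^sub>R E) \<bullet> P - Nem (F + s *\<^sub>R E) \<bullet> P) / h =
        (LINT x|lebesgue. ((indicator D x *\<^sub>R A x (rep F x + (s + h) *\<^sub>R rep E x) -
        indicator D x *\<^sub>R A x (rep F x + s *\<^sub>R rep E x)) \<bullet> rep P x) / h)" by simp
    then show ?thesis
      by (simp add: j_def scaleR_add_left add.assoc divide_inverse scaleR_diff_right inner_diff_left algebra_simps)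
  qed
  have lim: "DNem (F + s *\<^sub>R E) E \<bullet> P = (LINT x|lebesgue. (indicator D x *\<^sub>R dA x (rep F x + s *\<^sub>R rep E x) (rep E x)) \<bullet> rep P x)"
    using inner_cl[OF dN[OF Lm] rep_L2[of P]] unfolding DNem_line cl_rep .
  have "((\<lambda>h. LINT x|lebesgue. j h x) \<longlongrightarrow> DNem (F + s *\<^sub>R E) E \<bullet> P) (at 0)"
    unfolding tendsto_at_iff_sequentially
  proof safe
    fix X :: "nat \<Rightarrow> real" assume X: "\<forall>i. X i \<in> UNIV - {0}" "X \<longlonglongrightarrow> 0"
    have "(\<lambda>n. LINT x|lebesgue. j (X n) x) \<longlonglongrightarrow> (LINT x|lebesgue. (indicator D x *\<^sub>R dA x (rep F x + s *\<^sub>R rep E x) (rep E x)) \<bullet> rep P x)"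
    proof (rule integral_dominated_convergence[where w="\<lambda>x. c\<^sub>2 * (norm (rep E x) * norm (rep P x))"])
      show "(\<lambda>x. (indicator D x *\<^sub>R dA x (rep F x + s *\<^sub>R rep E x) (rep E x)) \<bullet> rep P x) \<in> borel_measurable lebesgue"
        using integrable_inner_L2[OF dN[OF Lm] rep_L2[of P]] by (rule borel_measurable_integrable)
      show "j (X n) \<in> borel_measurable lebesgue" for n
        unfolding j_def scaleR_add_left[symmetric] add.assoc
        by (intro borel_measurable_inner indicator_measurable borel_measurable_scaleR borel_measurable_diff meas Lm
            borel_measurable_const rep_measurable)
      show "AE x in lebesgue. (\<lambda>n. j (X n) x) \<longlonglongrightarrow> (indicator D x *\<^sub>R dA x (rep F x + s *\<^sub>R rep E x) (rep E x)) \<bullet> rep P x"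
        unfolding j_def
      proof (intro AE_I2 tendsto_inner tendsto_scaleR tendsto_const)
        fix x
        have "filterlim X (at 0) sequentially" using X by (auto simp: filterlim_at)
        from filterlim_compose[OF directional_limit this]
        show "(\<lambda>n. (A x (rep F x + s *\<^sub>R rep E x + X n *\<^sub>R rep E x) - A x (rep F x + s *\<^sub>R rep E x)) /\<^sub>R X n)
            \<longlonglongrightarrow> dA x (rep F x + s *\<^sub>R rep E x) (rep E x)" .
      qed
      show "AE x in lebesgue. norm (j (X n) x) \<le> c\<^sub>2 * (norm (rep E x) * norm (rep P x))" for n
      proof (rule AE_I2)
        fix x
        let ?q = "(A x (rep F x + s *\<^sub>R rep E x + X n *\<^sub>R rep E x) - A x (rep F x + s *\<^sub>R rep E x)) /\<^sub>R X n"
        have "X n \<noteq> 0" using X(1) by auto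
        then have "norm ?q \<le> c\<^sub>2 * norm (rep E x)" by (rule quotient_bound)
        then have "norm (indicat_real D x *\<^sub>R ?q) \<le> c\<^sub>2 * norm (rep E x)"
          using pos by (auto simp: indicator_def)
        then have "norm (indicat_real D x *\<^sub>R ?q) * norm (rep P x) \<le> c\<^sub>2 * norm (rep E x) * norm (rep P x)"
          by (rule mult_right_mono) simp
        then show "norm (j (X n) x) \<le> c\<^sub>2 * (norm (rep E x) * norm (rep P x))"
          unfolding j_def real_norm_def mult.assoc[symmetric] by (rule order_trans[OF Cauchy_Schwarz_ineq2])
      qed
    qed (rule integrable_norm_product)
    then show "((\<lambda>h. LINT x|lebesgue. j h x) \<circ> X) \<longlonglongrightarrow> DNem (F + s *\<^sub>R E) E \<bullet> P"
      unfolding lim by (simp add: o_def)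
  qed
  then show ?thesis unfolding DERIV_def q .
qed

text \<open>Pointwise convergence comes from the Lipschitz bound \<open>c\<^sub>3\<close> on the
  derivative, domination from its bound \<open>c\<^sub>2\<close>.\<close>

lemma DNem_continuous: "continuous_on S (\<lambda>s. DNem (F + s *\<^sub>R E) E \<bullet> P)"
proof -
  note L = L2_add[OF rep_L2 L2_scaleR[OF rep_L2], of F _ E]
  have Lm: "(\<lambda>x. rep F x + t *\<^sub>R rep E x) \<in> borel_measurable lebesgue" for t
    using L[of t] by (simp add: L2_UNIV_iff)
  note dN = DNem_L2[OF Lm rep_L2[of E]]
  have eq: "DNem (F + s *\<^sub>R E) E \<bullet> P = (LINT x|lebesgue. (indicator D x *\<^sub>R dA x (rep F x + s *\<^sub>R rep E x) (rep E x)) \<bullet> rep P x)" for s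
    using inner_cl[OF dN rep_L2[of P]] unfolding DNem_line cl_rep .
  show ?thesis
    unfolding continuous_on_sequentially eq comp_def
  proof safe
    fix X :: "nat \<Rightarrow> real" and s assume X: "X \<longlonglongrightarrow> s"
    show "(\<lambda>n. LINT x|lebesgue. (indicator D x *\<^sub>R dA x (rep F x + X n *\<^sub>R rep E x) (rep E x)) \<bullet> rep P x)
        \<longlonglongrightarrow> (LINT x|lebesgue. (indicator D x *\<^sub>R dA x (rep F x + s *\<^sub>R rep E x) (rep E x)) \<bullet> rep P x)"
    proof (rule integral_dominated_convergence[where w="\<lambda>x. c\<^sub>2 * (norm (rep E x) * norm (rep P x))"])
      show "(\<lambda>x. (indicator D x *\<^sub>R dA x (rep F x + t *\<^sub>R rep E x) (rep E x)) \<bullet> rep P x) \<in> borel_measurable lebesgue" for t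
        using integrable_inner_L2[OF dN rep_L2[of P]] by (rule borel_measurable_integrable)
      then show "(\<lambda>x. (indicator D x *\<^sub>R dA x (rep F x + X n *\<^sub>R rep E x) (rep E x)) \<bullet> rep P x) \<in> borel_measurable lebesgue" for n .
      show "AE x in lebesgue. (\<lambda>n. (indicator D x *\<^sub>R dA x (rep F x + X n *\<^sub>R rep E x) (rep E x)) \<bullet> rep P x)
          \<longlonglongrightarrow> (indicator D x *\<^sub>R dA x (rep F x + s *\<^sub>R rep E x) (rep E x)) \<bullet> rep P x"
      proof (intro AE_I2 tendsto_inner tendsto_scaleR tendsto_const)
        fix x
        have "(\<lambda>n. dA x (rep F x + X n *\<^sub>R rep E x) (rep E x) - dA x (rep F x + s *\<^sub>R rep E x) (rep E x)) \<longlonglongrightarrow> 0"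
        proof (rule Lim_null_comparison[OF always_eventually])
          show "\<forall>n. norm (dA x (rep F x + X n *\<^sub>R rep E x) (rep E x) - dA x (rep F x + s *\<^sub>R rep E x) (rep E x))
              \<le> c\<^sub>3 * norm ((X n - s) *\<^sub>R rep E x) * norm (rep E x)"
            using dlip[of x "rep F x + X n *\<^sub>R rep E x" "rep E x" "rep F x + s *\<^sub>R rep E x" for n]
            by (simp add: scaleR_diff_left)
          have "(\<lambda>n. c\<^sub>3 * norm ((X n - s) *\<^sub>R rep E x) * norm (rep E x)) \<longlonglongrightarrow> c\<^sub>3 * norm ((s - s) *\<^sub>R rep E x) * norm (rep E x)"
            by (intro tendsto_intros X)
          then show "(\<lambda>n. c\<^sub>3 * norm ((X n - s) *\<^sub>R rep E x) * norm (rep E x)) \<longlonglongrightarrow> 0" by simp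
        qed
        then show "(\<lambda>n. dA x (rep F x + X n *\<^sub>R rep E x) (rep E x)) \<longlonglongrightarrow> dA x (rep F x + s *\<^sub>R rep E x) (rep E x)"
          by (rule LIM_zero_cancel)
      qed
      show "AE x in lebesgue. norm ((indicator D x *\<^sub>R dA x (rep F x + X n *\<^sub>R rep E x) (rep E x)) \<bullet> rep P x)
          \<le> c\<^sub>2 * (norm (rep E x) * norm (rep P x))" for n
      proof (rule AE_I2)
        fix x
        let ?q = "dA x (rep F x + X n *\<^sub>R rep E x) (rep E x)"
        have "norm (indicat_real D x *\<^sub>R ?q) \<le> c\<^sub>2 * norm (rep E x)"
          using dA_bound pos by (auto simp: indicator_def)
        then have "norm (indicat_real D x *\<^sub>R ?q) * norm (rep P x) \<le> c\<^sub>2 * norm (rep E x) * norm (rep P x)"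
          by (rule mult_right_mono) simp
        then show "norm ((indicat_real D x *\<^sub>R ?q) \<bullet> rep P x) \<le> c\<^sub>2 * (norm (rep E x) * norm (rep P x))"
          unfolding real_norm_def mult.assoc[symmetric] by (rule order_trans[OF Cauchy_Schwarz_ineq2])
      qed
    qed (rule integrable_norm_product)
  qed
qed

end

section \<open>Convergence of solutions of monotone equations\<close>

text \<open>Dominated convergence for the squared distance. The dominating \<open>w\<close> may take
  values in another space, as only its norm matters.\<close>

lemma tendsto_cl:
  fixes f :: "nat \<Rightarrow> 'a::euclidean_space \<Rightarrow> 'b::euclidean_space"
  assumes f: "\<And>n. f n \<in> L2 UNIV" and l: "l \<in> L2 UNIV" and w: "w \<in> L2 UNIV"
    and lim: "\<And>x. (\<lambda>n. f n x) \<longlonglongrightarrow> l x" and dom: "\<And>n x. norm (f n x - l x) \<le> norm (w x :: 'c::euclidean_space)"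
  shows "(\<lambda>n. cl (f n)) \<longlonglongrightarrow> cl l"
proof -
  have "(\<lambda>n. LINT x|lebesgue. (norm (f n x - l x))\<^sup>2) \<longlonglongrightarrow> (LINT x|lebesgue. (norm (l x - l x))\<^sup>2)"
  proof (rule integral_dominated_convergence[where w="\<lambda>x. (norm (w x))\<^sup>2"])
    show "AE x in lebesgue. (\<lambda>n. (norm (f n x - l x))\<^sup>2) \<longlonglongrightarrow> (norm (l x - l x))\<^sup>2"
      by (intro AE_I2 tendsto_intros lim)
    show "AE x in lebesgue. norm ((norm (f n x - l x))\<^sup>2) \<le> (norm (w x))\<^sup>2" for n
      using dom by (auto intro!: power_mono)
    have "f n \<in> borel_measurable lebesgue" "l \<in> borel_measurable lebesgue" for n
      using f[of n] l by (auto simp: L2_UNIV_iff)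
    then show "(\<lambda>x. (norm (f n x - l x))\<^sup>2) \<in> borel_measurable lebesgue" for n by measurable
  qed (use w in \<open>auto simp: L2_UNIV_iff\<close>)
  then have "(\<lambda>n. (norm (cl (f n) - cl l))\<^sup>2) \<longlonglongrightarrow> 0"
    by (simp add: cl_diff[OF f l] norm_cl_power2[OF L2_diff[OF f l]])
  then have "(\<lambda>n. sqrt ((norm (cl (f n) - cl l))\<^sup>2)) \<longlonglongrightarrow> sqrt 0" by (rule tendsto_real_sqrt)
  then have "(\<lambda>n. cl (f n) - cl l) \<longlonglongrightarrow> 0" by (simp add: tendsto_norm_zero_iff)
  then show ?thesis by (rule LIM_zero_cancel)
qed

text \<open>Abstract setting of the blow-up: operators on sets \<open>E n\<close> that exhaust the
  space, all with the same constants. Vanishing at 0 yields bounds uniform in \<open>n\<close>;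
  derivatives are compared at 0 because the remainders are expanded there.\<close>

locale nemytskii_sequence =
  fixes B :: "nat \<Rightarrow> 'a::euclidean_space \<Rightarrow> 'a \<Rightarrow> 'a" and dB :: "nat \<Rightarrow> 'a \<Rightarrow> 'a \<Rightarrow> 'a \<Rightarrow> 'a"
    and E :: "nat \<Rightarrow> 'a set" and B' :: "'a \<Rightarrow> 'a \<Rightarrow> 'a" and dB' :: "'a \<Rightarrow> 'a \<Rightarrow> 'a \<Rightarrow> 'a"
    and c\<^sub>1 c\<^sub>2 c\<^sub>3 :: real
  assumes N: "\<And>n. nemytskii (B n) (dB n) c\<^sub>1 c\<^sub>2 c\<^sub>3 (E n)"
    and N': "nemytskii B' dB' c\<^sub>1 c\<^sub>2 c\<^sub>3 UNIV"
    and zero: "\<And>n x. B n x 0 = 0" "\<And>x. B' x 0 = 0"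
    and exhaust: "\<And>x. \<forall>\<^sub>F n in sequentially. x \<in> E n"
    and lim: "\<And>x y. (\<lambda>n. B n x y) \<longlonglongrightarrow> B' x y" "\<And>x y. (\<lambda>n. dB n x 0 y) \<longlonglongrightarrow> dB' x 0 y"
begin

sublocale lim: nemytskii B' dB' c\<^sub>1 c\<^sub>2 c\<^sub>3 UNIV by (rule N')

abbreviation NB where "NB n \<equiv> nemytskii.Nem (B n) (E n)"

lemma c_pos: "c\<^sub>1 > 0" "c\<^sub>2 > 0" "c\<^sub>3 > 0"
  by (rule lim.pos)+

lemma indicator_tendsto:
  fixes f :: "nat \<Rightarrow> 'b::real_normed_vector"
  assumes "f \<longlonglongrightarrow> l"
  shows "(\<lambda>n. indicat_real (E n) x *\<^sub>R f n) \<longlonglongrightarrow> l"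
proof (rule Lim_transform_eventually[OF assms])
  show "\<forall>\<^sub>F n in sequentially. f n = indicat_real (E n) x *\<^sub>R f n"
    using exhaust[of x] by eventually_elim simp
qed

text \<open>At a fixed field the pointwise convergence is dominated by \<open>2 * c\<^sub>2\<close>
  times the field, since all the operators vanish at 0.\<close>

lemma Nem_tendsto: "(\<lambda>n. NB n F) \<longlonglongrightarrow> lim.Nem F"
proof -
  interpret N: nemytskii "B n" "dB n" c\<^sub>1 c\<^sub>2 c\<^sub>3 "E n" for n by (rule N)
  have "(\<lambda>n. cl (\<lambda>x. indicator (E n) x *\<^sub>R B n x (rep F x))) \<longlonglongrightarrow> cl (\<lambda>x. indicator UNIV x *\<^sub>R B' x (rep F x))"
  proof (rule tendsto_cl[where w="\<lambda>x. (2 * c\<^sub>2) *\<^sub>R rep F x"])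
    show "(\<lambda>x. indicat_real (E n) x *\<^sub>R B n x (rep F x)) \<in> L2 UNIV" for n by (rule N.Nem_L2[OF rep_L2])
    show "(\<lambda>x. indicat_real UNIV x *\<^sub>R B' x (rep F x)) \<in> L2 UNIV" by (rule lim.Nem_L2[OF rep_L2])
    show "(\<lambda>x. (2 * c\<^sub>2) *\<^sub>R rep F x) \<in> L2 UNIV" by (rule L2_scaleR[OF rep_L2])
    show "(\<lambda>n. indicat_real (E n) x *\<^sub>R B n x (rep F x)) \<longlonglongrightarrow> indicat_real UNIV x *\<^sub>R B' x (rep F x)" for x
      using indicator_tendsto[OF lim(1)] by simp
    show "norm (indicat_real (E n) x *\<^sub>R B n x (rep F x) - indicat_real UNIV x *\<^sub>R B' x (rep F x))
        \<le> norm ((2 * c\<^sub>2) *\<^sub>R rep F x)" for n x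
    proof -
      have "norm (indicat_real (E n) x *\<^sub>R B n x (rep F x)) \<le> c\<^sub>2 * norm (rep F x)"
        using N.lip[of n x "rep F x" 0] zero(1) c_pos by (auto simp: indicator_def)
      moreover have "norm (B' x (rep F x)) \<le> c\<^sub>2 * norm (rep F x)"
        using lim.lip[of x "rep F x" 0] zero(2) by simp
      ultimately show ?thesis
        using c_pos norm_triangle_ineq4[of "indicat_real (E n) x *\<^sub>R B n x (rep F x)" "B' x (rep F x)"] by simp
    qed
  qed
  then show ?thesis unfolding N.Nem_def lim.Nem_def .
qed

text \<open>A Galerkin-type argument: \<open>H\<close> need not lie in \<open>Wn n\<close>, so it is
  approximated by some \<open>\<Psi> \<in> S\<close>, which belongs to \<open>Wn n\<close>
  eventually, and the equations are tested with \<open>K n - \<Psi>\<close>. As \<open>Wn n\<close>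
  is contained in \<open>W\<close>, this field is admissible in the limit equation too.\<close>

theorem solution_tendsto:
  fixes W :: "('a, 'a) ell2 set" and Wn :: "nat \<Rightarrow> ('a, 'a) ell2 set"
  assumes W: "\<And>n. subspace (Wn n)" "\<And>n. Wn n \<subseteq> W"
    and off: "\<And>n F. F \<in> Wn n \<Longrightarrow> AE x in lebesgue. x \<notin> E n \<longrightarrow> rep F x = 0"
    and S: "\<And>\<Psi>. \<Psi> \<in> S \<Longrightarrow> \<forall>\<^sub>F n in sequentially. \<Psi> \<in> Wn n"
    and K: "\<And>n. K n \<in> Wn n" "\<And>n w. w \<in> Wn n \<Longrightarrow> NB n (K n) \<bullet> w = b n \<bullet> w"
    and H: "H \<in> closure S" "\<And>w. w \<in> W \<Longrightarrow> lim.Nem H \<bullet> w = b' \<bullet> w"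
    and b: "b \<longlonglongrightarrow> b'"
  shows "K \<longlonglongrightarrow> H"
proof (rule metric_LIMSEQ_I)
  interpret N: nemytskii "B n" "dB n" c\<^sub>1 c\<^sub>2 c\<^sub>3 "E n" for n by (rule N)
  fix r :: real assume r: "r > 0"
  \<comment> \<open>Chosen so that \<open>(1 + (2 + c\<^sub>2) / c\<^sub>1) * \<eta> = r\<close>,
    which is the final bound on the distance of \<open>K n\<close> from \<open>H\<close>.\<close>
  define \<eta> where "\<eta> = r / (1 + (2 + c\<^sub>2) / c\<^sub>1)"
  have \<eta>: "\<eta> > 0" using r c_pos by (simp add: \<eta>_def divide_pos_pos add_pos_pos)
  obtain \<Psi> where \<Psi>: "\<Psi> \<in> S" "dist \<Psi> H < \<eta>" using H(1) \<eta> by (metis closure_approachable)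
  have ev: "\<forall>\<^sub>F n in sequentially. dist (b n) b' < \<eta>" "\<forall>\<^sub>F n in sequentially. dist (NB n \<Psi>) (lim.Nem \<Psi>) < \<eta>"
    using b Nem_tendsto[of \<Psi>] \<eta> by (auto simp: tendsto_iff)
  have "\<forall>\<^sub>F n in sequentially. dist (K n) H < r"
    using ev S[OF \<Psi>(1)]
  proof eventually_elim
    case (elim n)
    define w where "w = K n - \<Psi>"
    have wn: "w \<in> Wn n" unfolding w_def by (intro subspace_diff W K elim)
    have "c\<^sub>1 * (norm w)\<^sup>2 \<le> (NB n (K n) - NB n \<Psi>) \<bullet> w"
      unfolding w_def by (intro N.Nem_mono off K elim)
    \<comment> \<open>The error of the right-hand sides, the error of approximating \<open>H\<close>
      by \<open>\<Psi>\<close>, and the consistency error of the operators at the fixed field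
      \<open>\<Psi>\<close>.\<close>
    also have "\<dots> = (b n - b') \<bullet> w + (lim.Nem H - lim.Nem \<Psi>) \<bullet> w + (lim.Nem \<Psi> - NB n \<Psi>) \<bullet> w"
      using K(2)[OF wn] H(2) W(2) wn by (auto simp: inner_diff_left)
    also have "\<dots> \<le> norm (b n - b') * norm w + norm (lim.Nem H - lim.Nem \<Psi>) * norm w + norm (lim.Nem \<Psi> - NB n \<Psi>) * norm w"
      by (intro add_mono norm_cauchy_schwarz)
    also have "\<dots> \<le> \<eta> * norm w + (c\<^sub>2 * \<eta>) * norm w + \<eta> * norm w"
    proof (intro add_mono mult_right_mono)
      show "norm (b n - b') \<le> \<eta>" "norm (lim.Nem \<Psi> - NB n \<Psi>) \<le> \<eta>"
        using elim by (auto simp: dist_norm norm_minus_commute)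
      have "norm (lim.Nem H - lim.Nem \<Psi>) \<le> c\<^sub>2 * norm (H - \<Psi>)" by (rule lim.Nem_lip)
      also have "\<dots> \<le> c\<^sub>2 * \<eta>" using \<Psi>(2) c_pos by (intro mult_left_mono) (auto simp: dist_norm norm_minus_commute)
      finally show "norm (lim.Nem H - lim.Nem \<Psi>) \<le> c\<^sub>2 * \<eta>" .
    qed auto
    finally have "(c\<^sub>1 * norm w) * norm w \<le> ((2 + c\<^sub>2) * \<eta>) * norm w" by (simp add: power2_eq_square algebra_simps)
    then have "c\<^sub>1 * norm w \<le> (2 + c\<^sub>2) * \<eta>"
    proof (cases "norm w = 0")
      case False
      assume "(c\<^sub>1 * norm w) * norm w \<le> ((2 + c\<^sub>2) * \<eta>) * norm w"
      moreover have "norm w > 0" using False by (simp add: less_le)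
      ultimately show ?thesis using mult_le_cancel_right_pos by blast
    qed (use \<eta> c_pos in auto)
    then have "norm w \<le> (2 + c\<^sub>2) / c\<^sub>1 * \<eta>" using c_pos by (simp add: field_simps)
    moreover have "dist (K n) H \<le> norm w + dist \<Psi> H"
      unfolding w_def dist_norm using norm_triangle_ineq[of "K n - \<Psi>" "\<Psi> - H"] by simp
    ultimately have "dist (K n) H < (1 + (2 + c\<^sub>2) / c\<^sub>1) * \<eta>" using \<Psi>(2) by (simp add: distrib_right)
    also have "\<dots> = r"
    proof -
      have "1 + (2 + c\<^sub>2) / c\<^sub>1 \<noteq> 0" using c_pos by (smt (verit) divide_pos_pos)
      then show ?thesis by (simp add: \<eta>_def)
    qed
    finally show ?case .
  qed
  then show "\<exists>no. \<forall>n\<ge>no. dist (K n) H < r" by (simp add: eventually_sequentially)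
qed

lemma integral_L2_norm_le:
  fixes f g :: "'a \<Rightarrow> 'a"
  assumes "f \<in> L2 UNIV" "g \<in> L2 UNIV"
  shows "(LINT x|lebesgue. norm (f x) * norm (g x)) \<le> norm (cl f) * norm (cl g)"
proof -
  \<comment> \<open>Scalar functions are turned into fields along one fixed unit vector, so that
    Cauchy-Schwarz in the space of vector fields applies to them.\<close>
  define b :: 'a where "b = (SOME b. b \<in> Basis)"
  have b: "b \<in> Basis" unfolding b_def by (rule someI_ex) (metis ex_in_conv nonempty_Basis)
  have bb: "b \<bullet> b = 1" "norm b = 1" using b by (auto simp: inner_same_Basis)
  have L: "(\<lambda>x. norm (h x) *\<^sub>R b) \<in> L2 UNIV" "norm (cl (\<lambda>x. norm (h x) *\<^sub>R b)) = norm (cl h)"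
    if "h \<in> L2 UNIV" for h :: "'a \<Rightarrow> 'a"
  proof -
    show l: "(\<lambda>x. norm (h x) *\<^sub>R b) \<in> L2 UNIV" using that bb by (auto simp: L2_UNIV_iff)
    have "(norm (cl (\<lambda>x. norm (h x) *\<^sub>R b)))\<^sup>2 = (norm (cl h))\<^sup>2"
      by (simp add: norm_cl_power2[OF l] norm_cl_power2[OF that] bb)
    then show "norm (cl (\<lambda>x. norm (h x) *\<^sub>R b)) = norm (cl h)" by simp
  qed
  have "(LINT x|lebesgue. norm (f x) * norm (g x)) = cl (\<lambda>x. norm (f x) *\<^sub>R b) \<bullet> cl (\<lambda>x. norm (g x) *\<^sub>R b)"
    by (simp add: inner_cl[OF L(1)[OF assms(1)] L(1)[OF assms(2)]] bb mult.commute)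
  also have "\<dots> \<le> norm (cl f) * norm (cl g)"
    using norm_cauchy_schwarz[of "cl (\<lambda>x. norm (f x) *\<^sub>R b)" "cl (\<lambda>x. norm (g x) *\<^sub>R b)"]
    by (simp add: L(2) assms)
  finally show ?thesis .
qed

text \<open>By stability of the remainder, \<open>k n\<close> may be replaced by \<open>h\<close> at
  the price of a term that tends to 0; for the fixed field \<open>h\<close> dominated convergence
  applies. Both steps rely on the uniform bound of \<open>q n\<close>, since remainders are
  controlled only in L1.\<close>

theorem remainder_tendsto:
  fixes k :: "nat \<Rightarrow> 'a \<Rightarrow> 'a" and q :: "nat \<Rightarrow> 'a \<Rightarrow> 'a"
  assumes k: "\<And>n. k n \<in> L2 UNIV" and h: "h \<in> L2 UNIV" and kh: "(\<lambda>n. cl (k n)) \<longlonglongrightarrow> cl h"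
    and q: "\<And>n. q n \<in> borel_measurable lebesgue" "\<And>n x. norm (q n x) \<le> M" "\<And>x. (\<lambda>n. q n x) \<longlonglongrightarrow> P"
  shows "(\<lambda>n. LINT x|lebesgue. (indicator (E n) x *\<^sub>R (B n x (k n x) - dB n x 0 (k n x))) \<bullet> q n x)
    \<longlonglongrightarrow> (LINT x|lebesgue. (B' x (h x) - dB' x 0 (h x)) \<bullet> P)"
proof -
  interpret N: nemytskii "B n" "dB n" c\<^sub>1 c\<^sub>2 c\<^sub>3 "E n" for n by (rule N)
  have M: "M \<ge> 0" using order_trans[OF norm_ge_zero q(2)] .
  define R where "R n f x = indicator (E n) x *\<^sub>R (B n x (f x) - dB n x 0 (f x))" for n and f :: "'a \<Rightarrow> 'a" and x
  have km: "k n \<in> borel_measurable lebesgue" "h \<in> borel_measurable lebesgue" for n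
    using k[of n] h by (auto simp: L2_UNIV_iff)
  have Rm: "R n f \<in> borel_measurable lebesgue" if "f \<in> borel_measurable lebesgue" for n f
    unfolding R_def by (intro N.indicator_measurable borel_measurable_diff N.meas N.dmeas that borel_measurable_const)
  have Rdiff: "norm (R n f x - R n f' x) \<le> c\<^sub>3 * (norm (f x) + norm (f' x)) * norm (f x - f' x)" for n f f' x
  proof -
    have "R n f x - R n f' x = indicator (E n) x *\<^sub>R (B n x (0 + f x) - B n x (0 + f' x) - dB n x 0 (f x - f' x))"
      by (simp add: R_def N.dA_linear algebra_simps)
    also have "norm \<dots> \<le> norm (B n x (0 + f x) - B n x (0 + f' x) - dB n x 0 (f x - f' x))"
      by (simp add: indicator_def)
    also have "\<dots> \<le> c\<^sub>3 * (norm (f x) + norm (f' x)) * norm (f x - f' x)" by (rule N.remainder_diff)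
    finally show ?thesis .
  qed
  have R0: "norm (R n f x) \<le> c\<^sub>3 * (norm (f x))\<^sup>2" for n f x
    using Rdiff[of n f x "\<lambda>_. 0"] zero(1) by (simp add: R_def N.dA_linear power2_eq_square)
  have int: "integrable lebesgue (\<lambda>x. R n f x \<bullet> q n x)" if f: "f \<in> L2 UNIV" for n f
  proof (rule Bochner_Integration.integrable_bound)
    show "integrable lebesgue (\<lambda>x. c\<^sub>3 * M * (norm (f x))\<^sup>2)" using f by (simp add: L2_UNIV_iff)
    show "(\<lambda>x. R n f x \<bullet> q n x) \<in> borel_measurable lebesgue"
      using f by (intro borel_measurable_inner Rm q) (simp add: L2_UNIV_iff)
    show "AE x in lebesgue. norm (R n f x \<bullet> q n x) \<le> norm (c\<^sub>3 * M * (norm (f x))\<^sup>2)"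
    proof (rule AE_I2)
      fix x
      have "norm (R n f x \<bullet> q n x) \<le> norm (R n f x) * norm (q n x)" by (simp add: Cauchy_Schwarz_ineq2)
      also have "\<dots> \<le> (c\<^sub>3 * (norm (f x))\<^sup>2) * M" using c_pos by (intro mult_mono R0 q) auto
      finally show "norm (R n f x \<bullet> q n x) \<le> norm (c\<^sub>3 * M * (norm (f x))\<^sup>2)" using M c_pos by (simp add: ac_simps)
    qed
  qed
  have 1: "(\<lambda>n. LINT x|lebesgue. R n h x \<bullet> q n x) \<longlonglongrightarrow> (LINT x|lebesgue. (B' x (h x) - dB' x 0 (h x)) \<bullet> P)"
  proof (rule integral_dominated_convergence[where w="\<lambda>x. c\<^sub>3 * M * (norm (h x))\<^sup>2"])
    show "(\<lambda>x. (B' x (h x) - dB' x 0 (h x)) \<bullet> P) \<in> borel_measurable lebesgue"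
      by (intro borel_measurable_inner borel_measurable_diff lim.meas lim.dmeas km borel_measurable_const)
    show "(\<lambda>x. R n h x \<bullet> q n x) \<in> borel_measurable lebesgue" for n by (intro borel_measurable_inner Rm q km)
    show "integrable lebesgue (\<lambda>x. c\<^sub>3 * M * (norm (h x))\<^sup>2)" using h by (simp add: L2_UNIV_iff)
    show "AE x in lebesgue. (\<lambda>n. R n h x \<bullet> q n x) \<longlonglongrightarrow> (B' x (h x) - dB' x 0 (h x)) \<bullet> P"
      unfolding R_def by (intro AE_I2 tendsto_inner q indicator_tendsto tendsto_diff lim)
    show "AE x in lebesgue. norm (R n h x \<bullet> q n x) \<le> c\<^sub>3 * M * (norm (h x))\<^sup>2" for n
    proof (rule AE_I2)
      fix x
      have "norm (R n h x \<bullet> q n x) \<le> norm (R n h x) * norm (q n x)" by (simp add: Cauchy_Schwarz_ineq2)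
      also have "\<dots> \<le> (c\<^sub>3 * (norm (h x))\<^sup>2) * M" using c_pos by (intro mult_mono R0 q) auto
      finally show "norm (R n h x \<bullet> q n x) \<le> c\<^sub>3 * M * (norm (h x))\<^sup>2" by (simp add: ac_simps)
    qed
  qed
  have 2: "(\<lambda>n. (LINT x|lebesgue. R n (k n) x \<bullet> q n x) - (LINT x|lebesgue. R n h x \<bullet> q n x)) \<longlonglongrightarrow> 0"
  proof (rule Lim_null_comparison[where g="\<lambda>n. c\<^sub>3 * M * ((norm (cl (k n)) + norm (cl h)) * norm (cl (k n) - cl h))"])
    show "\<forall>\<^sub>F n in sequentially. norm ((LINT x|lebesgue. R n (k n) x \<bullet> q n x) - (LINT x|lebesgue. R n h x \<bullet> q n x))
        \<le> c\<^sub>3 * M * ((norm (cl (k n)) + norm (cl h)) * norm (cl (k n) - cl h))"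
    proof (rule always_eventually, rule allI)
      fix n
      note d = L2_diff[OF k[of n] h]
      note I = integral_L2_bound[OF k[of n] d] integral_L2_bound[OF h d]
      have "norm ((LINT x|lebesgue. R n (k n) x \<bullet> q n x) - (LINT x|lebesgue. R n h x \<bullet> q n x))
          = norm (LINT x|lebesgue. (R n (k n) x - R n h x) \<bullet> q n x)"
        unfolding inner_diff_left by (subst Bochner_Integration.integral_diff[OF int[OF k] int[OF h]]) simp
      also have "\<dots> \<le> (LINT x|lebesgue. c\<^sub>3 * M * (norm (k n x) * norm (k n x - h x) + norm (h x) * norm (k n x - h x)))"
      proof (rule integral_norm_bound[THEN order_trans], rule integral_mono)
        show "integrable lebesgue (\<lambda>x. norm ((R n (k n) x - R n h x) \<bullet> q n x))"
          unfolding inner_diff_left by (intro integrable_norm Bochner_Integration.integrable_diff int k h)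
        show "integrable lebesgue (\<lambda>x. c\<^sub>3 * M * (norm (k n x) * norm (k n x - h x) + norm (h x) * norm (k n x - h x)))"
          using I by simp
        fix x
        have "norm ((R n (k n) x - R n h x) \<bullet> q n x) \<le> norm (R n (k n) x - R n h x) * norm (q n x)"
          by (simp add: Cauchy_Schwarz_ineq2)
        also have "\<dots> \<le> (c\<^sub>3 * (norm (k n x) + norm (h x)) * norm (k n x - h x)) * M"
          using c_pos by (intro mult_mono Rdiff q) auto
        finally show "norm ((R n (k n) x - R n h x) \<bullet> q n x)
            \<le> c\<^sub>3 * M * (norm (k n x) * norm (k n x - h x) + norm (h x) * norm (k n x - h x))"
          by (simp add: algebra_simps)
      qed
      also have "\<dots> = c\<^sub>3 * M * ((LINT x|lebesgue. norm (k n x) * norm (k n x - h x)) + (LINT x|lebesgue. norm (h x) * norm (k n x - h x)))"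
        using I by simp
      also have "\<dots> \<le> c\<^sub>3 * M * (norm (cl (k n)) * norm (cl (\<lambda>x. k n x - h x)) + norm (cl h) * norm (cl (\<lambda>x. k n x - h x)))"
        using c_pos M by (intro mult_left_mono add_mono integral_L2_norm_le k h d) auto
      finally show "norm ((LINT x|lebesgue. R n (k n) x \<bullet> q n x) - (LINT x|lebesgue. R n h x \<bullet> q n x))
          \<le> c\<^sub>3 * M * ((norm (cl (k n)) + norm (cl h)) * norm (cl (k n) - cl h))"
        by (simp add: cl_diff[OF k h] distrib_right)
    qed
    have "(\<lambda>n. c\<^sub>3 * M * ((norm (cl (k n)) + norm (cl h)) * norm (cl (k n) - cl h)))
        \<longlonglongrightarrow> c\<^sub>3 * M * ((norm (cl h) + norm (cl h)) * norm (cl h - cl h))"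
      by (intro tendsto_intros kh)
    then show "(\<lambda>n. c\<^sub>3 * M * ((norm (cl (k n)) + norm (cl h)) * norm (cl (k n) - cl h))) \<longlonglongrightarrow> 0" by simp
  qed
  from tendsto_add[OF 2 1] show ?thesis unfolding R_def by simp
qed

end

section \<open>Rescaling\<close>

text \<open>For a potential \<open>v\<close>, the gradient of
  \<open>\<lambda>x. v (z + \<epsilon> *\<^sub>R x) / \<epsilon>\<close> is the gradient of
  \<open>v\<close> at the blown-up point, so gradients are rescaled without an extra factor.\<close>

definition rescale_field :: "'a::euclidean_space \<Rightarrow> real \<Rightarrow> ('a, 'a) ell2 \<Rightarrow> ('a, 'a) ell2" where
  "rescale_field z \<epsilon> F = cl (\<lambda>x. rep F (z + \<epsilon> *\<^sub>R x))"

context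
  fixes z :: "'a::euclidean_space" and \<epsilon> :: real
  assumes \<epsilon>: "\<epsilon> > 0"
begin

lemma L2_affine:
  fixes f :: "'a \<Rightarrow> 'a"
  assumes f: "f \<in> L2 UNIV"
  shows "(\<lambda>x. f (z + \<epsilon> *\<^sub>R x)) \<in> L2 UNIV"
proof -
  have n: "\<epsilon> \<noteq> 0" using \<epsilon> by simp
  have fm: "f \<in> borel_measurable lebesgue" "integrable lebesgue (\<lambda>x. (norm (f x))\<^sup>2)"
    using f by (auto simp: L2_UNIV_iff)
  then show ?thesis
    using measurable_affine[OF n fm(1), of z] integrable_affine_iff[OF n, of "\<lambda>x. (norm (f x))\<^sup>2" z]
    by (auto simp: L2_UNIV_iff)
qed

lemma rescale_cl:
  fixes f :: "'a \<Rightarrow> 'a"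
  assumes f: "f \<in> L2 UNIV"
  shows "rescale_field z \<epsilon> (cl f) = cl (\<lambda>x. f (z + \<epsilon> *\<^sub>R x))"
  unfolding rescale_field_def
proof (rule cl_cong[OF L2_affine[OF rep_L2]])
  show "AE x in lebesgue. rep (cl f) (z + \<epsilon> *\<^sub>R x) = f (z + \<epsilon> *\<^sub>R x)"
    using AE_affine[OF _ rep_cl[OF f], of \<epsilon> z] \<epsilon> by simp
qed

text \<open>The Jacobian is the same power of \<open>\<epsilon>\<close> that occurs in the volume of
  the inclusion, so quotients by that volume become inner products of blown-up fields divided by the
  volume of \<open>\<omega>\<close>.\<close>

lemma inner_rescale: "F \<bullet> G = \<epsilon> ^ DIM('a) * (rescale_field z \<epsilon> F \<bullet> rescale_field z \<epsilon> G)"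
proof -
  have n: "\<epsilon> \<noteq> 0" using \<epsilon> by simp
  have "(\<lambda>x. rep F x \<bullet> rep G x) \<in> borel_measurable lebesgue"
    by (intro borel_measurable_inner rep_measurable)
  from integral_affine[OF n this, of z]
  have "F \<bullet> G = \<epsilon> ^ DIM('a) * (LINT x|lebesgue. rep F (z + \<epsilon> *\<^sub>R x) \<bullet> rep G (z + \<epsilon> *\<^sub>R x))"
    using \<epsilon> by (simp add: inner_rep)
  also have "(LINT x|lebesgue. rep F (z + \<epsilon> *\<^sub>R x) \<bullet> rep G (z + \<epsilon> *\<^sub>R x)) = rescale_field z \<epsilon> F \<bullet> rescale_field z \<epsilon> G"
    unfolding rescale_field_def by (rule inner_cl[symmetric]) (intro L2_affine rep_L2)+
  finally show ?thesis .
qed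

lemma rescale_lincomb:
  "rescale_field z \<epsilon> (a *\<^sub>R F + b *\<^sub>R G) = a *\<^sub>R rescale_field z \<epsilon> F + b *\<^sub>R rescale_field z \<epsilon> G"
proof -
  note L = L2_scaleR[OF rep_L2, of a F] L2_scaleR[OF rep_L2, of b G]
  note L' = L2_affine[OF rep_L2, of F] L2_affine[OF rep_L2, of G]
  have "a *\<^sub>R F + b *\<^sub>R G = cl (\<lambda>x. a *\<^sub>R rep F x + b *\<^sub>R rep G x)"
    by (simp add: cl_add[OF L, symmetric] cl_scaleR[OF rep_L2, symmetric] cl_rep)
  then have "rescale_field z \<epsilon> (a *\<^sub>R F + b *\<^sub>R G) = cl (\<lambda>x. a *\<^sub>R rep F (z + \<epsilon> *\<^sub>R x) + b *\<^sub>R rep G (z + \<epsilon> *\<^sub>R x))"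
    by (simp add: rescale_cl[OF L2_add[OF L]])
  also have "\<dots> = a *\<^sub>R rescale_field z \<epsilon> F + b *\<^sub>R rescale_field z \<epsilon> G"
    unfolding rescale_field_def
    by (simp add: cl_add[OF L2_scaleR[OF L'(1)] L2_scaleR[OF L'(2)], symmetric] cl_scaleR[OF L'(1)] cl_scaleR[OF L'(2)])
  finally show ?thesis .
qed

lemma rescale_diff: "rescale_field z \<epsilon> (F - G) = rescale_field z \<epsilon> F - rescale_field z \<epsilon> G"
  using rescale_lincomb[of 1 F "-1" G] by simp

lemma subspace_rescale: "subspace W \<Longrightarrow> subspace (rescale_field z \<epsilon> ` W)"
proof (rule subspaceI)
  assume W: "subspace W"
  have lin: "a *\<^sub>R x + b *\<^sub>R y \<in> rescale_field z \<epsilon> ` W" if xy: "x \<in> rescale_field z \<epsilon> ` W" "y \<in> rescale_field z \<epsilon> ` W" for a b x y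
  proof -
    obtain F G where "F \<in> W" "G \<in> W" "x = rescale_field z \<epsilon> F" "y = rescale_field z \<epsilon> G" using xy by auto
    then show ?thesis
      using rescale_lincomb[of a F b G] W
      by (intro image_eqI[of _ _ "a *\<^sub>R F + b *\<^sub>R G"]) (auto intro!: subspace_add subspace_scale)
  qed
  have m0: "rescale_field z \<epsilon> 0 \<in> rescale_field z \<epsilon> ` W" using subspace_0[OF W] by blast
  show "0 \<in> rescale_field z \<epsilon> ` W" using lin[OF m0 m0, of 0 0] by simp
  show "x + y \<in> rescale_field z \<epsilon> ` W" if "x \<in> rescale_field z \<epsilon> ` W" "y \<in> rescale_field z \<epsilon> ` W" for x y
    using lin[OF that, of 1 1] by simp
  show "c *\<^sub>R x \<in> rescale_field z \<epsilon> ` W" if "x \<in> rescale_field z \<epsilon> ` W" for c x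
    using lin[OF that that, of c 0] by simp
qed

lemma rescale_test:
  assumes \<phi>: "\<phi> \<in> test_functions D"
  shows "rescale_field z \<epsilon> (cl (grad \<phi>)) \<in> gradspace UNIV"
proof -
  have t: "(\<lambda>x. \<phi> (z + \<epsilon> *\<^sub>R x)) \<in> test_functions UNIV" by (rule test_functions_affine[OF \<phi>]) (use \<epsilon> in auto)
  note t' = test_functions_cmult[OF t, of "1 / \<epsilon>"]
  have "grad (\<lambda>x. 1 / \<epsilon> * \<phi> (z + \<epsilon> *\<^sub>R x)) = (\<lambda>x. grad \<phi> (z + \<epsilon> *\<^sub>R x))"
    using grad_cmult[OF t, of "1 / \<epsilon>"] grad_affine[OF \<phi>] \<epsilon> by auto
  then have "rescale_field z \<epsilon> (cl (grad \<phi>)) = cl (grad (\<lambda>x. 1 / \<epsilon> * \<phi> (z + \<epsilon> *\<^sub>R x)))"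
    by (simp only: rescale_cl[OF test_functions_L2(2)[OF \<phi>]])
  then show ?thesis using cl_grad_in_gradspace[OF t'] by simp
qed

lemma rescale_tendsto:
  assumes "X \<longlonglongrightarrow> F"
  shows "(\<lambda>n. rescale_field z \<epsilon> (X n)) \<longlonglongrightarrow> rescale_field z \<epsilon> F"
proof -
  have sq: "(norm (rescale_field z \<epsilon> G))\<^sup>2 = (norm G)\<^sup>2 / \<epsilon> ^ DIM('a)" for G
    using inner_rescale[of G G] \<epsilon> by (simp add: power2_norm_eq_inner field_simps)
  have "(\<lambda>n. sqrt ((norm (X n - F))\<^sup>2 / \<epsilon> ^ DIM('a))) \<longlonglongrightarrow> sqrt ((norm (F - F))\<^sup>2 / \<epsilon> ^ DIM('a))"
    using \<epsilon> by (intro tendsto_intros assms) auto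
  moreover have "sqrt ((norm (X n - F))\<^sup>2 / \<epsilon> ^ DIM('a)) = norm (rescale_field z \<epsilon> (X n) - rescale_field z \<epsilon> F)" for n
    by (simp add: sq[symmetric] rescale_diff)
  ultimately have "(\<lambda>n. rescale_field z \<epsilon> (X n) - rescale_field z \<epsilon> F) \<longlonglongrightarrow> 0" by (simp add: tendsto_norm_zero_iff)
  then show ?thesis by (rule LIM_zero_cancel)
qed

lemma rescale_gradspace: "rescale_field z \<epsilon> ` gradspace D \<subseteq> gradspace UNIV"
proof safe
  fix F assume "F \<in> gradspace D"
  then obtain X where X: "\<And>n. X n \<in> (\<lambda>\<phi>. cl (grad \<phi>)) ` test_functions D" "X \<longlonglongrightarrow> F"
    unfolding gradspace_def closure_sequential by blast
  show "rescale_field z \<epsilon> F \<in> gradspace UNIV"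
  proof (rule closed_sequentially[OF closed_gradspace _ rescale_tendsto[OF X(2)]])
    show "rescale_field z \<epsilon> (X n) \<in> gradspace UNIV" for n using X(1)[of n] by (auto intro: rescale_test)
  qed
qed

text \<open>A fixed test function on the whole space comes from one on \<open>D\<close> as soon as
  its support, shrunk by \<open>\<epsilon>\<close> around \<open>z\<close>, fits into
  \<open>D\<close>. This is how the rescaled spaces exhaust the limit space.\<close>

lemma test_in_rescale_gradspace:
  fixes \<psi> :: "'a \<Rightarrow> real"
  assumes \<psi>: "\<psi> \<in> test_functions UNIV" and r: "\<And>x. norm x \<ge> r \<Longrightarrow> \<psi> x = 0" and D: "cball z (\<epsilon> * r) \<subseteq> D"
  shows "cl (grad \<psi>) \<in> rescale_field z \<epsilon> ` gradspace D"
proof -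
  have inv: "- ((1 / \<epsilon>) *\<^sub>R z) + (1 / \<epsilon>) *\<^sub>R y = (1 / \<epsilon>) *\<^sub>R (y - z)" for y by (simp add: scaleR_diff_right)
  \<comment> \<open>The factor \<open>\<epsilon>\<close> compensates the
    \<open>1 / \<epsilon>\<close> that the inner scaling brings into the gradient.\<close>
  define \<phi> where "\<phi> y = \<epsilon> * \<psi> (- ((1 / \<epsilon>) *\<^sub>R z) + (1 / \<epsilon>) *\<^sub>R y)" for y
  have t: "(\<lambda>y. \<psi> (- ((1 / \<epsilon>) *\<^sub>R z) + (1 / \<epsilon>) *\<^sub>R y)) \<in> test_functions UNIV"
    by (rule test_functions_affine[OF \<psi>]) (use \<epsilon> in auto)
  have "\<phi> \<in> test_functions D"
  proof (rule test_functionsI[of _ "cball z (\<epsilon> * r)"])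
    show "C_k k \<phi>" for k unfolding \<phi>_def by (intro C_k_cmult test_functionsD(1)[OF t])
    show "\<phi> y = 0" if "y \<notin> cball z (\<epsilon> * r)" for y
    proof -
      have "norm ((1 / \<epsilon>) *\<^sub>R (y - z)) = norm (y - z) / \<epsilon>" using \<epsilon> by simp
      moreover have "r \<le> norm (y - z) / \<epsilon>"
        using that \<epsilon> by (simp add: dist_norm norm_minus_commute pos_le_divide_eq mult.commute)
      ultimately have "norm ((1 / \<epsilon>) *\<^sub>R (y - z)) \<ge> r" by (simp only:)
      from r[OF this] show ?thesis unfolding \<phi>_def inv by simp
    qed
  qed (use D in auto)
  moreover have "cl (grad \<psi>) = rescale_field z \<epsilon> (cl (grad \<phi>))"
  proof -
    have "grad \<phi> y = grad \<psi> (- ((1 / \<epsilon>) *\<^sub>R z) + (1 / \<epsilon>) *\<^sub>R y)" for y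
    proof -
      have "grad \<phi> y = \<epsilon> *\<^sub>R grad (\<lambda>y. \<psi> (- ((1 / \<epsilon>) *\<^sub>R z) + (1 / \<epsilon>) *\<^sub>R y)) y"
        unfolding \<phi>_def by (rule grad_cmult[OF t])
      also have "\<dots> = \<epsilon> *\<^sub>R (1 / \<epsilon>) *\<^sub>R grad \<psi> (- ((1 / \<epsilon>) *\<^sub>R z) + (1 / \<epsilon>) *\<^sub>R y)"
        by (simp only: grad_affine[OF \<psi>])
      finally show ?thesis using \<epsilon> by simp
    qed
    then have "grad \<phi> (z + \<epsilon> *\<^sub>R x) = grad \<psi> x" for x using \<epsilon> by (simp add: inv scaleR_add_right)
    then show ?thesis by (simp add: rescale_cl[OF test_functions_L2(2)[OF \<open>\<phi> \<in> test_functions D\<close>]])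
  qed
  ultimately show ?thesis using cl_grad_in_gradspace by blast
qed

end

section \<open>The transmission problem\<close>

lemma lmeasurable_open_bounded: "open D \<Longrightarrow> bounded D \<Longrightarrow> D \<in> lmeasurable" for D :: "'a::euclidean_space set"
  by (rule lmeasurable_open) 

lemma L2_indicator_const:
  fixes c :: "'b::euclidean_space"
  assumes "S \<in> lmeasurable"
  shows "(\<lambda>x::'a::euclidean_space. indicat_real S x *\<^sub>R c) \<in> L2 UNIV"
proof -
  have S: "S \<in> sets lebesgue" using assms by blast
  have "integrable lebesgue (\<lambda>x. indicat_real S x * (norm c)\<^sup>2)"
    using assms by (simp add: lmeasurable_iff_integrable)
  moreover have "(\<lambda>x. indicat_real S x * (norm c)\<^sup>2) = (\<lambda>x. (norm (indicat_real S x *\<^sub>R c))\<^sup>2)"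
    by (auto simp: indicator_def)
  ultimately show ?thesis unfolding L2_UNIV_iff
    using S by (simp only: borel_measurable_scaleR borel_measurable_indicator borel_measurable_const)
qed

text \<open>Supplies the condition under which the operators on \<open>D\<close> are monotone in the
  full norm; the field is the zero extension of the gradient of a function in
  \<open>H10 D\<close>.\<close>

lemma gradspace_vanishes_off:
  fixes D :: "'a::euclidean_space set"
  assumes D: "open D" "bounded D" and F: "F \<in> gradspace D"
  shows "AE x in lebesgue. x \<notin> D \<longrightarrow> rep F x = 0"
proof -
  obtain u where u: "u \<in> H10 D" "gfield D u = F" using gradspace_imp_H10[OF D F] .
  have "AE x in lebesgue. rep F x = indicator D x *\<^sub>R wgrad D u x"
    using rep_cl[OF L2_wgrad[OF D(1) H10_imp_H1[OF u(1)]]] u(2) by (simp add: gfield_def)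
  then show ?thesis by eventually_elim auto
qed

text \<open>The test space of the corrector equation is thus the closed subspace in which the
  blown-up fields converge.\<close>

lemma gradspace_UNIV_eq: "gradspace UNIV = gfield UNIV ` BL"
  using gradspace_imp_BL gfield_BL_in_gradspace by blast

locale transmission =
  fixes a\<^sub>1 a\<^sub>2 :: "'a::euclidean_space \<Rightarrow> 'a" and c\<^sub>1 c\<^sub>2 c\<^sub>3 :: real
  assumes c_pos: "c\<^sub>1 > 0" "c\<^sub>2 > 0" "c\<^sub>3 > 0"
    and differentiable: "\<And>a x. a \<in> {a\<^sub>1, a\<^sub>2} \<Longrightarrow> a differentiable (at x)"
    and monotone: "\<And>a x y. a \<in> {a\<^sub>1, a\<^sub>2} \<Longrightarrow> (a x - a y) \<bullet> (x - y) \<ge> c\<^sub>1 * (norm (x - y))\<^sup>2"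
    and lipschitz: "\<And>a x y. a \<in> {a\<^sub>1, a\<^sub>2} \<Longrightarrow> norm (a x - a y) \<le> c\<^sub>2 * norm (x - y)"
    and lipschitz_derivative: "\<And>a x y. a \<in> {a\<^sub>1, a\<^sub>2} \<Longrightarrow>
          onorm (\<lambda>v. frechet_derivative a (at x) v - frechet_derivative a (at y) v) \<le> c\<^sub>3 * norm (x - y)"
begin

abbreviation AA where "AA \<equiv> \<A> a\<^sub>1 a\<^sub>2"
abbreviation dAA where "dAA \<equiv> d\<A> a\<^sub>1 a\<^sub>2"

lemma AA_eq: "AA \<Omega> x = (if x \<in> \<Omega> then a\<^sub>1 else a\<^sub>2)"
  by (auto simp: \<A>_def)

lemma dAA_eq: "dAA \<Omega> x y = frechet_derivative (if x \<in> \<Omega> then a\<^sub>1 else a\<^sub>2) (at y)"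
  by (simp add: d\<A>_def AA_eq)

context
  fixes a assumes a: "a \<in> {a\<^sub>1, a\<^sub>2}"
begin

lemma has_derivative_a: "(a has_derivative frechet_derivative a (at y)) (at y)"
  using differentiable[OF a] by (simp add: frechet_derivative_works)

lemma bounded_linear_da: "bounded_linear (frechet_derivative a (at y))"
  by (rule has_derivative_bounded_linear[OF has_derivative_a])

lemma da_lipschitz:
  "norm (frechet_derivative a (at x) v - frechet_derivative a (at y) v) \<le> c\<^sub>3 * norm (x - y) * norm v"
proof -
  have "norm (frechet_derivative a (at x) v - frechet_derivative a (at y) v)
      \<le> onorm (\<lambda>v. frechet_derivative a (at x) v - frechet_derivative a (at y) v) * norm v"
    by (rule onorm) (intro bounded_linear_sub bounded_linear_da)
  also have "\<dots> \<le> c\<^sub>3 * norm (x - y) * norm v" by (intro mult_right_mono lipschitz_derivative a) simp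
  finally show ?thesis .
qed

lemma continuous_a: "continuous_on UNIV a"
  using has_derivative_continuous[OF has_derivative_a] by (auto intro: continuous_at_imp_continuous_on)

text \<open>Joint continuity in base point and direction, the former by \<open>c\<^sub>3\<close> and
  the latter by linearity. It makes the superposition with two measurable fields measurable.\<close>

lemma continuous_da: "continuous_on UNIV (\<lambda>p. frechet_derivative a (at (fst p)) (snd p))"
proof (rule continuous_at_imp_continuous_on, rule ballI)
  fix p :: "'a \<times> 'a"
  let ?f = "\<lambda>p. frechet_derivative a (at (fst p)) (snd p)"
  interpret bounded_linear "frechet_derivative a (at (fst p))" by (rule bounded_linear_da)
  have "((\<lambda>q. ?f q - ?f p) \<longlongrightarrow> 0) (at p)"
  proof (rule Lim_null_comparison[OF always_eventually], rule allI)
    fix q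
    have "?f q - ?f p = (?f q - frechet_derivative a (at (fst p)) (snd q)) + frechet_derivative a (at (fst p)) (snd q - snd p)"
      by (simp add: diff)
    then have "norm (?f q - ?f p) \<le> norm (?f q - frechet_derivative a (at (fst p)) (snd q))
        + norm (frechet_derivative a (at (fst p)) (snd q - snd p))"
      using norm_triangle_ineq by metis
    also have "\<dots> \<le> c\<^sub>3 * norm (fst q - fst p) * norm (snd q)
        + onorm (frechet_derivative a (at (fst p))) * norm (snd q - snd p)"
      by (intro add_mono da_lipschitz onorm bounded_linear_da)
    finally show "norm (?f q - ?f p) \<le> c\<^sub>3 * norm (fst q - fst p) * norm (snd q)
        + onorm (frechet_derivative a (at (fst p))) * norm (snd q - snd p)" .
  next
    have "((\<lambda>q. c\<^sub>3 * norm (fst q - fst p) * norm (snd q) + onorm (frechet_derivative a (at (fst p))) * norm (snd q - snd p))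
      \<longlongrightarrow> c\<^sub>3 * norm (fst p - fst p) * norm (snd p) + onorm (frechet_derivative a (at (fst p))) * norm (snd p - snd p)) (at p)"
      by (intro tendsto_intros)
    then show "((\<lambda>q. c\<^sub>3 * norm (fst q - fst p) * norm (snd q) + onorm (frechet_derivative a (at (fst p))) * norm (snd q - snd p))
      \<longlongrightarrow> 0) (at p)" by simp
  qed
  then show "isCont ?f p" unfolding isCont_def by (rule LIM_zero_cancel)
qed

lemma measurable_a: "f \<in> borel_measurable lebesgue \<Longrightarrow> (\<lambda>x. a (f x)) \<in> borel_measurable lebesgue"
  by (rule borel_measurable_continuous_on[OF continuous_a])

lemma measurable_da:
  fixes f g :: "'a \<Rightarrow> 'a"
  assumes "f \<in> borel_measurable lebesgue" "g \<in> borel_measurable lebesgue"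
  shows "(\<lambda>x. frechet_derivative a (at (f x)) (g x)) \<in> borel_measurable lebesgue"
  using borel_measurable_continuous_Pair[OF assms continuous_da] .

end

lemma monotone_field_AA:
  assumes \<Omega>: "\<Omega> \<in> sets lebesgue"
  shows "monotone_field (AA \<Omega>) (dAA \<Omega>) c\<^sub>1 c\<^sub>2 c\<^sub>3"
proof
  fix x y y' v :: 'a and f g :: "'a \<Rightarrow> 'a"
  have a: "(if x \<in> \<Omega> then a\<^sub>1 else a\<^sub>2) \<in> {a\<^sub>1, a\<^sub>2}" by simp
  show "(AA \<Omega> x has_derivative dAA \<Omega> x y) (at y)"
    unfolding dAA_eq unfolding AA_eq by (rule has_derivative_a[OF a])
  show "c\<^sub>1 * (norm (y - y'))\<^sup>2 \<le> (AA \<Omega> x y - AA \<Omega> x y') \<bullet> (y - y')"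
    unfolding AA_eq by (rule monotone[OF a])
  show "norm (AA \<Omega> x y - AA \<Omega> x y') \<le> c\<^sub>2 * norm (y - y')"
    unfolding AA_eq by (rule lipschitz[OF a])
  show "norm (dAA \<Omega> x y v - dAA \<Omega> x y' v) \<le> c\<^sub>3 * norm (y - y') * norm v"
    unfolding dAA_eq by (rule da_lipschitz[OF a])
  assume f: "f \<in> borel_measurable lebesgue"
  show "(\<lambda>x. AA \<Omega> x (f x)) \<in> borel_measurable lebesgue"
    unfolding \<A>_def
    by (rule measurable_If_set[OF measurable_a[OF _ f] measurable_a[OF _ f]]) (use \<Omega> in simp_all)
  assume g: "g \<in> borel_measurable lebesgue"
  have "(\<lambda>x. dAA \<Omega> x (f x) (g x)) =
      (\<lambda>x. if x \<in> \<Omega> then frechet_derivative a\<^sub>1 (at (f x)) (g x) else frechet_derivative a\<^sub>2 (at (f x)) (g x))"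
    by (auto simp: dAA_eq)
  moreover have "(\<lambda>x. if x \<in> \<Omega> then frechet_derivative a\<^sub>1 (at (f x)) (g x) else frechet_derivative a\<^sub>2 (at (f x)) (g x))
      \<in> borel_measurable lebesgue"
    by (rule measurable_If_set[OF measurable_da[OF _ f g] measurable_da[OF _ f g]]) (use \<Omega> in simp_all)
  ultimately show "(\<lambda>x. dAA \<Omega> x (f x) (g x)) \<in> borel_measurable lebesgue" by argo
qed (rule c_pos)+

lemma nemytskii_AA:
  assumes \<Omega>: "\<Omega> \<in> sets lebesgue" and D: "open D" "bounded D"
  shows "nemytskii (AA \<Omega>) (dAA \<Omega>) c\<^sub>1 c\<^sub>2 c\<^sub>3 D"
proof -
  interpret monotone_field "AA \<Omega>" "dAA \<Omega>" c\<^sub>1 c\<^sub>2 c\<^sub>3 by (rule monotone_field_AA[OF \<Omega>])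
  have Dl: "D \<in> lmeasurable" using D by (rule lmeasurable_open_bounded)
  show ?thesis
  proof
    show Ds: "D \<in> sets lebesgue" using D by simp
    show "(\<lambda>x. indicat_real D x *\<^sub>R AA \<Omega> x 0) \<in> L2 UNIV"
    proof (rule L2_bound[OF L2_indicator_const[OF Dl, of "1::real"]])
      show "(\<lambda>x. indicat_real D x *\<^sub>R AA \<Omega> x 0) \<in> borel_measurable lebesgue"
        by (intro borel_measurable_scaleR borel_measurable_indicator meas Ds borel_measurable_const)
      show "norm (indicat_real D x *\<^sub>R AA \<Omega> x 0) \<le> (norm (a\<^sub>1 0) + norm (a\<^sub>2 0)) * norm (indicat_real D x *\<^sub>R (1::real))" for x
        by (auto simp: indicator_def \<A>_def)
    qed
  qed
qed

text \<open>The limit operator of the blow-up: the background gradient is frozen at the constant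
  \<open>U\<close>. A nonzero constant is not in L2 of the whole space, so its contribution is
  subtracted.\<close>

definition BB :: "'a set \<Rightarrow> 'a \<Rightarrow> 'a \<Rightarrow> 'a \<Rightarrow> 'a" where
  "BB \<omega> U x y = AA \<omega> x (U + y) - AA \<omega> x U"

definition dBB :: "'a set \<Rightarrow> 'a \<Rightarrow> 'a \<Rightarrow> 'a \<Rightarrow> 'a \<Rightarrow> 'a" where
  "dBB \<omega> U x y = dAA \<omega> x (U + y)"

lemma nemytskii_BB:
  assumes \<omega>: "\<omega> \<in> sets lebesgue"
  shows "nemytskii (BB \<omega> U) (dBB \<omega> U) c\<^sub>1 c\<^sub>2 c\<^sub>3 UNIV"
proof -
  interpret A: monotone_field "AA \<omega>" "dAA \<omega>" c\<^sub>1 c\<^sub>2 c\<^sub>3 by (rule monotone_field_AA[OF \<omega>])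
  interpret B: monotone_field "BB \<omega> U" "dBB \<omega> U" c\<^sub>1 c\<^sub>2 c\<^sub>3
    unfolding BB_def[abs_def] dBB_def[abs_def] by (rule A.shift) simp
  show ?thesis by unfold_locales (simp_all add: BB_def L2_zero)
qed

subsection \<open>The corrector\<close>

text \<open>Riesz representative of the right-hand side; the minus sign is absorbed by exchanging
  \<open>a\<^sub>1\<close> and \<open>a\<^sub>2\<close>.\<close>

definition corrector_rhs :: "'a set \<Rightarrow> 'a \<Rightarrow> ('a, 'a) ell2" where
  "corrector_rhs \<omega> U = cl (\<lambda>x. indicator \<omega> x *\<^sub>R (a\<^sub>2 U - a\<^sub>1 U))"

text \<open>The equation involves \<open>K\<close> and the test functions only through their
  gradients, and those of \<open>BL\<close> fill \<open>gradspace UNIV\<close>.\<close>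

lemma corrector_equation_iff:
  assumes \<omega>: "\<omega> \<in> lmeasurable" and K: "K \<in> BL"
  shows "corrector_equation a\<^sub>1 a\<^sub>2 \<omega> U K \<longleftrightarrow>
    (\<forall>w\<in>gradspace UNIV. nemytskii.Nem (BB \<omega> U) UNIV (gfield UNIV K) \<bullet> w = corrector_rhs \<omega> U \<bullet> w)"
proof -
  have \<omega>s: "\<omega> \<in> sets lebesgue" using \<omega> by blast
  interpret B: nemytskii "BB \<omega> U" "dBB \<omega> U" c\<^sub>1 c\<^sub>2 c\<^sub>3 UNIV by (rule nemytskii_BB[OF \<omega>s])
  note K2 = BL_D(2)[OF K]
  have "(LINT x|lebesgue. (AA \<omega> x (wgrad UNIV K x + U) - AA \<omega> x U) \<bullet> wgrad UNIV \<phi> x)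
        = B.Nem (gfield UNIV K) \<bullet> gfield UNIV \<phi>"
    "- (LINT x|lebesgue_on \<omega>. (a\<^sub>1 U - a\<^sub>2 U) \<bullet> wgrad UNIV \<phi> x) = corrector_rhs \<omega> U \<bullet> gfield UNIV \<phi>"
    if \<phi>: "\<phi> \<in> BL" for \<phi>
  proof -
    note \<phi>2 = BL_D(2)[OF \<phi>]
    show "(LINT x|lebesgue. (AA \<omega> x (wgrad UNIV K x + U) - AA \<omega> x U) \<bullet> wgrad UNIV \<phi> x)
        = B.Nem (gfield UNIV K) \<bullet> gfield UNIV \<phi>"
      unfolding BL_D(4)[OF K] BL_D(4)[OF \<phi>] B.Nem_cl[OF K2]
      by (subst inner_cl[OF B.Nem_L2[OF K2] \<phi>2]) (simp add: BB_def add.commute)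
    have "corrector_rhs \<omega> U \<bullet> gfield UNIV \<phi> = (LINT x|lebesgue. (indicator \<omega> x *\<^sub>R (a\<^sub>2 U - a\<^sub>1 U)) \<bullet> wgrad UNIV \<phi> x)"
      unfolding BL_D(4)[OF \<phi>] corrector_rhs_def by (rule inner_cl[OF L2_indicator_const[OF \<omega>] \<phi>2])
    also have "\<dots> = (LINT x|lebesgue. - (indicator \<omega> x *\<^sub>R ((a\<^sub>1 U - a\<^sub>2 U) \<bullet> wgrad UNIV \<phi> x)))"
      by (intro Bochner_Integration.integral_cong) (auto simp: inner_diff_left algebra_simps)
    also have "\<dots> = - (LINT x|lebesgue_on \<omega>. (a\<^sub>1 U - a\<^sub>2 U) \<bullet> wgrad UNIV \<phi> x)"
      by (simp add: integral_lebesgue_on[OF \<omega>s])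
    finally show "- (LINT x|lebesgue_on \<omega>. (a\<^sub>1 U - a\<^sub>2 U) \<bullet> wgrad UNIV \<phi> x) = corrector_rhs \<omega> U \<bullet> gfield UNIV \<phi>" ..
  qed
  then show ?thesis unfolding corrector_equation_def gradspace_UNIV_eq by simp
qed

lemma corrector_field_exists:
  assumes \<omega>: "\<omega> \<in> sets lebesgue"
  shows "\<exists>!H. H \<in> gradspace UNIV \<and>
    (\<forall>w\<in>gradspace UNIV. nemytskii.Nem (BB \<omega> U) UNIV H \<bullet> w = corrector_rhs \<omega> U \<bullet> w)"
proof -
  interpret B: nemytskii "BB \<omega> U" "dBB \<omega> U" c\<^sub>1 c\<^sub>2 c\<^sub>3 UNIV by (rule nemytskii_BB[OF \<omega>])
  show ?thesis
    using B.Nem_solution[OF subspace_gradspace closed_gradspace, of UNIV "corrector_rhs \<omega> U"]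
      B.Nem_unique[OF subspace_gradspace, of UNIV] by (auto intro!: ex_ex1I)
qed

end

text \<open>Gradients of test functions integrate to zero, so zero is a weak gradient of a
  constant.\<close>

lemma AE_const_imp_gfield_zero:
  fixes u :: "'a::euclidean_space \<Rightarrow> real"
  assumes u: "u \<in> BL" and c: "AE x in lebesgue. u x = c"
  shows "gfield UNIV u = 0"
proof -
  have loc: "u \<in> L1_loc UNIV" using BL_D(1)[OF u] by (simp add: weak_gradient_def)
  have um: "u \<in> borel_measurable lebesgue" by (rule L1_loc_UNIV_measurable[OF loc])
  have "weak_gradient UNIV u (\<lambda>x. 0)"
    unfolding weak_gradient_def lebesgue_on_UNIV_eq
  proof (intro conjI ballI loc)
    show "(\<lambda>x. 0) \<in> L1_loc UNIV" by (simp add: L1_loc_def)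
    fix \<phi> :: "'a \<Rightarrow> real" assume \<phi>: "\<phi> \<in> test_functions UNIV"
    obtain S where S: "compact S" "\<And>x. x \<notin> S \<Longrightarrow> \<phi> x = 0" "\<And>x. x \<notin> S \<Longrightarrow> grad \<phi> x = 0"
      using test_functions_support[OF \<phi>] by metis
    have "(LINT x|lebesgue. u x *\<^sub>R grad \<phi> x) = (LINT x|lebesgue. c *\<^sub>R grad \<phi> x)"
      using c um test_functions_measurable(4)[OF \<phi>] by (intro integral_cong_AE) (auto elim: eventually_mono)
    also have "\<dots> = 0"
      using integral_gradient_compact_support[OF test_functionsD(3)[OF \<phi>] test_functionsD(4)[OF \<phi>] S] by simp
    finally show "(LINT x|lebesgue. u x *\<^sub>R grad \<phi> x) = - (LINT x|lebesgue. \<phi> x *\<^sub>R 0)" by simp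
  qed
  from gfield_eqI[OF open_UNIV this L2_zero] show ?thesis by (simp add: zero_ell2_def)
qed

text \<open>Makes the classes in \<open>BL_dot\<close> correspond to gradient fields: constants have
  zero gradient, and conversely a vanishing weak gradient forces a constant.\<close>

lemma BL_rel_iff:
  assumes "u \<in> BL" "v \<in> BL"
  shows "(u, v) \<in> BL_rel \<longleftrightarrow> gfield UNIV u = gfield UNIV v"
proof
  assume "(u, v) \<in> BL_rel"
  then obtain c where "AE x in lebesgue. u x - v x = c" by (auto simp: BL_rel_def)
  from AE_const_imp_gfield_zero[OF BL_diff(1)[OF assms] this]
  show "gfield UNIV u = gfield UNIV v" by (simp add: BL_diff(2)[OF assms])
next
  assume eq: "gfield UNIV u = gfield UNIV v"
  note d = BL_diff[OF assms]
  have "cl (wgrad UNIV (\<lambda>x. u x - v x)) = cl (\<lambda>x. 0)"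
    using d(2) eq unfolding BL_D(4)[OF d(1)] by (simp add: zero_ell2_def)
  then have "AE x in lebesgue. wgrad UNIV (\<lambda>x. u x - v x) x = 0"
    using cl_eq_iff[OF BL_D(2)[OF d(1)] L2_zero] by simp
  from weak_gradient_zero_imp_const[OF BL_D(1)[OF d(1)] this] show "(u, v) \<in> BL_rel"
    using assms by (auto simp: BL_rel_def)
qed

context transmission
begin

text \<open>The equation determines exactly the gradient field, and the potentials with a given
  gradient field form one full class.\<close>

lemma corrector_class_unique:
  assumes \<omega>: "\<omega> \<in> lmeasurable"
  shows "\<exists>!\<kappa>. \<kappa> \<in> BL_dot \<and> (\<forall>K\<in>\<kappa>. corrector_equation a\<^sub>1 a\<^sub>2 \<omega> U K)"
proof -
  have "\<omega> \<in> sets lebesgue" using \<omega> by blast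
  from corrector_field_exists[OF this, of U] obtain H where H: "H \<in> gradspace UNIV"
    "\<forall>w\<in>gradspace UNIV. nemytskii.Nem (BB \<omega> U) UNIV H \<bullet> w = corrector_rhs \<omega> U \<bullet> w"
    "\<And>H'. H' \<in> gradspace UNIV \<Longrightarrow> \<forall>w\<in>gradspace UNIV. nemytskii.Nem (BB \<omega> U) UNIV H' \<bullet> w = corrector_rhs \<omega> U \<bullet> w \<Longrightarrow> H' = H"
    by blast
  obtain K where K: "K \<in> BL" "gfield UNIV K = H" using gradspace_imp_BL[OF H(1)] .
  have cls: "BL_rel `` {u} = {v \<in> BL. gfield UNIV v = gfield UNIV u}" if "u \<in> BL" for u :: "'a \<Rightarrow> real"
  proof (rule set_eqI)
    fix v :: "'a \<Rightarrow> real"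
    show "v \<in> BL_rel `` {u} \<longleftrightarrow> v \<in> {v \<in> BL. gfield UNIV v = gfield UNIV u}"
    proof (cases "v \<in> BL")
      case True
      then show ?thesis using BL_rel_iff[OF that True] by (simp add: eq_commute)
    next
      case False
      then show ?thesis by (auto simp: BL_rel_def)
    qed
  qed
  have sol: "corrector_equation a\<^sub>1 a\<^sub>2 \<omega> U v \<longleftrightarrow> gfield UNIV v = H" if v: "v \<in> BL" for v
    unfolding corrector_equation_iff[OF \<omega> v] using H gfield_BL_in_gradspace[OF v] by blast
  show ?thesis
  proof (rule ex1I[of _ "BL_rel `` {K}"])
    show "BL_rel `` {K} \<in> BL_dot \<and> (\<forall>K\<in>BL_rel `` {K}. corrector_equation a\<^sub>1 a\<^sub>2 \<omega> U K)"
    proof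
      show "BL_rel `` {K} \<in> BL_dot" unfolding BL_dot_def using K(1) by (rule quotientI)
      show "\<forall>K\<in>BL_rel `` {K}. corrector_equation a\<^sub>1 a\<^sub>2 \<omega> U K" using sol K by (auto simp: cls[OF K(1)])
    qed
    fix \<kappa> assume \<kappa>: "\<kappa> \<in> BL_dot \<and> (\<forall>K\<in>\<kappa>. corrector_equation a\<^sub>1 a\<^sub>2 \<omega> U K)"
    then obtain v where v: "v \<in> BL" "\<kappa> = BL_rel `` {v}" unfolding BL_dot_def by (auto elim: quotientE)
    then have "corrector_equation a\<^sub>1 a\<^sub>2 \<omega> U v" using \<kappa> cls[OF v(1)] by auto
    then have "gfield UNIV v = H" using sol[OF v(1)] by simp
    then show "\<kappa> = BL_rel `` {K}" using v K by (simp add: cls)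
  qed
qed

lemma BL_dot_subset_BL: "\<kappa> \<in> BL_dot \<Longrightarrow> K \<in> \<kappa> \<Longrightarrow> K \<in> BL"
  unfolding BL_dot_def BL_rel_def by (auto elim!: quotientE)

subsection \<open>The state equation\<close>

context
  fixes D :: "'a set"
  assumes D: "open D" "bounded D"
begin

abbreviation NN where "NN \<Omega> \<equiv> nemytskii.Nem (AA \<Omega>) D"
abbreviation dNN where "dNN \<Omega> \<equiv> nemytskii.DNem (dAA \<Omega>) D"

lemma NN_cong:
  assumes "\<Omega> \<in> sets lebesgue" "\<Omega>' \<in> sets lebesgue" "AE x in lebesgue. x \<in> \<Omega> \<longleftrightarrow> x \<in> \<Omega>'"
  shows "NN \<Omega> F = NN \<Omega>' F" "dNN \<Omega> F E = dNN \<Omega>' F E"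
proof -
  interpret N: nemytskii "AA \<Omega>" "dAA \<Omega>" c\<^sub>1 c\<^sub>2 c\<^sub>3 D by (rule nemytskii_AA[OF assms(1) D])
  interpret N': nemytskii "AA \<Omega>'" "dAA \<Omega>'" c\<^sub>1 c\<^sub>2 c\<^sub>3 D by (rule nemytskii_AA[OF assms(2) D])
  show "NN \<Omega> F = NN \<Omega>' F" unfolding N.Nem_def N'.Nem_def
    by (rule cl_cong[OF N.Nem_L2[OF rep_L2]]) (use assms(3) in eventually_elim, simp add: AA_eq)
  show "dNN \<Omega> F E = dNN \<Omega>' F E" unfolding N.DNem_def N'.DNem_def
    by (rule cl_cong[OF N.DNem_L2[OF rep_measurable rep_L2]]) (use assms(3) in eventually_elim, simp add: dAA_eq)
qed

lemma integral_NN: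
  assumes \<Omega>: "\<Omega> \<in> sets lebesgue" and u: "u \<in> H1 D" and p: "p \<in> H1 D"
  shows "(LINT x|lebesgue_on D. AA \<Omega> x (wgrad D u x) \<bullet> wgrad D p x) = NN \<Omega> (gfield D u) \<bullet> gfield D p"
proof -
  interpret N: nemytskii "AA \<Omega>" "dAA \<Omega>" c\<^sub>1 c\<^sub>2 c\<^sub>3 D by (rule nemytskii_AA[OF \<Omega> D])
  have D': "D \<in> sets lebesgue" using D by simp
  note L = L2_wgrad[OF D(1) u] L2_wgrad[OF D(1) p]
  show ?thesis
    unfolding gfield_def N.Nem_cl[OF L(1)] inner_cl[OF N.Nem_L2[OF L(1)] L(2)] integral_lebesgue_on[OF D']
    by (intro Bochner_Integration.integral_cong) (auto simp: indicator_def)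
qed

lemma integral_dNN:
  assumes \<Omega>: "\<Omega> \<in> sets lebesgue" and u: "u \<in> H1 D" and v: "v \<in> H1 D" and p: "p \<in> H1 D"
  shows "(LINT x|lebesgue_on D. dAA \<Omega> x (wgrad D u x) (wgrad D v x) \<bullet> wgrad D p x) = dNN \<Omega> (gfield D u) (gfield D v) \<bullet> gfield D p"
proof -
  interpret N: nemytskii "AA \<Omega>" "dAA \<Omega>" c\<^sub>1 c\<^sub>2 c\<^sub>3 D by (rule nemytskii_AA[OF \<Omega> D])
  have D': "D \<in> sets lebesgue" using D by simp
  note L = L2_wgrad[OF D(1) u] L2_wgrad[OF D(1) v] L2_wgrad[OF D(1) p]
  have Lm: "(\<lambda>x. indicat_real D x *\<^sub>R wgrad D u x) \<in> borel_measurable lebesgue" using L(1) by (simp add: L2_UNIV_iff)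
  show ?thesis
    unfolding gfield_def N.DNem_cl[OF L(1,2)] inner_cl[OF N.DNem_L2[OF Lm L(2)] L(3)] integral_lebesgue_on[OF D']
    by (intro Bochner_Integration.integral_cong) (auto simp: indicator_def)
qed

lemma integral_gfield:
  assumes u: "u \<in> H1 D" and v: "v \<in> H1 D"
  shows "(LINT x|lebesgue_on D. wgrad D u x \<bullet> wgrad D v x) = gfield D u \<bullet> gfield D v"
proof -
  have D': "D \<in> sets lebesgue" using D by simp
  note L = L2_wgrad[OF D(1) u] L2_wgrad[OF D(1) v]
  show ?thesis
    unfolding gfield_def inner_cl[OF L] integral_lebesgue_on[OF D']
    by (intro Bochner_Integration.integral_cong) (auto simp: indicator_def)
qed

lemma integral_gfield_diff_power2:
  assumes u: "u \<in> H1 D" and v: "v \<in> H1 D"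
  shows "(LINT x|lebesgue_on D. (norm (wgrad D (\<lambda>y. u y - v y) x))\<^sup>2) = (norm (gfield D u - gfield D v))\<^sup>2"
  using integral_gfield[OF H1_diff(1)[OF D(1) u v] H1_diff(1)[OF D(1) u v]]
  by (simp add: power2_norm_eq_inner H1_diff(2)[OF D(1) u v])

lemma is_state_iff:
  assumes \<Omega>: "\<Omega> \<in> sets lebesgue"
  shows "is_state D f a\<^sub>1 a\<^sub>2 \<Omega> u \<longleftrightarrow> u \<in> H10 D \<and>
    (\<forall>\<phi>\<in>H10 D. NN \<Omega> (gfield D u) \<bullet> gfield D \<phi> = (LINT x|lebesgue_on D. f x * \<phi> x))"
  unfolding is_state_def using integral_NN[OF \<Omega>] H10_imp_H1 by (metis (no_types, lifting))

lemma gradspace_eq: "gradspace D = gfield D ` H10 D"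
  using gradspace_imp_H10[OF D] gfield_in_gradspace[OF D(1)] by blast

text \<open>The given state for \<open>\<Omega>\<close> already represents the load functional on
  gradients, by \<open>NN \<Omega> (gfield D u)\<close>; this serves as right-hand side for the
  problem with \<open>\<Omega>'\<close>.\<close>

lemma state_exists:
  assumes \<Omega>: "\<Omega> \<in> sets lebesgue" "\<Omega>' \<in> sets lebesgue" and u: "is_state D f a\<^sub>1 a\<^sub>2 \<Omega> u"
  shows "\<exists>v. is_state D f a\<^sub>1 a\<^sub>2 \<Omega>' v"
proof -
  interpret N: nemytskii "AA \<Omega>'" "dAA \<Omega>'" c\<^sub>1 c\<^sub>2 c\<^sub>3 D by (rule nemytskii_AA[OF \<Omega>(2) D])
  obtain F where F: "F \<in> gradspace D" "\<forall>w\<in>gradspace D. N.Nem F \<bullet> w = NN \<Omega> (gfield D u) \<bullet> w"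
    using N.Nem_solution[OF subspace_gradspace closed_gradspace gradspace_vanishes_off[OF D]] by blast
  obtain v where v: "v \<in> H10 D" "gfield D v = F" using gradspace_imp_H10[OF D F(1)] .
  have "is_state D f a\<^sub>1 a\<^sub>2 \<Omega>' v"
    unfolding is_state_iff[OF \<Omega>(2)]
    using v F(2) u[unfolded is_state_iff[OF \<Omega>(1)]] gfield_in_gradspace[OF D(1)] by simp
  then show ?thesis by blast
qed

lemma state_field_unique:
  assumes \<Omega>: "\<Omega> \<in> sets lebesgue" and u: "u \<in> H10 D" and v: "v \<in> H10 D"
    and eq: "\<And>\<phi>. \<phi> \<in> H10 D \<Longrightarrow> NN \<Omega> (gfield D u) \<bullet> gfield D \<phi> = NN \<Omega> (gfield D v) \<bullet> gfield D \<phi>"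
  shows "gfield D u = gfield D v"
proof -
  interpret N: nemytskii "AA \<Omega>" "dAA \<Omega>" c\<^sub>1 c\<^sub>2 c\<^sub>3 D by (rule nemytskii_AA[OF \<Omega> D])
  show ?thesis
    by (rule N.Nem_unique[OF subspace_gradspace[of D] gradspace_vanishes_off[OF D]])
       (use u v eq in \<open>auto simp: gradspace_eq\<close>)
qed

lemma gfield_eq_imp_ae_eq:
  assumes u: "u \<in> H10 D" and v: "v \<in> H10 D" and eq: "gfield D u = gfield D v"
  shows "ae_eq D u v"
  unfolding ae_eq_def
  using gfield_zero_imp_AE_zero[OF D H10_diff[OF D(1) u v]] H1_diff(2)[OF D(1) H10_imp_H1[OF u] H10_imp_H1[OF v]] eq
  by simp

end

end

section \<open>Blow-up at the point of perturbation\<close>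

text \<open>Weak gradients are only defined almost everywhere; these representatives can be evaluated at \<open>z\<close>.\<close>

lemma C1_representative:
  fixes u :: "'a::euclidean_space \<Rightarrow> real"
  assumes D: "open D" and u: "u \<in> H1 D" and z: "z \<in> D" and \<delta>: "\<delta> > 0"
    and G: "\<And>x. x \<in> ball z \<delta> \<Longrightarrow> GDERIV u x :> G x" "continuous_on (ball z \<delta>) G"
  obtains g where "g \<in> L2 UNIV" "cl g = gfield D u" "isCont g z" "g z = grad u z"
proof -
  define B where "B = ball z \<delta> \<inter> D"
  have B: "open B" "B \<subseteq> D" "z \<in> B" using D z \<delta> by (auto simp: B_def)
  have B': "B \<in> sets lebesgue" using B by simp
  have 1: "weak_gradient B u G"
    by (rule weak_gradient_C1[OF B(1)]) (use G in \<open>auto simp: B_def intro: continuous_on_subset\<close>)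
  have 2: "weak_gradient B u (wgrad D u)"
    by (rule weak_gradient_subset[OF D B(1,2) H1_weak_gradient[OF u]])
  have ae: "AE x in lebesgue. x \<in> B \<longrightarrow> wgrad D u x = G x"
    using weak_gradient_unique[OF B(1) 2 1] unfolding AE_lebesgue_on[OF B'] .
  \<comment> \<open>Near \<open>z\<close> the classical gradient is used, elsewhere the weak one; on
    \<open>B\<close> the two agree almost everywhere.\<close>
  define g where "g x = (if x \<in> B then G x else indicator D x *\<^sub>R wgrad D u x)" for x
  have eq: "AE x in lebesgue. indicator D x *\<^sub>R wgrad D u x = g x"
    using ae by eventually_elim (use B(2) in \<open>auto simp: g_def\<close>)
  show ?thesis
  proof
    show "g \<in> L2 UNIV" by (rule L2_AE_cong[OF L2_wgrad[OF D u] eq])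
    show "cl g = gfield D u" unfolding gfield_def by (rule cl_cong[OF L2_wgrad[OF D u] eq, symmetric])
    have "continuous_on B g"
      by (rule continuous_on_eq[of B G]) (use G in \<open>auto simp: g_def B_def intro: continuous_on_subset\<close>)
    then show "isCont g z" using B continuous_on_eq_continuous_at by blast
    show "g z = grad u z" using B(3) grad_eqI[OF G(1)[of z]] \<delta> by (simp add: g_def)
  qed
qed

lemma bounded_representative:
  fixes g :: "'a::euclidean_space \<Rightarrow> 'b::euclidean_space"
  assumes g: "g \<in> L2 UNIV" "isCont g z" and M: "AE x in lebesgue. norm (g x) \<le> M"
  obtains q N where "q \<in> L2 UNIV" "cl q = cl g" "isCont q z" "q z = g z" "\<And>x. norm (q x) \<le> N"
proof -
  \<comment> \<open>The part \<open>M\<close> lets the truncation at \<open>N\<close> change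
    \<open>g\<close> only on a null set; the part \<open>norm (g z) + 1\<close> keeps it from
    changing \<open>g\<close> near \<open>z\<close>, which preserves continuity there.\<close>
  define N where "N = max M (norm (g z) + 1)"
  define q where "q x = (if norm (g x) \<le> N then g x else 0)" for x
  have N0: "N \<ge> 0" by (simp add: N_def max.coboundedI2)
  have ae: "AE x in lebesgue. g x = q x" using M by eventually_elim (auto simp: q_def N_def max_def)
  have "(g \<longlongrightarrow> g z) (nhds z)" using g(2) by (simp add: isCont_def tendsto_at_iff_tendsto_nhds)
  from order_tendstoD(2)[OF tendsto_norm[OF this], of "norm (g z) + 1"]
  have "\<forall>\<^sub>F x in nhds z. norm (g x) < norm (g z) + 1" by simp
  then have ev: "\<forall>\<^sub>F x in nhds z. g x = q x" by eventually_elim (auto simp: q_def N_def max_def)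
  show ?thesis
  proof
    show "q \<in> L2 UNIV" by (rule L2_AE_cong[OF g(1) ae])
    show "cl q = cl g" by (rule cl_cong[OF g(1) ae, symmetric])
    show "isCont q z" using g(2) isCont_cong[OF ev] by simp
    show "q z = g z" by (simp add: q_def N_def max.coboundedI2)
    show "norm (q x) \<le> N" for x using N0 by (simp add: q_def)
  qed
qed

locale perturbation = transmission +
  fixes D \<Omega> \<omega> :: "'a set" and z :: 'a and \<tau> :: real
  assumes D: "open D" "bounded D" and \<Omega>: "open \<Omega>" "\<Omega> \<subseteq> D" and z: "z \<in> D - closure \<Omega>"
    and \<omega>: "open \<omega>" "bounded \<omega>" "0 \<in> \<omega>" and \<tau>: "\<tau> > 0"
    and contained: "\<And>\<epsilon>. \<epsilon> \<in> {0..\<tau>} \<Longrightarrow> closure (inclusion \<omega> z \<epsilon>) \<subseteq> D - closure \<Omega>"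
begin

abbreviation \<Omega>e where "\<Omega>e \<epsilon> \<equiv> \<Omega> \<union> inclusion \<omega> z \<epsilon>"

lemma \<omega>_meas: "\<omega> \<in> lmeasurable" "\<omega> \<in> sets lebesgue"
  using lmeasurable_open_bounded[OF \<omega>(1,2)] by auto

lemma mem_inclusion: "\<epsilon> > 0 \<Longrightarrow> z + \<epsilon> *\<^sub>R x \<in> inclusion \<omega> z \<epsilon> \<longleftrightarrow> x \<in> \<omega>"
  by (auto simp: inclusion_def)

lemma inclusion_subset: "\<epsilon> \<in> {0..\<tau>} \<Longrightarrow> inclusion \<omega> z \<epsilon> \<subseteq> D" "\<epsilon> \<in> {0..\<tau>} \<Longrightarrow> inclusion \<omega> z \<epsilon> \<inter> \<Omega> = {}"
  using contained[of \<epsilon>] closure_subset[of "inclusion \<omega> z \<epsilon>"] closure_subset[of \<Omega>] by auto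

lemma inclusion_zero: "inclusion \<omega> z 0 = {z}"
  using \<omega>(3) by (auto simp: inclusion_def)

lemma measure_inclusion: "\<epsilon> \<ge> 0 \<Longrightarrow> measure lebesgue (inclusion \<omega> z \<epsilon>) = \<epsilon> ^ DIM('a) * measure lebesgue \<omega>"
proof -
  assume "\<epsilon> \<ge> 0"
  have "inclusion \<omega> z \<epsilon> = (\<lambda>x. \<epsilon> *\<^sub>R x + z) ` \<omega>" by (simp add: inclusion_def add.commute)
  then show ?thesis using measure_lebesgue_affine[of \<epsilon> z \<omega>] \<open>\<epsilon> \<ge> 0\<close> by simp
qed

lemma measure_\<omega>_pos: "measure lebesgue \<omega> > 0"
proof -
  have "\<not> negligible \<omega>" using open_not_negligible[OF \<omega>(1)] \<omega>(3) by auto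
  then show ?thesis using \<omega>_meas(1) negligible_iff_measure[of \<omega>] zero_less_measure_iff by blast
qed

lemma \<Omega>e_sets: "\<epsilon> \<ge> 0 \<Longrightarrow> \<Omega>e \<epsilon> \<in> sets lebesgue"
proof -
  assume "\<epsilon> \<ge> 0"
  show ?thesis
  proof (cases "\<epsilon> = 0")
    case True
    then show ?thesis using \<Omega>(1) by (simp add: inclusion_zero)
  next
    case False
    have "inclusion \<omega> z \<epsilon> = (+) z ` ((*\<^sub>R) \<epsilon> ` \<omega>)" by (auto simp: inclusion_def)
    then have "open (inclusion \<omega> z \<epsilon>)" using open_scaling[OF False \<omega>(1)] open_translation by metis
    then show ?thesis using \<Omega>(1) by (simp add: open_Un)
  qed
qed

lemma \<Omega>_sets: "\<Omega> \<in> sets lebesgue"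
  using \<Omega>(1) by simp

abbreviation N where "N \<epsilon> \<equiv> NN D (\<Omega>e \<epsilon>)"
abbreviation dN where "dN \<epsilon> \<equiv> dNN D (\<Omega>e \<epsilon>)"

text \<open>At \<open>\<epsilon> = 0\<close> the inclusion is the single point \<open>z\<close>
  rather than empty, so the operators for \<open>\<Omega>e 0\<close> and \<open>\<Omega>\<close> are
  identified by discarding a null set.\<close>

lemma N_zero: "N 0 F = NN D \<Omega> F" "dN 0 F E = dNN D \<Omega> F E"
proof -
  have "AE x in lebesgue. x \<noteq> z" by (rule AE_completion[OF AE_lborel_singleton])
  then have "AE x in lebesgue. x \<in> \<Omega>e 0 \<longleftrightarrow> x \<in> \<Omega>" by eventually_elim (simp add: inclusion_zero)
  from NN_cong[OF D \<Omega>e_sets \<Omega>_sets this] show "N 0 F = NN D \<Omega> F" "dN 0 F E = dNN D \<Omega> F E" by simp_all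
qed

end

text \<open>\<open>g\<close> and \<open>q\<close> will be representatives of the gradients of the
  state and the adjoint state, and \<open>E n\<close> the change of the state's gradient at scale
  \<open>\<epsilon> n\<close>. A sequence of scales is used so that dominated convergence applies;
  \<open>near\<close> bounds the variation of \<open>g\<close> on the inclusion for every
  \<open>n\<close>, for the sake of domination.\<close>

locale blow_up = perturbation +
  fixes g q :: "'a \<Rightarrow> 'a" and M :: real and \<epsilon> :: "nat \<Rightarrow> real" and E :: "nat \<Rightarrow> ('a, 'a) ell2"
  assumes g: "g \<in> L2 UNIV" "isCont g z"
    and q: "q \<in> L2 UNIV" "isCont q z" "\<And>x. norm (q x) \<le> M"
    and \<epsilon>: "\<And>n. \<epsilon> n > 0" "\<And>n. \<epsilon> n \<le> \<tau>" "\<epsilon> \<longlonglongrightarrow> 0"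
    and near: "\<And>n x. x \<in> \<omega> \<Longrightarrow> norm (g (z + \<epsilon> n *\<^sub>R x) - g z) \<le> 1"
    and E: "\<And>n. E n \<in> gradspace D"
    and eq: "\<And>n w. w \<in> gradspace D \<Longrightarrow> N (\<epsilon> n) (cl g + E n) \<bullet> w = N 0 (cl g) \<bullet> w"
begin

abbreviation gn where "gn n x \<equiv> g (z + \<epsilon> n *\<^sub>R x)"
abbreviation qn where "qn n x \<equiv> q (z + \<epsilon> n *\<^sub>R x)"
abbreviation kn where "kn n x \<equiv> rep (E n) (z + \<epsilon> n *\<^sub>R x)"
abbreviation resc where "resc n \<equiv> rescale_field z (\<epsilon> n)"
abbreviation Dn where "Dn n \<equiv> {x. z + \<epsilon> n *\<^sub>R x \<in> D}"

definition B where "B n x y = AA (\<Omega>e (\<epsilon> n)) (z + \<epsilon> n *\<^sub>R x) (gn n x + y) - AA (\<Omega>e (\<epsilon> n)) (z + \<epsilon> n *\<^sub>R x) (gn n x)"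
definition dB where "dB n x y = dAA (\<Omega>e (\<epsilon> n)) (z + \<epsilon> n *\<^sub>R x) (gn n x + y)"

lemma g_meas: "g \<in> borel_measurable lebesgue" and q_meas: "q \<in> borel_measurable lebesgue"
  using g(1) q(1) by (auto simp: L2_UNIV_iff)

lemma \<epsilon>_nz: "\<epsilon> n \<noteq> 0" "\<epsilon> n \<ge> 0" "\<epsilon> n \<in> {0..\<tau>}"
  using \<epsilon>(1,2)[of n] by auto

lemma zx_tendsto: "(\<lambda>n. z + \<epsilon> n *\<^sub>R x) \<longlonglongrightarrow> z"
proof -
  have "(\<lambda>n. z + \<epsilon> n *\<^sub>R x) \<longlonglongrightarrow> z + 0 *\<^sub>R x" by (intro tendsto_intros \<epsilon>)
  then show ?thesis by simp
qed

lemma gn_tendsto: "(\<lambda>n. gn n x) \<longlonglongrightarrow> g z" and qn_tendsto: "(\<lambda>n. qn n x) \<longlonglongrightarrow> q z"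
  using isCont_tendsto_compose[OF g(2) zx_tendsto] isCont_tendsto_compose[OF q(2) zx_tendsto] by auto

text \<open>\<open>z\<close> lies outside the closure of \<open>\<Omega>\<close>, so for fixed
  \<open>x\<close> the blown-up point eventually avoids \<open>\<Omega>\<close>, and its material is
  decided by \<open>\<omega>\<close> alone.\<close>

lemma AA_eventually: "\<forall>\<^sub>F n in sequentially. z + \<epsilon> n *\<^sub>R x \<in> \<Omega>e (\<epsilon> n) \<longleftrightarrow> x \<in> \<omega>"
proof -
  have "\<forall>\<^sub>F n in sequentially. z + \<epsilon> n *\<^sub>R x \<in> - closure \<Omega>"
    using topological_tendstoD[OF zx_tendsto, of "- closure \<Omega>"] z by (auto simp: open_Compl)
  then show ?thesis
    by eventually_elim (use closure_subset[of \<Omega>] mem_inclusion[OF \<epsilon>(1)] in auto)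
qed

lemma a_tendsto: "a \<in> {a\<^sub>1, a\<^sub>2} \<Longrightarrow> f \<longlonglongrightarrow> l \<Longrightarrow> (\<lambda>n. a (f n)) \<longlonglongrightarrow> a l"
  by (rule continuous_on_tendsto_compose[OF continuous_a]) auto

lemma da_tendsto: "a \<in> {a\<^sub>1, a\<^sub>2} \<Longrightarrow> f \<longlonglongrightarrow> l \<Longrightarrow> (\<lambda>n. frechet_derivative a (at (f n)) v) \<longlonglongrightarrow> frechet_derivative a (at l) v"
  using continuous_on_tendsto_compose[OF continuous_da tendsto_Pair[OF _ tendsto_const], of a f l sequentially v] by simp

text \<open>Shifting by \<open>g\<close> and then rescaling both keep the constants. The
  coefficients converge pointwise because the material at a fixed blown-up point is eventually
  constant and \<open>g\<close> is continuous at \<open>z\<close>.\<close>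

sublocale nemytskii_sequence B dB Dn "BB \<omega> (g z)" "dBB \<omega> (g z)" c\<^sub>1 c\<^sub>2 c\<^sub>3
proof (rule nemytskii_sequence.intro)
  fix n
  interpret A: monotone_field "AA (\<Omega>e (\<epsilon> n))" "dAA (\<Omega>e (\<epsilon> n))" c\<^sub>1 c\<^sub>2 c\<^sub>3
    by (rule monotone_field_AA[OF \<Omega>e_sets[OF \<epsilon>_nz(2)]])
  interpret S: monotone_field "\<lambda>x y. AA (\<Omega>e (\<epsilon> n)) x (g x + y) - AA (\<Omega>e (\<epsilon> n)) x (g x)"
      "\<lambda>x y. dAA (\<Omega>e (\<epsilon> n)) x (g x + y)" c\<^sub>1 c\<^sub>2 c\<^sub>3
    by (rule A.shift[OF g_meas])
  interpret R: monotone_field "B n" "dB n" c\<^sub>1 c\<^sub>2 c\<^sub>3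
    unfolding B_def[abs_def] dB_def[abs_def] by (rule S.rescale[OF \<epsilon>_nz(1)])
  have Dn: "Dn n \<in> sets lebesgue"
  proof -
    have "open ((\<lambda>x. z + \<epsilon> n *\<^sub>R x) -` D)" by (intro continuous_open_vimage D) (intro continuous_intros)
    then show ?thesis by (simp add: vimage_def)
  qed
  show "nemytskii (B n) (dB n) c\<^sub>1 c\<^sub>2 c\<^sub>3 (Dn n)"
    by unfold_locales (simp_all add: Dn B_def L2_zero)
next
  show "nemytskii (BB \<omega> (g z)) (dBB \<omega> (g z)) c\<^sub>1 c\<^sub>2 c\<^sub>3 UNIV" by (rule nemytskii_BB[OF \<omega>_meas(2)])
  show "B n x 0 = 0" "BB \<omega> (g z) x 0 = 0" for n x by (simp_all add: B_def BB_def)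
  fix x y :: 'a
  show "\<forall>\<^sub>F n in sequentially. x \<in> Dn n"
    using topological_tendstoD[OF zx_tendsto[of x] D(1)] z by simp
  let ?a = "if x \<in> \<omega> then a\<^sub>1 else a\<^sub>2"
  have a: "?a \<in> {a\<^sub>1, a\<^sub>2}" by simp
  have ev: "\<forall>\<^sub>F n in sequentially. (if z + \<epsilon> n *\<^sub>R x \<in> \<Omega>e (\<epsilon> n) then a\<^sub>1 else a\<^sub>2) = ?a"
    using AA_eventually[of x] by eventually_elim simp
  have "(\<lambda>n. ?a (gn n x + y) - ?a (gn n x)) \<longlonglongrightarrow> ?a (g z + y) - ?a (g z)"
    by (rule tendsto_diff[OF a_tendsto[OF a tendsto_add[OF gn_tendsto tendsto_const]] a_tendsto[OF a gn_tendsto]])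
  then show "(\<lambda>n. B n x y) \<longlonglongrightarrow> BB \<omega> (g z) x y"
    unfolding BB_def AA_eq
    by (rule Lim_transform_eventually) (use ev in eventually_elim, simp add: B_def AA_eq)
  have "(\<lambda>n. frechet_derivative ?a (at (gn n x + 0)) y) \<longlonglongrightarrow> frechet_derivative ?a (at (g z + 0)) y"
    by (rule da_tendsto[OF a tendsto_add[OF gn_tendsto tendsto_const]])
  then show "(\<lambda>n. dB n x 0 y) \<longlonglongrightarrow> dBB \<omega> (g z) x 0 y"
    unfolding dBB_def dAA_eq
    by (rule Lim_transform_eventually) (use ev in eventually_elim, simp add: dB_def dAA_eq)
qed

lemma indicator_vimage: "indicat_real (Dn n) x = indicat_real D (z + \<epsilon> n *\<^sub>R x)"
  by (simp add: indicator_def)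

lemma resc_N_diff: "resc n (N (\<epsilon> n) (cl g + F) - N (\<epsilon> n) (cl g)) = NB n (resc n F)"
proof -
  interpret A: nemytskii "AA (\<Omega>e (\<epsilon> n))" "dAA (\<Omega>e (\<epsilon> n))" c\<^sub>1 c\<^sub>2 c\<^sub>3 D
    by (rule nemytskii_AA[OF \<Omega>e_sets[OF \<epsilon>_nz(2)] D])
  interpret Bn: nemytskii "B n" "dB n" c\<^sub>1 c\<^sub>2 c\<^sub>3 "Dn n" by (rule N)
  note s = L2_add[OF g(1) rep_L2[of F]]
  have gF: "cl g + F = cl (\<lambda>x. g x + rep F x)" by (simp add: cl_add[OF g(1) rep_L2, symmetric] cl_rep)
  have e: "N (\<epsilon> n) (cl g + F) - N (\<epsilon> n) (cl g)
      = cl (\<lambda>x. indicator D x *\<^sub>R AA (\<Omega>e (\<epsilon> n)) x (g x + rep F x) - indicator D x *\<^sub>R AA (\<Omega>e (\<epsilon> n)) x (g x))"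
    unfolding gF A.Nem_cl[OF s] A.Nem_cl[OF g(1)] by (rule cl_diff[OF A.Nem_L2[OF s] A.Nem_L2[OF g(1)]])
  have "resc n (N (\<epsilon> n) (cl g + F) - N (\<epsilon> n) (cl g)) = cl (\<lambda>x. indicator (Dn n) x *\<^sub>R B n x (rep F (z + \<epsilon> n *\<^sub>R x)))"
    unfolding e rescale_cl[OF \<epsilon>(1) L2_diff[OF A.Nem_L2[OF s] A.Nem_L2[OF g(1)]]]
  proof (rule arg_cong[where f=cl], rule ext)
    show "indicat_real D (z + \<epsilon> n *\<^sub>R x) *\<^sub>R AA (\<Omega>e (\<epsilon> n)) (z + \<epsilon> n *\<^sub>R x) (gn n x + rep F (z + \<epsilon> n *\<^sub>R x))
        - indicat_real D (z + \<epsilon> n *\<^sub>R x) *\<^sub>R AA (\<Omega>e (\<epsilon> n)) (z + \<epsilon> n *\<^sub>R x) (gn n x)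
        = indicat_real (Dn n) x *\<^sub>R B n x (rep F (z + \<epsilon> n *\<^sub>R x))" for x
      unfolding B_def indicator_vimage by (rule scaleR_diff_right[symmetric])
  qed
  also have "\<dots> = NB n (resc n F)"
    unfolding rescale_field_def Bn.Nem_cl[OF L2_affine[OF \<epsilon>(1)[of n] rep_L2[of F], of z]] ..
  finally show ?thesis .
qed

lemma resc_dN: "resc n (dN (\<epsilon> n) (cl g) F) = cl (\<lambda>x. indicator (Dn n) x *\<^sub>R dB n x 0 (rep F (z + \<epsilon> n *\<^sub>R x)))"
proof -
  interpret A: nemytskii "AA (\<Omega>e (\<epsilon> n))" "dAA (\<Omega>e (\<epsilon> n))" c\<^sub>1 c\<^sub>2 c\<^sub>3 D
    by (rule nemytskii_AA[OF \<Omega>e_sets[OF \<epsilon>_nz(2)] D])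
  have "dN (\<epsilon> n) (cl g) F = cl (\<lambda>x. indicator D x *\<^sub>R dAA (\<Omega>e (\<epsilon> n)) x (g x) (rep F x))"
    using A.DNem_cl[OF g(1) rep_L2[of F]] by (simp add: cl_rep)
  then have "resc n (dN (\<epsilon> n) (cl g) F) = cl (\<lambda>x. indicator D (z + \<epsilon> n *\<^sub>R x) *\<^sub>R dAA (\<Omega>e (\<epsilon> n)) (z + \<epsilon> n *\<^sub>R x) (gn n x) (rep F (z + \<epsilon> n *\<^sub>R x)))"
    by (simp only: rescale_cl[OF \<epsilon>(1) A.DNem_L2[OF g_meas rep_L2]])
  then show ?thesis by (simp add: dB_def indicator_def)
qed

text \<open>The blown-up effect of changing the material at the unperturbed gradient. It lives on
  \<open>\<omega>\<close>: the inclusion is contained in \<open>D\<close> and disjoint from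
  \<open>\<Omega>\<close>, so exactly there \<open>a\<^sub>2\<close> is replaced by
  \<open>a\<^sub>1\<close>.\<close>

definition jump where "jump n x = indicator \<omega> x *\<^sub>R (a\<^sub>1 (gn n x) - a\<^sub>2 (gn n x))"

lemma resc_N_jump: "resc n (N (\<epsilon> n) (cl g) - N 0 (cl g)) = cl (jump n)" and jump_L2: "jump n \<in> L2 UNIV"
proof -
  interpret A: nemytskii "AA (\<Omega>e (\<epsilon> n))" "dAA (\<Omega>e (\<epsilon> n))" c\<^sub>1 c\<^sub>2 c\<^sub>3 D
    by (rule nemytskii_AA[OF \<Omega>e_sets[OF \<epsilon>_nz(2)] D])
  interpret A0: nemytskii "AA \<Omega>" "dAA \<Omega>" c\<^sub>1 c\<^sub>2 c\<^sub>3 D by (rule nemytskii_AA[OF \<Omega>_sets D])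
  note L = L2_diff[OF A.Nem_L2[OF g(1)] A0.Nem_L2[OF g(1)]]
  have eq: "(\<lambda>x. indicat_real D (z + \<epsilon> n *\<^sub>R x) *\<^sub>R AA (\<Omega>e (\<epsilon> n)) (z + \<epsilon> n *\<^sub>R x) (gn n x)
      - indicat_real D (z + \<epsilon> n *\<^sub>R x) *\<^sub>R AA \<Omega> (z + \<epsilon> n *\<^sub>R x) (gn n x)) = jump n"
  proof
    fix x
    have "x \<in> \<omega> \<Longrightarrow> z + \<epsilon> n *\<^sub>R x \<in> D \<and> z + \<epsilon> n *\<^sub>R x \<notin> \<Omega>"
      using mem_inclusion[OF \<epsilon>(1), of n x] inclusion_subset[OF \<epsilon>_nz(3), of n] by auto
    then show "indicat_real D (z + \<epsilon> n *\<^sub>R x) *\<^sub>R AA (\<Omega>e (\<epsilon> n)) (z + \<epsilon> n *\<^sub>R x) (gn n x)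
      - indicat_real D (z + \<epsilon> n *\<^sub>R x) *\<^sub>R AA \<Omega> (z + \<epsilon> n *\<^sub>R x) (gn n x) = jump n x"
      using mem_inclusion[OF \<epsilon>(1), of n x] by (auto simp: jump_def AA_eq indicator_def)
  qed
  show "jump n \<in> L2 UNIV" using L2_affine[OF \<epsilon>(1) L, of z n] unfolding eq .
  have "N (\<epsilon> n) (cl g) - N 0 (cl g) = cl (\<lambda>x. indicator D x *\<^sub>R AA (\<Omega>e (\<epsilon> n)) x (g x) - indicator D x *\<^sub>R AA \<Omega> x (g x))"
    unfolding N_zero A.Nem_cl[OF g(1)] A0.Nem_cl[OF g(1)]
    by (rule cl_diff[OF A.Nem_L2[OF g(1)] A0.Nem_L2[OF g(1)]])
  then show "resc n (N (\<epsilon> n) (cl g) - N 0 (cl g)) = cl (jump n)"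
    by (simp only: rescale_cl[OF \<epsilon>(1) L] eq)
qed

definition djump where "djump n F x = indicator \<omega> x *\<^sub>R
  (frechet_derivative a\<^sub>1 (at (gn n x)) (rep F (z + \<epsilon> n *\<^sub>R x)) - frechet_derivative a\<^sub>2 (at (gn n x)) (rep F (z + \<epsilon> n *\<^sub>R x)))"

lemma resc_dN_jump: "resc n (dN (\<epsilon> n) (cl g) F - dN 0 (cl g) F) = cl (djump n F)"
  and djump_L2: "djump n F \<in> L2 UNIV"
proof -
  interpret A: nemytskii "AA (\<Omega>e (\<epsilon> n))" "dAA (\<Omega>e (\<epsilon> n))" c\<^sub>1 c\<^sub>2 c\<^sub>3 D
    by (rule nemytskii_AA[OF \<Omega>e_sets[OF \<epsilon>_nz(2)] D])
  interpret A0: nemytskii "AA \<Omega>" "dAA \<Omega>" c\<^sub>1 c\<^sub>2 c\<^sub>3 D by (rule nemytskii_AA[OF \<Omega>_sets D])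
  note L0 = A.DNem_L2[OF g_meas rep_L2[of F]] A0.DNem_L2[OF g_meas rep_L2[of F]]
  note L = L2_diff[OF L0]
  have eq: "(\<lambda>x. indicat_real D (z + \<epsilon> n *\<^sub>R x) *\<^sub>R dAA (\<Omega>e (\<epsilon> n)) (z + \<epsilon> n *\<^sub>R x) (gn n x) (rep F (z + \<epsilon> n *\<^sub>R x))
      - indicat_real D (z + \<epsilon> n *\<^sub>R x) *\<^sub>R dAA \<Omega> (z + \<epsilon> n *\<^sub>R x) (gn n x) (rep F (z + \<epsilon> n *\<^sub>R x))) = djump n F"
  proof
    fix x
    have "x \<in> \<omega> \<Longrightarrow> z + \<epsilon> n *\<^sub>R x \<in> D \<and> z + \<epsilon> n *\<^sub>R x \<notin> \<Omega>"
      using mem_inclusion[OF \<epsilon>(1), of n x] inclusion_subset[OF \<epsilon>_nz(3), of n] by auto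
    then show "indicat_real D (z + \<epsilon> n *\<^sub>R x) *\<^sub>R dAA (\<Omega>e (\<epsilon> n)) (z + \<epsilon> n *\<^sub>R x) (gn n x) (rep F (z + \<epsilon> n *\<^sub>R x))
      - indicat_real D (z + \<epsilon> n *\<^sub>R x) *\<^sub>R dAA \<Omega> (z + \<epsilon> n *\<^sub>R x) (gn n x) (rep F (z + \<epsilon> n *\<^sub>R x)) = djump n F x"
      using mem_inclusion[OF \<epsilon>(1), of n x] by (auto simp: djump_def dAA_eq indicator_def)
  qed
  show "djump n F \<in> L2 UNIV" using L2_affine[OF \<epsilon>(1) L, of z n] unfolding eq .
  have "dN (\<epsilon> n) (cl g) F = cl (\<lambda>x. indicator D x *\<^sub>R dAA (\<Omega>e (\<epsilon> n)) x (g x) (rep F x))"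
    "dN 0 (cl g) F = cl (\<lambda>x. indicator D x *\<^sub>R dAA \<Omega> x (g x) (rep F x))"
    using A.DNem_cl[OF g(1) rep_L2[of F]] A0.DNem_cl[OF g(1) rep_L2[of F]] by (simp_all add: cl_rep N_zero)
  then have "dN (\<epsilon> n) (cl g) F - dN 0 (cl g) F
      = cl (\<lambda>x. indicator D x *\<^sub>R dAA (\<Omega>e (\<epsilon> n)) x (g x) (rep F x) - indicator D x *\<^sub>R dAA \<Omega> x (g x) (rep F x))"
    by (simp only: cl_diff[OF L0])
  then show "resc n (dN (\<epsilon> n) (cl g) F - dN 0 (cl g) F) = cl (djump n F)"
    by (simp only: rescale_cl[OF \<epsilon>(1) L] eq)
qed

lemma jump_tendsto: "(\<lambda>n. cl (jump n)) \<longlonglongrightarrow> cl (\<lambda>x. indicator \<omega> x *\<^sub>R (a\<^sub>1 (g z) - a\<^sub>2 (g z)))"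
\<comment> \<open>By \<open>near\<close>, each of \<open>a\<^sub>1\<close> and
  \<open>a\<^sub>2\<close> differs from its value at \<open>g z\<close> by at most
  \<open>c\<^sub>2\<close> on the inclusion.\<close>
proof (rule tendsto_cl[where w="\<lambda>x. indicator \<omega> x *\<^sub>R (2 * c\<^sub>2)"])
  show "jump n \<in> L2 UNIV" for n by (rule jump_L2)
  show "(\<lambda>x. indicat_real \<omega> x *\<^sub>R (a\<^sub>1 (g z) - a\<^sub>2 (g z))) \<in> L2 UNIV" by (rule L2_indicator_const[OF \<omega>_meas(1)])
  show "(\<lambda>x. indicat_real \<omega> x *\<^sub>R (2 * c\<^sub>2)) \<in> L2 UNIV" by (rule L2_indicator_const[OF \<omega>_meas(1)])
  show "(\<lambda>n. jump n x) \<longlonglongrightarrow> indicat_real \<omega> x *\<^sub>R (a\<^sub>1 (g z) - a\<^sub>2 (g z))" for x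
    unfolding jump_def
    by (rule tendsto_scaleR[OF tendsto_const tendsto_diff[OF a_tendsto[OF _ gn_tendsto] a_tendsto[OF _ gn_tendsto]]]) simp_all
  show "norm (jump n x - indicat_real \<omega> x *\<^sub>R (a\<^sub>1 (g z) - a\<^sub>2 (g z))) \<le> norm (indicat_real \<omega> x *\<^sub>R (2 * c\<^sub>2))" for n x
  proof (cases "x \<in> \<omega>")
    case True
    have b: "norm (a (gn n x) - a (g z)) \<le> c\<^sub>2" if a: "a \<in> {a\<^sub>1, a\<^sub>2}" for a
    proof -
      have "c\<^sub>2 * norm (gn n x - g z) \<le> c\<^sub>2 * 1"
        using near[OF True, of n] c_pos(2) by (intro mult_left_mono) auto
      then show ?thesis using lipschitz[OF a, of "gn n x" "g z"] by linarith
    qed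
    have "norm ((a\<^sub>1 (gn n x) - a\<^sub>1 (g z)) - (a\<^sub>2 (gn n x) - a\<^sub>2 (g z))) \<le> c\<^sub>2 + c\<^sub>2"
      by (rule order_trans[OF norm_triangle_ineq4 add_mono[OF b b]]) auto
    then show ?thesis using True c_pos(2) by (simp add: jump_def algebra_simps)
  qed (simp add: jump_def)
qed

text \<open>The gradient field of the corrector; working with it avoids the choice of a
  potential.\<close>

abbreviation H where "H \<equiv> THE H. H \<in> gradspace UNIV \<and>
    (\<forall>w\<in>gradspace UNIV. lim.Nem H \<bullet> w = corrector_rhs \<omega> (g z) \<bullet> w)"

lemma H: "H \<in> gradspace UNIV" "w \<in> gradspace UNIV \<Longrightarrow> lim.Nem H \<bullet> w = corrector_rhs \<omega> (g z) \<bullet> w"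
  using theI'[OF corrector_field_exists[OF \<omega>_meas(2), of "g z"]] by auto

text \<open>The blown-up perturbation solves a strongly monotone equation whose right-hand side is
  minus the jump, the powers of \<open>\<epsilon> n\<close> cancelling on both sides. Every gradient
  of a test function lies in the rescaled spaces eventually, and \<open>H\<close> is a limit of such
  gradients.\<close>

theorem resc_E_tendsto: "(\<lambda>n. resc n (E n)) \<longlonglongrightarrow> H"
proof (rule solution_tendsto[where Wn="\<lambda>n. resc n ` gradspace D" and W="gradspace UNIV"
      and S="(\<lambda>\<psi>. cl (grad \<psi>)) ` test_functions UNIV" and b="\<lambda>n. - cl (jump n)" and b'="corrector_rhs \<omega> (g z)"])
  show "subspace (resc n ` gradspace D)" for n by (rule subspace_rescale[OF \<epsilon>(1) subspace_gradspace])
  show "resc n ` gradspace D \<subseteq> gradspace UNIV" for n by (rule rescale_gradspace[OF \<epsilon>(1)])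
  show "AE x in lebesgue. x \<notin> Dn n \<longrightarrow> rep F x = 0" if F: "F \<in> resc n ` gradspace D" for n F
  proof -
    obtain F' where F': "F' \<in> gradspace D" "F = resc n F'" using F by auto
    have "AE x in lebesgue. rep F x = rep F' (z + \<epsilon> n *\<^sub>R x)"
      unfolding F'(2) rescale_field_def by (rule rep_cl[OF L2_affine[OF \<epsilon>(1) rep_L2]])
    with AE_affine[OF \<epsilon>_nz(1) gradspace_vanishes_off[OF D F'(1)], of z n]
    show ?thesis by eventually_elim simp
  qed
  show "\<forall>\<^sub>F n in sequentially. \<Psi> \<in> resc n ` gradspace D" if \<Psi>: "\<Psi> \<in> (\<lambda>\<psi>. cl (grad \<psi>)) ` test_functions UNIV" for \<Psi>
  proof -
    obtain \<psi> where \<psi>: "\<psi> \<in> test_functions UNIV" "\<Psi> = cl (grad \<psi>)" using \<Psi> by (rule imageE)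
    obtain S where S: "compact S" "\<And>x. x \<notin> S \<Longrightarrow> \<psi> x = 0" using test_functions_support[OF \<psi>(1)] by metis
    obtain r where r: "r > 0" "S \<subseteq> ball 0 r" using bounded_subset_ball0[OF compact_imp_bounded[OF S(1)]] .
    obtain s where s: "s > 0" "cball z s \<subseteq> D" using open_contains_cball D(1) z by (meson DiffD1)
    \<comment> \<open>The support of \<open>\<psi>\<close> lies in a ball of radius
      \<open>r\<close>; shrunk by \<open>\<epsilon> n\<close> it must fit into
      \<open>cball z s\<close>.\<close>
    have "\<forall>\<^sub>F n in sequentially. \<epsilon> n < s / r" using order_tendstoD(2)[OF \<epsilon>(3)] s r by simp
    then show ?thesis
    proof eventually_elim
      case (elim n)
      have "cball z (\<epsilon> n * r) \<subseteq> D"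
        using elim r(1) s(2) by (intro order_trans[OF subset_cball s(2)]) (simp add: field_simps)
      moreover have "\<psi> x = 0" if "norm x \<ge> r" for x
      proof -
        have "x \<notin> S" using that r(2) by force
        then show ?thesis by (rule S(2))
      qed
      ultimately show ?case unfolding \<psi>(2) by (intro test_in_rescale_gradspace[OF \<epsilon>(1) \<psi>(1)])
    qed
  qed
  show "resc n (E n) \<in> resc n ` gradspace D" for n using E by blast
  show "NB n (resc n (E n)) \<bullet> w = - cl (jump n) \<bullet> w" if w: "w \<in> resc n ` gradspace D" for n w
  proof -
    obtain w' where w': "w' \<in> gradspace D" "w = resc n w'" using w by auto
    \<comment> \<open>By \<open>eq\<close> the perturbed operator at the new field acts on
      \<open>w'\<close> like the unperturbed one at \<open>cl g\<close>, so the increment due to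
      \<open>E n\<close> balances the change of material at \<open>cl g\<close>.\<close>
    have "(N (\<epsilon> n) (cl g + E n) - N (\<epsilon> n) (cl g)) \<bullet> w' = - ((N (\<epsilon> n) (cl g) - N 0 (cl g)) \<bullet> w')"
      using eq[OF w'(1), of n] by (simp add: inner_diff_left)
    then have "\<epsilon> n ^ DIM('a) * (NB n (resc n (E n)) \<bullet> w) = \<epsilon> n ^ DIM('a) * - (cl (jump n) \<bullet> w)"
      unfolding inner_rescale[OF \<epsilon>(1)[of n], where z=z and F="N (\<epsilon> n) (cl g + E n) - N (\<epsilon> n) (cl g)"]
        inner_rescale[OF \<epsilon>(1)[of n], where z=z and F="N (\<epsilon> n) (cl g) - N 0 (cl g)"]
        resc_N_diff resc_N_jump w'(2) by simp
    then have "NB n (resc n (E n)) \<bullet> w = - (cl (jump n) \<bullet> w)"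
      using \<epsilon>_nz(1)[of n] by (subst (asm) mult_left_cancel) simp_all
    then show ?thesis by simp
  qed
  show "H \<in> closure ((\<lambda>\<psi>. cl (grad \<psi>)) ` test_functions UNIV)" using H(1) by (simp add: gradspace_def)
  show "lim.Nem H \<bullet> w = corrector_rhs \<omega> (g z) \<bullet> w" if "w \<in> gradspace UNIV" for w by (rule H(2)[OF that])
  have "- cl (\<lambda>x. indicator \<omega> x *\<^sub>R (a\<^sub>1 (g z) - a\<^sub>2 (g z))) = corrector_rhs \<omega> (g z)"
    using cl_scaleR[OF L2_indicator_const[OF \<omega>_meas(1), of "a\<^sub>1 (g z) - a\<^sub>2 (g z)"], of "-1"]
    by (simp add: corrector_rhs_def algebra_simps)
  then show "(\<lambda>n. - cl (jump n)) \<longlonglongrightarrow> corrector_rhs \<omega> (g z)"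
    using tendsto_minus[OF jump_tendsto] by simp
qed

section \<open>Limits of the rescaled energy, remainder and jump terms\<close>

lemma kn_L2: "kn n \<in> L2 UNIV" and cl_kn: "cl (kn n) = resc n (E n)"
  by (rule L2_affine[OF \<epsilon>(1) rep_L2]) (simp add: rescale_field_def)

lemma kn_tendsto: "(\<lambda>n. cl (kn n)) \<longlonglongrightarrow> cl (rep H)"
  unfolding cl_kn cl_rep by (rule resc_E_tendsto)

lemma qn_L2: "qn n \<in> L2 UNIV" and cl_qn: "cl (qn n) = resc n (cl q)"
  by (rule L2_affine[OF \<epsilon>(1) q(1)]) (simp add: rescale_cl[OF \<epsilon>(1) q(1)])

lemma unscale: "F \<bullet> cl q / \<epsilon> n ^ DIM('a) = resc n F \<bullet> cl (qn n)"
  using inner_rescale[OF \<epsilon>(1)[of n], of F "cl q" z] \<epsilon>_nz(1)[of n] by (simp add: cl_qn)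

theorem energy_tendsto: "(\<lambda>n. (norm (E n))\<^sup>2 / \<epsilon> n ^ DIM('a)) \<longlonglongrightarrow> (norm H)\<^sup>2"
proof -
  have "(norm (E n))\<^sup>2 / \<epsilon> n ^ DIM('a) = (norm (resc n (E n)))\<^sup>2" for n
    using inner_rescale[OF \<epsilon>(1)[of n], of "E n" "E n" z] \<epsilon>_nz(1)[of n] by (simp add: power2_norm_eq_inner)
  then show ?thesis by (simp only:) (intro tendsto_intros resc_E_tendsto)
qed

theorem nonlinear_remainder_tendsto:
  "(\<lambda>n. ((N (\<epsilon> n) (cl g + E n) - N (\<epsilon> n) (cl g) - dN (\<epsilon> n) (cl g) (E n)) \<bullet> cl q) / \<epsilon> n ^ DIM('a))
    \<longlonglongrightarrow> (LINT x|lebesgue. (BB \<omega> (g z) x (rep H x) - dBB \<omega> (g z) x 0 (rep H x)) \<bullet> q z)"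
proof -
  have "((N (\<epsilon> n) (cl g + E n) - N (\<epsilon> n) (cl g) - dN (\<epsilon> n) (cl g) (E n)) \<bullet> cl q) / \<epsilon> n ^ DIM('a)
      = (LINT x|lebesgue. (indicator (Dn n) x *\<^sub>R (B n x (kn n x) - dB n x 0 (kn n x))) \<bullet> qn n x)" for n
  proof -
    interpret Bn: nemytskii "B n" "dB n" c\<^sub>1 c\<^sub>2 c\<^sub>3 "Dn n" by (rule N)
    note L = Bn.Nem_L2[OF kn_L2] Bn.DNem_L2[OF borel_measurable_const kn_L2, of 0]
    have "resc n (N (\<epsilon> n) (cl g + E n) - N (\<epsilon> n) (cl g) - dN (\<epsilon> n) (cl g) (E n))
        = NB n (cl (kn n)) - cl (\<lambda>x. indicator (Dn n) x *\<^sub>R dB n x 0 (kn n x))"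
      unfolding rescale_diff[OF \<epsilon>(1)] by (simp only: resc_N_diff[unfolded rescale_diff[OF \<epsilon>(1)]] resc_dN cl_kn)
    also have "\<dots> = cl (\<lambda>x. indicator (Dn n) x *\<^sub>R B n x (kn n x) - indicator (Dn n) x *\<^sub>R dB n x 0 (kn n x))"
      unfolding Bn.Nem_cl[OF kn_L2] by (rule cl_diff[OF L])
    finally show ?thesis unfolding unscale
      by (simp only: inner_cl[OF L2_diff[OF L] qn_L2] scaleR_diff_right)
  qed
  then show ?thesis
    using remainder_tendsto[OF kn_L2 rep_L2 kn_tendsto measurable_affine[OF \<epsilon>_nz(1) q_meas] q(3) qn_tendsto]
    by simp
qed

lemma q\<omega>_tendsto: "(\<lambda>n. cl (\<lambda>x. indicator \<omega> x *\<^sub>R qn n x)) \<longlonglongrightarrow> cl (\<lambda>x. indicator \<omega> x *\<^sub>R q z)"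
proof (rule tendsto_cl[where w="\<lambda>x. indicator \<omega> x *\<^sub>R (2 * M)"])
  show "(\<lambda>x. indicat_real \<omega> x *\<^sub>R qn n x) \<in> L2 UNIV" for n by (rule L2_indicator[OF qn_L2 \<omega>_meas(2)])
  show "(\<lambda>x. indicat_real \<omega> x *\<^sub>R q z) \<in> L2 UNIV" "(\<lambda>x. indicat_real \<omega> x *\<^sub>R (2 * M)) \<in> L2 UNIV"
    by (rule L2_indicator_const[OF \<omega>_meas(1)])+
  show "(\<lambda>n. indicat_real \<omega> x *\<^sub>R qn n x) \<longlonglongrightarrow> indicat_real \<omega> x *\<^sub>R q z" for x
    by (intro tendsto_scaleR tendsto_const qn_tendsto)
  have M: "M \<ge> 0" using order_trans[OF norm_ge_zero q(3)] .
  have "norm (qn n x - q z) \<le> 2 * M" for n x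
    using norm_triangle_ineq4[of "qn n x" "q z"] q(3)[of "z + \<epsilon> n *\<^sub>R x"] q(3)[of z] by linarith
  then show "norm (indicat_real \<omega> x *\<^sub>R qn n x - indicat_real \<omega> x *\<^sub>R q z) \<le> norm (indicat_real \<omega> x *\<^sub>R (2 * M))" for n x
    using M by (cases "x \<in> \<omega>") auto
qed

text \<open>\<open>qn n\<close> tends to a constant, which is in L2 only locally. Jump terms vanish
  outside \<open>\<omega>\<close>, so \<open>qn n\<close> may be cut off there, and the cut-off
  fields do converge in L2.\<close>

lemma inner_indicator_\<omega>:
  assumes f: "f \<in> L2 UNIV" "\<And>x. x \<notin> \<omega> \<Longrightarrow> f x = 0" and p: "p \<in> L2 UNIV"
  shows "cl f \<bullet> cl p = cl f \<bullet> cl (\<lambda>x. indicator \<omega> x *\<^sub>R p x)"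
  unfolding inner_cl[OF f(1) p] inner_cl[OF f(1) L2_indicator[OF p \<omega>_meas(2)]]
  by (intro Bochner_Integration.integral_cong) (auto simp: indicator_def f(2))

theorem jump_term_tendsto:
  "(\<lambda>n. ((N (\<epsilon> n) (cl g) - N 0 (cl g)) \<bullet> cl q) / \<epsilon> n ^ DIM('a)) \<longlonglongrightarrow> measure lebesgue \<omega> * ((a\<^sub>1 (g z) - a\<^sub>2 (g z)) \<bullet> q z)"
proof -
  have "((N (\<epsilon> n) (cl g) - N 0 (cl g)) \<bullet> cl q) / \<epsilon> n ^ DIM('a) = cl (jump n) \<bullet> cl (\<lambda>x. indicator \<omega> x *\<^sub>R qn n x)" for n
    unfolding unscale resc_N_jump by (rule inner_indicator_\<omega>[OF jump_L2 _ qn_L2]) (simp add: jump_def)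
  moreover have "cl (\<lambda>x. indicator \<omega> x *\<^sub>R (a\<^sub>1 (g z) - a\<^sub>2 (g z))) \<bullet> cl (\<lambda>x. indicator \<omega> x *\<^sub>R q z)
      = measure lebesgue \<omega> * ((a\<^sub>1 (g z) - a\<^sub>2 (g z)) \<bullet> q z)"
  proof -
    have "cl (\<lambda>x. indicator \<omega> x *\<^sub>R (a\<^sub>1 (g z) - a\<^sub>2 (g z))) \<bullet> cl (\<lambda>x. indicator \<omega> x *\<^sub>R q z)
       = (LINT x|lebesgue. indicat_real \<omega> x * ((a\<^sub>1 (g z) - a\<^sub>2 (g z)) \<bullet> q z))"
      unfolding inner_cl[OF L2_indicator_const[OF \<omega>_meas(1)] L2_indicator_const[OF \<omega>_meas(1)]]
      by (intro Bochner_Integration.integral_cong) (auto simp: indicator_def)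
    then show ?thesis using \<omega>_meas(2) by simp
  qed
  ultimately show ?thesis using tendsto_inner[OF jump_tendsto q\<omega>_tendsto] by simp
qed

text \<open>Two limits are combined: for the fixed field \<open>H\<close> the coefficients converge
  at the blown-up points, and replacing the blown-up \<open>E n\<close> by \<open>H\<close> costs a
  bounded multiple of their L2 distance because the derivatives are linear and bounded by
  \<open>c\<^sub>2\<close>.\<close>

theorem derivative_jump_term_tendsto:
  "(\<lambda>n. ((dN (\<epsilon> n) (cl g) (E n) - dN 0 (cl g) (E n)) \<bullet> cl q) / \<epsilon> n ^ DIM('a))
    \<longlonglongrightarrow> (LINT x|lebesgue_on \<omega>. (frechet_derivative a\<^sub>1 (at (g z)) (rep H x) - frechet_derivative a\<^sub>2 (at (g z)) (rep H x)) \<bullet> q z)"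
proof -
  let ?d = "\<lambda>y v. frechet_derivative a\<^sub>1 (at y) v - frechet_derivative a\<^sub>2 (at y) v"
  \<comment> \<open>With the whole space or the empty set as first region the transmission field is
    \<open>a\<^sub>1\<close> or \<open>a\<^sub>2\<close> alone; this makes linearity and the bound
    on the derivative available for each of them.\<close>
  interpret A: monotone_field "AA UNIV" "dAA UNIV" c\<^sub>1 c\<^sub>2 c\<^sub>3 by (rule monotone_field_AA) simp
  interpret A': monotone_field "AA {}" "dAA {}" c\<^sub>1 c\<^sub>2 c\<^sub>3 by (rule monotone_field_AA) simp
  have dd: "?d y v = dAA UNIV x y v - dAA {} x y v" for x y v by (simp add: dAA_eq)
  have d_bound: "norm (?d y v) \<le> 2 * c\<^sub>2 * norm v" for y v
    unfolding dd[of _ _ 0] using norm_triangle_ineq4[of "dAA UNIV 0 y v" "dAA {} 0 y v"]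
      A.dA_bound[of 0 y v] A'.dA_bound[of 0 y v] by simp
  have d_diff: "?d y (v - w) = ?d y v - ?d y w" for y v w
    unfolding dd[of _ _ 0] A.dA_linear A'.dA_linear by simp
  have d_meas: "(\<lambda>x. ?d (f x) (h x)) \<in> borel_measurable lebesgue"
    if "f \<in> borel_measurable lebesgue" "h \<in> borel_measurable lebesgue" for f h :: "'a \<Rightarrow> 'a"
    using that by (intro borel_measurable_diff measurable_da) auto
  have gm: "gn n \<in> borel_measurable lebesgue" for n by (rule measurable_affine[OF \<epsilon>_nz(1) g_meas])
  define Y where "Y n x = indicator \<omega> x *\<^sub>R ?d (gn n x) (rep H x)" for n x
  define Y' where "Y' x = indicator \<omega> x *\<^sub>R ?d (g z) (rep H x)" for x
  have dL: "(\<lambda>x. indicator \<omega> x *\<^sub>R ?d (f x) (h x)) \<in> L2 UNIV" if f: "f \<in> borel_measurable lebesgue" and h: "h \<in> L2 UNIV" for f h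
  proof (rule L2_bound[OF h])
    show "(\<lambda>x. indicator \<omega> x *\<^sub>R ?d (f x) (h x)) \<in> borel_measurable lebesgue"
      using h by (intro borel_measurable_scaleR borel_measurable_indicator \<omega>_meas d_meas f) (simp add: L2_UNIV_iff)
    show "norm (indicat_real \<omega> x *\<^sub>R ?d (f x) (h x)) \<le> (2 * c\<^sub>2) * norm (h x)" for x
      using d_bound[of "f x" "h x"] c_pos(2) by (auto simp: indicator_def)
  qed
  have YL: "Y n \<in> L2 UNIV" "Y' \<in> L2 UNIV" for n
    unfolding Y_def[abs_def] Y'_def[abs_def] by (rule dL[OF gm rep_L2], rule dL[OF borel_measurable_const rep_L2])
  have "(\<lambda>n. cl (Y n)) \<longlonglongrightarrow> cl Y'"
  proof (rule tendsto_cl[where w="\<lambda>x. (4 * c\<^sub>2) *\<^sub>R rep H x", OF YL L2_scaleR[OF rep_L2]])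
    show "(\<lambda>n. Y n x) \<longlonglongrightarrow> Y' x" for x
      unfolding Y_def Y'_def
      by (rule tendsto_scaleR[OF tendsto_const tendsto_diff[OF da_tendsto[OF _ gn_tendsto] da_tendsto[OF _ gn_tendsto]]]) simp_all
    show "norm (Y n x - Y' x) \<le> norm ((4 * c\<^sub>2) *\<^sub>R rep H x)" for n x
    proof -
      have "norm (Y n x) \<le> 2 * c\<^sub>2 * norm (rep H x)" "norm (Y' x) \<le> 2 * c\<^sub>2 * norm (rep H x)"
        using d_bound[of "gn n x" "rep H x"] d_bound[of "g z" "rep H x"] c_pos(2)
        by (auto simp: Y_def Y'_def indicator_def)
      then show ?thesis using norm_triangle_ineq4[of "Y n x" "Y' x"] c_pos(2) by simp
    qed
  qed
  moreover have "(\<lambda>n. cl (djump n (E n)) - cl (Y n)) \<longlonglongrightarrow> 0"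
  proof (rule Lim_null_comparison[OF always_eventually], rule allI)
    fix n
    have "norm (cl (\<lambda>x. djump n (E n) x - Y n x)) \<le> (2 * c\<^sub>2) * norm (cl (\<lambda>x. kn n x - rep H x))"
    proof (rule norm_cl_le[OF L2_diff[OF djump_L2 YL(1)] L2_diff[OF kn_L2 rep_L2]])
      have "djump n (E n) x - Y n x = indicator \<omega> x *\<^sub>R ?d (gn n x) (kn n x - rep H x)" for x
        by (simp only: djump_def Y_def d_diff scaleR_diff_right)
      then show "AE x in lebesgue. norm (djump n (E n) x - Y n x) \<le> (2 * c\<^sub>2) * norm (kn n x - rep H x)"
        using d_bound c_pos(2) by (intro AE_I2) (simp add: indicator_def)
    qed (use c_pos(2) in simp)
    then show "norm (cl (djump n (E n)) - cl (Y n)) \<le> (2 * c\<^sub>2) * norm (cl (kn n) - cl (rep H))"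
      by (simp only: cl_diff[OF djump_L2 YL(1)] cl_diff[OF kn_L2 rep_L2])
  next
    have "(\<lambda>n. (2 * c\<^sub>2) * norm (cl (kn n) - cl (rep H))) \<longlonglongrightarrow> (2 * c\<^sub>2) * norm (cl (rep H) - cl (rep H))"
      by (intro tendsto_intros kn_tendsto)
    then show "(\<lambda>n. (2 * c\<^sub>2) * norm (cl (kn n) - cl (rep H))) \<longlonglongrightarrow> 0" by simp
  qed
  ultimately have "(\<lambda>n. cl (djump n (E n))) \<longlonglongrightarrow> cl Y'" using tendsto_add by fastforce
  from tendsto_inner[OF this q\<omega>_tendsto]
  have "(\<lambda>n. cl (djump n (E n)) \<bullet> cl (\<lambda>x. indicator \<omega> x *\<^sub>R qn n x)) \<longlonglongrightarrow> cl Y' \<bullet> cl (\<lambda>x. indicator \<omega> x *\<^sub>R q z)" .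
  moreover have "((dN (\<epsilon> n) (cl g) (E n) - dN 0 (cl g) (E n)) \<bullet> cl q) / \<epsilon> n ^ DIM('a)
      = cl (djump n (E n)) \<bullet> cl (\<lambda>x. indicator \<omega> x *\<^sub>R qn n x)" for n
    unfolding unscale resc_dN_jump by (rule inner_indicator_\<omega>[OF djump_L2 _ qn_L2]) (simp add: djump_def)
  moreover have "cl Y' \<bullet> cl (\<lambda>x. indicator \<omega> x *\<^sub>R q z)
      = (LINT x|lebesgue_on \<omega>. ?d (g z) (rep H x) \<bullet> q z)"
    unfolding inner_cl[OF YL(2) L2_indicator_const[OF \<omega>_meas(1)]] integral_lebesgue_on[OF \<omega>_meas(2)]
    by (intro Bochner_Integration.integral_cong) (auto simp: Y'_def indicator_def)
  ultimately show ?thesis by simp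
qed

end

text \<open>The blow-up works along sequences that stay below a threshold; an arbitrary null
  sequence is altered at finitely many places to do so.\<close>

lemma tendsto_at_right_0_sequentially:
  fixes f :: "real \<Rightarrow> 'b::metric_space"
  assumes r: "r > 0" and lim: "\<And>X. (\<And>i. 0 < X i) \<Longrightarrow> (\<And>i. X i < r) \<Longrightarrow> X \<longlonglongrightarrow> 0 \<Longrightarrow> (\<lambda>i. f (X i)) \<longlonglongrightarrow> l"
  shows "(f \<longlongrightarrow> l) (at_right 0)"
  unfolding tendsto_at_iff_sequentially
proof safe
  fix Y :: "nat \<Rightarrow> real" assume Y: "\<forall>i. Y i \<in> {0<..} - {0}" "Y \<longlonglongrightarrow> 0"
  define X where "X i = (if Y i < r then Y i else r / 2)" for i
  have ev: "\<forall>\<^sub>F i in sequentially. Y i = X i"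
    using order_tendstoD(2)[OF Y(2) r] by eventually_elim (simp add: X_def)
  have "(\<lambda>i. f (X i)) \<longlonglongrightarrow> l"
    by (rule lim) (use Y r Lim_transform_eventually[OF Y(2) ev] in \<open>auto simp: X_def\<close>)
  then show "(f \<circ> Y) \<longlonglongrightarrow> l"
    by (rule Lim_transform_eventually) (use ev in eventually_elim, simp)
qed

section \<open>The tracking problem\<close>

locale tracking_problem = perturbation +
  fixes f u\<^sub>d u\<^sub>0 p\<^sub>0 :: "'a \<Rightarrow> real" and \<delta> :: real and G\<^sub>u G\<^sub>p :: "'a \<Rightarrow> 'a"
  assumes f: "f \<in> L2 D" and u\<^sub>d: "u\<^sub>d \<in> H10 D"
    and state: "is_state D f a\<^sub>1 a\<^sub>2 \<Omega> u\<^sub>0"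
    and adjoint: "is_adjoint D u\<^sub>d a\<^sub>1 a\<^sub>2 \<Omega> u\<^sub>0 p\<^sub>0"
    and \<delta>: "\<delta> > 0"
    and regular_u: "\<And>x. x \<in> ball z \<delta> \<Longrightarrow> GDERIV u\<^sub>0 x :> G\<^sub>u x" "continuous_on (ball z \<delta>) G\<^sub>u"
    and regular_p: "\<And>x. x \<in> ball z \<delta> \<Longrightarrow> GDERIV p\<^sub>0 x :> G\<^sub>p x" "continuous_on (ball z \<delta>) G\<^sub>p"
    and bounded_gradient: "wgrad D p\<^sub>0 \<in> L_infty D"
begin

abbreviation F where "F \<equiv> gfield D"
abbreviation U where "U \<equiv> F u\<^sub>0"
abbreviation P where "P \<equiv> F p\<^sub>0"
abbreviation Ud where "Ud \<equiv> F u\<^sub>d"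
definition load where "load \<phi> = (LINT x|lebesgue_on D. f x * \<phi> x)" for \<phi>
definition G where "G = lagrangian D f u\<^sub>d a\<^sub>1 a\<^sub>2 \<Omega> \<omega> z"
definition ell where "ell = (\<lambda>\<epsilon>. measure lebesgue (inclusion \<omega> z \<epsilon>))"
text \<open>The value at \<open>0\<close> is overridden because the chosen state would be one for
  \<open>\<Omega>\<close> with the point \<open>z\<close> added, possibly a different representative
  than \<open>u\<^sub>0\<close>.\<close>

definition u where "u = (\<lambda>\<epsilon>. Defs.state D f a\<^sub>1 a\<^sub>2 (\<Omega>e \<epsilon>))(0 := u\<^sub>0)"
abbreviation J where "J \<equiv> cost D f u\<^sub>d a\<^sub>1 a\<^sub>2"

lemma D_sets: "D \<in> sets lebesgue"
  using D by simp

lemma u0: "u\<^sub>0 \<in> H10 D" and p0: "p\<^sub>0 \<in> H10 D"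
  using state adjoint by (auto simp: is_state_def is_adjoint_def)

lemma F_lincomb:
  assumes "v \<in> H10 D" "w \<in> H10 D"
  shows "F (\<lambda>x. a * v x + b * w x) = a *\<^sub>R F v + b *\<^sub>R F w"
  by (rule H1_lincomb(2)[OF D(1)]) (use assms H10_imp_H1 in auto)

lemma F_diff: "v \<in> H10 D \<Longrightarrow> w \<in> H10 D \<Longrightarrow> F (\<lambda>x. v x - w x) = F v - F w"
  using F_lincomb[of v w 1 "-1"] by simp

lemma load_lincomb:
  assumes "v \<in> H10 D" "w \<in> H10 D"
  shows "load (\<lambda>x. a * v x + b * w x) = a * load v + b * load w"
proof -
  have f': "(\<lambda>x. indicator D x *\<^sub>R f x) \<in> L2 UNIV" using f by (simp only: L2_iff_UNIV[OF D_sets])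
  have eq: "load v = cl (\<lambda>x. indicator D x *\<^sub>R f x) \<bullet> sfield D v" if v: "v \<in> H10 D" for v
    unfolding load_def sfield_def inner_cl[OF f' L2_sobolev[OF D(1) H10_imp_H1[OF v]]] integral_lebesgue_on[OF D_sets]
    by (intro Bochner_Integration.integral_cong) (auto simp: indicator_def)
  show ?thesis
    unfolding eq[OF H10_lincomb[OF D(1) assms]] eq[OF assms(1)] eq[OF assms(2)]
      H1_lincomb(3)[OF D(1) H10_imp_H1[OF assms(1)] H10_imp_H1[OF assms(2)]]
    by (simp add: inner_add_right)
qed

lemma nemytskii_N: "\<epsilon> \<ge> 0 \<Longrightarrow> nemytskii (AA (\<Omega>e \<epsilon>)) (dAA (\<Omega>e \<epsilon>)) c\<^sub>1 c\<^sub>2 c\<^sub>3 D"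
  by (rule nemytskii_AA[OF \<Omega>e_sets D])

lemma G_eq:
  assumes "\<epsilon> \<ge> 0" "v \<in> H10 D" "p \<in> H10 D"
  shows "G \<epsilon> v p = (norm (F v - Ud))\<^sup>2 + N \<epsilon> (F v) \<bullet> F p - load p"
  unfolding G_def lagrangian_def load_def
  using integral_gfield_diff_power2[OF D H10_imp_H1[OF assms(2)] H10_imp_H1[OF u\<^sub>d]]
    integral_NN[OF D \<Omega>e_sets[OF assms(1)] H10_imp_H1[OF assms(2)] H10_imp_H1[OF assms(3)]] by simp

lemma u_state:
  assumes "\<epsilon> \<in> {0..\<tau>}"
  shows "u \<epsilon> \<in> H10 D" "\<phi> \<in> H10 D \<Longrightarrow> N \<epsilon> (F (u \<epsilon>)) \<bullet> F \<phi> = load \<phi>"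
proof -
  have "u \<epsilon> \<in> H10 D \<and> (\<forall>\<phi>\<in>H10 D. N \<epsilon> (F (u \<epsilon>)) \<bullet> F \<phi> = load \<phi>)"
  proof (cases "\<epsilon> = 0")
    case True
    then show ?thesis using state unfolding is_state_iff[OF D \<Omega>_sets] by (simp add: u_def load_def N_zero)
  next
    case False
    have s: "\<Omega>e \<epsilon> \<in> sets lebesgue" using assms by (intro \<Omega>e_sets) simp
    have "is_state D f a\<^sub>1 a\<^sub>2 (\<Omega>e \<epsilon>) (Defs.state D f a\<^sub>1 a\<^sub>2 (\<Omega>e \<epsilon>))"
      unfolding Defs.state_def by (rule someI_ex[OF state_exists[OF D \<Omega>_sets s state]])
    then show ?thesis using False unfolding is_state_iff[OF D s] by (simp add: u_def load_def)
  qed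
  then show "u \<epsilon> \<in> H10 D" "\<phi> \<in> H10 D \<Longrightarrow> N \<epsilon> (F (u \<epsilon>)) \<bullet> F \<phi> = load \<phi>" by auto
qed

lemma u_zero: "u 0 = u\<^sub>0"
  by (simp add: u_def)

lemma adjoint_eq:
  assumes \<phi>: "\<phi> \<in> H10 D"
  shows "dN 0 U (F \<phi>) \<bullet> P = - 2 * ((U - Ud) \<bullet> F \<phi>)"
proof -
  have d: "(\<lambda>y. u\<^sub>0 y - u\<^sub>d y) \<in> H10 D" by (rule H10_diff[OF D(1) u0 u\<^sub>d])
  have "dN 0 U (F \<phi>) \<bullet> P = (LINT x|lebesgue_on D. dAA \<Omega> x (wgrad D u\<^sub>0 x) (wgrad D \<phi> x) \<bullet> wgrad D p\<^sub>0 x)"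
    unfolding N_zero by (rule integral_dNN[OF D \<Omega>_sets, symmetric]) (intro H10_imp_H1 u0 \<phi> p0)+
  also have "\<dots> = - (LINT x|lebesgue_on D. 2 * (wgrad D (\<lambda>y. u\<^sub>0 y - u\<^sub>d y) x \<bullet> wgrad D \<phi> x))"
    using adjoint \<phi> by (simp add: is_adjoint_def)
  also have "\<dots> = - 2 * (F (\<lambda>y. u\<^sub>0 y - u\<^sub>d y) \<bullet> F \<phi>)"
    using integral_gfield[OF D H10_imp_H1[OF d] H10_imp_H1[OF \<phi>]] by simp
  finally show ?thesis by (simp add: F_diff[OF u0 u\<^sub>d])
qed

text \<open>The value of \<open>partial_u G\<close>, written for gradient fields so that segments
  between states become lines \<open>V + s *\<^sub>R W\<close>.\<close>

definition slope where "slope \<epsilon> V W p = 2 * ((V - Ud) \<bullet> W) + dN \<epsilon> V W \<bullet> F p"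

lemma norm_line_derivative:
  "((\<lambda>s. (norm (V + s *\<^sub>R W - Ud))\<^sup>2) has_real_derivative 2 * ((V + s *\<^sub>R W - Ud) \<bullet> W)) (at s)"
proof -
  have "(norm (V + s *\<^sub>R W - Ud))\<^sup>2 = (norm (V - Ud))\<^sup>2 + 2 * s * ((V - Ud) \<bullet> W) + s\<^sup>2 * (W \<bullet> W)" for s
    unfolding power2_norm_eq_inner
    by (simp add: inner_add_left inner_add_right inner_diff_left inner_diff_right inner_commute
        power2_eq_square algebra_simps)
  moreover have "((\<lambda>s. (norm (V - Ud))\<^sup>2 + 2 * s * ((V - Ud) \<bullet> W) + s\<^sup>2 * (W \<bullet> W)) has_real_derivative
      2 * ((V - Ud) \<bullet> W) + 2 * s * (W \<bullet> W)) (at s)"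
    by (auto intro!: derivative_eq_intros)
  moreover have "2 * ((V - Ud) \<bullet> W) + 2 * s * (W \<bullet> W) = 2 * ((V + s *\<^sub>R W - Ud) \<bullet> W)"
    by (simp add: inner_add_left inner_diff_left algebra_simps)
  ultimately show ?thesis by simp
qed

lemma line_derivative:
  assumes \<epsilon>: "\<epsilon> \<ge> 0"
  shows "((\<lambda>s. (norm (V + s *\<^sub>R W - Ud))\<^sup>2 + N \<epsilon> (V + s *\<^sub>R W) \<bullet> F p) has_real_derivative
    slope \<epsilon> (V + s *\<^sub>R W) W p) (at s)"
    and "continuous_on S (\<lambda>s. slope \<epsilon> (V + s *\<^sub>R W) W p)"
proof -
  interpret N\<epsilon>: nemytskii "AA (\<Omega>e \<epsilon>)" "dAA (\<Omega>e \<epsilon>)" c\<^sub>1 c\<^sub>2 c\<^sub>3 D by (rule nemytskii_N[OF \<epsilon>])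
  show "((\<lambda>s. (norm (V + s *\<^sub>R W - Ud))\<^sup>2 + N \<epsilon> (V + s *\<^sub>R W) \<bullet> F p) has_real_derivative
    slope \<epsilon> (V + s *\<^sub>R W) W p) (at s)"
    unfolding slope_def by (rule DERIV_add[OF norm_line_derivative N\<epsilon>.Nem_has_derivative])
  show "continuous_on S (\<lambda>s. slope \<epsilon> (V + s *\<^sub>R W) W p)"
    unfolding slope_def by (intro continuous_intros N\<epsilon>.DNem_continuous)
qed

lemma G_line:
  assumes "\<epsilon> \<ge> 0" "v \<in> H10 D" "w \<in> H10 D" "p \<in> H10 D"
  shows "G \<epsilon> (\<lambda>x. v x + s * w x) p = (norm (F v + s *\<^sub>R F w - Ud))\<^sup>2 + N \<epsilon> (F v + s *\<^sub>R F w) \<bullet> F p - load p"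
  using G_eq[OF assms(1) H10_lincomb[OF D(1) assms(2,3), of 1 s] assms(4)] F_lincomb[OF assms(2,3), of 1 s]
  by simp

lemma G_derivative:
  assumes "\<epsilon> \<ge> 0" "v \<in> H10 D" "w \<in> H10 D" "p \<in> H10 D"
  shows "((\<lambda>s. G \<epsilon> (\<lambda>x. v x + s * w x) p) has_real_derivative slope \<epsilon> (F v + s *\<^sub>R F w) (F w) p) (at s)"
  unfolding G_line[OF assms]
  using DERIV_diff[OF line_derivative(1)[OF assms(1)] DERIV_const] by simp

lemma partial_u_eq:
  assumes "\<epsilon> \<ge> 0" "v \<in> H10 D" "w \<in> H10 D" "p \<in> H10 D"
  shows "partial_u G \<epsilon> v p w = slope \<epsilon> (F v) (F w) p"
  unfolding partial_u_def using DERIV_imp_deriv[OF G_derivative[OF assms, of 0]] by simp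

lemma partial_p_eq:
  assumes "\<epsilon> \<ge> 0" "v \<in> H10 D" "\<phi> \<in> H10 D"
  shows "partial_p G \<epsilon> v (\<lambda>x. 0) \<phi> = N \<epsilon> (F v) \<bullet> F \<phi> - load \<phi>"
proof -
  have "(\<lambda>s. G \<epsilon> v (\<lambda>x. 0 + s * \<phi> x)) = (\<lambda>s. (norm (F v - Ud))\<^sup>2 + s * (N \<epsilon> (F v) \<bullet> F \<phi> - load \<phi>))"
  proof
    fix s
    have h: "(\<lambda>x. s * \<phi> x) \<in> H10 D" "F (\<lambda>x. s * \<phi> x) = s *\<^sub>R F \<phi>" "load (\<lambda>x. s * \<phi> x) = s * load \<phi>"
      using H10_lincomb[OF D(1) assms(3,3), of s 0] F_lincomb[OF assms(3,3), of s 0] load_lincomb[OF assms(3,3), of s 0]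
      by simp_all
    show "G \<epsilon> v (\<lambda>x. 0 + s * \<phi> x) = (norm (F v - Ud))\<^sup>2 + s * (N \<epsilon> (F v) \<bullet> F \<phi> - load \<phi>)"
      using G_eq[OF assms(1,2) h(1)] by (simp add: h algebra_simps)
  qed
  moreover have "((\<lambda>s. (norm (F v - Ud))\<^sup>2 + s * (N \<epsilon> (F v) \<bullet> F \<phi> - load \<phi>)) has_real_derivative
      (N \<epsilon> (F v) \<bullet> F \<phi> - load \<phi>)) (at 0)"
    by (auto intro!: derivative_eq_intros)
  ultimately show ?thesis unfolding partial_p_def by (simp add: DERIV_imp_deriv)
qed

lemma G_affine:
  assumes "\<epsilon> \<ge> 0" "v \<in> H10 D" "p \<in> H10 D" "q \<in> H10 D"
  shows "G \<epsilon> v (\<lambda>x. (1 - t) * p x + t * q x) = (1 - t) * G \<epsilon> v p + t * G \<epsilon> v q"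
proof -
  have "G \<epsilon> v (\<lambda>x. (1 - t) * p x + t * q x) = (norm (F v - Ud))\<^sup>2
      + ((1 - t) * (N \<epsilon> (F v) \<bullet> F p) + t * (N \<epsilon> (F v) \<bullet> F q)) - ((1 - t) * load p + t * load q)"
    using G_eq[OF assms(1,2) H10_lincomb[OF D(1) assms(3,4), of "1 - t" t]]
    by (simp add: F_lincomb[OF assms(3,4)] load_lincomb[OF assms(3,4)] inner_add_right)
  also have "\<dots> = (1 - t) * G \<epsilon> v p + t * G \<epsilon> v q"
    unfolding G_eq[OF assms(1,2,3)] G_eq[OF assms(1,2,4)] by algebra
  finally show ?thesis .
qed

lemma G_C1:
  assumes "\<epsilon> \<ge> 0" "v \<in> H10 D" "w \<in> H10 D" "p \<in> H10 D"
  shows "(\<lambda>s. G \<epsilon> (\<lambda>x. v x + s * w x) p) C1_differentiable_on {0..1}"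
  unfolding C1_differentiable_on_def
  using G_derivative[OF assms] line_derivative(2)[OF assms(1)]
  by (intro exI[of _ "\<lambda>s. slope \<epsilon> (F v + s *\<^sub>R F w) (F w) p"]) (auto simp: has_real_derivative_iff_has_vector_derivative)

text \<open>Uniqueness of the state rests on strong monotonicity, uniqueness of the adjoint state on
  coercivity of the linearised operator; equal gradients then mean equal functions by the Poincare
  inequality.\<close>

theorem hypothesis_H0: "hypothesis_H0 \<tau> (ae_eq D) (H10 D) (H10 D) G u p\<^sub>0"
  unfolding hypothesis_H0_def is_unique_def
proof (intro conjI ballI impI)
  fix \<epsilon> assume \<epsilon>: "\<epsilon> \<in> {0..\<tau>}"
  then have \<epsilon>0: "\<epsilon> \<ge> 0" by simp
  show "u \<epsilon> \<in> H10 D" by (rule u_state(1)[OF \<epsilon>])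
  show "partial_p G \<epsilon> (u \<epsilon>) (\<lambda>x. 0) \<phi> = 0" if "\<phi> \<in> H10 D" for \<phi>
    using partial_p_eq[OF \<epsilon>0 u_state(1)[OF \<epsilon>] that] u_state(2)[OF \<epsilon> that] by simp
  fix v assume v: "v \<in> H10 D" "\<forall>\<phi>\<in>H10 D. partial_p G \<epsilon> v (\<lambda>x. 0) \<phi> = 0"
  show "ae_eq D v (u \<epsilon>)"
  proof (rule gfield_eq_imp_ae_eq[OF D v(1) u_state(1)[OF \<epsilon>]])
    show "F v = F (u \<epsilon>)"
    proof (rule state_field_unique[OF D \<Omega>e_sets[OF \<epsilon>0] v(1) u_state(1)[OF \<epsilon>]])
      fix \<phi> assume \<phi>: "\<phi> \<in> H10 D"
      show "N \<epsilon> (F v) \<bullet> F \<phi> = N \<epsilon> (F (u \<epsilon>)) \<bullet> F \<phi>"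
        using v(2) \<phi> partial_p_eq[OF \<epsilon>0 v(1) \<phi>] u_state(2)[OF \<epsilon> \<phi>] by simp
    qed
  qed
next
  show "p\<^sub>0 \<in> H10 D" by (rule p0)
  have pu: "partial_u G 0 (u 0) p \<phi> = 2 * ((U - Ud) \<bullet> F \<phi>) + dN 0 U (F \<phi>) \<bullet> F p"
    if "p \<in> H10 D" "\<phi> \<in> H10 D" for p \<phi>
    unfolding u_zero partial_u_eq[OF order_refl u0 that(2,1)] slope_def ..
  show "partial_u G 0 (u 0) p\<^sub>0 \<phi> = 0" if "\<phi> \<in> H10 D" for \<phi>
    using pu[OF p0 that] adjoint_eq[OF that] by simp
  fix p assume p: "p \<in> H10 D" "\<forall>\<phi>\<in>H10 D. partial_u G 0 (u 0) p \<phi> = 0"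
  interpret N0: nemytskii "AA (\<Omega>e 0)" "dAA (\<Omega>e 0)" c\<^sub>1 c\<^sub>2 c\<^sub>3 D by (rule nemytskii_N) simp
  \<comment> \<open>The difference of two adjoint states is taken as direction, so that subtracting
    their equations leaves the coercive form at this difference.\<close>
  define \<phi> where "\<phi> x = p x - p\<^sub>0 x" for x
  have \<phi>: "\<phi> \<in> H10 D" "F \<phi> = F p - P"
    unfolding \<phi>_def[abs_def] by (rule H10_diff[OF D(1) p(1) p0], rule F_diff[OF p(1) p0])
  have "dN 0 U (F \<phi>) \<bullet> F p = dN 0 U (F \<phi>) \<bullet> P"
    using p(2) \<phi>(1) pu[OF p(1) \<phi>(1)] adjoint_eq[OF \<phi>(1)] by simp
  then have "dN 0 U (F \<phi>) \<bullet> F \<phi> = 0" by (simp add: \<phi>(2) inner_diff_right)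
  moreover have "c\<^sub>1 * (norm (F \<phi>))\<^sup>2 \<le> dN 0 U (F \<phi>) \<bullet> F \<phi>"
    by (rule N0.DNem_coercive[OF gradspace_vanishes_off[OF D gfield_in_gradspace[OF D(1) \<phi>(1)]]])
  ultimately have "F p = P" using c_pos(1) \<phi>(2) by (simp add: mult_le_0_iff)
  then show "ae_eq D p p\<^sub>0" by (rule gfield_eq_imp_ae_eq[OF D p(1) p0])
qed

section \<open>Exact expansion of the cost difference\<close>

definition Ee where "Ee \<epsilon> = F (u \<epsilon>) - U"

lemma ell_eq: "\<epsilon> \<ge> 0 \<Longrightarrow> ell \<epsilon> = \<epsilon> ^ DIM('a) * measure lebesgue \<omega>"
  unfolding ell_def by (rule measure_inclusion)

lemma partial_ell_eq:
  assumes "\<epsilon> \<in> {0..\<tau>}"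
  shows "G \<epsilon> u\<^sub>0 p\<^sub>0 - G 0 u\<^sub>0 p\<^sub>0 = (N \<epsilon> U - N 0 U) \<bullet> P"
  using assms by (simp add: G_eq u0 p0 inner_diff_left)

text \<open>The integrand is the derivative of \<open>j s - s * S 0\<close> along the segment from
  \<open>u\<^sub>0\<close> to \<open>u \<epsilon>\<close>, so the integral is the remainder of
  \<open>G\<close> after its linear part at \<open>u\<^sub>0\<close>. The quadratic cost contributes
  exactly the squared norm of \<open>Ee \<epsilon>\<close>.\<close>

lemma R1_eq:
  assumes "\<epsilon> \<in> {0..\<tau>}"
  shows "R1_eps G ell u p\<^sub>0 \<epsilon> = 1 / ell \<epsilon> * ((norm (Ee \<epsilon>))\<^sup>2 + (N \<epsilon> (U + Ee \<epsilon>) - N \<epsilon> U - dN \<epsilon> U (Ee \<epsilon>)) \<bullet> P)"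
proof -
  have \<epsilon>0: "\<epsilon> \<ge> 0" using assms by simp
  note u\<epsilon> = u_state(1)[OF assms]
  have d: "(\<lambda>x. u \<epsilon> x - u 0 x) \<in> H10 D" "F (\<lambda>x. u \<epsilon> x - u 0 x) = Ee \<epsilon>"
    unfolding u_zero Ee_def by (rule H10_diff[OF D(1) u\<epsilon> u0], rule F_diff[OF u\<epsilon> u0])
  define S where "S s = slope \<epsilon> (U + s *\<^sub>R Ee \<epsilon>) (Ee \<epsilon>) p\<^sub>0" for s
  define j where "j s = (norm (U + s *\<^sub>R Ee \<epsilon> - Ud))\<^sup>2 + N \<epsilon> (U + s *\<^sub>R Ee \<epsilon>) \<bullet> P" for s
  have "partial_u G \<epsilon> (\<lambda>x. s * u \<epsilon> x + (1 - s) * u 0 x) p\<^sub>0 (\<lambda>x. u \<epsilon> x - u 0 x)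
      - partial_u G \<epsilon> (u 0) p\<^sub>0 (\<lambda>x. u \<epsilon> x - u 0 x) = S s - S 0" for s
  proof -
    have m: "(\<lambda>x. s * u \<epsilon> x + (1 - s) * u 0 x) \<in> H10 D" "F (\<lambda>x. s * u \<epsilon> x + (1 - s) * u 0 x) = U + s *\<^sub>R Ee \<epsilon>"
      unfolding u_zero F_lincomb[OF u\<epsilon> u0]
      by (rule H10_lincomb[OF D(1) u\<epsilon> u0], simp add: Ee_def scaleR_diff_left scaleR_diff_right)
    show ?thesis
      unfolding partial_u_eq[OF \<epsilon>0 m(1) d(1) p0] m(2) d(2) S_def
      using partial_u_eq[OF \<epsilon>0 u0 d(1) p0] d(2) by (simp add: u_zero)
  qed
  then have "R1_eps G ell u p\<^sub>0 \<epsilon> = 1 / ell \<epsilon> * (LBINT s:{0..1}. S s - S 0)"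
    by (simp add: R1_eps_def)
  also have "(LBINT s:{0..1}. S s - S 0) = (j 1 - 1 * S 0) - (j 0 - 0 * S 0)"
    unfolding set_lebesgue_integral_def
  proof (rule integral_FTC_Icc[OF zero_le_one])
    show "((\<lambda>s. j s - s * S 0) has_vector_derivative S s - S 0) (at s within {0..1})" for s
    proof -
      have "((\<lambda>s. j s - s * S 0) has_real_derivative S s - 1 * S 0) (at s)"
        unfolding j_def S_def by (intro DERIV_diff DERIV_cmult_right DERIV_ident line_derivative(1)[OF \<epsilon>0])
      then show ?thesis
        by (simp add: has_real_derivative_iff_has_vector_derivative has_vector_derivative_at_within)
    qed
    show "continuous_on {0..1} (\<lambda>s. S s - S 0)"
      unfolding S_def by (intro continuous_intros line_derivative(2)[OF \<epsilon>0])
  qed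
  also have "(j 1 - 1 * S 0) - (j 0 - 0 * S 0) = (norm (Ee \<epsilon>))\<^sup>2 + (N \<epsilon> (U + Ee \<epsilon>) - N \<epsilon> U - dN \<epsilon> U (Ee \<epsilon>)) \<bullet> P"
    by (simp add: j_def S_def slope_def power2_norm_eq_inner inner_add_left inner_add_right inner_diff_left
        inner_diff_right inner_commute algebra_simps)
  finally show ?thesis .
qed

lemma R2_eq:
  assumes "\<epsilon> \<in> {0..\<tau>}"
  shows "R2_eps G ell u p\<^sub>0 \<epsilon> = 1 / ell \<epsilon> * ((dN \<epsilon> U (Ee \<epsilon>) - dN 0 U (Ee \<epsilon>)) \<bullet> P)"
proof -
  have \<epsilon>0: "\<epsilon> \<ge> 0" using assms by simp
  note u\<epsilon> = u_state(1)[OF assms]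
  have d: "(\<lambda>x. u \<epsilon> x - u 0 x) \<in> H10 D" "F (\<lambda>x. u \<epsilon> x - u 0 x) = Ee \<epsilon>"
    unfolding u_zero Ee_def by (rule H10_diff[OF D(1) u\<epsilon> u0], rule F_diff[OF u\<epsilon> u0])
  have z: "u 0 \<in> H10 D" unfolding u_zero by (rule u0)
  show ?thesis
    unfolding R2_eps_def partial_u_eq[OF \<epsilon>0 z d(1) p0] partial_u_eq[OF order_refl z d(1) p0] d(2) slope_def
    by (simp add: inner_diff_left u_zero)
qed

lemma cost_eq:
  assumes \<Omega>': "\<Omega>' \<in> sets lebesgue" and v: "is_state D f a\<^sub>1 a\<^sub>2 \<Omega>' v"
  shows "J \<Omega>' = (norm (F v - Ud))\<^sup>2"
proof -
  have s: "is_state D f a\<^sub>1 a\<^sub>2 \<Omega>' (Defs.state D f a\<^sub>1 a\<^sub>2 \<Omega>')"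
    unfolding Defs.state_def by (rule someI[where P="is_state D f a\<^sub>1 a\<^sub>2 \<Omega>'"]) (rule v)
  note s' = s[unfolded is_state_iff[OF D \<Omega>']] and v' = v[unfolded is_state_iff[OF D \<Omega>']]
  have "F (Defs.state D f a\<^sub>1 a\<^sub>2 \<Omega>') = F v"
    by (rule state_field_unique[OF D \<Omega>']) (use s' v' in auto)
  then show ?thesis
    unfolding cost_def using integral_gfield_diff_power2[OF D H10_imp_H1 H10_imp_H1[OF u\<^sub>d]] s' by simp
qed

text \<open>Expanding the square gives the squared norm of \<open>Ee \<epsilon>\<close> and a term
  linear in \<open>Ee \<epsilon>\<close>. The adjoint equation rewrites the linear term as a pairing
  of \<open>dN 0 U (Ee \<epsilon>)\<close> with \<open>P\<close>; the two state equations tested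
  with \<open>p\<^sub>0\<close> have the same load, which cancels what is left on the right.\<close>

lemma cost_difference:
  assumes \<epsilon>: "\<epsilon> \<in> {0<..\<tau>}"
  shows "J (\<Omega>e \<epsilon>) - J \<Omega> = (N \<epsilon> U - N 0 U) \<bullet> P
    + ((norm (Ee \<epsilon>))\<^sup>2 + (N \<epsilon> (U + Ee \<epsilon>) - N \<epsilon> U - dN \<epsilon> U (Ee \<epsilon>)) \<bullet> P)
    + (dN \<epsilon> U (Ee \<epsilon>) - dN 0 U (Ee \<epsilon>)) \<bullet> P"
proof -
  have \<epsilon>': "\<epsilon> \<in> {0..\<tau>}" "0 \<in> {0..\<tau>}" using \<epsilon> by auto
  have s: "\<Omega>e \<epsilon> \<in> sets lebesgue" using \<epsilon> by (intro \<Omega>e_sets) simp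
  note u\<epsilon> = u_state[OF \<epsilon>'(1)]
  have "is_state D f a\<^sub>1 a\<^sub>2 (\<Omega>e \<epsilon>) (u \<epsilon>)"
    unfolding is_state_iff[OF D s] using u\<epsilon> by (simp add: load_def)
  then have J1: "J (\<Omega>e \<epsilon>) = (norm (Ee \<epsilon> + (U - Ud)))\<^sup>2" using cost_eq[OF s] by (simp add: Ee_def)
  have J0: "J \<Omega> = (norm (U - Ud))\<^sup>2" by (rule cost_eq[OF \<Omega>_sets state])
  have a: "dN 0 U (Ee \<epsilon>) \<bullet> P = - 2 * ((U - Ud) \<bullet> Ee \<epsilon>)"
    unfolding Ee_def F_diff[OF u\<epsilon>(1) u0, symmetric] by (rule adjoint_eq[OF H10_diff[OF D(1) u\<epsilon>(1) u0]])
  have "N \<epsilon> (U + Ee \<epsilon>) \<bullet> P = load p\<^sub>0" using u\<epsilon>(2)[OF p0] by (simp add: Ee_def)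
  moreover have "N 0 U \<bullet> P = load p\<^sub>0" using u_state(2)[OF \<epsilon>'(2) p0] by (simp add: u_zero)
  moreover have "J (\<Omega>e \<epsilon>) - J \<Omega> = (norm (Ee \<epsilon>))\<^sup>2 + 2 * ((U - Ud) \<bullet> Ee \<epsilon>)"
    unfolding J1 J0 by (simp add: power2_norm_eq_inner inner_add_left inner_add_right inner_commute)
  ultimately show ?thesis using a by (simp add: inner_diff_left)
qed

section \<open>Limits as \<epsilon> tends to 0 and the topological derivative\<close>

abbreviation U0 where "U0 \<equiv> grad u\<^sub>0 z"
abbreviation P0 where "P0 \<equiv> grad p\<^sub>0 z"

abbreviation Hc where "Hc \<equiv> THE Hc. Hc \<in> gradspace UNIV \<and>
    (\<forall>w\<in>gradspace UNIV. nemytskii.Nem (BB \<omega> U0) UNIV Hc \<bullet> w = corrector_rhs \<omega> U0 \<bullet> w)"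

text \<open>Stated with the gradient field of the corrector; \<open>limR1_eq\<close> and
  \<open>limR2_eq\<close> pass to an arbitrary potential \<open>K\<close>, whose gradient agrees
  with it almost everywhere.\<close>

definition limR1 where "limR1 = (1 / measure lebesgue \<omega>) *
  ((LINT x|lebesgue. (BB \<omega> U0 x (rep Hc x) - dBB \<omega> U0 x 0 (rep Hc x)) \<bullet> P0) + (norm Hc)\<^sup>2)"
definition limR2 where "limR2 = (1 / measure lebesgue \<omega>) *
  (LINT x|lebesgue_on \<omega>. (frechet_derivative a\<^sub>1 (at U0) (rep Hc x) - frechet_derivative a\<^sub>2 (at U0) (rep Hc x)) \<bullet> P0)"
abbreviation limG where "limG \<equiv> (a\<^sub>1 U0 - a\<^sub>2 U0) \<bullet> P0"

text \<open>The gradients of state and adjoint state are replaced by representatives that are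
  continuous at \<open>z\<close>, the second one also bounded everywhere. Each quotient is then, up
  to the factor \<open>1 / m\<close>, one of the blow-up limits.\<close>

theorem limits:
  shows "has_partial_ell G ell u\<^sub>0 p\<^sub>0 limG"
    and "(R1_eps G ell u p\<^sub>0 \<longlongrightarrow> limR1) (at_right 0)"
    and "(R2_eps G ell u p\<^sub>0 \<longlongrightarrow> limR2) (at_right 0)"
proof -
  have zD: "z \<in> D" using z by simp
  obtain g where gz: "g \<in> L2 UNIV" "cl g = U" "isCont g z" "g z = U0"
    using C1_representative[OF D(1) H10_imp_H1[OF u0] zD \<delta> regular_u] .
  obtain q' where q': "q' \<in> L2 UNIV" "cl q' = P" "isCont q' z" "q' z = P0"
    using C1_representative[OF D(1) H10_imp_H1[OF p0] zD \<delta> regular_p] .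
  obtain M' where M': "AE x in lebesgue_on D. norm (wgrad D p\<^sub>0 x) \<le> M'"
    using bounded_gradient by (auto simp: L_infty_def)
  have "AE x in lebesgue. q' x = indicator D x *\<^sub>R wgrad D p\<^sub>0 x"
    using q'(2) cl_eq_iff[OF q'(1) L2_wgrad[OF D(1) H10_imp_H1[OF p0]]] by (simp add: gfield_def)
  with M'[unfolded AE_lebesgue_on[OF D_sets]] have "AE x in lebesgue. norm (q' x) \<le> max M' 0"
    by eventually_elim (auto simp: indicator_def)
  from bounded_representative[OF q'(1,3) this] obtain q M where qz: "q \<in> L2 UNIV" "cl q = P" "isCont q z" "q z = P0"
    "\<And>x. norm (q x) \<le> M"
    using q'(2,4) by metis
  obtain s where s: "s > 0" "\<And>y. dist y z < s \<Longrightarrow> dist (g y) (g z) < 1"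
    using gz(3) unfolding continuous_at_eps_delta by (metis zero_less_one)
  obtain R where R: "R > 0" "\<omega> \<subseteq> ball 0 R" using bounded_subset_ball0[OF \<omega>(2)] .
  \<comment> \<open>For \<open>\<epsilon> < r\<close> the perturbation is admissible, and
    \<open>\<epsilon> * R < s\<close> keeps the inclusion where \<open>g\<close> differs from its
    value at \<open>z\<close> by less than 1.\<close>
  define r where "r = min \<tau> (s / R)"
  have r: "r > 0" using \<tau> s R by (simp add: r_def)
  define m where "m = measure lebesgue \<omega>"
  have m: "m > 0" unfolding m_def by (rule measure_\<omega>_pos)
  have bu: "blow_up a\<^sub>1 a\<^sub>2 c\<^sub>1 c\<^sub>2 c\<^sub>3 D \<Omega> \<omega> z \<tau> g q M X (\<lambda>n. Ee (X n))"
    if X: "\<And>i. 0 < X i" "\<And>i. X i < r" "X \<longlonglongrightarrow> 0" for X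
  proof
    show "g \<in> L2 UNIV" "isCont g z" "q \<in> L2 UNIV" "isCont q z" by fact+
    show "norm (q x) \<le> M" for x by (rule qz(5))
    show "0 < X n" "X n \<le> \<tau>" for n using X(1)[of n] X(2)[of n] by (auto simp: r_def)
    show "X \<longlonglongrightarrow> 0" by (rule X(3))
    show "norm (g (z + X n *\<^sub>R x) - g z) \<le> 1" if "x \<in> \<omega>" for n x
    proof -
      have "norm x < R" using that R by auto
      then have "X n * norm x < (s / R) * R"
        using X(1)[of n] X(2)[of n] R(1) by (intro mult_strict_mono) (auto simp: r_def)
      then have "dist (z + X n *\<^sub>R x) z < s" using R(1) X(1)[of n] by (simp add: dist_norm)
      then show ?thesis using s(2) by (simp add: dist_norm less_imp_le)
    qed
    have Xt: "X n \<in> {0..\<tau>}" "0 \<in> {0..\<tau>}" for n using X(1)[of n] X(2)[of n] by (auto simp: r_def)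
    show "Ee (X n) \<in> gradspace D" for n
      unfolding Ee_def by (intro subspace_diff[OF subspace_gradspace] gfield_in_gradspace[OF D(1)] u_state(1)[OF Xt(1)] u0)
    show "N (X n) (cl g + Ee (X n)) \<bullet> w = N 0 (cl g) \<bullet> w" if w: "w \<in> gradspace D" for n w
    proof -
      obtain \<phi> where \<phi>: "\<phi> \<in> H10 D" "F \<phi> = w" using gradspace_imp_H10[OF D w] .
      show ?thesis
        using u_state(2)[OF Xt(1)[of n] \<phi>(1)] u_state(2)[OF Xt(2) \<phi>(1)] \<phi>(2) by (simp add: gz(2) Ee_def u_zero)
    qed
  qed
  have ell: "ell (X i) = X i ^ DIM('a) * m" if "\<And>i. 0 < X i" for X :: "nat \<Rightarrow> real" and i
    using ell_eq[of "X i"] that[of i] by (simp add: m_def)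
  have X\<tau>: "X i \<in> {0..\<tau>}" if "\<And>i. 0 < X i" "\<And>i. X i < r" for X :: "nat \<Rightarrow> real" and i
    using that(1)[of i] that(2)[of i] by (auto simp: r_def)
  show "has_partial_ell G ell u\<^sub>0 p\<^sub>0 limG"
    unfolding has_partial_ell_def
  proof (rule tendsto_at_right_0_sequentially[OF r])
    fix X :: "nat \<Rightarrow> real" assume X: "\<And>i. 0 < X i" "\<And>i. X i < r" "X \<longlonglongrightarrow> 0"
    interpret blow_up a\<^sub>1 a\<^sub>2 c\<^sub>1 c\<^sub>2 c\<^sub>3 D \<Omega> \<omega> z \<tau> g q M X "\<lambda>n. Ee (X n)" by (rule bu[OF X])
    have "(\<lambda>i. ((N (X i) U - N 0 U) \<bullet> P) / X i ^ DIM('a) / m) \<longlonglongrightarrow> (m * limG) / m"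
      using jump_term_tendsto m unfolding gz(2,4) qz(2,4) m_def[symmetric] by (intro tendsto_intros) auto
    moreover have "((N (X i) U - N 0 U) \<bullet> P) / X i ^ DIM('a) / m = (G (X i) u\<^sub>0 p\<^sub>0 - G 0 u\<^sub>0 p\<^sub>0) / ell (X i)" for i
      using partial_ell_eq[OF X\<tau>[of X i, OF X(1,2)]] ell[of X i, OF X(1)] by simp
    ultimately show "(\<lambda>i. (G (X i) u\<^sub>0 p\<^sub>0 - G 0 u\<^sub>0 p\<^sub>0) / ell (X i)) \<longlonglongrightarrow> limG" using m by simp
  qed
  show "(R1_eps G ell u p\<^sub>0 \<longlongrightarrow> limR1) (at_right 0)"
  proof (rule tendsto_at_right_0_sequentially[OF r])
    fix X :: "nat \<Rightarrow> real" assume X: "\<And>i. 0 < X i" "\<And>i. X i < r" "X \<longlonglongrightarrow> 0"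
    interpret blow_up a\<^sub>1 a\<^sub>2 c\<^sub>1 c\<^sub>2 c\<^sub>3 D \<Omega> \<omega> z \<tau> g q M X "\<lambda>n. Ee (X n)" by (rule bu[OF X])
    have "(\<lambda>i. (1 / m) * (((N (X i) (U + Ee (X i)) - N (X i) U - dN (X i) U (Ee (X i))) \<bullet> P) / X i ^ DIM('a)
        + (norm (Ee (X i)))\<^sup>2 / X i ^ DIM('a))) \<longlonglongrightarrow> limR1"
      unfolding limR1_def m_def[symmetric]
      using nonlinear_remainder_tendsto energy_tendsto unfolding gz(2,4) qz(2,4) by (intro tendsto_intros) auto
    moreover have "(1 / m) * (((N (X i) (U + Ee (X i)) - N (X i) U - dN (X i) U (Ee (X i))) \<bullet> P) / X i ^ DIM('a)
        + (norm (Ee (X i)))\<^sup>2 / X i ^ DIM('a)) = R1_eps G ell u p\<^sub>0 (X i)" for i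
      unfolding R1_eq[OF X\<tau>[of X i, OF X(1,2)]] ell[of X i, OF X(1)] by (simp add: add_divide_distrib add.commute)
    ultimately show "(\<lambda>i. R1_eps G ell u p\<^sub>0 (X i)) \<longlonglongrightarrow> limR1" by simp
  qed
  show "(R2_eps G ell u p\<^sub>0 \<longlongrightarrow> limR2) (at_right 0)"
  proof (rule tendsto_at_right_0_sequentially[OF r])
    fix X :: "nat \<Rightarrow> real" assume X: "\<And>i. 0 < X i" "\<And>i. X i < r" "X \<longlonglongrightarrow> 0"
    interpret blow_up a\<^sub>1 a\<^sub>2 c\<^sub>1 c\<^sub>2 c\<^sub>3 D \<Omega> \<omega> z \<tau> g q M X "\<lambda>n. Ee (X n)" by (rule bu[OF X])
    have "(\<lambda>i. (1 / m) * (((dN (X i) U (Ee (X i)) - dN 0 U (Ee (X i))) \<bullet> P) / X i ^ DIM('a))) \<longlonglongrightarrow> limR2"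
      unfolding limR2_def m_def[symmetric]
      using derivative_jump_term_tendsto unfolding gz(2,4) qz(2,4) by (intro tendsto_intros) auto
    moreover have "(1 / m) * (((dN (X i) U (Ee (X i)) - dN 0 U (Ee (X i))) \<bullet> P) / X i ^ DIM('a)) = R2_eps G ell u p\<^sub>0 (X i)" for i
      unfolding R2_eq[OF X\<tau>[of X i, OF X(1,2)]] ell[of X i, OF X(1)] by simp
    ultimately show "(\<lambda>i. R2_eps G ell u p\<^sub>0 (X i)) \<longlonglongrightarrow> limR2" by simp
  qed
qed

text \<open>For \<open>0 < \<epsilon> < \<tau>\<close> the expansion of the cost is an identity, so
  the three limits simply add up.\<close>

theorem topological_derivative: "has_topological_derivative J \<omega> \<Omega> z (limG + limR1 + limR2)"
  unfolding has_topological_derivative_def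
proof (rule Lim_transform_eventually)
  show "((\<lambda>\<epsilon>. (G \<epsilon> u\<^sub>0 p\<^sub>0 - G 0 u\<^sub>0 p\<^sub>0) / ell \<epsilon> + R1_eps G ell u p\<^sub>0 \<epsilon> + R2_eps G ell u p\<^sub>0 \<epsilon>) \<longlongrightarrow> limG + limR1 + limR2) (at_right 0)"
    using limits unfolding has_partial_ell_def by (intro tendsto_add)
  have "(G \<epsilon> u\<^sub>0 p\<^sub>0 - G 0 u\<^sub>0 p\<^sub>0) / ell \<epsilon> + R1_eps G ell u p\<^sub>0 \<epsilon> + R2_eps G ell u p\<^sub>0 \<epsilon>
      = (J (\<Omega>e \<epsilon>) - J \<Omega>) / measure lebesgue (inclusion \<omega> z \<epsilon>)" if "\<epsilon> > 0" "\<epsilon> < \<tau>" for \<epsilon>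
  proof -
    have "\<epsilon> \<in> {0<..\<tau>}" "\<epsilon> \<in> {0..\<tau>}" using that by auto
    then show ?thesis
      by (simp add: cost_difference partial_ell_eq R1_eq R2_eq add_divide_distrib flip: ell_def[THEN fun_cong])
  qed
  then show "\<forall>\<^sub>F \<epsilon> in at_right 0. (G \<epsilon> u\<^sub>0 p\<^sub>0 - G 0 u\<^sub>0 p\<^sub>0) / ell \<epsilon> + R1_eps G ell u p\<^sub>0 \<epsilon> + R2_eps G ell u p\<^sub>0 \<epsilon>
      = (J (\<Omega>e \<epsilon>) - J \<Omega>) / measure lebesgue (inclusion \<omega> z \<epsilon>)"
    using \<tau> by (auto simp: eventually_at_right[of 0 \<tau>] intro!: exI[of _ \<tau>])
qed

theorem ell_differentiable: "ell_differentiable_lagrangian \<tau> (H10 D) (H10 D) G ell u\<^sub>0 p\<^sub>0"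
  unfolding ell_differentiable_lagrangian_def
  using G_affine G_C1 limits(1) by auto

lemma corrector_gfield:
  assumes K: "K \<in> BL" "corrector_equation a\<^sub>1 a\<^sub>2 \<omega> U0 K"
  shows "gfield UNIV K = Hc"
  using the1_equality[OF corrector_field_exists[OF \<omega>_meas(2), of U0]] K(2) gfield_BL_in_gradspace[OF K(1)]
  unfolding corrector_equation_iff[OF \<omega>_meas(1) K(1)] by simp

lemma
  assumes K: "K \<in> BL" "corrector_equation a\<^sub>1 a\<^sub>2 \<omega> U0 K"
  shows limR1_eq: "limR1 = 1 / measure lebesgue \<omega> *
      ((LINT x|lebesgue. (\<A> a\<^sub>1 a\<^sub>2 \<omega> x (wgrad UNIV K x + U0) - \<A> a\<^sub>1 a\<^sub>2 \<omega> x U0 - d\<A> a\<^sub>1 a\<^sub>2 \<omega> x U0 (wgrad UNIV K x)) \<bullet> P0)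
       + (LINT x|lebesgue. (norm (wgrad UNIV K x))\<^sup>2))"
    and limR2_eq: "limR2 = 1 / measure lebesgue \<omega> *
      (LINT x|lebesgue_on \<omega>. (frechet_derivative a\<^sub>1 (at U0) (wgrad UNIV K x) - frechet_derivative a\<^sub>2 (at U0) (wgrad UNIV K x)) \<bullet> P0)"
proof -
  interpret B: nemytskii "BB \<omega> U0" "dBB \<omega> U0" c\<^sub>1 c\<^sub>2 c\<^sub>3 UNIV by (rule nemytskii_BB[OF \<omega>_meas(2)])
  define h where "h = wgrad UNIV K"
  have h: "h \<in> L2 UNIV" "cl h = Hc"
    using BL_D(2,4)[OF K(1)] corrector_gfield[OF K] by (auto simp: h_def)
  have hm: "h \<in> borel_measurable lebesgue" using h(1) by (simp add: L2_UNIV_iff)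
  have ae: "AE x in lebesgue. rep Hc x = h x" using rep_cl[OF h(1)] unfolding h(2) .
  have "(LINT x|lebesgue. (BB \<omega> U0 x (rep Hc x) - dBB \<omega> U0 x 0 (rep Hc x)) \<bullet> P0)
      = (LINT x|lebesgue. (BB \<omega> U0 x (h x) - dBB \<omega> U0 x 0 (h x)) \<bullet> P0)"
  proof (rule integral_cong_AE)
    show "AE x in lebesgue. (BB \<omega> U0 x (rep Hc x) - dBB \<omega> U0 x 0 (rep Hc x)) \<bullet> P0 = (BB \<omega> U0 x (h x) - dBB \<omega> U0 x 0 (h x)) \<bullet> P0"
      using ae by eventually_elim simp
  qed (intro borel_measurable_inner borel_measurable_diff B.meas B.dmeas rep_measurable hm borel_measurable_const)+
  moreover have "(norm Hc)\<^sup>2 = (LINT x|lebesgue. (norm (h x))\<^sup>2)"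
    using norm_cl_power2[OF h(1)] unfolding h(2) .
  ultimately show "limR1 = 1 / measure lebesgue \<omega> *
      ((LINT x|lebesgue. (\<A> a\<^sub>1 a\<^sub>2 \<omega> x (wgrad UNIV K x + U0) - \<A> a\<^sub>1 a\<^sub>2 \<omega> x U0 - d\<A> a\<^sub>1 a\<^sub>2 \<omega> x U0 (wgrad UNIV K x)) \<bullet> P0)
       + (LINT x|lebesgue. (norm (wgrad UNIV K x))\<^sup>2))"
    unfolding limR1_def h_def[symmetric] by (simp only: BB_def dBB_def add.commute[of U0] add_0)
  let ?d = "\<lambda>v. frechet_derivative a\<^sub>1 (at U0) v - frechet_derivative a\<^sub>2 (at U0) v"
  have dm: "(\<lambda>x. ?d (k x) \<bullet> P0) \<in> borel_measurable lebesgue" if "k \<in> borel_measurable lebesgue" for k :: "'a \<Rightarrow> 'a"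
    using that by (intro borel_measurable_inner borel_measurable_diff measurable_da borel_measurable_const) auto
  have "(LINT x|lebesgue_on \<omega>. ?d (rep Hc x) \<bullet> P0) = (LINT x|lebesgue_on \<omega>. ?d (h x) \<bullet> P0)"
  proof (rule integral_cong_AE)
    show "AE x in lebesgue_on \<omega>. ?d (rep Hc x) \<bullet> P0 = ?d (h x) \<bullet> P0"
      unfolding AE_lebesgue_on[OF \<omega>_meas(2)] using ae by eventually_elim simp
  qed (intro measurable_restrict_space1 dm rep_measurable hm)+
  then show "limR2 = 1 / measure lebesgue \<omega> *
      (LINT x|lebesgue_on \<omega>. (frechet_derivative a\<^sub>1 (at U0) (wgrad UNIV K x) - frechet_derivative a\<^sub>2 (at U0) (wgrad UNIV K x)) \<bullet> P0)"
    unfolding limR2_def h_def[symmetric] by simp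
qed

end

section \<open>The theorem for the given data\<close>

theorem mainTheorem1:
  fixes D \<Omega> \<omega> :: "'a::euclidean_space set"
    and f u\<^sub>d u\<^sub>0 p\<^sub>0 :: "'a \<Rightarrow> real"
    and a\<^sub>1 a\<^sub>2 :: "'a \<Rightarrow> 'a"
    and z U\<^sub>0 P\<^sub>0 :: 'a
    and c\<^sub>1 c\<^sub>2 c\<^sub>3 \<tau> \<delta> \<alpha> :: real
    and G :: "real \<Rightarrow> ('a \<Rightarrow> real) \<Rightarrow> ('a \<Rightarrow> real) \<Rightarrow> real"
    and ell :: "real \<Rightarrow> real"
    and u :: "real \<Rightarrow> 'a \<Rightarrow> real"
  assumes D: "open D" "bounded D"
    and data: "f \<in> L2 D" "u\<^sub>d \<in> H10 D"
    and c: "c\<^sub>1 > 0" "c\<^sub>2 > 0" "c\<^sub>3 > 0"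
    and differentiable: "\<And>a x. a \<in> {a\<^sub>1, a\<^sub>2} \<Longrightarrow> a differentiable (at x)"
    and monotone: "\<And>a x y. a \<in> {a\<^sub>1, a\<^sub>2} \<Longrightarrow> (a x - a y) \<bullet> (x - y) \<ge> c\<^sub>1 * (norm (x - y))\<^sup>2"
    and lipschitz: "\<And>a x y. a \<in> {a\<^sub>1, a\<^sub>2} \<Longrightarrow> norm (a x - a y) \<le> c\<^sub>2 * norm (x - y)"
    and lipschitz_derivative: "\<And>a x y. a \<in> {a\<^sub>1, a\<^sub>2} \<Longrightarrow>
          onorm (\<lambda>v. frechet_derivative a (at x) v - frechet_derivative a (at y) v)
            \<le> c\<^sub>3 * norm (x - y)"
    and \<Omega>: "open \<Omega>" "\<Omega> \<subseteq> D"
    and state: "is_state D f a\<^sub>1 a\<^sub>2 \<Omega> u\<^sub>0"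
    and adjoint: "is_adjoint D u\<^sub>d a\<^sub>1 a\<^sub>2 \<Omega> u\<^sub>0 p\<^sub>0"
    and z: "z \<in> D - closure \<Omega>"
    and \<alpha>: "0 < \<alpha>" "\<alpha> < 1"
    and \<delta>: "\<delta> > 0"
    and regularity: "u\<^sub>0 \<in> C1_Holder_closure \<alpha> (ball z \<delta>)" "p\<^sub>0 \<in> C1_closure (ball z \<delta>)"
    and bounded_gradient: "wgrad D p\<^sub>0 \<in> L_infty D"
    and \<omega>: "open \<omega>" "bounded \<omega>" "0 \<in> \<omega>"
    and \<tau>: "\<tau> > 0"
    and compactly_contained: "\<And>\<epsilon>. \<epsilon> \<in> {0..\<tau>} \<Longrightarrow>
          compact (closure (inclusion \<omega> z \<epsilon>)) \<and> closure (inclusion \<omega> z \<epsilon>) \<subseteq> D - closure \<Omega>"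
    and U\<^sub>0: "U\<^sub>0 = grad u\<^sub>0 z"
    and P\<^sub>0: "P\<^sub>0 = grad p\<^sub>0 z"
    and G: "G = lagrangian D f u\<^sub>d a\<^sub>1 a\<^sub>2 \<Omega> \<omega> z"
    and ell: "ell = (\<lambda>\<epsilon>. measure lebesgue (inclusion \<omega> z \<epsilon>))"
    and u: "u = (\<lambda>\<epsilon>. state D f a\<^sub>1 a\<^sub>2 (\<Omega> \<union> inclusion \<omega> z \<epsilon>))(0 := u\<^sub>0)"
  shows "\<exists>dG R\<^sub>1 R\<^sub>2.
     \<comment> \<open>(a)\<close>
     ell_differentiable_lagrangian \<tau> (H10 D) (H10 D) G ell u\<^sub>0 p\<^sub>0 \<and>
     hypothesis_H0 \<tau> (ae_eq D) (H10 D) (H10 D) G u p\<^sub>0 \<and>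
     has_partial_ell G ell u\<^sub>0 p\<^sub>0 dG \<and>
     (R1_eps G ell u p\<^sub>0 \<longlongrightarrow> R\<^sub>1) (at_right 0) \<and>
     (R2_eps G ell u p\<^sub>0 \<longlongrightarrow> R\<^sub>2) (at_right 0) \<and>
     has_topological_derivative (cost D f u\<^sub>d a\<^sub>1 a\<^sub>2) \<omega> \<Omega> z (dG + R\<^sub>1 + R\<^sub>2) \<and>
     \<comment> \<open>(b)\<close>
     (\<exists>!\<kappa>. \<kappa> \<in> BL_dot \<and> (\<forall>K\<in>\<kappa>. corrector_equation a\<^sub>1 a\<^sub>2 \<omega> U\<^sub>0 K)) \<and>
     dG = (a\<^sub>1 U\<^sub>0 - a\<^sub>2 U\<^sub>0) \<bullet> P\<^sub>0 \<and>
     (\<forall>\<kappa>\<in>BL_dot. \<forall>K\<in>\<kappa>. corrector_equation a\<^sub>1 a\<^sub>2 \<omega> U\<^sub>0 K \<longrightarrow>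
        R\<^sub>1 = 1 / measure lebesgue \<omega> *
          ((LINT x|lebesgue. (\<A> a\<^sub>1 a\<^sub>2 \<omega> x (wgrad UNIV K x + U\<^sub>0) - \<A> a\<^sub>1 a\<^sub>2 \<omega> x U\<^sub>0
                              - d\<A> a\<^sub>1 a\<^sub>2 \<omega> x U\<^sub>0 (wgrad UNIV K x)) \<bullet> P\<^sub>0)
           + (LINT x|lebesgue. (norm (wgrad UNIV K x))\<^sup>2)) \<and>
        R\<^sub>2 = 1 / measure lebesgue \<omega> *
          (LINT x|lebesgue_on \<omega>. (frechet_derivative a\<^sub>1 (at U\<^sub>0) (wgrad UNIV K x)
                                 - frechet_derivative a\<^sub>2 (at U\<^sub>0) (wgrad UNIV K x)) \<bullet> P\<^sub>0))"
proof -
  obtain g\<^sub>u where g\<^sub>u: "continuous_on (closure (ball z \<delta>)) g\<^sub>u" "\<And>x. x \<in> ball z \<delta> \<Longrightarrow> GDERIV u\<^sub>0 x :> g\<^sub>u x"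
    using regularity(1) by (auto simp: C1_Holder_closure_def)
  obtain g\<^sub>p where g\<^sub>p: "continuous_on (closure (ball z \<delta>)) g\<^sub>p" "\<And>x. x \<in> ball z \<delta> \<Longrightarrow> GDERIV p\<^sub>0 x :> g\<^sub>p x"
    using regularity(2) by (auto simp: C1_closure_def)
  interpret T: tracking_problem a\<^sub>1 a\<^sub>2 c\<^sub>1 c\<^sub>2 c\<^sub>3 D \<Omega> \<omega> z \<tau> f u\<^sub>d u\<^sub>0 p\<^sub>0 \<delta> g\<^sub>u g\<^sub>p
  proof
    show "a differentiable at x" if "a \<in> {a\<^sub>1, a\<^sub>2}" for a x using differentiable[OF that] .
    show "closure (inclusion \<omega> z \<epsilon>) \<subseteq> D - closure \<Omega>" if "\<epsilon> \<in> {0..\<tau>}" for \<epsilon>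
      using compactly_contained[OF that] by blast
    show "continuous_on (ball z \<delta>) g\<^sub>u" "continuous_on (ball z \<delta>) g\<^sub>p"
      by (rule continuous_on_subset[OF g\<^sub>u(1) closure_subset], rule continuous_on_subset[OF g\<^sub>p(1) closure_subset])
  qed (fact c monotone lipschitz lipschitz_derivative D \<Omega> z \<omega> \<tau> data state adjoint \<delta> bounded_gradient g\<^sub>u g\<^sub>p)+
  have eq: "G = T.G" "ell = T.ell" "u = T.u"
    unfolding G ell u T.G_def T.ell_def T.u_def by (rule refl)+
  have K: "K \<in> BL" if "\<kappa> \<in> BL_dot" "K \<in> \<kappa>" for \<kappa> K by (rule T.BL_dot_subset_BL[OF that])
  show ?thesis
    unfolding eq U\<^sub>0 P\<^sub>0
  \<comment> \<open>The three witnesses are defined without reference to a potential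
    \<open>K\<close>, so part (b) can hold for every solution of the corrector equation at
    once.\<close>
  proof (rule exI[of _ T.limG], rule exI[of _ T.limR1], rule exI[of _ T.limR2], intro conjI ballI impI)
    show "ell_differentiable_lagrangian \<tau> (H10 D) (H10 D) T.G T.ell u\<^sub>0 p\<^sub>0" by (rule T.ell_differentiable)
    show "hypothesis_H0 \<tau> (ae_eq D) (H10 D) (H10 D) T.G T.u p\<^sub>0" by (rule T.hypothesis_H0)
    show "\<exists>!\<kappa>. \<kappa> \<in> BL_dot \<and> (\<forall>K\<in>\<kappa>. corrector_equation a\<^sub>1 a\<^sub>2 \<omega> (grad u\<^sub>0 z) K)"
      by (rule T.corrector_class_unique[OF T.\<omega>_meas(1)])
  qed (rule T.limits T.topological_derivative refl T.limR1_eq T.limR2_eq | erule (1) K | assumption)+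
qed

end
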